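(* Let $K$ be a $p$-adic field and let $f\in K[x_1,\ldots,x_n,x_1^{-1},\ldots,x_n^{-1}]$ be a non-constant Laurent polynomial whose Newton polytope at infinity $\Gamma_\infty$ has dimension $n$. Assume that $f$ is weakly non-degenerate with respect to $\Gamma_\infty$, and let $\mathcal F$ be a fixed simple, non-trivial fan subordinated to $\Gamma_\infty$ with support $\mathbb R_+^n$. Let $\Phi$ be a Bruhat-Schwartz function on $K^n$. Then the following assertions hold. (i) $Z_\Phi(\omega,f)$ converges for $\omega\in\Omega_{(\beta,\alpha)}(K^\times)$, where $\alpha=\alpha(\mathcal F)$ and $\beta=\beta(\mathcal F)$. (ii) $Z_\Phi(\omega,f)$ has a meromorphic continuation to $\Omega(K^\times)$ as a rational function of $\omega(\mathfrak p)=q^{-s}$, and the poles (in the variable $s$) belong to $$\bigcup_{a\in edges(\mathcal F)}\mathcal P(a)\ \cup\ \left\{-1+\frac{2\pi\sqrt{-1}\,\mathbb Z}{\ln q}\right\}.$$ In addition, the multiplicity of any pole is $\leq n$.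
   Context: $K$ is a finite extension of $\mathbb Q_p$, with valuation ring $R_K$, maximal ideal $P_K$, fixed uniformizer $\mathfrak p$, residue field of cardinality $q$, $|z|_K=q^{-ord(z)}$, $ac\,z=z\mathfrak p^{-ord(z)}$. $\mathbb R_+=\{x\in\mathbb R: x\ge 0\}$ and $T^n(K)=\{x\in K^n: x_1\cdots x_n\ne 0\}$. Newton polytope: for $f(x)=\sum_{m\in\mathbb Z^n}c_mx^m$, $\Gamma_\infty$ is the convex hull in $\mathbb R^n$ of $supp(f)=\{m: c_m\neq0\}$. For $a\in\mathbb R^n$, $d(a)=\inf\{\langle a,x\rangle: x\in\Gamma_\infty\}$ and $F(a)=\{x\in\Gamma_\infty:\langle a,x\rangle=d(a)\}$ (a face of $\Gamma_\infty$; $F(0)=\Gamma_\infty$). The face function of $f$ with respect to $a\in\mathbb R_+^n$ is $f_a(x)=\sum_{m\in F(a)}c_mx^m$. $f$ is weakly non-degenerate with respect to $\Gamma_\infty$ if for every $a\in\mathbb R_+^n$ the system $f_a(x)=0,\ \nabla f_a(x)=0$ has no solution in $T^n(K)$. Fans: a fan is a finite collection of rational strongly convex (closed) polyhedral cones, closed under taking faces, in which the intersection of two cones is a face of each; its support is the union of its cones. It is simple if each of its cones is generated by a subset of a basis of the $\mathbb Z$-module $\mathbb Z^n$. It is subordinated to $\Gamma_\infty$ if the relative interior of each of its cones is contained in one equivalence class of the relation $a\sim a'\iff F(a)=F(a')$. The trivial fan consists of $\mathbb R_+^n$ and its faces. $edges(\mathcal F)$ is the set of all (primitive integral) generators of the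 cones of $\mathcal F$. For $a=(a_1,\ldots,a_n)\in\mathbb Z^n\setminus\{0\}$ put $\|a\|=a_1+\cdots+a_n$, and $\mathcal P(a)=\left\{-\frac{\|a\|}{d(a)}+\frac{2\pi\sqrt{-1}\,\mathbb Z}{d(a)\ln q}\right\}$ if $d(a)\ne0$, $\mathcal P(a)=\emptyset$ if $d(a)=0$. Put $A(\mathcal F)=\{\|a\|/(-d(a)): a\in edges(\mathcal F),\ d(a)<0\}$, $B(\mathcal F)=\{\|a\|/(-d(a)): a\in edges(\mathcal F),\ d(a)>0\}$; $\alpha(\mathcal F)=\min A(\mathcal F)$ if $A(\mathcal F)\ne\emptyset$ and $\alpha(\mathcal F)=+\infty$ otherwise; $\beta(\mathcal F)=\max(B(\mathcal F)\cup\{-1\})$. Quasicharacters: $\Omega(K^\times)$ is the group of continuous homomorphisms $\omega:K^\times\to\mathbb C^\times$. Each can be written $\omega(x)=|x|_K^s\,\chi(ac\,x)$ with $\omega(\mathfrak p)=q^{-s}$ and $\chi=\omega|_{R_K^\times}$, so $\Omega(K^\times)\cong\mathbb C/(2\pi\sqrt{-1}/\ln q)\mathbb Z\times(R_K^\times)^*$ is a one-dimensional complex manifold, where $(R_K^\times)^*$ is the group of characters of $R_K^\times$. $\sigma(\omega)=\mathrm{Re}(s)$ and $\Omega_{(b,c)}(K^\times)=\{\omega:\sigma(\omega)\in(b,c)\}$. A Bruhat-Schwartz function is a locally constant, compactly supported function $K^n\to\mathbb C$. The local zeta function is $Z_\Phi(\omega,f)=Z_\Phi(s,\chi,f)=\int_{T^n(K)}\Phi(x)\,\omega(f(x))\,|dx|$,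 where $|dx|$ is the Haar measure of $K^n$ normalized so that $R_K^n$ has volume 1 (the integrand being taken off the null set $f=0$). *)

theory Defs
  imports
    "HOL-Complex_Analysis.Complex_Analysis"
    "HOL-Computational_Algebra.Computational_Algebra"
    "HOL-Library.Poly_Mapping"
begin

section \<open>\<open>p\<close>-adic fields\<close>

text \<open>
  A field of characteristic 0 with a non-archimedean multiplicative absolute value \<open>vabs\<close>,
  whose topology is the one induced by the absolute value. (The library's \<open>norm\<close> is reserved
  for real normed spaces; positivity and definiteness of \<open>vabs\<close> come from those of \<open>dist\<close>.)
\<close>

class valued_field = field_char_0 + metric_space +
  fixes vabs :: "'a \<Rightarrow> real"
  assumes dist_vabs: "dist x y = vabs (x - y)"
    and vabs_mult: "vabs (x * y) = vabs x * vabs y"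
    and vabs_add: "vabs (x + y) \<le> max (vabs x) (vabs y)"

definition valuation_ring :: "'k::valued_field set" where
  "valuation_ring = {x. vabs x \<le> 1}"

definition maximal_ideal :: "'k::valued_field set" where
  "maximal_ideal = {x. vabs x < 1}"

definition unit_group :: "'k::valued_field set" where
  "unit_group = {x. vabs x = 1}"

definition uniformizer :: "'k::valued_field \<Rightarrow> bool" where
  "uniformizer \<pi> \<longleftrightarrow> \<pi> \<noteq> 0 \<and> maximal_ideal = (\<lambda>y. \<pi> * y) ` valuation_ring"

text \<open>The number of elements of the residue field (0 if that field is infinite).\<close>

definition residue_card :: "'k::valued_field itself \<Rightarrow> nat" where
  "residue_card _ = card ((valuation_ring :: 'k set) //
     {(x, y). x \<in> valuation_ring \<and> y \<in> valuation_ring \<and> x - y \<in> maximal_ideal})"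

definition padic_abs :: "nat \<Rightarrow> rat \<Rightarrow> real" where
  "padic_abs p r = (if r = 0 then 0 else
     (let (a, b) = quotient_of r
      in real p powi (int (multiplicity (int p) b) - int (multiplicity (int p) a))))"

text \<open>
  The field \<open>\<rat>\<^sub>p\<close> is the completion of \<open>\<rat>\<close> for the \<open>p\<close>-adic absolute value. Inside a valued
  field \<open>K\<close> of characteristic 0 it is therefore present (as a valued field) precisely when
  \<open>vabs\<close> restricts on \<open>\<rat>\<close> to a power of the \<open>p\<close>-adic absolute value and the closure of \<open>\<rat>\<close>
  is complete; that closure is then \<open>\<rat>\<^sub>p\<close>. The exponent \<open>e\<close> is needed because the absolute
  value of \<open>K\<close> is normalised on \<open>K\<close>, not on \<open>\<rat>\<^sub>p\<close>.
\<close>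

definition rat_closure :: "'k::valued_field set" where
  "rat_closure = closure (range of_rat)"

definition rat_closure_is_Qp :: "'k::valued_field itself \<Rightarrow> nat \<Rightarrow> bool" where
  "rat_closure_is_Qp _ p \<longleftrightarrow>
     (\<exists>e>0. \<forall>r. vabs (of_rat r :: 'k) = padic_abs p r powr e) \<and>
     complete (rat_closure :: 'k set)"

definition finite_over_rat_closure :: "'k::valued_field itself \<Rightarrow> bool" where
  "finite_over_rat_closure _ \<longleftrightarrow>
     (\<exists>B :: 'k set. finite B \<and>
        (\<forall>x. \<exists>c. (\<forall>b\<in>B. c b \<in> rat_closure) \<and> x = (\<Sum>b\<in>B. c b * b)))"

text \<open>
  The last condition is the normalisation \<open>|z|\<^sub>K = q\<^bsup>-ord z\<^esup>\<close> of the absolute value.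
\<close>

definition padic_field :: "'k::valued_field itself \<Rightarrow> bool" where
  "padic_field _ \<longleftrightarrow>
     (\<exists>p. prime p \<and> rat_closure_is_Qp TYPE('k) p \<and> finite_over_rat_closure TYPE('k)) \<and>
     (\<exists>\<pi>::'k. uniformizer \<pi> \<and> vabs \<pi> = 1 / real (residue_card TYPE('k)))"

definition kord :: "'k::valued_field \<Rightarrow> int" where
  "kord z = (THE k. vabs z = real (residue_card TYPE('k)) powi (- k))"

definition ac :: "'k::valued_field \<Rightarrow> 'k \<Rightarrow> 'k" where
  "ac \<pi> z = z * \<pi> powi (- kord z)"

section \<open>Laurent polynomials\<close>

text \<open>
  The Laurent polynomial ring in variables indexed by \<open>'n\<close> is the group algebra of \<open>\<int>\<^sup>n\<close>,
  whose elements are the finitely supported coefficient families.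
\<close>

type_synonym ('k, 'n) laurent_poly = "(int ^ 'n) \<Rightarrow>\<^sub>0 'k"

definition laurent_eval :: "('k::field, 'n::finite) laurent_poly \<Rightarrow> 'k ^ 'n \<Rightarrow> 'k" where
  "laurent_eval f x =
     (\<Sum>m\<in>Poly_Mapping.keys f. Poly_Mapping.lookup f m * (\<Prod>i\<in>UNIV. x $ i powi (m $ i)))"

definition laurent_partial ::
    "'n \<Rightarrow> ('k::field, 'n::finite) laurent_poly \<Rightarrow> ('k, 'n) laurent_poly" where
  "laurent_partial i f =
     (\<Sum>m\<in>Poly_Mapping.keys f.
        Poly_Mapping.single (m - axis i 1) (of_int (m $ i) * Poly_Mapping.lookup f m))"

definition torus :: "('k::field ^ 'n::finite) set" where
  "torus = {x. \<forall>i. x $ i \<noteq> 0}"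

section \<open>Newton polytopes\<close>

definition real_vec :: "int ^ 'n \<Rightarrow> real ^ 'n" where
  "real_vec m = (\<chi> i. real_of_int (m $ i))"

definition nonneg_orthant :: "(real ^ 'n) set" where
  "nonneg_orthant = {x. \<forall>i. 0 \<le> x $ i}"

definition newton_polytope :: "('k::field, 'n::finite) laurent_poly \<Rightarrow> (real ^ 'n) set" where
  "newton_polytope f = convex hull (real_vec ` Poly_Mapping.keys f)"

definition newton_d :: "('k::field, 'n::finite) laurent_poly \<Rightarrow> real ^ 'n \<Rightarrow> real" where
  "newton_d f a = (INF x\<in>newton_polytope f. a \<bullet> x)"

definition newton_face ::
    "('k::field, 'n::finite) laurent_poly \<Rightarrow> real ^ 'n \<Rightarrow> (real ^ 'n) set" where
  "newton_face f a = {x \<in> newton_polytope f. a \<bullet> x = newton_d f a}"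

definition face_function ::
    "('k::field, 'n::finite) laurent_poly \<Rightarrow> real ^ 'n \<Rightarrow> ('k, 'n) laurent_poly" where
  "face_function f a =
     (\<Sum>m\<in>{m \<in> Poly_Mapping.keys f. real_vec m \<in> newton_face f a}.
        Poly_Mapping.single m (Poly_Mapping.lookup f m))"

definition weakly_nondegenerate :: "('k::field, 'n::finite) laurent_poly \<Rightarrow> bool" where
  "weakly_nondegenerate f \<longleftrightarrow>
     (\<forall>a\<in>nonneg_orthant. \<not> (\<exists>x\<in>torus.
        laurent_eval (face_function f a) x = 0 \<and>
        (\<forall>i. laurent_eval (laurent_partial i (face_function f a)) x = 0)))"

section \<open>Fans\<close>

definition rational_cone :: "(real ^ 'n::finite) set \<Rightarrow> bool" where
  "rational_cone \<sigma> \<longleftrightarrow> (\<exists>S. finite S \<and> \<sigma> = convex_cone hull (real_vec ` S))"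

definition strongly_convex :: "(real ^ 'n::finite) set \<Rightarrow> bool" where
  "strongly_convex \<sigma> \<longleftrightarrow> \<sigma> \<inter> uminus ` \<sigma> = {0}"

text \<open>The library's \<open>face_of\<close> counts the empty set as a face; a face of a cone is nonempty.\<close>

definition fan :: "(real ^ 'n::finite) set set \<Rightarrow> bool" where
  "fan \<F> \<longleftrightarrow> finite \<F> \<and>
     (\<forall>\<sigma>\<in>\<F>. rational_cone \<sigma> \<and> strongly_convex \<sigma>) \<and>
     (\<forall>\<sigma>\<in>\<F>. \<forall>\<tau>. \<tau> face_of \<sigma> \<and> \<tau> \<noteq> {} \<longrightarrow> \<tau> \<in> \<F>) \<and>
     (\<forall>\<sigma>\<in>\<F>. \<forall>\<tau>\<in>\<F>. (\<sigma> \<inter> \<tau>) face_of \<sigma> \<and> (\<sigma> \<inter> \<tau>) face_of \<tau>)"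

definition fan_support :: "(real ^ 'n::finite) set set \<Rightarrow> (real ^ 'n) set" where
  "fan_support \<F> = \<Union>\<F>"

definition lattice_basis :: "(int ^ 'n::finite) set \<Rightarrow> bool" where
  "lattice_basis B \<longleftrightarrow> \<not> module.dependent (*s) B \<and> module.span (*s) B = UNIV"

definition simple_fan :: "(real ^ 'n::finite) set set \<Rightarrow> bool" where
  "simple_fan \<F> \<longleftrightarrow>
     (\<forall>\<sigma>\<in>\<F>. \<exists>B S. lattice_basis B \<and> S \<subseteq> B \<and> \<sigma> = convex_cone hull (real_vec ` S))"

definition subordinated ::
    "('k::field, 'n::finite) laurent_poly \<Rightarrow> (real ^ 'n) set set \<Rightarrow> bool" where
  "subordinated f \<F> \<longleftrightarrow>
     (\<forall>\<sigma>\<in>\<F>. \<forall>a\<in>rel_interior \<sigma>. \<forall>a'\<in>rel_interior \<sigma>. newton_face f a = newton_face f a')"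

definition trivial_fan :: "(real ^ 'n::finite) set set" where
  "trivial_fan = {\<tau>. \<tau> face_of nonneg_orthant \<and> \<tau> \<noteq> {}}"

definition primitive_vec :: "int ^ 'n::finite \<Rightarrow> bool" where
  "primitive_vec a \<longleftrightarrow> (GCD i\<in>UNIV. a $ i) = 1"

text \<open>The primitive integral generators of a cone are those of its one-dimensional faces.\<close>

definition fan_edges :: "(real ^ 'n::finite) set set \<Rightarrow> (int ^ 'n) set" where
  "fan_edges \<F> =
     {a. primitive_vec a \<and> (\<exists>\<sigma>\<in>\<F>. (convex_cone hull {real_vec a}) face_of \<sigma>)}"

section \<open>Candidate poles\<close>

definition vec_weight :: "int ^ 'n::finite \<Rightarrow> int" where
  "vec_weight a = (\<Sum>i\<in>UNIV. a $ i)"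

definition candidate_poles ::
    "('k::valued_field, 'n::finite) laurent_poly \<Rightarrow> int ^ 'n \<Rightarrow> complex set" where
  "candidate_poles f a =
     (let d = newton_d f (real_vec a); q = real (residue_card TYPE('k)) in
      if d = 0 then {}
      else {complex_of_real (- of_int (vec_weight a) / d)
              + 2 * complex_of_real pi * \<i> * of_int k / complex_of_real (d * ln q) |k. True})"

definition neg_ratios ::
    "('k::field, 'n::finite) laurent_poly \<Rightarrow> (real ^ 'n) set set \<Rightarrow> real set" where
  "neg_ratios f \<F> =
     {of_int (vec_weight a) / (- newton_d f (real_vec a)) |a.
        a \<in> fan_edges \<F> \<and> newton_d f (real_vec a) < 0}"

definition pos_ratios ::
    "('k::field, 'n::finite) laurent_poly \<Rightarrow> (real ^ 'n) set set \<Rightarrow> real set" where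
  "pos_ratios f \<F> =
     {of_int (vec_weight a) / (- newton_d f (real_vec a)) |a.
        a \<in> fan_edges \<F> \<and> newton_d f (real_vec a) > 0}"

definition fan_alpha ::
    "('k::field, 'n::finite) laurent_poly \<Rightarrow> (real ^ 'n) set set \<Rightarrow> ereal" where
  "fan_alpha f \<F> = (if neg_ratios f \<F> = {} then \<infinity> else ereal (Min (neg_ratios f \<F>)))"

definition fan_beta ::
    "('k::field, 'n::finite) laurent_poly \<Rightarrow> (real ^ 'n) set set \<Rightarrow> real" where
  "fan_beta f \<F> = Max (pos_ratios f \<F> \<union> {-1})"

section \<open>Quasicharacters\<close>

text \<open>
  Homomorphisms from \<open>K\<^sup>\<times>\<close> and from the group of units are represented by functions on \<open>K\<close>
  that vanish outside the group, so that distinct functions are distinct homomorphisms.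
\<close>

definition quasichars :: "('k::valued_field \<Rightarrow> complex) set" where
  "quasichars = {\<omega>. continuous_on (UNIV - {0}) \<omega> \<and>
     (\<forall>x. \<omega> x = 0 \<longleftrightarrow> x = 0) \<and>
     (\<forall>x y. x \<noteq> 0 \<longrightarrow> y \<noteq> 0 \<longrightarrow> \<omega> (x * y) = \<omega> x * \<omega> y)}"

definition unit_chars :: "('k::valued_field \<Rightarrow> complex) set" where
  "unit_chars = {\<eta>. continuous_on unit_group \<eta> \<and>
     (\<forall>x. \<eta> x = 0 \<longleftrightarrow> x \<notin> unit_group) \<and>
     (\<forall>x\<in>unit_group. \<forall>y\<in>unit_group. \<eta> (x * y) = \<eta> x * \<eta> y)}"

definition q_powr_neg :: "'k::valued_field itself \<Rightarrow> complex \<Rightarrow> complex" where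
  "q_powr_neg _ s = of_nat (residue_card TYPE('k)) powr (- s)"

definition quasichars_strip ::
    "'k::valued_field \<Rightarrow> ereal \<Rightarrow> ereal \<Rightarrow> ('k \<Rightarrow> complex) set" where
  "quasichars_strip \<pi> b c =
     {\<omega> \<in> quasichars. \<exists>s. \<omega> \<pi> = q_powr_neg TYPE('k) s \<and> b < ereal (Re s) \<and> ereal (Re s) < c}"

text \<open>The quasicharacter with parameters \<open>(s, \<eta>)\<close>; its value at 0 is 0, as \<open>0 powr s = 0\<close>.\<close>

definition quasichar ::
    "'k::valued_field \<Rightarrow> complex \<Rightarrow> ('k \<Rightarrow> complex) \<Rightarrow> 'k \<Rightarrow> complex" where
  "quasichar \<pi> s \<eta> x = complex_of_real (vabs x) powr s * \<eta> (ac \<pi> x)"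

section \<open>Local zeta functions\<close>

text \<open>
  Every compact set is covered by finitely many translates of the unit polydisc, so the measure
  is automatically finite on compact sets.
\<close>

definition normalised_haar :: "('k::valued_field ^ 'n::finite) measure \<Rightarrow> bool" where
  "normalised_haar \<mu> \<longleftrightarrow> sets \<mu> = sets borel \<and>
     (\<forall>a. distr \<mu> borel (\<lambda>x. a + x) = \<mu>) \<and>
     emeasure \<mu> {x. \<forall>i. x $ i \<in> valuation_ring} = 1"

definition bruhat_schwartz :: "('k::valued_field ^ 'n::finite \<Rightarrow> complex) \<Rightarrow> bool" where
  "bruhat_schwartz \<Phi> \<longleftrightarrow>
     (\<forall>x. \<exists>U. open U \<and> x \<in> U \<and> \<Phi> constant_on U) \<and> compact (closure {x. \<Phi> x \<noteq> 0})"

definition zeta_domain :: "('k::valued_field, 'n::finite) laurent_poly \<Rightarrow> ('k ^ 'n) set" where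
  "zeta_domain f = {x \<in> torus. laurent_eval f x \<noteq> 0}"

definition zeta_converges ::
    "('k::valued_field ^ 'n::finite) measure \<Rightarrow> ('k ^ 'n \<Rightarrow> complex) \<Rightarrow> ('k \<Rightarrow> complex)
      \<Rightarrow> ('k, 'n) laurent_poly \<Rightarrow> bool" where
  "zeta_converges \<mu> \<Phi> \<omega> f \<longleftrightarrow>
     set_integrable \<mu> (zeta_domain f) (\<lambda>x. \<Phi> x * \<omega> (laurent_eval f x))"

definition local_zeta ::
    "('k::valued_field ^ 'n::finite) measure \<Rightarrow> ('k ^ 'n \<Rightarrow> complex) \<Rightarrow> ('k \<Rightarrow> complex)
      \<Rightarrow> ('k, 'n) laurent_poly \<Rightarrow> complex" where
  "local_zeta \<mu> \<Phi> \<omega> f =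
     set_lebesgue_integral \<mu> (zeta_domain f) (\<lambda>x. \<Phi> x * \<omega> (laurent_eval f x))"

end

theory Submission
  imports Defs "HOL-Computational_Algebra.Field_as_Ring"
begin

no_notation fps_nth (infixl \<open>$\<close> 75)

text \<open>
  Split the part of the torus that meets the support of \<open>\<Phi>\<close> according to the vector of orders of the
  coordinates; after a translation these vectors lie in the orthant, hence in exactly one relatively
  open cone of the fan. On the points of order \<open>k + \<Sum> \<kappa>\<^sub>a a\<close>, with \<open>a\<close> running over generators of a
  cone, the substitution \<open>x\<^sub>i = \<pi>\<^bsup>\<Sum> \<kappa>\<^sub>a a\<^sub>i\<^esup> y\<^sub>i\<close> turns \<open>f\<close> into
  \<open>\<pi>\<^bsup>\<Sum> \<kappa>\<^sub>a d(a)\<^esup>\<close> times a small perturbation of a face polynomial. Near a zero of the face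
  polynomial non-degeneracy gives a nonzero gradient, so \<open>f\<close> is equidistributed there and the
  remaining integral over one variable contributes the factor with pole \<open>-1\<close>; elsewhere
  \<open>\<omega>(f)\<close> is locally constant. Once the \<open>\<kappa>\<^sub>a\<close> are large, the integral over one level is therefore
  exactly a constant times \<open>\<Prod> (q\<^bsup>-\<parallel>a\<parallel>\<^esup> \<tau>\<^bsup>d(a)\<^esup>)\<^bsup>\<kappa>\<^sub>a\<^esup>\<close> with \<open>\<tau> = \<omega>(\<pi>)\<close>, and
  the sum over \<open>\<kappa>\<close> is a product of geometric series. For a cone of full dimension the face is a
  vertex, whose monomial has no zeros on the torus; so the pole \<open>-1\<close> only arises together with at
  most \<open>n - 1\<close> geometric series, and no pole has order above \<open>n\<close>.
\<close>

section \<open>Discretely valued fields\<close>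

text \<open>The geometric series have to be exact beyond some threshold, since asymptotics would not
  give a rational function. Exactness comes from discreteness: a unit character is constant on balls
  of radius \<open>rad c\<close> around units, \<open>\<Phi>\<close> is locally constant even at
  points with vanishing coordinates, and absolute values are powers of \<open>q\<close>. The
  thresholds vary with the point of the torus; instead of a compactness argument on a level set,
  \<open>pball_induct\<close> descends along nested balls and uses completeness. Large coefficients
  alone do not cover a cone: bounding some of them leaves series over the remaining generators.
  Hence everything is stated for an arbitrary subset \<open>I\<close> of the generators, and
  non-degeneracy is applied to the face of each \<open>I\<close>. For a fixed unit character the
  integrals depend on the quasicharacter only through \<open>\<tau>\<close>, so one function of
  \<open>\<tau>\<close> serves all of them. Pole orders are tracked in \<open>\<tau>\<close> through
  \<open>admissible\<close> and pass to \<open>s\<close> because the exponential map is locally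
  biholomorphic.\<close>

lemma vabs_eq_0_iff [simp]: "vabs (x::'k::valued_field) = 0 \<longleftrightarrow> x = 0"
  using dist_vabs[of x 0] dist_eq_0_iff[of x 0] by simp

lemma vabs_nonneg [simp]: "0 \<le> vabs (x::'k::valued_field)"
  using dist_vabs[of x 0] zero_le_dist[of x 0] by simp

lemma vabs_pos_iff [simp]: "0 < vabs (x::'k::valued_field) \<longleftrightarrow> x \<noteq> 0"
  using vabs_nonneg[of x] vabs_eq_0_iff[of x] by linarith

lemma vabs_0 [simp]: "vabs (0::'k::valued_field) = 0"
  by simp

lemma vabs_1 [simp]: "vabs (1::'k::valued_field) = 1"
  using vabs_mult[of "1::'k" 1] by simp

lemma vabs_minus [simp]: "vabs (- x) = vabs (x::'k::valued_field)"
  using dist_vabs[of x 0] dist_vabs[of 0 x] by (simp add: dist_commute)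

lemma vabs_diff_commute: "vabs (x - y) = vabs (y - (x::'k::valued_field))"
  by (metis minus_diff_eq vabs_minus)

lemma vabs_diff: "vabs (x - y) \<le> max (vabs x) (vabs (y::'k::valued_field))"
  using vabs_add[of x "- y"] by simp

lemma vabs_add_le: "vabs x \<le> r \<Longrightarrow> vabs y \<le> r \<Longrightarrow> vabs (x + y) \<le> r" for x y :: "'k::valued_field"
  using vabs_add[of x y] by linarith

lemma vabs_add_less: "vabs x < r \<Longrightarrow> vabs y < r \<Longrightarrow> vabs (x + y) < r" for x y :: "'k::valued_field"
  using vabs_add[of x y] by linarith

lemma vabs_diff_le: "vabs x \<le> r \<Longrightarrow> vabs y \<le> r \<Longrightarrow> vabs (x - y) \<le> r" for x y :: "'k::valued_field"
  using vabs_diff[of x y] by linarith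

lemma vabs_triangle:
  "vabs (x - y) \<le> r \<Longrightarrow> vabs (y - z) \<le> r \<Longrightarrow> vabs (x - z) \<le> r" for x y z :: "'k::valued_field"
  using vabs_add_le[of "x - y" r "y - z"] by simp

lemma vabs_triangle_left:
  "vabs (x - y) \<le> r \<Longrightarrow> vabs (z - y) \<le> r \<Longrightarrow> vabs (x - z) \<le> r" for x y z :: "'k::valued_field"
  using vabs_diff_le[of "x - y" r "z - y"] by simp

lemma vabs_triangle_right:
  "vabs (y - x) \<le> r \<Longrightarrow> vabs (y - z) \<le> r \<Longrightarrow> vabs (x - z) \<le> r" for x y z :: "'k::valued_field"
  using vabs_diff_le[of "y - z" r "y - x"] by simp

text \<open>The isosceles triangle principle. It yields exact, not merely approximate, sizes, on
  which the scaling argument rests.\<close>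

lemma vabs_dominant: "vabs (y - x) < vabs x \<Longrightarrow> vabs y = vabs x" for x y :: "'k::valued_field"
  using vabs_add[of "y - x" x] vabs_diff[of y "y - x"] by auto

lemma vabs_power: "vabs (x ^ n) = vabs (x::'k::valued_field) ^ n"
  by (induction n) (auto simp: vabs_mult)

lemma vabs_inverse: "vabs (inverse x) = inverse (vabs (x::'k::valued_field))"
proof (cases "x = 0")
  case False
  then have "vabs x * vabs (inverse x) = 1" by (metis right_inverse vabs_1 vabs_mult)
  then show ?thesis by (simp add: inverse_unique)
qed auto

lemma vabs_divide: "vabs (x / y) = vabs x / vabs (y::'k::valued_field)"
  by (simp add: divide_inverse vabs_mult vabs_inverse)

lemma vabs_power_int: "vabs (x powi k) = vabs (x::'k::valued_field) powi k"
  by (auto simp: power_int_def vabs_power vabs_inverse)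

lemma vabs_sum_le:
  fixes g :: "'i \<Rightarrow> 'k::valued_field"
  shows "(\<And>i. i \<in> A \<Longrightarrow> vabs (g i) \<le> r) \<Longrightarrow> 0 \<le> r \<Longrightarrow> vabs (sum g A) \<le> r"
  by (induction A rule: infinite_finite_induct) (auto intro!: vabs_add_le)

locale discretely_valued =
  fixes \<pi> :: "'k::valued_field"
  assumes uniformizer: "uniformizer \<pi>"
    and vabs_uniformizer: "vabs \<pi> = 1 / real (residue_card TYPE('k))"
begin

text \<open>The residue cardinality read off from the uniformizer; the floor merely turns the real
  number \<open>1 / vabs \<pi>\<close> into a natural number.\<close>

definition q :: nat where "q = nat \<lfloor>1 / vabs \<pi>\<rfloor>"

lemma residue_card_eq: "residue_card TYPE('k) = q"
  by (simp add: q_def vabs_uniformizer)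

text \<open>The uniformizer is a nonzero element of the maximal ideal, so \<open>1 / q\<close> lies
  strictly between 0 and 1. This also rules out the value 0 that stands for an infinite residue
  field.\<close>

lemma q_ge_2: "q \<ge> 2"
proof -
  have "\<pi> * 1 \<in> (\<lambda>y. \<pi> * y) ` valuation_ring"
    by (intro imageI) (simp add: valuation_ring_def)
  then have "\<pi> \<noteq> 0" "\<pi> \<in> maximal_ideal"
    using uniformizer by (simp_all add: uniformizer_def)
  then have "0 < vabs \<pi>" "vabs \<pi> < 1" by (auto simp: maximal_ideal_def)
  then show ?thesis using vabs_uniformizer unfolding residue_card_eq
    by (cases q; cases "q - 1") (auto simp: field_simps)
qed

text \<open>Radii are indexed by integer exponents. A larger exponent means a smaller ball, so
  inequalities between exponents and radii are reversed.\<close>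

definition rad :: "int \<Rightarrow> real" where "rad N = vabs \<pi> powi N"

lemma rad_eq: "rad N = real q powi (- N)"
  by (simp add: rad_def vabs_uniformizer residue_card_eq power_int_minus power_int_divide_distrib field_simps)

lemma rad_pos [simp]: "0 < rad N" using q_ge_2 by (simp add: rad_eq)
lemma rad_nonneg [simp]: "0 \<le> rad N" using rad_pos[of N] by linarith
lemma rad_neq_0 [simp]: "rad N \<noteq> 0" using rad_pos[of N] by linarith
lemma rad_0 [simp]: "rad 0 = 1" by (simp add: rad_eq)
lemma rad_add: "rad (a + b) = rad a * rad b"
  using q_ge_2 by (simp add: rad_eq power_int_add[symmetric])
lemma rad_minus: "rad (- a) = 1 / rad a"
  using q_ge_2 by (simp add: rad_eq power_int_minus field_simps)
lemma rad_diff: "rad (a - b) = rad a / rad b"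
  using rad_add[of a "-b"] by (simp add: rad_minus)
lemma rad_less_iff [simp]: "rad a < rad b \<longleftrightarrow> b < a"
  using power_int_strict_increasing[of "-a" "-b" "real q"] power_int_increasing[of "-b" "-a" "real q"] q_ge_2
  by (cases "b < a") (auto simp: rad_eq not_less)
lemma rad_le_iff [simp]: "rad a \<le> rad b \<longleftrightarrow> b \<le> a"
  using rad_less_iff[of b a] by (simp only: linorder_not_less[symmetric])
lemma rad_eq_iff [simp]: "rad a = rad b \<longleftrightarrow> a = b"
  using rad_le_iff[of a b] rad_le_iff[of b a] by linarith
lemma rad_le_1_iff [simp]: "rad a \<le> 1 \<longleftrightarrow> 0 \<le> a"
  using rad_le_iff[of a 0] by (simp del: rad_le_iff)
lemma rad_less_1_iff [simp]: "rad a < 1 \<longleftrightarrow> 0 < a"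
  using rad_less_iff[of a 0] by (simp del: rad_less_iff)
lemma rad_1: "rad 1 = 1 / real q" by (simp add: rad_eq power_int_minus field_simps)
lemma rad_power: "rad a ^ n = rad (a * int n)"
  by (induction n) (auto simp: rad_add[symmetric] algebra_simps)
lemma rad_of_nat: "rad (int n) = 1 / real q ^ n"
  by (simp add: rad_eq power_int_minus field_simps)
lemma rad_arbitrarily_small: "0 < e \<Longrightarrow> \<exists>N. \<forall>M\<ge>N. rad M < e"
proof -
  assume "0 < e"
  obtain n where n: "(1/2::real) ^ n < e" using real_arch_pow_inv[OF \<open>0 < e\<close>, of "1/2"] by auto
  have "rad (int n) \<le> (1/2) ^ n"
    unfolding rad_of_nat power_one_over using q_ge_2
    by (intro divide_left_mono power_mono) auto
  then have "rad M < e" if "M \<ge> int n" for M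
    using n that rad_le_iff[of M "int n"] by linarith
  then show ?thesis by blast
qed

lemma vabs_pi_powi [simp]: "vabs (\<pi> powi k) = rad k"
  by (simp add: vabs_power_int rad_def)

lemma vabs_pi_power [simp]: "vabs (\<pi> ^ n) = rad (int n)"
  using vabs_pi_powi[of "int n"] by simp

lemma pi_neq_0 [simp]: "\<pi> \<noteq> 0" using uniformizer by (simp add: uniformizer_def)

lemma vabs_less_1: "vabs (x::'k) < 1 \<Longrightarrow> vabs x \<le> rad 1"
proof -
  assume "vabs x < 1"
  then obtain y where "x = \<pi> * y" "vabs y \<le> 1"
    using uniformizer by (auto simp: uniformizer_def maximal_ideal_def valuation_ring_def)
  then show ?thesis by (simp add: vabs_mult vabs_uniformizer residue_card_eq rad_1 divide_right_mono)
qed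

text \<open>The values are discrete: after scaling to exponent 0, an element of the maximal ideal is
  a multiple of the uniformizer, which costs a full power of \<open>q\<close>.\<close>

lemma vabs_less_rad: "vabs (x::'k) < rad k \<Longrightarrow> vabs x \<le> rad (k + 1)"
  using vabs_less_1[of "x * \<pi> powi (-k)"]
  by (simp add: vabs_mult rad_minus rad_add field_simps)

lemma vabs_eq_rad: assumes "(x::'k) \<noteq> 0" shows "\<exists>!k. vabs x = rad k"
proof -
  obtain N0 where N0: "\<And>M. M \<ge> N0 \<Longrightarrow> rad M < vabs x" using rad_arbitrarily_small[of "vabs x"] assms by auto
  obtain N1 where N1: "\<And>M. M \<ge> N1 \<Longrightarrow> rad M < 1 / vabs x" using rad_arbitrarily_small[of "1 / vabs x"] assms by auto
  have "vabs x < rad (-N1)" using N1[of N1] assms by (simp add: rad_minus field_simps)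
  moreover have "rad N0 < vabs x" using N0 by simp
  ultimately have lt: "- N1 < N0" by (metis less_trans rad_less_iff)
  \<comment> \<open>Each step either hits the value or lowers the upper bound by one power of
    \<open>q\<close>; at \<open>n = 0\<close> the bound contradicts
    \<open>rad N0 < vabs x\<close>.\<close>
  have "\<exists>k. vabs x = rad k" if "vabs x \<le> rad (N0 - int n)" for n
    using that
  proof (induction n)
    case 0 then show ?case using \<open>rad N0 < vabs x\<close> by simp
  next
    case (Suc n)
    show ?case
    proof (cases "vabs x = rad (N0 - int (Suc n))")
      case False
      then have "vabs x < rad (N0 - int (Suc n))" using Suc.prems by linarith
      from vabs_less_rad[OF this] have "vabs x \<le> rad (N0 - int n)" by (simp add: algebra_simps)
      then show ?thesis using Suc.IH by blast
    qed blast
  qed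
  from this[of "nat (N0 + N1)"] \<open>vabs x < rad (-N1)\<close> lt show ?thesis by auto
qed

lemma kord_def': "kord (z::'k) = (THE k. vabs z = rad k)"
  by (simp add: kord_def rad_eq residue_card_eq)

lemma vabs_kord: "(x::'k) \<noteq> 0 \<Longrightarrow> vabs x = rad (kord x)"
  unfolding kord_def' by (rule theI') (rule vabs_eq_rad)

lemma kord_eqI: "vabs (x::'k) = rad k \<Longrightarrow> kord x = k"
  unfolding kord_def' by (rule the_equality) auto

lemma kord_mult: "(x::'k) \<noteq> 0 \<Longrightarrow> y \<noteq> 0 \<Longrightarrow> kord (x * y) = kord x + kord y"
  by (intro kord_eqI) (simp add: vabs_mult vabs_kord rad_add)

lemma kord_pi_powi [simp]: "kord (\<pi> powi k) = k" by (intro kord_eqI) simp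

section \<open>Representatives modulo powers of the maximal ideal\<close>

lemma residue_reps_1:
  "\<exists>T. finite T \<and> card T = q \<and> (\<forall>t\<in>T. vabs t \<le> 1) \<and> (\<forall>x::'k. vabs x \<le> 1 \<longrightarrow> (\<exists>!t. t \<in> T \<and> vabs (x - t) \<le> rad 1))"
proof -
  let ?E = "{(x, y::'k). x \<in> valuation_ring \<and> y \<in> valuation_ring \<and> x - y \<in> maximal_ideal}"
  let ?Q = "(valuation_ring :: 'k set) // ?E"
  have equiv: "equiv valuation_ring ?E"
  proof (rule equivI)
    show "refl_on valuation_ring ?E" by (auto simp: refl_on_def maximal_ideal_def)
    show "sym ?E" unfolding sym_def maximal_ideal_def by (auto, metis vabs_diff_commute)
    show "trans ?E" unfolding trans_def maximal_ideal_def
    proof clarsimp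
      fix x y z :: 'k assume "vabs (x - y) < 1" "vabs (y - z) < 1"
      then show "vabs (x - z) < 1" using vabs_add_less[of "x - y" 1 "y - z"] by simp
    qed
  qed (auto)
  have card: "card ?Q = q" by (simp add: residue_card_def flip: residue_card_eq)
  then have fin: "finite ?Q" using q_ge_2 by (intro card_ge_0_finite) simp
  define r where "r C = (SOME x::'k. x \<in> C)" for C
  have r: "r C \<in> C" if "C \<in> ?Q" for C
    unfolding r_def using in_quotient_imp_non_empty[OF equiv that] by (simp add: some_in_eq)
  have inj: "inj_on r ?Q"
  proof (rule inj_onI)
    fix C D assume "C \<in> ?Q" "D \<in> ?Q" "r C = r D"
    then show "C = D" using r[of C] r[of D] quotient_disj[OF equiv, of C D] by auto
  qed
  have small: "x - y \<in> maximal_ideal \<longleftrightarrow> vabs (x - y) \<le> rad 1" for x y :: 'k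
    using vabs_less_1[of "x - y"] le_less_trans[of "vabs (x - y)" "rad 1" 1] by (auto simp: maximal_ideal_def)
  have sub: "C \<subseteq> valuation_ring" if "C \<in> ?Q" for C
    using that by (auto simp: quotient_def)
  have "\<exists>!t. t \<in> r ` ?Q \<and> vabs (x - t) \<le> rad 1" if "vabs x \<le> 1" for x :: 'k
  proof -
    have x: "x \<in> valuation_ring" using that by (simp add: valuation_ring_def)
    let ?C = "?E `` {x}"
    have C: "?C \<in> ?Q" using x by (rule quotientI)
    show ?thesis
    proof (rule ex1I[of _ "r ?C"])
      show "r ?C \<in> r ` ?Q \<and> vabs (x - r ?C) \<le> rad 1" using r[OF C] C by (auto simp: small)
      fix t assume t: "t \<in> r ` ?Q \<and> vabs (x - t) \<le> rad 1"
      then obtain D where D: "D \<in> ?Q" "t = r D" by auto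
      have "t \<in> valuation_ring" using sub r D by blast
      then have "t \<in> ?C" using t x by (auto simp: small)
      then have "?C = D" using quotient_disj[OF equiv C D(1)] r[OF D(1)] D(2) by blast
      then show "t = r ?C" using D by simp
    qed
  qed
  moreover have "card (r ` ?Q) = q" using card card_image[OF inj] by simp
  moreover have "\<forall>t\<in>r ` ?Q. vabs t \<le> 1" using r sub by (fastforce simp: valuation_ring_def)
  ultimately show ?thesis using fin by (intro exI[of _ "r ` ?Q"]) blast
qed

text \<open>Representatives of the valuation ring modulo the \<open>r\<close>-th power of the
  maximal ideal. The exact cardinality is included because Haar measures are computed by counting
  translates.\<close>

definition reps :: "nat \<Rightarrow> 'k set \<Rightarrow> bool" where
  "reps r T \<longleftrightarrow> finite T \<and> card T = q ^ r \<and> (\<forall>t\<in>T. vabs t \<le> 1) \<and>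
     (\<forall>x. vabs x \<le> 1 \<longrightarrow> (\<exists>!t. t \<in> T \<and> vabs (x - t) \<le> rad (int r)))"

lemma reps_unique:
  assumes "reps r T" "t \<in> T" "t' \<in> T" "vabs (t - t') \<le> rad (int r)" shows "t = t'"
proof -
  have "\<exists>!u. u \<in> T \<and> vabs (t - u) \<le> rad (int r)" using assms by (simp add: reps_def)
  then show ?thesis using assms(2-4) by (metis cancel_comm_monoid_add_class.diff_cancel rad_nonneg vabs_0)
qed

lemma reps_obtain:
  assumes "reps r T" "vabs x \<le> 1" obtains t where "t \<in> T" "vabs (x - t) \<le> rad (int r)"
  using assms unfolding reps_def by blast

lemma reps_le_1: "reps r T \<Longrightarrow> t \<in> T \<Longrightarrow> vabs t \<le> 1"
  by (simp add: reps_def)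

text \<open>One further digit: each class modulo \<open>\<pi> ^ r\<close> is refined by the residue
  class of the next coefficient.\<close>

lemma reps_Suc:
  assumes T: "reps r T" and S: "reps 1 S"
  shows "reps (Suc r) ((\<lambda>(t, s). t + \<pi> powi (int r) * s) ` (T \<times> S))"
proof -
  let ?f = "\<lambda>(t, s). t + \<pi> powi (int r) * s"
  \<comment> \<open>The new term has absolute value at most \<open>rad r\<close>, so the congruence
    modulo \<open>\<pi> ^ r\<close> determines \<open>t\<close> alone; with \<open>t = t'\<close>,
    division by that power exposes \<open>s\<close>.\<close>
  have uniq: "t = t' \<and> s = s'"
    if "t \<in> T" "t' \<in> T" "s \<in> S" "s' \<in> S" "vabs (x - ?f (t, s)) \<le> rad (int (Suc r))"
      "vabs (x - ?f (t', s')) \<le> rad (int (Suc r))" for x t t' s s'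
  proof -
    have d: "vabs (?f (t, s) - ?f (t', s')) \<le> rad (int (Suc r))"
      using vabs_triangle[of "?f (t, s)" x _ "?f (t', s')"] that by (simp add: vabs_diff_commute)
    have "vabs (\<pi> powi (int r) * s) \<le> rad (int r)" "vabs (\<pi> powi (int r) * s') \<le> rad (int r)"
      using reps_le_1[OF S that(3)] reps_le_1[OF S that(4)] by (auto simp: vabs_mult mult_left_le)
    moreover have "vabs (?f (t, s) - ?f (t', s')) \<le> rad (int r)"
      using d by (rule order_trans) simp
    ultimately have "vabs (?f (t, s) - ?f (t', s') - \<pi> powi (int r) * s + \<pi> powi (int r) * s') \<le> rad (int r)"
      using vabs_add_le[OF vabs_diff_le] by blast
    then have "vabs (t - t') \<le> rad (int r)" by simp
    then have t: "t = t'" using reps_unique T that by blast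
    have "vabs (\<pi> powi (int r) * (s - s')) \<le> rad (int (Suc r))" using d t by (simp add: algebra_simps)
    then have "vabs (s - s') \<le> rad 1" by (simp add: vabs_mult rad_add)
    then have "s = s'" using reps_unique[OF S] that by simp
    with t show ?thesis by simp
  qed
  have inj: "inj_on ?f (T \<times> S)"
  proof (rule inj_onI)
    fix a b assume ab: "a \<in> T \<times> S" "b \<in> T \<times> S" "?f a = ?f b"
    obtain t s t' s' where "a = (t, s)" "b = (t', s')" by (cases a; cases b)
    then show "a = b" using uniq[of t t' s s' "?f a"] ab by simp
  qed
  have "\<exists>!u. u \<in> ?f ` (T \<times> S) \<and> vabs (x - u) \<le> rad (int (Suc r))" if x: "vabs x \<le> 1" for x
  proof -
    obtain t where t: "t \<in> T" "vabs (x - t) \<le> rad (int r)" using reps_obtain[OF T x] .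
    define y where "y = (x - t) * \<pi> powi (- int r)"
    have "vabs y \<le> 1" using t by (simp add: y_def vabs_mult rad_minus divide_le_eq)
    then obtain s where s: "s \<in> S" "vabs (y - s) \<le> rad 1" using reps_obtain[OF S, of y] by auto
    have "x - ?f (t, s) = \<pi> powi (int r) * (y - s)" by (simp add: y_def power_int_minus field_simps)
    then have 1: "vabs (x - ?f (t, s)) \<le> rad (int (Suc r))" using s by (simp add: vabs_mult rad_add)
    have 2: "u = ?f (t, s)" if u: "u \<in> ?f ` (T \<times> S)" "vabs (x - u) \<le> rad (int (Suc r))" for u
    proof -
      obtain t' s' where ts: "u = ?f (t', s')" "t' \<in> T" "s' \<in> S" using u(1) by blast
      have "t = t' \<and> s = s'" using uniq[OF t(1) ts(2) s(1) ts(3) 1] u(2) ts(1) by blast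
      then show ?thesis using ts(1) by blast
    qed
    have 3: "?f (t, s) \<in> ?f ` (T \<times> S)" using t(1) s(1) by (intro imageI) simp
    show ?thesis by (rule ex1I[of _ "?f (t, s)"]) (use 1 2 3 in blast)+
  qed
  moreover have "vabs (?f a) \<le> 1" if "a \<in> T \<times> S" for a
  proof -
    have "rad (int r) \<le> 1" by simp
    then show ?thesis using that reps_le_1[OF T] reps_le_1[OF S]
      by (auto simp: vabs_mult intro!: vabs_add_le mult_le_one)
  qed
  moreover have "card (?f ` (T \<times> S)) = q ^ Suc r"
    using card_image[OF inj] T S by (simp add: reps_def card_cartesian_product mult.commute)
  moreover have "finite (T \<times> S)" using T S by (simp add: reps_def)
  ultimately show ?thesis unfolding reps_def by simp
qed

lemma reps_exist: "\<exists>T. reps r T"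
proof (induction r)
  case 0
  have "reps 0 {0}" unfolding reps_def by auto
  then show ?case by blast
next
  case (Suc r)
  obtain S where "reps 1 S" using residue_reps_1 by (auto simp: reps_def)
  with Suc reps_Suc show ?case by blast
qed

end

section \<open>Completeness of the field\<close>

lemma vabs_limit_le:
  fixes X :: "nat \<Rightarrow> 'k::valued_field"
  assumes "X \<longlonglongrightarrow> l" "\<And>m. m \<ge> n \<Longrightarrow> vabs (X m - b) \<le> r" "r > 0"
  shows "vabs (l - b) \<le> r"
proof -
  obtain M where M: "\<And>m. m \<ge> M \<Longrightarrow> dist (X m) l < r" using assms(1,3) unfolding lim_sequentially by blast
  have "dist (X (max M n)) l < r" by (rule M) simp
  then have "vabs (X (max M n) - l) \<le> r" unfolding dist_vabs by (rule less_imp_le)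
  then show ?thesis using assms(2)[of "max M n"] vabs_triangle_right[of "X (max M n)" l r b] by simp
qed

context discretely_valued
begin

lemma reps_finite: "reps r T \<Longrightarrow> finite T" and reps_card: "reps r T \<Longrightarrow> card T = q ^ r"
  by (simp_all add: reps_def)

text \<open>
  Digit expansions in powers of \<open>P\<close>: the coefficient of each digit is a partial sum of powers
  of \<open>P\<close>, so it converges in the closure of the rationals.
\<close>

lemma Cauchy_converges_if_rat_closure_complete:
  fixes X :: "nat \<Rightarrow> 'k" and P :: 'k
  assumes P: "P \<noteq> 0" "vabs P < 1" "P \<in> range of_rat" and compl: "complete (rat_closure :: 'k set)"
    and X: "Cauchy X"
  shows "\<exists>l. X \<longlonglongrightarrow> l"
proof -
  have small: "\<exists>n0. \<forall>n\<ge>n0. vabs P ^ n < e" if e: "e > 0" for e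
  proof -
    obtain n where "vabs P ^ n < e" using real_arch_pow_inv[OF e P(2)] by auto
    moreover have "vabs P ^ m \<le> vabs P ^ n" if "m \<ge> n" for m using that P by (intro power_decreasing) auto
    ultimately show ?thesis by (meson order_le_less_trans)
  qed
  have pw: "0 < vabs P ^ n" for n using P by simp
  have pw_Suc: "vabs P ^ Suc n \<le> vabs P ^ n" for n using P by (intro power_decreasing) auto
  have "\<forall>n. \<exists>N. \<forall>m\<ge>N. \<forall>k\<ge>N. vabs (X m - X k) < vabs P ^ n"
    using X pw unfolding Cauchy_def dist_vabs by blast
  from choice[OF this] obtain N where
    N': "\<forall>n. \<forall>m\<ge>N n. \<forall>k\<ge>N n. vabs (X m - X k) < vabs P ^ n" by blast
  then have N: "vabs (X m - X k) \<le> vabs P ^ n" if "m \<ge> N n" "k \<ge> N n" for n m k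
    using N' that less_imp_le by blast
  define y where "y n = X (N n)" for n
  have y: "vabs (y (Suc n) - y n) \<le> vabs P ^ n" for n
  proof -
    let ?m = "max (N n) (N (Suc n))"
    have "vabs (y (Suc n) - X ?m) \<le> vabs P ^ n"
      unfolding y_def by (rule order_trans[OF N[of "Suc n"] pw_Suc]) auto
    moreover have "vabs (X ?m - y n) \<le> vabs P ^ n" unfolding y_def by (rule N) auto
    ultimately show ?thesis by (rule vabs_triangle)
  qed
  \<comment> \<open>The base of the expansion is the rational element \<open>P\<close>, later a
    prime number, and not \<open>\<pi>\<close>, because the partial sums below have to be rational.
    With \<open>vabs P = rad e\<close>, the set \<open>reps e\<close> represents the ring modulo
    \<open>P\<close>.\<close>
  define e where "e = nat (kord P)"
  have "kord P \<ge> 0" using P vabs_kord[of P] rad_le_1_iff[of "kord P"] by linarith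
  then have e: "vabs P = rad (int e)" using P vabs_kord[of P] by (simp add: e_def)
  obtain T where T: "reps e T" using reps_exist by blast
  have "\<exists>t. vabs x \<le> 1 \<longrightarrow> t \<in> T \<and> vabs (x - t) \<le> vabs P" for x
    using reps_obtain[OF T, of x] unfolding e by blast
  then have "\<forall>x. \<exists>t. vabs x \<le> 1 \<longrightarrow> t \<in> T \<and> vabs (x - t) \<le> vabs P" by blast
  from choice[OF this] obtain \<tau> where \<tau>: "\<And>x. vabs x \<le> 1 \<Longrightarrow> \<tau> x \<in> T" "\<And>x. vabs x \<le> 1 \<Longrightarrow> vabs (x - \<tau> x) \<le> vabs P"
    by blast
  \<comment> \<open>Greedy expansion: the next digit is the residue of what remains of
    \<open>y\<close> after division by \<open>P ^ n\<close>. By \<open>close\<close> this quotient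
    always lies in the valuation ring.\<close>
  define a where "a = rec_nat (y 0) (\<lambda>n b. b + P ^ n * \<tau> ((y (Suc n) - b) / P ^ n))"
  define t where "t n = \<tau> ((y (Suc n) - a n) / P ^ n)" for n
  have a_0: "a 0 = y 0" and a_Suc: "a (Suc n) = a n + P ^ n * t n" for n
    by (simp_all add: a_def t_def)
  have close: "vabs (y n - a n) \<le> vabs P ^ n \<and> vabs ((y (Suc n) - a n) / P ^ n) \<le> 1" for n
  proof (induction n)
    case 0
    then show ?case using y[of 0] by (simp add: a_0)
  next
    case (Suc n)
    let ?z = "(y (Suc n) - a n) / P ^ n"
    have "y (Suc n) - a (Suc n) = P ^ n * (?z - t n)" using P by (simp add: a_Suc field_simps)
    then have 1: "vabs (y (Suc n) - a (Suc n)) \<le> vabs P ^ Suc n"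
      using \<tau>(2)[of ?z] Suc P by (simp add: vabs_mult vabs_power t_def)
    have "vabs (y (Suc (Suc n)) - a (Suc n)) \<le> vabs P ^ Suc n"
      using vabs_triangle[OF y[of "Suc n"] 1] .
    with 1 show ?case using P by (simp add: vabs_divide vabs_power vabs_mult divide_le_eq)
  qed
  have tT: "t n \<in> T" for n unfolding t_def by (rule \<tau>(1)) (use close in blast)
  \<comment> \<open>Collects the places at which the digit \<open>u\<close> occurs. As there are
    only finitely many digits, convergence in the field reduces to finitely many sequences of
    rational elements.\<close>
  define C where "C n u = (\<Sum>j<n. if t j = u then P ^ j else 0)" for n u
  have C_diff: "vabs (C m u - C n u) \<le> vabs P ^ n" if "m \<ge> n" for m n u
  proof -
    have "C m u - C n u = (\<Sum>j\<in>{n..<m}. if t j = u then P ^ j else 0)"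
      using sum_diff_nat_ivl[of 0 n m "\<lambda>j. if t j = u then P ^ j else 0"] that
      by (simp add: C_def lessThan_atLeast0)
    also have "vabs \<dots> \<le> vabs P ^ n"
      using P by (intro vabs_sum_le) (auto simp: vabs_power intro: power_decreasing)
    finally show ?thesis .
  qed
  have C_rat: "C n u \<in> range of_rat" for n u
    unfolding C_def
  proof (induction n)
    case 0 show ?case by (rule range_eqI[of _ _ 0]) simp
  next
    case (Suc n)
    obtain r where "P = of_rat r" using P by blast
    then have "(if t n = u then P ^ n else 0) = of_rat (if t n = u then r ^ n else 0)" by (simp add: of_rat_power)
    with Suc show ?case by (auto simp: image_iff simp flip: of_rat_add)
  qed
  have "\<exists>c. (\<lambda>n. C n u) \<longlonglongrightarrow> c" for u
  proof -
    have "Cauchy (\<lambda>n. C n u)"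
      unfolding Cauchy_def
    proof (intro allI impI)
      fix d :: real assume "d > 0"
      from small[OF this] obtain n where n: "vabs P ^ n < d" by blast
      have "dist (C m u) (C k u) < d" if "m \<ge> n" "k \<ge> n" for m k
      proof -
        have "vabs (C m u - C k u) \<le> vabs P ^ n"
          using vabs_triangle_left[OF C_diff[of n m u] C_diff[of n k u]] that by simp
        then show ?thesis using n by (simp add: dist_vabs)
      qed
      then show "\<exists>M. \<forall>m\<ge>M. \<forall>k\<ge>M. dist (C m u) (C k u) < d" by blast
    qed
    moreover have "C n u \<in> rat_closure" for n using C_rat closure_subset unfolding rat_closure_def by blast
    ultimately show ?thesis
      using compl[unfolded complete_def, THEN spec, of "\<lambda>n. C n u"] by (auto simp del: Cauchy_convergent_iff)
  qed
  then have "\<forall>u. \<exists>c. (\<lambda>n. C n u) \<longlonglongrightarrow> c" by blast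
  from choice[OF this] obtain c where c: "\<And>u. (\<lambda>n. C n u) \<longlonglongrightarrow> c u" by blast
  have c_diff: "vabs (c u - C n u) \<le> vabs P ^ n" for n u
    by (rule vabs_limit_le[OF c]) (use C_diff pw in auto)
  define l where "l = y 0 + (\<Sum>u\<in>T. c u * u)"
  have a_eq: "a n = y 0 + (\<Sum>u\<in>T. C n u * u)" for n
  proof (induction n)
    case 0 then show ?case by (simp add: a_0 C_def)
  next
    case (Suc n)
    have "(\<Sum>u\<in>T. C (Suc n) u * u) = (\<Sum>u\<in>T. C n u * u + (if t n = u then P ^ n * u else 0))"
      by (intro sum.cong) (auto simp: C_def algebra_simps)
    also have "\<dots> = (\<Sum>u\<in>T. C n u * u) + P ^ n * t n"
      using tT reps_finite[OF T] by (simp add: sum.distrib)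
    finally show ?case using Suc by (simp add: a_Suc)
  qed
  have "vabs (l - a n) \<le> vabs P ^ n" for n
  proof -
    have "l - a n = (\<Sum>u\<in>T. (c u - C n u) * u)"
      by (simp add: l_def a_eq sum_subtractf algebra_simps)
    also have "vabs \<dots> \<le> vabs P ^ n"
    proof (rule vabs_sum_le)
      fix u assume "u \<in> T"
      then show "vabs ((c u - C n u) * u) \<le> vabs P ^ n"
        using mult_mono[OF c_diff[of u n] reps_le_1[OF T, of u]] by (simp add: vabs_mult)
    qed simp
    finally show ?thesis .
  qed
  then have "vabs (y n - l) \<le> vabs P ^ n" for n
    using close vabs_triangle_left[of "y n" "a n" "vabs P ^ n" l for n] by blast
  then have Xl: "vabs (X m - l) \<le> vabs P ^ n" if "m \<ge> N n" for m n
    using vabs_triangle[of "X m" "y n" _ l] N[of n m "N n"] that by (simp add: y_def)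
  have "X \<longlonglongrightarrow> l"
    unfolding lim_sequentially
  proof (intro allI impI)
    fix d :: real assume "d > 0"
    from small[OF this] obtain n where "vabs P ^ n < d" by blast
    then show "\<exists>M. \<forall>m\<ge>M. dist (X m) l < d" using Xl[of n] by (force simp: dist_vabs intro!: exI[of _ "N n"])
  qed
  then show ?thesis by blast
qed

end

lemma padic_abs_prime: assumes "prime p" shows "padic_abs p (of_nat p) = 1 / real p"
proof -
  have "quotient_of (of_nat p) = (int p, 1)" using quotient_of_int[of "int p"] by simp
  moreover have "multiplicity (int p) (int p) = 1" using assms by (intro multiplicity_self) (auto dest: prime_gt_1_nat)
  ultimately show ?thesis using assms prime_gt_0_nat[of p]
    by (simp add: padic_abs_def power_int_minus field_simps)
qed

locale padic = discretely_valued \<pi> for \<pi> :: "'k::valued_field" +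
  assumes Cauchy_converges: "Cauchy (X :: nat \<Rightarrow> 'k) \<Longrightarrow> \<exists>l. X \<longlonglongrightarrow> l"

text \<open>The normalisation is given for some uniformizer only. Two uniformizers generate the same
  ideal and hence have the same absolute value, so it passes to \<open>\<pi>\<close>. The prime
  \<open>p\<close>, whose absolute value is below 1, serves as the base of the digit
  expansions.\<close>

lemma padic_locale:
  assumes K: "padic_field TYPE('k::valued_field)" and u: "uniformizer (\<pi> :: 'k)"
  shows "padic \<pi>"
proof -
  obtain \<pi>0 :: 'k where \<pi>0: "uniformizer \<pi>0" "vabs \<pi>0 = 1 / real (residue_card TYPE('k))"
    using K by (auto simp: padic_field_def)
  have le: "vabs a \<le> vabs b" if "uniformizer a" "uniformizer b" for a b :: 'k
  proof -
    have "a * 1 \<in> (\<lambda>y. a * y) ` valuation_ring" by (intro imageI) (simp add: valuation_ring_def)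
    then have "a \<in> (\<lambda>y. b * y) ` valuation_ring" using that by (simp add: uniformizer_def)
    then show ?thesis by (auto simp: valuation_ring_def vabs_mult mult_left_le)
  qed
  interpret discretely_valued \<pi>
    using u \<pi>0 le[of \<pi> \<pi>0] le[of \<pi>0 \<pi>] by unfold_locales auto
  obtain p where p: "prime p" "rat_closure_is_Qp TYPE('k) p" using K by (auto simp: padic_field_def)
  then obtain e where e: "e > 0" "\<And>r. vabs (of_rat r :: 'k) = padic_abs p r powr e"
    and c: "complete (rat_closure :: 'k set)" by (auto simp: rat_closure_is_Qp_def)
  have "vabs (of_nat p :: 'k) = (1 / real p) powr e"
    using e(2)[of "of_nat p"] padic_abs_prime[OF p(1)] by simp
  also have "\<dots> < 1 powr e" using p e prime_gt_1_nat[of p] by (intro powr_less_mono2) auto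
  finally have "vabs (of_nat p :: 'k) < 1" by simp
  moreover have "(of_nat p :: 'k) \<in> range of_rat" by (metis of_rat_of_nat_eq rangeI)
  moreover have "(of_nat p :: 'k) \<noteq> 0" using p by auto
  ultimately show "padic \<pi>"
    using Cauchy_converges_if_rat_closure_complete[OF _ _ _ c] by unfold_locales blast
qed

section \<open>Polydiscs\<close>

context padic
begin

text \<open>The radii may differ between coordinates because multiplying each coordinate by its own
  power of \<open>\<pi>\<close> turns a ball into such a polydisc.\<close>

definition pdisc :: "'k ^ 'n \<Rightarrow> int ^ 'n \<Rightarrow> ('k ^ 'n) set" where
  "pdisc y e = {x. \<forall>i. vabs (x $ i - y $ i) \<le> rad (e $ i)}"

abbreviation pball :: "'k ^ 'n \<Rightarrow> int \<Rightarrow> ('k ^ 'n) set" where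
  "pball y N \<equiv> pdisc y (vec N)"

lemma pdisc_self [simp]: "y \<in> pdisc y e" by (simp add: pdisc_def)

lemma pdisc_eq: "z \<in> pdisc y e \<Longrightarrow> pdisc z e = pdisc y e"
proof -
  assume z: "z \<in> pdisc y e"
  have "vabs (x $ i - z $ i) \<le> rad (e $ i) \<longleftrightarrow> vabs (x $ i - y $ i) \<le> rad (e $ i)" for x i
    using vabs_triangle[of "x $ i" "z $ i" "rad (e $ i)" "y $ i"]
      vabs_triangle_left[of "x $ i" "y $ i" "rad (e $ i)" "z $ i"] z by (auto simp: pdisc_def)
  then show ?thesis by (simp add: pdisc_def)
qed

lemma pball_mono: "M \<le> N \<Longrightarrow> pball y N \<subseteq> pball y M"
  by (auto simp: pdisc_def intro: order_trans)

text \<open>Substitute for compactness. If the property failed on the first ball, it would fail on a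
  nested sequence of balls; their centres converge by completeness, and the assumption at the limit
  point is contradicted. The radius in \<open>base\<close> may depend on the point.\<close>

lemma pball_induct:
  fixes y :: "'k ^ 'n::finite"
  assumes step: "\<And>y N. N \<ge> N0 \<Longrightarrow> (\<And>z. z \<in> pball y N \<Longrightarrow> R (pball z (N + 1))) \<Longrightarrow> R (pball y N)"
    and base: "\<And>y. \<exists>M. \<forall>N\<ge>M. R (pball y N)"
  shows "R (pball y N0)"
proof (rule ccontr)
  assume neg: "\<not> R (pball y N0)"
  have "\<exists>z'. \<not> R (pball z (N0 + int j)) \<longrightarrow> z' \<in> pball z (N0 + int j) \<and> \<not> R (pball z' (N0 + int (Suc j)))" for z j
    using step[of "N0 + int j" z] by (auto simp: algebra_simps)
  then have "\<forall>z j. \<exists>z'. \<not> R (pball z (N0 + int j)) \<longrightarrow> z' \<in> pball z (N0 + int j) \<and> \<not> R (pball z' (N0 + int (Suc j)))"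
    by blast
  then obtain nx where nx: "\<And>z j. \<not> R (pball z (N0 + int j)) \<Longrightarrow>
      nx z j \<in> pball z (N0 + int j) \<and> \<not> R (pball (nx z j) (N0 + int (Suc j)))"
    unfolding choice_iff by blast
  define Y where "Y = rec_nat y (\<lambda>j z. nx z j)"
  have Y: "\<not> R (pball (Y j) (N0 + int j))" for j
    by (induction j) (use neg nx in \<open>auto simp: Y_def\<close>)
  have Y_Suc: "Y (Suc j) \<in> pball (Y j) (N0 + int j)" for j using nx[OF Y[of j]] by (simp add: Y_def)
  have Y_diff: "vabs (Y m $ i - Y j $ i) \<le> rad (N0 + int j)" if "m \<ge> j" for m j i
    using that
  proof (induction m rule: dec_induct)
    case (step m)
    have "vabs (Y (Suc m) $ i - Y m $ i) \<le> rad (N0 + int m)" using Y_Suc[of m] by (simp add: pdisc_def)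
    also have "\<dots> \<le> rad (N0 + int j)" using step by simp
    finally show ?case using step.IH by (rule vabs_triangle)
  qed simp
  have "\<exists>l. (\<lambda>j. Y j $ i) \<longlonglongrightarrow> l" for i
  proof (rule Cauchy_converges, unfold Cauchy_def, intro allI impI)
    fix d :: real assume "d > 0"
    from rad_arbitrarily_small[OF this] obtain M where M: "\<And>N. N \<ge> M \<Longrightarrow> rad N < d" by blast
    let ?n = "nat (M - N0)"
    have "dist (Y m $ i) (Y k $ i) < d" if "m \<ge> ?n" "k \<ge> ?n" for m k
    proof -
      have "vabs (Y m $ i - Y k $ i) \<le> rad (N0 + int ?n)"
        using vabs_triangle_left[OF Y_diff[of ?n m i] Y_diff[of ?n k i]] that by blast
      moreover have "rad (N0 + int ?n) < d" by (rule M) simp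
      ultimately show ?thesis by (simp add: dist_vabs)
    qed
    then show "\<exists>M. \<forall>m\<ge>M. \<forall>k\<ge>M. dist (Y m $ i) (Y k $ i) < d" by blast
  qed
  then have "\<forall>i. \<exists>l. (\<lambda>j. Y j $ i) \<longlonglongrightarrow> l" by blast
  from choice[OF this] obtain l where l: "\<And>i. (\<lambda>j. Y j $ i) \<longlonglongrightarrow> l i" by blast
  define z where "z = (\<chi> i. l i)"
  have "vabs (z $ i - Y j $ i) \<le> rad (N0 + int j)" for i j
    unfolding z_def vec_lambda_beta by (rule vabs_limit_le[OF l]) (use Y_diff in auto)
  \<comment> \<open>The limit lies in every ball of the sequence and is therefore a centre of each:
    the failing balls are balls around \<open>z\<close> itself.\<close>
  then have z: "pball z (N0 + int j) = pball (Y j) (N0 + int j)" for j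
    by (intro pdisc_eq) (simp add: pdisc_def)
  obtain M where "\<And>N. N \<ge> M \<Longrightarrow> R (pball z N)" using base by blast
  then have "R (pball z (N0 + int (nat (M - N0))))" by simp
  then show False unfolding z using Y by blast
qed

text \<open>By discreteness of the values, the shift of the exponent by one turns a weak inequality
  into a strict one; this makes closed balls open.\<close>

lemma le_rad_eq_ball: "{t::'k. vabs (t - c) \<le> rad k} = ball c (rad (k - 1))"
proof -
  have "vabs (t - c) \<le> rad k \<longleftrightarrow> vabs (c - t) < rad (k - 1)" for t :: 'k
    unfolding vabs_diff_commute[of t c]
    using vabs_less_rad[of "c - t" "k - 1"] le_less_trans[of "vabs (c - t)" "rad k" "rad (k - 1)"] by auto
  then show ?thesis unfolding ball_def dist_vabs by blast
qed

lemma open_pdisc: "open (pdisc y (e :: int ^ 'n::finite))"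
proof -
  have "pdisc y e = (\<Inter>i\<in>UNIV. (\<lambda>x. x $ i) -` {t. vabs (t - y $ i) \<le> rad (e $ i)})"
    by (auto simp: pdisc_def)
  also have "open \<dots>" by (intro open_INT finite ballI open_vimage_vec_nth) (simp add: le_rad_eq_ball)
  finally show ?thesis .
qed

lemma open_contains_pball:
  assumes "open U" "x \<in> U" shows "\<exists>N. pball x N \<subseteq> (U :: ('k ^ 'n::finite) set)"
proof -
  obtain d where d: "d > 0" "\<And>z. dist z x < d \<Longrightarrow> z \<in> U" using assms unfolding open_dist by blast
  \<comment> \<open>The metric on vectors is Euclidean; bounding it by the sum of the coordinate
    distances costs the factor \<open>CARD('n)\<close>.\<close>
  obtain N where N: "rad N < d / real CARD('n)"
    using rad_arbitrarily_small[of "d / real CARD('n)"] d by auto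
  have "dist z x < d" if "z \<in> pball x N" for z
  proof -
    have "dist z x \<le> (\<Sum>i\<in>UNIV. dist (z $ i) (x $ i))"
      unfolding dist_vec_def by (rule L2_set_le_sum) simp
    also have "\<dots> \<le> (\<Sum>i\<in>(UNIV :: 'n set). rad N)"
      using that by (intro sum_mono) (auto simp: pdisc_def dist_vabs)
    also have "\<dots> < d" using N by (simp add: field_simps)
    finally show ?thesis .
  qed
  then show ?thesis using d by blast
qed

lemma continuous_on_translate: "continuous_on UNIV (\<lambda>x. a + (x :: 'k ^ 'n::finite))"
proof -
  have "dist (a + x) (a + y) = dist x y" for x y :: "'k ^ 'n"
    unfolding dist_vec_def by (simp add: dist_vabs)
  then show ?thesis unfolding continuous_on_iff by auto
qed

end

section \<open>Haar measure\<close>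

locale haar = padic \<pi> for \<pi> :: "'k::valued_field" +
  fixes \<mu> :: "('k ^ 'n::finite) measure"
  assumes haar: "normalised_haar \<mu>"
begin

lemma sets_haar [measurable_cong, simp]: "sets \<mu> = sets borel"
  using haar by (simp add: normalised_haar_def)

lemma space_haar [simp]: "space \<mu> = UNIV"
  using sets_eq_imp_space_eq[OF sets_haar] by simp

lemma translate_measurable: "(\<lambda>x::'k ^ 'n. x - a) \<in> \<mu> \<rightarrow>\<^sub>M borel" 
proof -
  have "(\<lambda>x. x - a) = (\<lambda>x. - a + x)" by auto
  then show ?thesis using continuous_on_translate[of "- a"]
    by (simp add: borel_measurable_continuous_onI cong: measurable_cong_sets)
qed

lemma translate_sets: "(A :: ('k ^ 'n) set) \<in> sets borel \<Longrightarrow> {x. x - a \<in> A} \<in> sets borel"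
  using measurable_sets[OF translate_measurable, of A a] by (simp add: vimage_def)

lemma emeasure_translate:
  assumes "A \<in> sets borel" shows "emeasure \<mu> {x. x - a \<in> A} = emeasure \<mu> (A :: ('k ^ 'n) set)"
proof -
  have "distr \<mu> borel (\<lambda>x. x - a) = \<mu>"
  proof -
    have "(\<lambda>x::'k ^ 'n. x - a) = (\<lambda>x. - a + x)" by auto
    then show ?thesis using haar unfolding normalised_haar_def by (simp only:)
  qed
  then have "emeasure \<mu> A = emeasure (distr \<mu> borel (\<lambda>x. x - a)) A" by simp
  also have "\<dots> = emeasure \<mu> ((\<lambda>x. x - a) -` A \<inter> space \<mu>)"
    by (rule emeasure_distr[OF translate_measurable assms])
  finally show ?thesis by (simp add: vimage_def)
qed

text \<open>Translation invariance turns the computation of a measure into counting. Used for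
  polydiscs and again for the fibres of a function.\<close>

lemma emeasure_tiling:
  assumes Z: "finite Z" and A0: "A0 \<in> sets borel"
    and ex: "\<And>x. x \<in> A \<longleftrightarrow> (\<exists>z\<in>Z. x - z \<in> A0)"
    and un: "\<And>x z z'. z \<in> Z \<Longrightarrow> z' \<in> Z \<Longrightarrow> x - z \<in> A0 \<Longrightarrow> x - z' \<in> A0 \<Longrightarrow> z = z'"
  shows "emeasure \<mu> A = of_nat (card Z) * emeasure \<mu> A0"
proof -
  have "A = (\<Union>z\<in>Z. {x. x - z \<in> A0})" using ex by auto
  moreover have "disjoint_family_on (\<lambda>z. {x. x - z \<in> A0}) Z"
    using un by (fastforce simp: disjoint_family_on_def)
  ultimately have "emeasure \<mu> A = (\<Sum>z\<in>Z. emeasure \<mu> {x. x - z \<in> A0})"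
    using Z translate_sets[OF A0] by (simp add: sum_emeasure image_subset_iff)
  then show ?thesis using emeasure_translate[OF A0] by simp
qed

lemma pdisc_sets [measurable, simp]: "pdisc y e \<in> sets borel"
  by (intro borel_open open_pdisc)

lemma emeasure_pdisc_translate: "emeasure \<mu> (pdisc y e) = emeasure \<mu> (pdisc 0 (e :: int ^ 'n))"
proof -
  have "pdisc y e = {x. x - y \<in> pdisc 0 e}" by (auto simp: pdisc_def)
  then show ?thesis using emeasure_translate[of "pdisc 0 e" y] by simp
qed

text \<open>Only coordinate \<open>j\<close> is refined: its ball is the union of \<open>q\<close>
  smaller ones, centred at the residue representatives scaled by
  \<open>\<pi> powi (e $ j)\<close>.\<close>

lemma emeasure_pdisc_split:
  "emeasure \<mu> (pdisc 0 e) = of_nat q * emeasure \<mu> (pdisc 0 (e + axis j 1))"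
proof -
  obtain T where T: "reps 1 T" using reps_exist by blast
  define g where "g t = (axis j (\<pi> powi (e $ j) * t) :: 'k ^ 'n)" for t
  have inj: "inj_on g T"
    by (rule inj_onI) (auto simp: g_def axis_eq_axis)
  have mem: "x - g t \<in> pdisc 0 (e + axis j 1) \<longleftrightarrow>
     (\<forall>i. i \<noteq> j \<longrightarrow> vabs (x $ i) \<le> rad (e $ i)) \<and> vabs (x $ j * \<pi> powi (- (e $ j)) - t) \<le> rad 1" for x t
  proof -
    have "vabs (x $ j * \<pi> powi (- (e $ j)) - t) = vabs (\<pi> powi (- (e $ j)) * (x $ j - \<pi> powi (e $ j) * t))"
      by (simp add: power_int_minus algebra_simps)
    also have "\<dots> = vabs (x $ j - \<pi> powi (e $ j) * t) / rad (e $ j)"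
      by (simp only: vabs_mult vabs_pi_powi rad_minus) simp
    finally have "vabs (x $ j * \<pi> powi (- (e $ j)) - t) \<le> rad 1 \<longleftrightarrow> vabs (x $ j - \<pi> powi (e $ j) * t) \<le> rad (e $ j + 1)"
      by (simp add: rad_add divide_le_eq mult.commute)
    then show ?thesis by (auto simp: pdisc_def g_def axis_def)
  qed
  have "emeasure \<mu> (pdisc 0 e) = of_nat (card (g ` T)) * emeasure \<mu> (pdisc 0 (e + axis j 1))"
  proof (rule emeasure_tiling)
    fix x
    have "vabs (x $ j * \<pi> powi (- (e $ j))) \<le> 1 \<longleftrightarrow> vabs (x $ j) \<le> rad (e $ j)"
      by (simp add: vabs_mult rad_minus field_simps)
    moreover have "vabs (x $ j * \<pi> powi (- (e $ j))) \<le> 1 \<longleftrightarrow> (\<exists>t\<in>T. vabs (x $ j * \<pi> powi (- (e $ j)) - t) \<le> rad 1)"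
    proof
      assume "vabs (x $ j * \<pi> powi (- (e $ j))) \<le> 1"
      from reps_obtain[OF T this] show "\<exists>t\<in>T. vabs (x $ j * \<pi> powi (- (e $ j)) - t) \<le> rad 1" by auto
    next
      assume "\<exists>t\<in>T. vabs (x $ j * \<pi> powi (- (e $ j)) - t) \<le> rad 1"
      then obtain t where "t \<in> T" "vabs (x $ j * \<pi> powi (- (e $ j)) - t) \<le> rad 1" by blast
      moreover have "rad 1 \<le> 1" by simp
      ultimately have "vabs (x $ j * \<pi> powi (- (e $ j)) - t) \<le> 1" "vabs t \<le> 1"
        using reps_le_1[OF T, of t] by linarith+
      then have "vabs (x $ j * \<pi> powi (- (e $ j)) - t + t) \<le> 1" by (rule vabs_add_le)
      then show "vabs (x $ j * \<pi> powi (- (e $ j))) \<le> 1" by simp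
    qed
    ultimately show "x \<in> pdisc 0 e \<longleftrightarrow> (\<exists>z\<in>g ` T. x - z \<in> pdisc 0 (e + axis j 1))"
      unfolding bex_simps mem by (auto simp: pdisc_def)
  next
    fix x z z' assume z: "z \<in> g ` T" "z' \<in> g ` T" "x - z \<in> pdisc 0 (e + axis j 1)" "x - z' \<in> pdisc 0 (e + axis j 1)"
    then obtain t t' where t: "t \<in> T" "t' \<in> T" "z = g t" "z' = g t'" by blast
    have "vabs (t - t') \<le> rad 1"
      using z(3,4)[unfolded t mem] by (blast intro: vabs_triangle_right[of "x $ j * \<pi> powi (- (e $ j))"])
    then show "z = z'" using reps_unique[OF T t(1,2)] t by simp
  qed (use reps_finite[OF T] in auto)
  then show ?thesis using card_image[OF inj] reps_card[OF T] by simp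
qed

theorem emeasure_pdisc: "emeasure \<mu> (pdisc y e) = ennreal (rad (\<Sum>i\<in>UNIV. e $ i))"
proof -
  \<comment> \<open>The claim is unaffected by changing one exponent by 1 in either direction, and
    the normalisation provides it at 0; from there every exponent vector is reached coordinate by
    coordinate.\<close>
  define good where "good e \<longleftrightarrow> emeasure \<mu> (pdisc 0 e) = ennreal (rad (\<Sum>i\<in>UNIV. e $ i))" for e :: "int ^ 'n"
  have step: "good (v + axis j 1) \<longleftrightarrow> good v" for v j
  proof -
    have s: "(\<Sum>i\<in>UNIV. (v + axis j 1) $ i) = (\<Sum>i\<in>UNIV. v $ i) + 1"
      by (simp add: sum.distrib axis_def)
    have "ennreal (rad (\<Sum>i\<in>UNIV. v $ i)) = of_nat q * ennreal (rad (\<Sum>i\<in>UNIV. (v + axis j 1) $ i))"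
      unfolding s using q_ge_2 by (simp add: rad_add rad_1 ennreal_of_nat_eq_real_of_nat flip: ennreal_mult)
    then show ?thesis using q_ge_2 emeasure_pdisc_split[of v j]
      unfolding good_def by (auto simp: ennreal_mult_cancel_left)
  qed
  have step': "good (v + axis j k) \<longleftrightarrow> good v" for v j k
  proof (induction k rule: int_induct[of _ 0])
    case base then show ?case by (simp add: axis_def vec_eq_iff flip: zero_vec_def)
  next
    case (step1 k)
    have "v + axis j (k + 1) = (v + axis j k) + axis j 1" by (simp add: vec_eq_iff axis_def)
    then show ?case using step[of "v + axis j k" j] step1 by (simp only:)
  next
    case (step2 k)
    have "v + axis j k = (v + axis j (k - 1)) + axis j 1" by (simp add: vec_eq_iff axis_def)
    then show ?case using step[of "v + axis j (k - 1)" j] step2 by (simp only:)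
  qed
  have "good 0"
    using haar unfolding good_def normalised_haar_def by (simp add: pdisc_def valuation_ring_def)
  have "good (\<Sum>j\<in>J. axis j (e $ j))" if "finite J" for J
    using that by induction (use \<open>good 0\<close> step' in \<open>simp_all add: add.commute[of "axis _ _"]\<close>)
  moreover have "(\<Sum>j\<in>UNIV. axis j (e $ j)) = e" by (simp add: vec_eq_iff axis_def)
  ultimately have "good e" using finite[of "UNIV :: 'n set"] by (metis (no_types))
  then show ?thesis by (simp add: good_def emeasure_pdisc_translate[of y e])
qed

end

section \<open>Rational functions with poles of bounded order\<close>

text \<open>Rational on \<open>E\<close>, with a pole of order at most \<open>n\<close> at every
  nonzero point. The identities are required on \<open>E\<close> only, since at singular points the
  values of \<open>R\<close> carry no information. The point 0 is exempt because
  \<open>q^(-s)\<close> never vanishes; so negative powers of \<open>t\<close> are harmless.\<close>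

definition admissible :: "complex set \<Rightarrow> nat \<Rightarrow> (complex \<Rightarrow> complex) \<Rightarrow> bool" where
  "admissible E n R \<longleftrightarrow>
     (\<exists>P Q. \<forall>t\<in>E. poly Q t \<noteq> 0 \<and> R t = poly P t / poly Q t) \<and>
     (\<forall>t0. t0 \<noteq> 0 \<longrightarrow> (\<exists>P Q. poly Q t0 \<noteq> 0 \<and>
        (\<forall>t\<in>E. poly Q t \<noteq> 0 \<and> (t - t0) ^ n * R t = poly P t / poly Q t)))"

lemma admissible_local:
  assumes "admissible E n R" "t0 \<noteq> 0"
  obtains P Q where "poly Q t0 \<noteq> 0"
    "\<And>t. t \<in> E \<Longrightarrow> poly Q t \<noteq> 0 \<and> (t - t0) ^ n * R t = poly P t / poly Q t"
  using assms unfolding admissible_def by blast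

lemma admissible_add:
  assumes "admissible E n R" "admissible E n S"
  shows "admissible E n (\<lambda>t. R t + S t)"
  unfolding admissible_def
proof (intro conjI allI impI)
  obtain P Q P' Q' where "\<forall>t\<in>E. poly Q t \<noteq> 0 \<and> R t = poly P t / poly Q t"
    "\<forall>t\<in>E. poly Q' t \<noteq> 0 \<and> S t = poly P' t / poly Q' t"
    using assms unfolding admissible_def by blast
  then have "\<forall>t\<in>E. poly (Q * Q') t \<noteq> 0 \<and> R t + S t = poly (P * Q' + P' * Q) t / poly (Q * Q') t"
    by (auto simp: add_frac_eq)
  then show "\<exists>P Q. \<forall>t\<in>E. poly Q t \<noteq> 0 \<and> R t + S t = poly P t / poly Q t" by blast
next
  fix t0 :: complex assume "t0 \<noteq> 0"
  note t0 = this
  obtain P Q where PQ: "poly Q t0 \<noteq> 0"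
    "\<And>t. t \<in> E \<Longrightarrow> poly Q t \<noteq> 0 \<and> (t - t0) ^ n * R t = poly P t / poly Q t"
    by (rule admissible_local[OF assms(1) t0]) (rule that; assumption)
  obtain P' Q' where PQ': "poly Q' t0 \<noteq> 0"
    "\<And>t. t \<in> E \<Longrightarrow> poly Q' t \<noteq> 0 \<and> (t - t0) ^ n * S t = poly P' t / poly Q' t"
    by (rule admissible_local[OF assms(2) t0]) (rule that; assumption)
  have "poly (Q * Q') t \<noteq> 0 \<and> (t - t0) ^ n * (R t + S t) = poly (P * Q' + P' * Q) t / poly (Q * Q') t"
    if "t \<in> E" for t
    using PQ(2)[OF that] PQ'(2)[OF that] by (simp only: distrib_left) (simp add: add_frac_eq)
  moreover have "poly (Q * Q') t0 \<noteq> 0" using PQ(1) PQ'(1) by simp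
  ultimately show "\<exists>P Q. poly Q t0 \<noteq> 0 \<and>
      (\<forall>t\<in>E. poly Q t \<noteq> 0 \<and> (t - t0) ^ n * (R t + S t) = poly P t / poly Q t)" by blast
qed

lemma admissible_mult:
  assumes "admissible E n R" "admissible E m S"
  shows "admissible E (n + m) (\<lambda>t. R t * S t)"
  unfolding admissible_def
proof (intro conjI allI impI)
  obtain P Q P' Q' where "\<forall>t\<in>E. poly Q t \<noteq> 0 \<and> R t = poly P t / poly Q t"
    "\<forall>t\<in>E. poly Q' t \<noteq> 0 \<and> S t = poly P' t / poly Q' t"
    using assms unfolding admissible_def by blast
  then have "\<forall>t\<in>E. poly (Q * Q') t \<noteq> 0 \<and> R t * S t = poly (P * P') t / poly (Q * Q') t" by auto
  then show "\<exists>P Q. \<forall>t\<in>E. poly Q t \<noteq> 0 \<and> R t * S t = poly P t / poly Q t" by blast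
next
  fix t0 :: complex assume "t0 \<noteq> 0"
  note t0 = this
  obtain P Q where PQ: "poly Q t0 \<noteq> 0"
    "\<And>t. t \<in> E \<Longrightarrow> poly Q t \<noteq> 0 \<and> (t - t0) ^ n * R t = poly P t / poly Q t"
    by (rule admissible_local[OF assms(1) t0]) (rule that; assumption)
  obtain P' Q' where PQ': "poly Q' t0 \<noteq> 0"
    "\<And>t. t \<in> E \<Longrightarrow> poly Q' t \<noteq> 0 \<and> (t - t0) ^ m * S t = poly P' t / poly Q' t"
    by (rule admissible_local[OF assms(2) t0]) (rule that; assumption)
  have "(t - t0) ^ (n + m) * (R t * S t) = ((t - t0) ^ n * R t) * ((t - t0) ^ m * S t)" for t
    by (simp add: power_add mult_ac)
  note split = this
  have "poly (Q * Q') t \<noteq> 0 \<and> (t - t0) ^ (n + m) * (R t * S t) = poly (P * P') t / poly (Q * Q') t"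
    if "t \<in> E" for t
    unfolding split using PQ(2)[OF that] PQ'(2)[OF that] by simp
  moreover have "poly (Q * Q') t0 \<noteq> 0" using PQ(1) PQ'(1) by simp
  ultimately show "\<exists>P Q. poly Q t0 \<noteq> 0 \<and>
      (\<forall>t\<in>E. poly Q t \<noteq> 0 \<and> (t - t0) ^ (n + m) * (R t * S t) = poly P t / poly Q t)" by blast
qed

lemma admissible_quotient:
  assumes "\<And>t. t \<in> E \<Longrightarrow> poly Q t \<noteq> 0" "\<And>t. t \<noteq> 0 \<Longrightarrow> poly Q t \<noteq> 0"
  shows "admissible E n (\<lambda>t. poly P t / poly Q t)"
  unfolding admissible_def
proof (intro conjI allI impI)
  show "\<exists>P' Q'. \<forall>t\<in>E. poly Q' t \<noteq> 0 \<and> poly P t / poly Q t = poly P' t / poly Q' t"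
    using assms by blast
  fix t0 :: complex assume "t0 \<noteq> 0"
  show "\<exists>P' Q'. poly Q' t0 \<noteq> 0 \<and>
      (\<forall>t\<in>E. poly Q' t \<noteq> 0 \<and> (t - t0) ^ n * (poly P t / poly Q t) = poly P' t / poly Q' t)"
  proof -
    have "(t - t0) ^ n * (poly P t / poly Q t) = poly ([:-t0, 1:] ^ n * P) t / poly Q t" for t by simp
    then show ?thesis using assms(1) assms(2)[OF \<open>t0 \<noteq> 0\<close>] by blast
  qed
qed

lemma admissible_const: "admissible E n (\<lambda>t. c)"
  using admissible_quotient[of E "[:1:]" n "[:c:]"] by simp

lemma admissible_cong: "(\<And>t. t \<in> E \<Longrightarrow> R t = S t) \<Longrightarrow> admissible E n R \<longleftrightarrow> admissible E n S"
  by (simp add: admissible_def)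

lemma admissible_mono: "admissible E m R \<Longrightarrow> m \<le> n \<Longrightarrow> admissible E n R"
  using admissible_mult[OF admissible_const[of E "n - m" 1], of m R] by simp

lemma admissible_power_int:
  assumes "0 \<notin> E" shows "admissible E n (\<lambda>t. t powi k)"
proof (cases "k \<ge> 0")
  case True
  then have "t powi k = poly (monom 1 (nat k)) t / poly 1 t" for t :: complex
    by (simp add: power_int_def poly_monom)
  then show ?thesis using admissible_quotient[of E 1 n "monom 1 (nat k)"] by simp
next
  case False
  then have "t powi k = poly 1 t / poly (monom 1 (nat (- k))) t" for t :: complex
    by (simp add: power_int_def poly_monom inverse_eq_divide power_one_over)
  then show ?thesis using admissible_quotient[of E "monom 1 (nat (-k))" n 1] assms
    by (simp add: poly_monom) (metis)
qed

lemma admissible_sum: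
  "(\<And>i. i \<in> A \<Longrightarrow> admissible E n (R i)) \<Longrightarrow> admissible E n (\<lambda>t. \<Sum>i\<in>A. R i t)"
  by (induction A rule: infinite_finite_induct) (auto intro: admissible_const admissible_add)

lemma admissible_cmult: "admissible E n R \<Longrightarrow> admissible E n (\<lambda>t. c * R t)"
  using admissible_mult[OF admissible_const[of E 0 c], of n R] by simp

text \<open>At a simple root of \<open>Q\<close> a single factor \<open>t - t0\<close> cancels the
  whole zero.\<close>

lemma admissible_simple_roots:
  assumes nz: "\<And>t. t \<in> E \<Longrightarrow> poly Q t \<noteq> 0"
    and simple: "\<And>t. t \<noteq> 0 \<Longrightarrow> poly Q t = 0 \<Longrightarrow> poly (pderiv Q) t \<noteq> 0"
  shows "admissible E 1 (\<lambda>t. 1 / poly Q t)"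
  unfolding admissible_def
proof (intro conjI allI impI)
  show "\<exists>P' Q'. \<forall>t\<in>E. poly Q' t \<noteq> 0 \<and> 1 / poly Q t = poly P' t / poly Q' t"
    using nz by (intro exI[of _ 1] exI[of _ Q]) simp
  fix t0 :: complex assume t0: "t0 \<noteq> 0"
  show "\<exists>P' Q'. poly Q' t0 \<noteq> 0 \<and>
      (\<forall>t\<in>E. poly Q' t \<noteq> 0 \<and> (t - t0) ^ 1 * (1 / poly Q t) = poly P' t / poly Q' t)"
  proof (cases "poly Q t0 = 0")
    case False
    then show ?thesis using nz by (intro exI[of _ "[:-t0, 1:]"] exI[of _ Q]) simp
  next
    case True
    then obtain Q' where Q': "Q = [:-t0, 1:] * Q'" unfolding poly_eq_0_iff_dvd by (rule dvdE)
    have "poly (pderiv Q) t0 = poly Q' t0" unfolding Q' pderiv_mult poly_add poly_mult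
      by (simp add: pderiv_pCons)
    then have "poly Q' t0 \<noteq> 0" using simple[OF t0 True] by simp
    moreover have "poly Q' t \<noteq> 0 \<and> (t - t0) ^ 1 * (1 / poly Q t) = poly 1 t / poly Q' t" if "t \<in> E" for t
      using nz[OF that] unfolding Q' by (simp add: field_simps)
    ultimately show ?thesis by blast
  qed
qed

text \<open>The derivative of a binomial vanishes at most at 0, so all nonzero roots are simple. A
  negative \<open>d\<close> is cleared by multiplying with \<open>t^(-d)\<close>; for
  \<open>d = 0\<close> the function is constant.\<close>

lemma admissible_geometric:
  assumes "0 \<notin> E" "c \<noteq> 0" and nz: "\<And>t. t \<in> E \<Longrightarrow> c * t powi d \<noteq> 1" and d0: "d = 0 \<Longrightarrow> c \<noteq> 1"
  shows "admissible E 1 (\<lambda>t. 1 / (1 - c * t powi d))"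
proof (cases d "0::int" rule: linorder_cases)
  case equal
  then show ?thesis by (simp add: admissible_const)
next
  case greater
  define k where "k = nat d"
  have k: "d = int k" "k > 0" using greater by (auto simp: k_def)
  have "admissible E 1 (\<lambda>t. 1 / poly (1 - monom c k) t)"
  proof (rule admissible_simple_roots)
    show "poly (1 - monom c k) t \<noteq> 0" if "t \<in> E" for t using nz[OF that] by (simp add: poly_monom k)
    show "poly (pderiv (1 - monom c k)) t \<noteq> 0" if "t \<noteq> 0" for t
      using that k assms by (simp add: pderiv_diff pderiv_monom poly_monom)
  qed
  then show ?thesis by (simp add: poly_monom k)
next
  case less
  define k where "k = nat (- d)"
  have k: "d = - int k" "k > 0" using less by (auto simp: k_def)
  have "admissible E (0 + 1) (\<lambda>t. t powi int k * (1 / poly (monom 1 k - [:c:]) t))"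
  proof (rule admissible_mult[OF admissible_power_int[OF assms(1)] admissible_simple_roots])
    show "poly (monom 1 k - [:c:]) t \<noteq> 0" if "t \<in> E" for t
      using nz[OF that] assms(1) that by (auto simp: poly_monom k power_int_minus field_simps)
    show "poly (pderiv (monom 1 k - [:c:])) t \<noteq> 0" if "t \<noteq> 0" for t
      using that k by (simp add: pderiv_diff pderiv_monom poly_monom pderiv_pCons)
  qed
  moreover have "t powi int k * (1 / poly (monom 1 k - [:c:]) t) = 1 / (1 - c * t powi d)" if "t \<in> E" for t
    using that assms(1) nz[OF that] by (auto simp: poly_monom k power_int_minus field_simps)
  ultimately show ?thesis using admissible_cong[of E "\<lambda>t. t powi int k * (1 / poly (monom 1 k - [:c:]) t)"] by simp
qed

lemma admissible_power: "admissible E 0 R \<Longrightarrow> admissible E 0 (\<lambda>t. R t ^ k)"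
proof (induction k)
  case 0 then show ?case by (simp add: admissible_const)
next
  case (Suc k)
  then have "admissible E (0 + 0) (\<lambda>t. R t * R t ^ k)" by (intro admissible_mult) auto
  then show ?case by simp
qed

lemma admissible_prod:
  assumes "finite I" "\<And>a. a \<in> I \<Longrightarrow> admissible E 1 (R a)"
  shows "admissible E (card I) (\<lambda>t. \<Prod>a\<in>I. R a t)"
  using assms
proof induction
  case empty then show ?case by (simp add: admissible_const)
next
  case (insert a I)
  then have "admissible E (1 + card I) (\<lambda>t. R a t * (\<Prod>a\<in>I. R a t))" by (intro admissible_mult) auto
  then show ?case using insert by simp
qed

text \<open>The local representations have different denominators. As \<open>E\<close> is infinite,
  polynomial identities on it hold identically; comparing orders at \<open>t0\<close> after
  cancelling the gcd then bounds the zeros of the one global denominator.\<close>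

lemma admissible_imp_coprime:
  assumes adm: "admissible E n R" and E: "finite (- E)"
  obtains P Q where "Q \<noteq> 0" "coprime P Q" "\<And>t. t \<in> E \<Longrightarrow> poly Q t \<noteq> 0"
    "\<And>t. t \<in> E \<Longrightarrow> R t = poly P t / poly Q t" "\<And>t. t \<noteq> 0 \<Longrightarrow> order t Q \<le> n"
proof -
  have inf: "infinite E" using E infinite_UNIV_char_0[where 'a = complex] by (metis Compl_partition finite_Un)
  obtain P1 Q1 where PQ: "\<And>t. t \<in> E \<Longrightarrow> poly Q1 t \<noteq> 0" "\<And>t. t \<in> E \<Longrightarrow> R t = poly P1 t / poly Q1 t"
    using adm unfolding admissible_def by blast
  obtain t1 where "t1 \<in> E" using inf by (metis finite.emptyI ex_in_conv)
  then have Q1: "Q1 \<noteq> 0" using PQ by force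
  define g where "g = gcd P1 Q1"
  define P where "P = P1 div g"
  define Q where "Q = Q1 div g"
  have eq: "P1 = P * g" "Q1 = Q * g" by (simp_all add: P_def Q_def g_def)
  have cop: "coprime P Q" unfolding P_def Q_def g_def by (rule div_gcd_coprime) (use Q1 in simp)
  have Q: "Q \<noteq> 0" using Q1 eq by auto
  have QE: "poly Q t \<noteq> 0" "R t = poly P t / poly Q t" if "t \<in> E" for t
    using PQ[OF that] unfolding eq by auto
  have "order t0 Q \<le> n" if t0: "t0 \<noteq> 0" for t0
  proof (cases "poly Q t0 = 0")
    case True
    have Pt0: "poly P t0 \<noteq> 0"
    proof
      assume "poly P t0 = 0"
      then have "[:-t0, 1:] dvd P" "[:-t0, 1:] dvd Q" using True by (simp_all add: poly_eq_0_iff_dvd)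
      then have "is_unit [:-t0, 1:]" using cop coprime_common_divisor by blast
      then show False by (auto simp: is_unit_pCons_iff)
    qed
    obtain P2 Q2 where 2: "poly Q2 t0 \<noteq> 0"
      "\<And>t. t \<in> E \<Longrightarrow> poly Q2 t \<noteq> 0 \<and> (t - t0) ^ n * R t = poly P2 t / poly Q2 t"
      by (rule admissible_local[OF adm t0]) (rule that; assumption)
    \<comment> \<open>The two representations of \<open>(t - t0) ^ n * R t\<close>,
      cross-multiplied; this polynomial vanishes on the infinite set \<open>E\<close>.\<close>
    let ?D = "[:-t0, 1:] ^ n * (P * Q2) - P2 * Q"
    have "poly ?D t = 0" if "t \<in> E" for t
    proof -
      have "(t - t0) ^ n * (poly P t / poly Q t) = poly P2 t / poly Q2 t" "poly Q2 t \<noteq> 0"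
        using 2(2)[OF that] QE[OF that] by auto
      then have "(t - t0) ^ n * poly P t * poly Q2 t = poly P2 t * poly Q t"
        using QE(1)[OF that] by (simp add: frac_eq_eq)
      then show ?thesis by (simp add: mult_ac)
    qed
    then have "E \<subseteq> {t. poly ?D t = 0}" by blast
    then have "?D = 0" using inf poly_roots_finite[of ?D] finite_subset by blast
    then have eq2: "[:-t0, 1:] ^ n * (P * Q2) = P2 * Q" by simp
    have nz: "[:-t0, 1:] ^ n * (P * Q2) \<noteq> 0" using Pt0 2 by auto
    then have "order t0 (P * Q2) + n = order t0 ([:-t0, 1:] ^ n * (P * Q2))"
      by (subst order_mult) (auto simp: order_power_n_n)
    moreover have "order t0 (P * Q2) = 0" using Pt0 2 by (intro order_0I) simp
    moreover have "order t0 (P2 * Q) = order t0 P2 + order t0 Q" using nz eq2 by (intro order_mult) simp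
    ultimately show ?thesis using eq2 by simp
  qed (simp add: order_0I)
  then show ?thesis using that Q cop QE by blast
qed

text \<open>The derivative \<open>- L * w\<close> never vanishes, so \<open>w\<close> minus its
  value at \<open>s\<close> has a simple zero there, and the pole order in \<open>s\<close> equals
  the order of \<open>Q\<close> in \<open>t\<close>. Coprimality makes every zero of
  \<open>Q\<close> on the image of \<open>w\<close> a genuine pole.\<close>

lemma rational_exp_meromorphic:
  fixes L :: real
  assumes L: "L \<noteq> 0" and Q: "Q \<noteq> 0" and cop: "coprime P Q" and ord: "\<And>t. t \<noteq> 0 \<Longrightarrow> order t Q \<le> n"
  defines "w \<equiv> (\<lambda>s. exp (- (s * complex_of_real L)))"
  defines "Z \<equiv> (\<lambda>s. poly P (w s) / poly Q (w s))"
  shows "Z nicely_meromorphic_on UNIV"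
    and "is_pole Z s \<Longrightarrow> poly Q (w s) = 0 \<and> - zorder Z s \<le> int n"
proof -
  have w_ana: "w analytic_on A" for A unfolding w_def by (intro analytic_intros)
  have p_ana: "(\<lambda>s. poly p (w s)) analytic_on A" for p A
  proof -
    have "poly p analytic_on UNIV" by (intro analytic_on_holomorphic[THEN iffD2] exI[of _ UNIV]) (auto intro!: holomorphic_intros)
    then show ?thesis using analytic_on_compose_gen[OF w_ana, of "poly p" UNIV] by (simp add: o_def)
  qed
  have deriv_w: "deriv (\<lambda>s. w s - c) s \<noteq> 0" for s c
  proof -
    have "((\<lambda>s. w s - c) has_field_derivative (- (complex_of_real L) * w s)) (at s)"
      unfolding w_def by (auto intro!: derivative_eq_intros)
    then show ?thesis using L by (simp add: DERIV_imp_deriv w_def)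
  qed
  have local: "\<exists>g S. open S \<and> s \<in> S \<and> g holomorphic_on S \<and> g s \<noteq> 0 \<and> order (w s) Q \<le> n \<and>
      (\<forall>z\<in>S. z \<noteq> s \<longrightarrow> Z z = g z * (z - s) powi (- int (order (w s) Q)))"
    if Q0: "poly Q (w s) = 0" for s
  proof -
    define t0 where "t0 = w s"
    define k where "k = order t0 Q"
    have "t0 \<noteq> 0" by (simp add: t0_def w_def)
    have P0: "poly P t0 \<noteq> 0"
    proof
      assume "poly P t0 = 0"
      then have "[:-t0, 1:] dvd P" "[:-t0, 1:] dvd Q" using Q0 by (simp_all add: poly_eq_0_iff_dvd t0_def)
      then have "is_unit [:-t0, 1:]" using cop coprime_common_divisor by blast
      then show False by (auto simp: is_unit_pCons_iff)
    qed
    obtain Q' where Q': "Q = [:- t0, 1:] ^ k * Q'" "\<not> [:- t0, 1:] dvd Q'"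
      using order_decomp[OF Q, of t0] k_def by blast
    have Q't0: "poly Q' t0 \<noteq> 0" using Q'(2) by (simp add: poly_eq_0_iff_dvd)
    let ?f = "\<lambda>z. w z - t0"
    have f_hol: "?f holomorphic_on A" for A unfolding w_def by (intro holomorphic_intros)
    have z1: "zorder ?f s = 1"
      by (rule zorder_zero_eqI[of _ UNIV]) (use f_hol deriv_w[of t0 s] in \<open>auto simp: t0_def\<close>)
    have "\<exists>z\<in>UNIV. ?f z \<noteq> 0"
    proof (rule ccontr)
      assume "\<not> (\<exists>z\<in>UNIV. ?f z \<noteq> 0)"
      then have "?f = (\<lambda>z. 0)" by auto
      then show False using deriv_w[of t0 s] by simp
    qed
    from zorder_exist_zero[OF f_hol open_UNIV connected_UNIV UNIV_I this, of s]
    obtain r h where r: "r > 0" "h holomorphic_on cball s r"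
        "\<And>z. z \<in> cball s r \<Longrightarrow> ?f z = h z * (z - s) ^ nat 1 \<and> h z \<noteq> 0"
      unfolding z1 by blast
    define S where "S = ball s r \<inter> {z. poly Q' (w z) \<noteq> 0}"
    have "continuous_on UNIV (\<lambda>z. poly Q' (w z))" unfolding w_def by (intro continuous_intros)
    then have "open {z. poly Q' (w z) \<noteq> 0}" by (intro open_Collect_neq continuous_on_const)
    then have S: "open S" "s \<in> S" using r(1) Q't0 by (auto simp: S_def t0_def)
    define g where "g z = poly P (w z) / (poly Q' (w z) * h z ^ k)" for z
    have sub: "S \<subseteq> cball s r" by (auto simp: S_def)
    have h_ne: "h z \<noteq> 0" if "z \<in> S" for z using r(3) sub that by blast
    have g_hol: "g holomorphic_on S"
      unfolding g_def
      by (intro holomorphic_intros analytic_imp_holomorphic p_ana holomorphic_on_subset[OF r(2) sub])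
         (use h_ne in \<open>auto simp: S_def\<close>)
    have gs: "g s \<noteq> 0" using P0 Q't0 h_ne[OF S(2)] by (simp add: g_def t0_def)
    have eq: "Z z = g z * (z - s) powi (- int k)" if "z \<in> S" for z
    proof -
      have "poly [:- t0, 1:] (w z) = h z * (z - s)" using r(3)[of z] that sub by auto
      then have "poly Q (w z) = (h z * (z - s)) ^ k * poly Q' (w z)"
        by (subst Q'(1)) (simp only: poly_mult poly_power)
      then show ?thesis
        by (simp add: Z_def g_def power_mult_distrib power_int_minus divide_inverse mult_ac)
    qed
    have "k \<le> n" unfolding k_def by (rule ord) fact
    then show ?thesis using S g_hol gs eq unfolding k_def t0_def by blast
  qed
  have regular: "isCont Z s" "\<not> is_pole Z s" if "poly Q (w s) \<noteq> 0" for s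
  proof -
    have "Z analytic_on {s}" unfolding Z_def using that by (intro analytic_intros p_ana) auto
    then show "isCont Z s" "\<not> is_pole Z s"
      using analytic_at_imp_isCont analytic_at_imp_no_pole by blast+
  qed
  show "is_pole Z s \<Longrightarrow> poly Q (w s) = 0 \<and> - zorder Z s \<le> int n"
  proof -
    assume pole: "is_pole Z s"
    then have Q0: "poly Q (w s) = 0" using regular by blast
    from local[OF this] obtain g S where gS: "open S" "s \<in> S" "g holomorphic_on S" "g s \<noteq> 0" "order (w s) Q \<le> n"
      "\<And>z. z \<in> S \<Longrightarrow> z \<noteq> s \<Longrightarrow> Z z = g z * (z - s) powi (- int (order (w s) Q))" by blast
    have "zorder Z s = - int (order (w s) Q)" using gS by (intro zorder_eqI[of S s g])
    then show ?thesis using Q0 gS(5) by simp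
  qed
  have pole: "is_pole Z s" if Q0: "poly Q (w s) = 0" for s
  proof -
    from local[OF Q0] obtain g S where gS: "open S" "s \<in> S" "g holomorphic_on S" "g s \<noteq> 0"
      "\<And>z. z \<in> S \<Longrightarrow> z \<noteq> s \<Longrightarrow> Z z = g z * (z - s) powi (- int (order (w s) Q))" by blast
    have k: "order (w s) Q > 0" using Q Q0 by (simp add: order_root)
    have cont: "isCont g s" using gS continuous_on_interior holomorphic_on_imp_continuous_on interior_open by metis
    have "filterlim (\<lambda>z. (z - s) ^ order (w s) Q) (at 0) (at s)"
      unfolding filterlim_at using k
      by (auto simp: eventually_at_filter intro!: tendsto_eq_intros)
    then have "is_pole (\<lambda>z. g z / (z - s) ^ order (w s) Q) s" using cont gS(4) by (intro is_pole_divide)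
    moreover have "eventually (\<lambda>z. g z / (z - s) ^ order (w s) Q = Z z) (at s)"
      unfolding eventually_at_topological using gS
      by (intro exI[of _ S]) (auto simp: power_int_minus divide_inverse)
    ultimately show ?thesis by (simp add: is_pole_cong)
  qed
  have "Z meromorphic_on UNIV"
    unfolding Z_def by (intro meromorphic_intros analytic_on_imp_meromorphic_on p_ana)
  \<comment> \<open>At a pole \<open>nicely_meromorphic_on\<close> asks for the value 0, which the
    convention \<open>x / 0 = 0\<close> supplies.\<close>
  moreover have "(is_pole Z s \<and> Z s = 0) \<or> Z \<midarrow>s\<rightarrow> Z s" for s
    using pole[of s] regular(1)[of s] by (cases "poly Q (w s) = 0") (auto simp: Z_def isCont_def)
  ultimately show "Z nicely_meromorphic_on UNIV" unfolding nicely_meromorphic_on_def by blast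
qed

section \<open>Integration\<close>

text \<open>The bound on the integrals of the norms justifies exchanging sum and integral. A bound
  of the same kind is returned, so that the lemma can be iterated over several coordinates.\<close>

lemma set_integral_geometric_union:
  fixes g :: "'a \<Rightarrow> complex" and B :: "nat \<Rightarrow> 'a set"
  assumes disj: "disjoint_family B" and B: "\<And>l. B l \<in> sets M"
    and int: "\<And>l. set_integrable M (B l) g"
    and val: "\<And>l. (LINT x:B l|M. g x) = c * z ^ l"
    and bound: "\<And>l. (LINT x:B l|M. norm (g x)) \<le> C * r ^ l"
    and r: "0 \<le> r" "r < 1" and z: "norm z < 1"
  shows "set_integrable M (\<Union>l. B l) g" "(LINT x:(\<Union>l. B l)|M. g x) = c / (1 - z)"
    "(LINT x:(\<Union>l. B l)|M. norm (g x)) \<le> C / (1 - r)"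
proof -
  \<comment> \<open>At each point at most one indicator is nonzero, so the series has at most one
    nonzero term.\<close>
  have sums_ind: "(\<lambda>l. indicator (B l) x *\<^sub>R h x) sums (indicator (\<Union>l. B l) x *\<^sub>R h x)"
    for h :: "'a \<Rightarrow> 'b::real_normed_vector" and x
  proof (cases "x \<in> (\<Union>l. B l)")
    case True
    then obtain l where l: "x \<in> B l" by blast
    have "x \<notin> B k" if "k \<noteq> l" for k using disj l that by (auto simp: disjoint_family_on_def)
    then have "(\<lambda>k. indicator (B k) x *\<^sub>R h x) = (\<lambda>k. if k = l then h x else 0)"
      using l by (auto simp: fun_eq_iff indicator_def)
    then show ?thesis using True sums_single[of l "\<lambda>_. h x"] by simp
  next
    case False then show ?thesis by simp
  qed
  have int': "integrable M (\<lambda>x. indicator (B l) x *\<^sub>R g x)" for l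
    using int[of l] by (simp add: set_integrable_def)
  have norm_eq: "norm (indicator (B l) x *\<^sub>R g x) = indicator (B l) x *\<^sub>R norm (g x)" for l x
    by (auto simp: indicator_def)
  have nint: "integrable M (\<lambda>x. indicator (B l) x *\<^sub>R norm (g x))" for l
    using integrable_norm[OF int'[of l]] by (simp only: norm_eq)
  have nn: "0 \<le> (LINT x:B l|M. norm (g x))" for l
    unfolding set_lebesgue_integral_def by (intro integral_nonneg_AE) auto
  have "summable (\<lambda>l. C * r ^ l)" using r by (intro summable_mult summable_geometric) auto
  then have summ: "summable (\<lambda>l. LINT x:B l|M. norm (g x))"
    by (rule summable_comparison_test_ev[rotated]) (use bound nn in auto)
  have ae: "AE x in M. summable (\<lambda>l. norm (indicator (B l) x *\<^sub>R g x))"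
    unfolding norm_eq using sums_ind[of _ "\<lambda>x. norm (g x)"] sums_summable by blast
  have summ': "summable (\<lambda>l. \<integral>x. norm (indicator (B l) x *\<^sub>R g x) \<partial>M)"
    using summ unfolding norm_eq set_lebesgue_integral_def .
  have sum_eq: "suminf (\<lambda>l. indicator (B l) x *\<^sub>R h x) = indicator (\<Union>l. B l) x *\<^sub>R h x"
    for h :: "'a \<Rightarrow> 'b::real_normed_vector" and x
    using sums_ind[of x h] sums_unique by metis
  show 1: "set_integrable M (\<Union>l. B l) g"
    using integrable_suminf[OF int' ae summ'] unfolding sum_eq set_integrable_def .
  have "(\<lambda>l. LINT x:B l|M. g x) sums (LINT x:(\<Union>l. B l)|M. g x)"
    using sums_integral[OF int' ae summ'] unfolding sum_eq set_lebesgue_integral_def .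
  moreover have "(\<lambda>l. c * z ^ l) sums (c * (1 / (1 - z)))"
    by (intro sums_mult geometric_sums z)
  ultimately show "(LINT x:(\<Union>l. B l)|M. g x) = c / (1 - z)"
    unfolding val using sums_unique2 by fastforce
  have ae2: "AE x in M. summable (\<lambda>l. norm (indicator (B l) x *\<^sub>R norm (g x)))"
    using ae by (simp add: norm_eq)
  have summ2: "summable (\<lambda>l. \<integral>x. norm (indicator (B l) x *\<^sub>R norm (g x)) \<partial>M)"
    using summ' by (simp add: norm_eq)
  have s: "(\<lambda>l. LINT x:B l|M. norm (g x)) sums (LINT x:(\<Union>l. B l)|M. norm (g x))"
    using sums_integral[OF nint ae2 summ2] unfolding sum_eq[of _ "\<lambda>x. norm (g x)"] set_lebesgue_integral_def .
  have g: "(\<lambda>l. C * r ^ l) sums (C * (1 / (1 - r)))"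
    using r by (intro sums_mult geometric_sums) simp
  show "(LINT x:(\<Union>l. B l)|M. norm (g x)) \<le> C / (1 - r)"
    using sums_le[OF bound s g] by simp
qed

context haar
begin

lemma pi_powi_cancel: "x = \<pi> powi k * (x * \<pi> powi (- k))"
  by (simp add: power_int_minus)

lemma vabs_scale: "vabs x = rad k \<Longrightarrow> vabs (x * \<pi> powi (- k)) = 1"
  by (simp add: vabs_mult rad_minus)

lemma measure_pdisc: "measure \<mu> (pdisc y e) = rad (\<Sum>i\<in>UNIV. e $ i)"
  by (simp add: measure_def emeasure_pdisc)

lemma emeasure_pdisc_finite: "emeasure \<mu> (pdisc y e) < \<infinity>"
  by (simp add: emeasure_pdisc)

lemma finite_self_map_surj:
  assumes "finite T" "f ` T \<subseteq> T" "inj_on f T" "u \<in> T" shows "\<exists>t\<in>T. f t = u"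
proof -
  have "f ` T = T" using assms by (intro endo_inj_surj)
  then have "u \<in> f ` T" using assms(4) by simp
  then show ?thesis by auto
qed

text \<open>
  On every line in direction \<open>j\<close> the function is an isometry up to scaling, hence by counting it
  hits each small ball in exactly one residue class; the fibres are translates of each other.
\<close>

lemma measure_fibre:
  fixes F :: "'k ^ 'n \<Rightarrow> 'k"
  assumes meas: "{x \<in> pdisc y e. vabs (F x - v) \<le> rad (\<rho> + e $ j + int r)} \<in> sets borel"
    and line: "\<And>x h. x \<in> pdisc y e \<Longrightarrow> vabs h \<le> rad (e $ j) \<Longrightarrow> vabs (F (x + axis j h) - F x) = rad \<rho> * vabs h"
    and bound: "\<And>x. x \<in> pdisc y e \<Longrightarrow> vabs (F x) \<le> rad (\<rho> + e $ j)"
    and v: "vabs v \<le> rad (\<rho> + e $ j)"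
  shows "measure \<mu> {x \<in> pdisc y e. vabs (F x - v) \<le> rad (\<rho> + e $ j + int r)} = rad (int r) * measure \<mu> (pdisc y e)"
proof -
  define s where "s = \<rho> + e $ j"
  define A0 where "A0 = {x \<in> pdisc y e. vabs (F x - v) \<le> rad (s + int r)}"
  have A0: "A0 \<in> sets borel" using meas by (simp add: A0_def s_def)
  obtain T where T: "reps r T" using reps_exist by blast
  define g where "g t = (axis j (\<pi> powi (e $ j) * t) :: 'k ^ 'n)" for t
  have inj: "inj_on g T" by (rule inj_onI) (auto simp: g_def axis_eq_axis)
  have g_small: "vabs (\<pi> powi (e $ j) * t) \<le> rad (e $ j)" if "t \<in> T" for t
    using reps_le_1[OF T that] by (simp add: vabs_mult mult_left_le)
  have shift: "x + axis j h \<in> pdisc y e \<longleftrightarrow> x \<in> pdisc y e" if "vabs h \<le> rad (e $ j)" for x h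
  proof -
    have "vabs (x $ j + h - y $ j) \<le> rad (e $ j) \<longleftrightarrow> vabs (x $ j - y $ j) \<le> rad (e $ j)"
      using vabs_add_le[of "x $ j - y $ j" "rad (e $ j)" h] vabs_diff_le[of "x $ j + h - y $ j" "rad (e $ j)" h] that
      by (auto simp: algebra_simps)
    then show ?thesis by (auto simp: pdisc_def axis_def)
  qed
  have minus: "x - g t = x + axis j (- (\<pi> powi (e $ j) * t))" for x t
    by (simp add: g_def axis_def vec_eq_iff)
  have shift': "x - g t \<in> pdisc y e \<longleftrightarrow> x \<in> pdisc y e" if "t \<in> T" for x t
    unfolding minus by (rule shift) (use g_small[OF that] in simp)
  have F_diff: "vabs (F (x - g t) - F (x - g t')) = rad s * vabs (t - t')"
    if "x \<in> pdisc y e" "t \<in> T" "t' \<in> T" for x t t'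
  proof -
    let ?h = "\<pi> powi (e $ j) * (t' - t)"
    have "x - g t = (x - g t') + axis j ?h" by (simp add: g_def axis_def vec_eq_iff algebra_simps)
    moreover have "vabs ?h \<le> rad (e $ j)"
      using vabs_diff_le[OF reps_le_1[OF T that(3)] reps_le_1[OF T that(2)]] by (simp add: vabs_mult mult_left_le)
    moreover have "x - g t' \<in> pdisc y e" using shift' that by blast
    ultimately have "vabs (F (x - g t) - F (x - g t')) = rad \<rho> * vabs ?h" using line by metis
    then show ?thesis by (simp add: vabs_mult s_def rad_add vabs_diff_commute[of t])
  qed
  have un: "t = t'" if "x \<in> pdisc y e" "t \<in> T" "t' \<in> T"
    "vabs (F (x - g t) - w) \<le> rad (s + int r)" "vabs (F (x - g t') - w) \<le> rad (s + int r)" for x t t' w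
  proof -
    have "vabs (F (x - g t) - F (x - g t')) \<le> rad (s + int r)"
      using that(4,5) by (rule vabs_triangle_left)
    then have "vabs (t - t') \<le> rad (int r)" unfolding F_diff[OF that(1-3)] rad_add by simp
    then show ?thesis using reps_unique[OF T] that by blast
  qed
  \<comment> \<open>Sending \<open>t\<close> to the class of \<open>F (x - g t)\<close> is an
    injective self-map of the finite set \<open>T\<close>, because \<open>F\<close> separates the
    translates; hence it is onto and reaches the class of \<open>v\<close>.\<close>
  have ex: "\<exists>t\<in>T. vabs (F (x - g t) - v) \<le> rad (s + int r)" if x: "x \<in> pdisc y e" for x
  proof -
    have scale: "vabs (a * \<pi> powi (-s)) \<le> 1" if "vabs a \<le> rad s" for a
      using that by (simp add: vabs_mult rad_minus divide_le_eq)
    have scale': "vabs (a - \<pi> powi s * u) \<le> rad (s + int r)" if "vabs (a * \<pi> powi (-s) - u) \<le> rad (int r)" for a u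
    proof -
      have "a - \<pi> powi s * u = \<pi> powi s * (a * \<pi> powi (-s) - u)" by (simp add: power_int_minus algebra_simps)
      then show ?thesis using that by (simp add: vabs_mult rad_add)
    qed
    have Fb: "vabs (F (x - g t)) \<le> rad s" if "t \<in> T" for t
      using bound shift'[OF that] x by (simp add: s_def)
    have "\<forall>t. \<exists>u. t \<in> T \<longrightarrow> u \<in> T \<and> vabs (F (x - g t) - \<pi> powi s * u) \<le> rad (s + int r)"
    proof
      fix t
      show "\<exists>u. t \<in> T \<longrightarrow> u \<in> T \<and> vabs (F (x - g t) - \<pi> powi s * u) \<le> rad (s + int r)"
        using reps_obtain[OF T scale[OF Fb[of t]]] scale' by blast
    qed
    from choice[OF this] obtain \<psi> where \<psi>: "\<And>t. t \<in> T \<Longrightarrow> \<psi> t \<in> T"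
      "\<And>t. t \<in> T \<Longrightarrow> vabs (F (x - g t) - \<pi> powi s * \<psi> t) \<le> rad (s + int r)" by blast
    have "inj_on \<psi> T"
    proof (rule inj_onI)
      fix t t' assume t: "t \<in> T" "t' \<in> T" "\<psi> t = \<psi> t'"
      then show "t = t'" using un[OF x t(1,2) \<psi>(2)[OF t(1)]] \<psi>(2)[OF t(2)] by simp
    qed
    moreover obtain u where u: "u \<in> T" "vabs (v - \<pi> powi s * u) \<le> rad (s + int r)"
      using reps_obtain[OF T scale[OF v[folded s_def]]] scale' by blast
    ultimately obtain t where "t \<in> T" "\<psi> t = u"
      using finite_self_map_surj[OF reps_finite[OF T], of \<psi> u] \<psi>(1) by blast
    then have "vabs (F (x - g t) - v) \<le> rad (s + int r)"
      using vabs_triangle_left[OF \<psi>(2)[of t], of v] u(2) by blast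
    then show ?thesis using \<open>t \<in> T\<close> by blast
  qed
  have "emeasure \<mu> (pdisc y e) = of_nat (card (g ` T)) * emeasure \<mu> A0"
  proof (rule emeasure_tiling)
    show "x \<in> pdisc y e \<longleftrightarrow> (\<exists>z\<in>g ` T. x - z \<in> A0)" for x
    proof
      assume "x \<in> pdisc y e"
      from ex[OF this] this show "\<exists>z\<in>g ` T. x - z \<in> A0" using shift' by (auto simp: A0_def)
    next
      assume "\<exists>z\<in>g ` T. x - z \<in> A0"
      then show "x \<in> pdisc y e" using shift' by (auto simp: A0_def)
    qed
    fix x z z' assume z: "z \<in> g ` T" "z' \<in> g ` T" "x - z \<in> A0" "x - z' \<in> A0"
    then obtain t t' where t: "t \<in> T" "t' \<in> T" "z = g t" "z' = g t'" by blast
    have "x \<in> pdisc y e" using z(3) shift'[OF t(1)] unfolding t(3) A0_def by blast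
    then have "t = t'" using un[of x t t' v] t z(3,4) unfolding t(3,4) A0_def by blast
    then show "z = z'" using t by simp
  qed (use reps_finite[OF T] A0 in auto)
  then have "measure \<mu> (pdisc y e) = real q ^ r * measure \<mu> A0"
    using card_image[OF inj] reps_card[OF T]
    by (simp add: measure_def enn2real_mult flip: of_nat_power)
  then have "rad (int r) * measure \<mu> (pdisc y e) = measure \<mu> A0"
    using q_ge_2 by (simp add: rad_of_nat)
  then show ?thesis by (simp add: A0_def s_def)
qed

end

text \<open>
  \<open>quasichar_data\<close> says that \<open>\<omega>\<close> is given by its value \<open>\<tau>\<close> at the uniformizer and its
  restriction \<open>\<eta>\<close> to the units, which has conductor at most \<open>c\<close>.
\<close>

definition (in padic) quasichar_data :: "('k \<Rightarrow> complex) \<Rightarrow> complex \<Rightarrow> ('k \<Rightarrow> complex) \<Rightarrow> nat \<Rightarrow> bool" where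
  "quasichar_data \<omega> \<tau> \<eta> c \<longleftrightarrow> \<tau> \<noteq> 0 \<and> c \<ge> 1 \<and> \<omega> 0 = 0 \<and>
     (\<forall>k u. vabs u = 1 \<longrightarrow> \<omega> (\<pi> powi k * u) = \<tau> powi k * \<eta> u) \<and>
     (\<forall>u u'. vabs u = 1 \<longrightarrow> vabs (u - u') \<le> rad (int c) \<longrightarrow> \<eta> u' = \<eta> u)"

context haar
begin

text \<open>The accuracy is relative to \<open>v\<close>: after division by the leading power of
  \<open>\<pi>\<close>, \<open>x\<close> and \<open>v\<close> become units which the conductor does
  not distinguish.\<close>

lemma quasichar_data_near:
  assumes \<omega>: "quasichar_data \<omega> \<tau> \<eta> c" and v: "v \<noteq> 0" and x: "vabs (x - v) \<le> rad (int c) * vabs v"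
  shows "\<omega> x = \<tau> powi (kord v) * \<eta> (ac \<pi> v)" "vabs x = vabs v"
proof -
  have c: "rad (int c) < 1" using \<omega> by (simp add: quasichar_data_def)
  then have "rad (int c) * vabs v < vabs v" using v by simp
  then show eq: "vabs x = vabs v" using x by (intro vabs_dominant) linarith
  define u where "u = x * \<pi> powi (- kord v)"
  have vk: "vabs v = rad (kord v)" using vabs_kord[OF v] .
  have xu: "x = \<pi> powi (kord v) * u" by (simp add: u_def power_int_minus)
  have u: "vabs u = 1" by (simp add: u_def vabs_mult eq vk rad_minus)
  have "u - ac \<pi> v = (x - v) * \<pi> powi (- kord v)" by (simp add: u_def ac_def algebra_simps)
  then have "vabs (u - ac \<pi> v) \<le> rad (int c)" using x by (simp add: vabs_mult vk rad_minus divide_le_eq)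
  then have "\<eta> (ac \<pi> v) = \<eta> u" using \<omega> u unfolding quasichar_data_def by blast
  moreover have "\<omega> (\<pi> powi kord v * u) = \<tau> powi (kord v) * \<eta> u"
    using \<omega> u unfolding quasichar_data_def by blast
  ultimately show "\<omega> x = \<tau> powi (kord v) * \<eta> (ac \<pi> v)" unfolding xu[symmetric] by simp
qed

lemma integral_near:
  assumes \<omega>: "quasichar_data \<omega> \<tau> \<eta> c" and v: "v \<noteq> 0"
    and F: "\<And>x. x \<in> pdisc y e \<Longrightarrow> vabs (F x - v) \<le> rad (int c) * vabs v"
  shows "set_integrable \<mu> (pdisc y e) (\<lambda>x. \<omega> (F x))"
    "(LINT x:pdisc y e|\<mu>. \<omega> (F x)) = measure \<mu> (pdisc y e) *\<^sub>R (\<tau> powi (kord v) * \<eta> (ac \<pi> v))"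
    "(LINT x:pdisc y e|\<mu>. norm (\<omega> (F x))) = measure \<mu> (pdisc y e) * norm (\<tau> powi (kord v) * \<eta> (ac \<pi> v))"
proof -
  let ?w = "\<tau> powi (kord v) * \<eta> (ac \<pi> v)"
  have eq: "indicator (pdisc y e) x *\<^sub>R \<omega> (F x) = indicator (pdisc y e) x *\<^sub>R ?w" for x
    using quasichar_data_near(1)[OF \<omega> v F] by (auto simp: indicator_def)
  have eq': "indicator (pdisc y e) x *\<^sub>R norm (\<omega> (F x)) = indicator (pdisc y e) x *\<^sub>R norm ?w" for x
    using quasichar_data_near(1)[OF \<omega> v F] by (auto simp: indicator_def)
  show "set_integrable \<mu> (pdisc y e) (\<lambda>x. \<omega> (F x))"
    unfolding set_integrable_def eq using emeasure_pdisc_finite by (intro integrable_scaleR_left integrable_real_indicator) auto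
  show "(LINT x:pdisc y e|\<mu>. \<omega> (F x)) = measure \<mu> (pdisc y e) *\<^sub>R ?w"
    unfolding set_lebesgue_integral_def eq using emeasure_pdisc_finite
    by (subst integral_scaleR_left) auto
  show "(LINT x:pdisc y e|\<mu>. norm (\<omega> (F x))) = measure \<mu> (pdisc y e) * norm ?w"
    unfolding set_lebesgue_integral_def eq' using emeasure_pdisc_finite
    by (subst integral_scaleR_left) auto
qed

text \<open>If \<open>c\<close> bounds the conductor, this is the Haar integral of
  \<open>\<eta>\<close> over the unit group: each class of units modulo \<open>\<pi> ^ c\<close> has
  measure \<open>rad c\<close>.\<close>

definition unit_mean :: "('k \<Rightarrow> complex) \<Rightarrow> nat \<Rightarrow> complex" where
  "unit_mean \<eta> c = rad (int c) *\<^sub>R (\<Sum>u\<in>{u \<in> (SOME T. reps c T). vabs u = 1}. \<eta> u)"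

definition unit_norm_mean :: "('k \<Rightarrow> complex) \<Rightarrow> nat \<Rightarrow> real" where
  "unit_norm_mean \<eta> c = rad (int c) * (\<Sum>u\<in>{u \<in> (SOME T. reps c T). vabs u = 1}. norm (\<eta> u))"

text \<open>The shells on which \<open>vabs (F x) = rad (s + l)\<close> are cut into fibres over the
  unit classes. By \<open>measure_fibre\<close> all fibres in a shell have equal measure, so shell
  \<open>l\<close> contributes a constant times \<open>(\<tau> / q) ^ l\<close>. The zeros of
  \<open>F\<close> lie in no shell but add nothing, as \<open>\<omega> 0 = 0\<close>. The resulting
  factor is the source of the pole at -1.\<close>

lemma integral_fibred:
  fixes F :: "'k ^ 'n \<Rightarrow> 'k"
  assumes \<omega>: "quasichar_data \<omega> \<tau> \<eta> c" and \<tau>: "norm \<tau> < real q"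
    and meas: "\<And>v k. {x \<in> pdisc y e. vabs (F x - v) \<le> rad k} \<in> sets borel"
    and line: "\<And>x h. x \<in> pdisc y e \<Longrightarrow> vabs h \<le> rad (e $ j) \<Longrightarrow> vabs (F (x + axis j h) - F x) = rad \<rho> * vabs h"
    and bound: "\<And>x. x \<in> pdisc y e \<Longrightarrow> vabs (F x) \<le> rad (\<rho> + e $ j)"
  defines "s \<equiv> \<rho> + e $ j" and "m \<equiv> measure \<mu> (pdisc y e)"
  shows "set_integrable \<mu> (pdisc y e) (\<lambda>x. \<omega> (F x))"
    "(LINT x:pdisc y e|\<mu>. \<omega> (F x)) = m *\<^sub>R (\<tau> powi s * unit_mean \<eta> c) / (1 - \<tau> / of_nat q)"
    "(LINT x:pdisc y e|\<mu>. norm (\<omega> (F x))) \<le> m * (norm \<tau> powi s * unit_norm_mean \<eta> c) / (1 - norm \<tau> / q)"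
proof -
  define T where "T = (SOME T. reps c T)"
  have T: "reps c T" unfolding T_def using reps_exist by (rule someI_ex)
  define U where "U = {u \<in> T. vabs u = 1}"
  have U: "finite U" using reps_finite[OF T] by (simp add: U_def)
  have c: "c \<ge> 1" and \<tau>0: "\<tau> \<noteq> 0" using \<omega> by (simp_all add: quasichar_data_def)
  define B where "B l = {x \<in> pdisc y e. vabs (F x) = rad (s + int l)}" for l :: nat
  \<comment> \<open>In shell \<open>l\<close> the accuracy \<open>s + l + c\<close> is the relative
    accuracy \<open>c\<close> of the conductor, so \<open>\<omega>\<close> is constant on each of
    these fibres.\<close>
  define Bu where "Bu l u = {x \<in> pdisc y e. vabs (F x - \<pi> powi (s + int l) * u) \<le> rad (s + int (l + c))}" for l :: nat and u
  have Bu_sets: "Bu l u \<in> sets \<mu>" for l u using meas by (simp add: Bu_def)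
  have Bu_sub: "Bu l u \<subseteq> pdisc y e" for l u by (auto simp: Bu_def)
  have Bu_fin: "emeasure \<mu> (Bu l u) < \<infinity>" for l u
    using emeasure_mono[OF Bu_sub, of \<mu>] emeasure_pdisc_finite[of y e] by (auto intro: le_less_trans)
  have Bu_meas: "measure \<mu> (Bu l u) = rad (int (l + c)) * m" if "u \<in> U" for l u
  proof -
    have "vabs (\<pi> powi (s + int l) * u) \<le> rad s" using that by (simp add: vabs_mult U_def)
    then show ?thesis
      unfolding Bu_def m_def s_def using measure_fibre[OF meas line bound, of "\<pi> powi (s + int l) * u" "l + c"]
      by (simp add: s_def)
  qed
  have in_B: "x \<in> Bu l u \<longleftrightarrow> x \<in> B l \<and> vabs (F x * \<pi> powi (- (s + int l)) - u) \<le> rad (int c)" if u: "u \<in> U" for x l u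
  proof -
    define z where "z = F x * \<pi> powi (- (s + int l))"
    have "F x = \<pi> powi (s + int l) * z" unfolding z_def by (rule pi_powi_cancel)
    then have "F x - \<pi> powi (s + int l) * u = \<pi> powi (s + int l) * (z - u)"
      by (simp only: right_diff_distrib)
    then have 1: "vabs (F x - \<pi> powi (s + int l) * u) = rad (s + int l) * vabs (z - u)"
      by (simp add: vabs_mult)
    have 2: "rad (s + int (l + c)) = rad (s + int l) * rad (int c)" by (simp add: rad_add)
    have 3: "vabs (F x) = rad (s + int l)" if "vabs (F x - \<pi> powi (s + int l) * u) \<le> rad (s + int (l + c))"
    proof -
      have "vabs (\<pi> powi (s + int l) * u) = rad (s + int l)" using u by (simp add: vabs_mult U_def)
      moreover have "rad (s + int (l + c)) < rad (s + int l)" using c by simp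
      ultimately show ?thesis
        using that vabs_dominant[of "F x" "\<pi> powi (s + int l) * u"] by linarith
    qed
    show ?thesis using 3 unfolding Bu_def B_def mem_Collect_eq z_def[symmetric] 1 2 by auto
  qed
  have B_eq: "B l = (\<Union>u\<in>U. Bu l u)" for l
  proof -
    have "\<exists>u\<in>U. x \<in> Bu l u" if "x \<in> B l" for x
    proof -
      let ?w = "F x * \<pi> powi (- (s + int l))"
      have w: "vabs ?w = 1" using that by (intro vabs_scale) (simp add: B_def)
      then obtain u where u: "u \<in> T" "vabs (?w - u) \<le> rad (int c)" using reps_obtain[OF T, of ?w] by auto
      have "rad (int c) < vabs ?w" using w c by simp
      then have "vabs (u - ?w) < vabs ?w" using u(2) vabs_diff_commute[of u ?w] by linarith
      then have "vabs u = 1" using vabs_dominant[of u ?w] w by linarith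
      then have "u \<in> U" using u by (simp add: U_def)
      then show ?thesis using in_B that u by blast
    qed
    then show ?thesis using in_B by blast
  qed
  have B_sets: "B l \<in> sets \<mu>" for l unfolding B_eq using U Bu_sets by blast
  have disjU: "u = u'" if "x \<in> Bu l u" "x \<in> Bu l u'" "u \<in> U" "u' \<in> U" for x l u u'
  proof -
    have "vabs (u - u') \<le> rad (int c)"
      using that in_B vabs_triangle_right[of "F x * \<pi> powi (- (s + int l))" u] by blast
    then show ?thesis using reps_unique[OF T] that by (auto simp: U_def)
  qed
  have val: "\<omega> (F x) = \<tau> powi (s + int l) * \<eta> u" if "x \<in> Bu l u" "u \<in> U" for x l u
  proof -
    let ?w = "F x * \<pi> powi (- (s + int l))"
    have x: "x \<in> B l" "vabs (?w - u) \<le> rad (int c)" using in_B that by blast+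
    have w: "vabs ?w = 1" using x(1) by (intro vabs_scale) (simp add: B_def)
    have "\<eta> u = \<eta> ?w" using \<omega> w x(2) unfolding quasichar_data_def by blast
    moreover have "F x = \<pi> powi (s + int l) * ?w" by (rule pi_powi_cancel)
    moreover have "\<omega> (\<pi> powi (s + int l) * ?w) = \<tau> powi (s + int l) * \<eta> ?w"
      using \<omega> w unfolding quasichar_data_def by blast
    ultimately show ?thesis by (simp only:)
  qed
  have ind: "indicator (B l) x *\<^sub>R h (\<omega> (F x)) = (\<Sum>u\<in>U. indicator (Bu l u) x *\<^sub>R h (\<tau> powi (s + int l) * \<eta> u))"
    for h :: "complex \<Rightarrow> 'b::real_normed_vector" and l x
  proof (cases "x \<in> B l")
    case True
    then obtain u where u: "u \<in> U" "x \<in> Bu l u" using B_eq by blast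
    have "(\<Sum>u'\<in>U. indicator (Bu l u') x *\<^sub>R h (\<tau> powi (s + int l) * \<eta> u'))
        = (\<Sum>u'\<in>U. if u' = u then h (\<tau> powi (s + int l) * \<eta> u) else 0)"
      using disjU u by (intro sum.cong) (auto simp: indicator_def)
    then show ?thesis using True u U val[OF u(2,1)] by simp
  next
    case False
    then show ?thesis using B_eq by (auto simp: indicator_def intro!: sum.neutral[symmetric])
  qed
  have term_int: "integrable \<mu> (\<lambda>x. indicator (Bu l u) x *\<^sub>R (b :: 'b::{banach,second_countable_topology}))" for l u b
    using Bu_sets Bu_fin by (intro integrable_scaleR_left integrable_real_indicator) auto
  have B_int: "set_integrable \<mu> (B l) (\<lambda>x. \<omega> (F x))" for l
    unfolding set_integrable_def ind[of l _ "\<lambda>x. x"] by (intro Bochner_Integration.integrable_sum term_int)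
  have B_val: "(LINT x:B l|\<mu>. h (\<omega> (F x))) = (\<Sum>u\<in>U. (rad (int (l + c)) * m) *\<^sub>R h (\<tau> powi (s + int l) * \<eta> u))"
    for h :: "complex \<Rightarrow> 'b::{banach,second_countable_topology}" and l
  proof -
    have "(LINT x:B l|\<mu>. h (\<omega> (F x))) = (\<Sum>u\<in>U. \<integral>x. indicator (Bu l u) x *\<^sub>R h (\<tau> powi (s + int l) * \<eta> u) \<partial>\<mu>)"
      unfolding set_lebesgue_integral_def ind by (intro Bochner_Integration.integral_sum term_int)
    also have "\<dots> = (\<Sum>u\<in>U. measure \<mu> (Bu l u) *\<^sub>R h (\<tau> powi (s + int l) * \<eta> u))"
      using Bu_sets Bu_fin by (intro sum.cong refl) (subst integral_scaleR_left, auto)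
    finally show ?thesis using Bu_meas by simp
  qed
  have um: "unit_mean \<eta> c = rad (int c) *\<^sub>R (\<Sum>u\<in>U. \<eta> u)" "unit_norm_mean \<eta> c = rad (int c) * (\<Sum>u\<in>U. norm (\<eta> u))"
    by (simp_all add: unit_mean_def unit_norm_mean_def U_def T_def)
  have lam: "rad (int l) = (1 / real q) ^ l" for l by (simp add: rad_of_nat power_one_over)
  have B_val1: "(LINT x:B l|\<mu>. \<omega> (F x)) = (m *\<^sub>R (\<tau> powi s * unit_mean \<eta> c)) * (\<tau> / of_nat q) ^ l" for l
  proof -
    have "(LINT x:B l|\<mu>. \<omega> (F x)) = (rad (int (l + c)) * m) *\<^sub>R (\<tau> powi (s + int l) * (\<Sum>u\<in>U. \<eta> u))"
      using B_val[of l "\<lambda>x. x"] by (simp add: sum_distrib_left scaleR_sum_right)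
    also have "\<dots> = (m *\<^sub>R (\<tau> powi s * unit_mean \<eta> c)) * (\<tau> / of_nat q) ^ l"
      unfolding um using \<tau>0 q_ge_2
      by (simp add: rad_add lam power_int_add power_divide scaleR_conv_of_real field_simps)
    finally show ?thesis .
  qed
  have B_val2: "(LINT x:B l|\<mu>. norm (\<omega> (F x))) \<le> (m * (norm \<tau> powi s * unit_norm_mean \<eta> c)) * (norm \<tau> / q) ^ l" for l
  proof -
    have "(LINT x:B l|\<mu>. norm (\<omega> (F x))) = (rad (int (l + c)) * m) * (norm \<tau> powi (s + int l) * (\<Sum>u\<in>U. norm (\<eta> u)))"
      using B_val[of l norm] by (simp add: sum_distrib_left norm_mult norm_power_int)
    also have "\<dots> = (m * (norm \<tau> powi s * unit_norm_mean \<eta> c)) * (norm \<tau> / q) ^ l"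
      unfolding um using \<tau>0 q_ge_2
      by (simp add: rad_add lam power_int_add power_divide field_simps)
    finally show ?thesis by simp
  qed
  have disj: "disjoint_family B" by (auto simp: disjoint_family_on_def B_def)
  have q: "real q > 0" using q_ge_2 by simp
  have small: "norm (\<tau> / of_nat q) < 1" "0 \<le> norm \<tau> / q" "norm \<tau> / q < 1" using \<tau> q by (simp_all add: norm_divide)
  note geo = set_integral_geometric_union[OF disj B_sets B_int B_val1 B_val2 small(2,3,1)]
  have eq: "indicator (pdisc y e) x *\<^sub>R h (\<omega> (F x)) = indicator (\<Union>l. B l) x *\<^sub>R h (\<omega> (F x))"
    if h0: "h 0 = 0" for h :: "complex \<Rightarrow> 'b::real_normed_vector" and x
  proof (cases "x \<in> pdisc y e \<and> x \<notin> (\<Union>l. B l)")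
    case True
    have "F x = 0"
    proof (rule ccontr)
      assume "F x \<noteq> 0"
      then have k: "vabs (F x) = rad (kord (F x))" by (rule vabs_kord)
      then have "kord (F x) \<ge> s" using bound[of x] True by (simp add: s_def)
      then have "kord (F x) = s + int (nat (kord (F x) - s))" by simp
      then have "x \<in> B (nat (kord (F x) - s))" unfolding B_def using k True by (metis (mono_tags, lifting) mem_Collect_eq)
      then show False using True by blast
    qed
    then show ?thesis using \<omega> h0 by (simp add: quasichar_data_def)
  next
    case False
    then show ?thesis by (auto simp: indicator_def B_def)
  qed
  show "set_integrable \<mu> (pdisc y e) (\<lambda>x. \<omega> (F x))"
    using geo(1) unfolding set_integrable_def eq[of "\<lambda>x. x", OF refl] .
  show "(LINT x:pdisc y e|\<mu>. \<omega> (F x)) = m *\<^sub>R (\<tau> powi s * unit_mean \<eta> c) / (1 - \<tau> / of_nat q)"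
    using geo(2) unfolding set_lebesgue_integral_def eq[of "\<lambda>x. x", OF refl] .
  show "(LINT x:pdisc y e|\<mu>. norm (\<omega> (F x))) \<le> m * (norm \<tau> powi s * unit_norm_mean \<eta> c) / (1 - norm \<tau> / q)"
    using geo(3) unfolding set_lebesgue_integral_def eq[of norm, OF norm_zero] .
qed

end

section \<open>Strict differentiability of Laurent polynomials\<close>

context padic
begin

text \<open>Strict differentiability: both points vary near \<open>y\<close>. An ordinary derivative
  at \<open>y\<close> would not control differences between two nearby points, which the scaled
  isometry along lines requires. The number \<open>r\<close> stands in for the maximum norm of the
  difference.\<close>

definition strict_deriv :: "('k ^ 'n::finite \<Rightarrow> 'k) \<Rightarrow> 'k ^ 'n \<Rightarrow> ('n \<Rightarrow> 'k) \<Rightarrow> bool" where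
  "strict_deriv F y G \<longleftrightarrow> (\<forall>\<epsilon>>0. \<exists>N0. \<forall>N\<ge>N0. \<forall>x\<in>pball y N. \<forall>z\<in>pball y N. \<forall>r.
     (\<forall>i. vabs (x $ i - z $ i) \<le> r) \<longrightarrow> vabs (F x - F z - (\<Sum>i\<in>UNIV. G i * (x $ i - z $ i))) \<le> \<epsilon> * r)"

lemma strict_derivE:
  assumes "strict_deriv F y G" "\<epsilon> > 0"
  obtains N0 where "\<And>N x z r. N \<ge> N0 \<Longrightarrow> x \<in> pball y N \<Longrightarrow> z \<in> pball y N \<Longrightarrow> (\<And>i. vabs (x $ i - z $ i) \<le> r) \<Longrightarrow>
    vabs (F x - F z - (\<Sum>i\<in>UNIV. G i * (x $ i - z $ i))) \<le> \<epsilon> * r"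
  using assms unfolding strict_deriv_def by blast

lemma vabs_linear_le:
  assumes "\<And>i. vabs (G i) \<le> L" "\<And>i. vabs (d i) \<le> r" "0 \<le> L" "0 \<le> r"
  shows "vabs (\<Sum>i\<in>A. G i * d i) \<le> L * r"
  by (rule vabs_sum_le) (use assms in \<open>auto simp: vabs_mult intro: mult_mono\<close>)

lemma finite_vabs_bound: "\<exists>L>0. \<forall>i. vabs (G (i::'n::finite) :: 'k) \<le> L"
proof (intro exI[of _ "1 + (\<Sum>i\<in>UNIV. vabs (G i))"] conjI allI)
  show "0 < 1 + (\<Sum>i\<in>UNIV. vabs (G i))" by (intro add_pos_nonneg sum_nonneg) auto
  show "vabs (G i) \<le> 1 + (\<Sum>i\<in>UNIV. vabs (G i))" for i
    using member_le_sum[of i UNIV "\<lambda>i. vabs (G i)"] by simp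
qed

lemma strict_deriv_Lipschitz:
  assumes "strict_deriv F y G"
  obtains L N0 where "L > 0" "\<And>N x z r. N \<ge> N0 \<Longrightarrow> x \<in> pball y N \<Longrightarrow> z \<in> pball y N \<Longrightarrow>
    (\<And>i. vabs (x $ i - z $ i) \<le> r) \<Longrightarrow> vabs (F x - F z) \<le> L * r"
proof -
  obtain L where L: "L > 0" "\<And>i. vabs (G i) \<le> L" using finite_vabs_bound by blast
  obtain N0 where N0: "\<And>N x z r. N \<ge> N0 \<Longrightarrow> x \<in> pball y N \<Longrightarrow> z \<in> pball y N \<Longrightarrow> (\<And>i. vabs (x $ i - z $ i) \<le> r) \<Longrightarrow>
    vabs (F x - F z - (\<Sum>i\<in>UNIV. G i * (x $ i - z $ i))) \<le> L * r"
    using strict_derivE[OF assms L(1)] by blast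
  have "vabs (F x - F z) \<le> L * r"
    if "N \<ge> N0" "x \<in> pball y N" "z \<in> pball y N" and d: "\<And>i. vabs (x $ i - z $ i) \<le> r" for N x z r
  proof -
    have r: "0 \<le> r" using d order_trans[OF vabs_nonneg] by blast
    have "vabs (\<Sum>i\<in>UNIV. G i * (x $ i - z $ i)) \<le> L * r"
      using L d r by (intro vabs_linear_le) auto
    from vabs_add_le[OF N0[OF that] this] show ?thesis by simp
  qed
  then show ?thesis using that L(1) by blast
qed

lemma strict_deriv_near:
  assumes "strict_deriv F y G" "\<epsilon> > 0"
  obtains N0 where "\<And>N x. N \<ge> N0 \<Longrightarrow> x \<in> pball y N \<Longrightarrow> vabs (F x - F y) \<le> \<epsilon>"
proof -
  obtain L N0 where L: "L > 0" "\<And>N x z r. N \<ge> N0 \<Longrightarrow> x \<in> pball y N \<Longrightarrow> z \<in> pball y N \<Longrightarrow>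
    (\<And>i. vabs (x $ i - z $ i) \<le> r) \<Longrightarrow> vabs (F x - F z) \<le> L * r"
    using strict_deriv_Lipschitz[OF assms(1)] by blast
  obtain N1 where N1: "\<And>N. N \<ge> N1 \<Longrightarrow> rad N < \<epsilon> / L"
    using rad_arbitrarily_small[of "\<epsilon> / L"] assms(2) L(1) by auto
  have "vabs (F x - F y) \<le> \<epsilon>" if "N \<ge> max N0 N1" "x \<in> pball y N" for N x
  proof -
    have "vabs (F x - F y) \<le> L * rad N" by (rule L(2)[of N]) (use that in \<open>auto simp: pdisc_def\<close>)
    also have "\<dots> \<le> \<epsilon>" using N1[of N] that L(1) by (simp add: field_simps)
    finally show ?thesis .
  qed
  then show ?thesis using that by blast
qed

lemma strict_deriv_const: "strict_deriv (\<lambda>x. c) (y :: 'k ^ 'n::finite) (\<lambda>i. 0)"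
  unfolding strict_deriv_def
proof (intro allI impI exI ballI)
  fix \<epsilon> r :: real and N and x z :: "'k ^ 'n"
  assume "\<epsilon> > 0" and d: "\<forall>i. vabs (x $ i - z $ i) \<le> r"
  have "0 \<le> r" using d order_trans[OF vabs_nonneg] by blast
  then show "vabs (c - c - (\<Sum>i\<in>UNIV. 0 * (x $ i - z $ i))) \<le> \<epsilon> * r" using \<open>\<epsilon> > 0\<close> by simp
qed

lemma strict_deriv_component: "strict_deriv (\<lambda>x. x $ j) (y :: 'k ^ 'n::finite) (\<lambda>i. if i = j then 1 else 0)"
  unfolding strict_deriv_def
proof (intro allI impI exI ballI)
  fix \<epsilon> r :: real and N and x z :: "'k ^ 'n"
  assume "\<epsilon> > 0" and d: "\<forall>i. vabs (x $ i - z $ i) \<le> r"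
  have "0 \<le> r" using d order_trans[OF vabs_nonneg] by blast
  moreover have "(\<Sum>i\<in>UNIV. (if i = j then 1 else 0) * (x $ i - z $ i)) = x $ j - z $ j"
    by (simp add: if_distrib[of "\<lambda>a. a * _"] sum.delta cong: if_cong)
  ultimately show "vabs (x $ j - z $ j - (\<Sum>i\<in>UNIV. (if i = j then 1 else 0) * (x $ i - z $ i))) \<le> \<epsilon> * r"
    using \<open>\<epsilon> > 0\<close> by simp
qed

lemma strict_deriv_add:
  assumes "strict_deriv F y G" "strict_deriv F' y G'"
  shows "strict_deriv (\<lambda>x. F x + F' x) y (\<lambda>i. G i + G' i)"
  unfolding strict_deriv_def
proof (intro allI impI)
  fix \<epsilon> :: real assume \<epsilon>: "\<epsilon> > 0"
  obtain N0 where N0: "\<And>N x z r. N \<ge> N0 \<Longrightarrow> x \<in> pball y N \<Longrightarrow> z \<in> pball y N \<Longrightarrow> (\<And>i. vabs (x $ i - z $ i) \<le> r) \<Longrightarrow>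
    vabs (F x - F z - (\<Sum>i\<in>UNIV. G i * (x $ i - z $ i))) \<le> \<epsilon> * r"
    using strict_derivE[OF assms(1) \<epsilon>] by blast
  obtain N1 where N1: "\<And>N x z r. N \<ge> N1 \<Longrightarrow> x \<in> pball y N \<Longrightarrow> z \<in> pball y N \<Longrightarrow> (\<And>i. vabs (x $ i - z $ i) \<le> r) \<Longrightarrow>
    vabs (F' x - F' z - (\<Sum>i\<in>UNIV. G' i * (x $ i - z $ i))) \<le> \<epsilon> * r"
    using strict_derivE[OF assms(2) \<epsilon>] by blast
  show "\<exists>N0. \<forall>N\<ge>N0. \<forall>x\<in>pball y N. \<forall>z\<in>pball y N. \<forall>r. (\<forall>i. vabs (x $ i - z $ i) \<le> r) \<longrightarrow>
     vabs (F x + F' x - (F z + F' z) - (\<Sum>i\<in>UNIV. (G i + G' i) * (x $ i - z $ i))) \<le> \<epsilon> * r"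
  proof (intro exI[of _ "max N0 N1"] allI impI ballI)
    fix N x z r assume N: "N \<ge> max N0 N1" and x: "x \<in> pball y N" and z: "z \<in> pball y N"
      and d: "\<forall>i. vabs (x $ i - z $ i) \<le> r"
    have "F x + F' x - (F z + F' z) - (\<Sum>i\<in>UNIV. (G i + G' i) * (x $ i - z $ i)) =
      (F x - F z - (\<Sum>i\<in>UNIV. G i * (x $ i - z $ i))) + (F' x - F' z - (\<Sum>i\<in>UNIV. G' i * (x $ i - z $ i)))"
      by (simp add: distrib_right sum.distrib)
    also have "vabs \<dots> \<le> \<epsilon> * r"
      using N0[of N x z r] N1[of N x z r] N x z d by (intro vabs_add_le) simp_all
    finally show "vabs (F x + F' x - (F z + F' z) - (\<Sum>i\<in>UNIV. (G i + G' i) * (x $ i - z $ i))) \<le> \<epsilon> * r" .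
  qed
qed

lemma strict_deriv_mult:
  assumes F: "strict_deriv F y G" and F': "strict_deriv F' y G'"
  shows "strict_deriv (\<lambda>x. F x * F' x) y (\<lambda>i. F y * G' i + F' y * G i)"
  unfolding strict_deriv_def
proof (intro allI impI)
  fix \<epsilon> :: real assume \<epsilon>: "\<epsilon> > 0"
  \<comment> \<open>Bounds the factors \<open>F x\<close> and \<open>F' z\<close> in the error of
    the product rule; the summand 1 covers their deviation from the values at \<open>y\<close>,
    which is at most \<open>\<delta> \<le> 1\<close>.\<close>
  define A where "A = 1 + vabs (F y) + vabs (F' y)"
  have A: "A > 0" by (simp add: A_def add_pos_nonneg)
  obtain L where L: "L > 0" "\<And>i. vabs (G i) \<le> L" using finite_vabs_bound by blast
  obtain L' where L': "L' > 0" "\<And>i. vabs (G' i) \<le> L'" using finite_vabs_bound by blast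
  obtain N0 where N0: "\<And>N x z r. N \<ge> N0 \<Longrightarrow> x \<in> pball y N \<Longrightarrow> z \<in> pball y N \<Longrightarrow> (\<And>i. vabs (x $ i - z $ i) \<le> r) \<Longrightarrow>
    vabs (F x - F z - (\<Sum>i\<in>UNIV. G i * (x $ i - z $ i))) \<le> \<epsilon> / A * r"
    using strict_derivE[OF F, of "\<epsilon> / A"] \<epsilon> A by (auto simp del: divide_le_eq le_divide_eq)
  obtain N1 where N1: "\<And>N x z r. N \<ge> N1 \<Longrightarrow> x \<in> pball y N \<Longrightarrow> z \<in> pball y N \<Longrightarrow> (\<And>i. vabs (x $ i - z $ i) \<le> r) \<Longrightarrow>
    vabs (F' x - F' z - (\<Sum>i\<in>UNIV. G' i * (x $ i - z $ i))) \<le> \<epsilon> / A * r"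
    using strict_derivE[OF F', of "\<epsilon> / A"] \<epsilon> A by (auto simp del: divide_le_eq le_divide_eq)
  \<comment> \<open>In the mixed terms a deviation from \<open>y\<close> multiplies a linear part of
    size at most \<open>L * r\<close> or \<open>L' * r\<close>; a deviation of at most
    \<open>\<epsilon> / L\<close> and \<open>\<epsilon> / L'\<close> keeps them below
    \<open>\<epsilon> * r\<close>.\<close>
  define \<delta> where "\<delta> = min 1 (min (\<epsilon> / L) (\<epsilon> / L'))"
  have \<delta>: "\<delta> > 0" "\<delta> \<le> 1" "\<delta> * L \<le> \<epsilon>" "\<delta> * L' \<le> \<epsilon>"
  proof -
    have "\<delta> \<le> \<epsilon> / L" "\<delta> \<le> \<epsilon> / L'" by (simp_all add: \<delta>_def)
    then show "\<delta> * L \<le> \<epsilon>" "\<delta> * L' \<le> \<epsilon>" using L(1) L'(1) by (simp_all add: le_divide_eq)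
    show "\<delta> > 0" "\<delta> \<le> 1" using \<epsilon> L(1) L'(1) by (simp_all add: \<delta>_def)
  qed
  obtain N2 where N2: "\<And>N x. N \<ge> N2 \<Longrightarrow> x \<in> pball y N \<Longrightarrow> vabs (F x - F y) \<le> \<delta>"
    using strict_deriv_near[OF F \<delta>(1)] by blast
  obtain N3 where N3: "\<And>N x. N \<ge> N3 \<Longrightarrow> x \<in> pball y N \<Longrightarrow> vabs (F' x - F' y) \<le> \<delta>"
    using strict_deriv_near[OF F' \<delta>(1)] by blast
  define M where "M = max (max N0 N1) (max N2 N3)"
  show "\<exists>N0. \<forall>N\<ge>N0. \<forall>x\<in>pball y N. \<forall>z\<in>pball y N. \<forall>r. (\<forall>i. vabs (x $ i - z $ i) \<le> r) \<longrightarrow>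
     vabs (F x * F' x - F z * F' z - (\<Sum>i\<in>UNIV. (F y * G' i + F' y * G i) * (x $ i - z $ i))) \<le> \<epsilon> * r"
  proof (intro exI[of _ M] allI impI ballI)
    fix N x z r assume N: "N \<ge> M" and x: "x \<in> pball y N" and z: "z \<in> pball y N"
      and d: "\<forall>i. vabs (x $ i - z $ i) \<le> r"
    have r: "0 \<le> r" using d order_trans[OF vabs_nonneg] by blast
    let ?D = "\<Sum>i\<in>UNIV. G i * (x $ i - z $ i)" and ?D' = "\<Sum>i\<in>UNIV. G' i * (x $ i - z $ i)"
    have D: "vabs ?D \<le> L * r" "vabs ?D' \<le> L' * r"
      using L L' d r by (auto intro!: vabs_linear_le)
    have e: "vabs (F x - F z - ?D) \<le> \<epsilon> / A * r" "vabs (F' x - F' z - ?D') \<le> \<epsilon> / A * r"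
      using N0[of N x z r] N1[of N x z r] N x z d by (simp_all add: M_def)
    have near: "vabs (F x - F y) \<le> \<delta>" "vabs (F' z - F' y) \<le> \<delta>"
      using N2[of N x] N3[of N z] N x z by (simp_all add: M_def)
    have size: "vabs (F x) \<le> A" "vabs (F' z) \<le> A"
    proof -
      have "vabs (F x - F y) \<le> A" "vabs (F y) \<le> A" "vabs (F' z - F' y) \<le> A" "vabs (F' y) \<le> A"
        using near \<delta>(2) vabs_nonneg[of "F y"] vabs_nonneg[of "F' y"] unfolding A_def by linarith+
      then have "vabs (F x - F y + F y) \<le> A" "vabs (F' z - F' y + F' y) \<le> A"
        by (blast intro: vabs_add_le)+
      then show "vabs (F x) \<le> A" "vabs (F' z) \<le> A" by simp_all
    qed
    have sum: "(\<Sum>i\<in>UNIV. (F y * G' i + F' y * G i) * (x $ i - z $ i)) = F y * ?D' + F' y * ?D"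
      by (simp add: distrib_right sum.distrib sum_distrib_left mult.assoc)
    have eq: "F x * F' x - F z * F' z - (F y * ?D' + F' y * ?D) =
      F x * (F' x - F' z - ?D') + (F x - F y) * ?D' + (F' z * (F x - F z - ?D) + (F' z - F' y) * ?D)"
      by (simp add: algebra_simps)
    have eA: "a * (\<epsilon> / A * r) \<le> \<epsilon> * r" if "0 \<le> a" "a \<le> A" for a
    proof -
      have "a * (\<epsilon> / A * r) \<le> A * (\<epsilon> / A * r)" using that \<epsilon> A r by (intro mult_right_mono) auto
      then show ?thesis using A by simp
    qed
    have dL: "\<delta> * (l * r) \<le> \<epsilon> * r" if "\<delta> * l \<le> \<epsilon>" for l
      using mult_right_mono[OF that r] by (simp add: mult.assoc)
    have "vabs (F x * (F' x - F' z - ?D')) \<le> \<epsilon> * r"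
      unfolding vabs_mult by (rule order_trans[OF mult_left_mono[OF e(2)] eA]) (use size in auto)
    moreover have "vabs (F' z * (F x - F z - ?D)) \<le> \<epsilon> * r"
      unfolding vabs_mult by (rule order_trans[OF mult_left_mono[OF e(1)] eA]) (use size in auto)
    moreover have "vabs ((F x - F y) * ?D') \<le> \<epsilon> * r"
      unfolding vabs_mult by (rule order_trans[OF mult_mono[OF near(1) D(2)] dL]) (use \<delta> in auto)
    moreover have "vabs ((F' z - F' y) * ?D) \<le> \<epsilon> * r"
      unfolding vabs_mult by (rule order_trans[OF mult_mono[OF near(2) D(1)] dL]) (use \<delta> in auto)
    ultimately show "vabs (F x * F' x - F z * F' z - (\<Sum>i\<in>UNIV. (F y * G' i + F' y * G i) * (x $ i - z $ i))) \<le> \<epsilon> * r"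
      unfolding sum eq by (intro vabs_add_le)
  qed
qed

lemma strict_deriv_inverse_component:
  assumes y: "(y :: 'k ^ 'n::finite) $ j \<noteq> 0"
  shows "strict_deriv (\<lambda>x. inverse (x $ j)) y (\<lambda>i. if i = j then - (inverse (y $ j) * inverse (y $ j)) else 0)"
  unfolding strict_deriv_def
proof (intro allI impI)
  fix \<epsilon> :: real assume \<epsilon>: "\<epsilon> > 0"
  let ?a = "vabs (y $ j)"
  have a: "?a > 0" using y by simp
  \<comment> \<open>The first bound keeps the \<open>j\<close>-th coordinates of \<open>x\<close>
    and \<open>z\<close> as large as that of \<open>y\<close>. The cube arises because the error is
    the difference times a quantity of size at most \<open>rad N / vabs (y $ j) ^ 3\<close>.\<close>
  obtain N1 where N1: "\<And>N. N \<ge> N1 \<Longrightarrow> rad N < min ?a (\<epsilon> * ?a ^ 3)"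
    using rad_arbitrarily_small[of "min ?a (\<epsilon> * ?a ^ 3)"] \<epsilon> a by auto
  show "\<exists>N0. \<forall>N\<ge>N0. \<forall>x\<in>pball y N. \<forall>z\<in>pball y N. \<forall>r. (\<forall>i. vabs (x $ i - z $ i) \<le> r) \<longrightarrow>
     vabs (inverse (x $ j) - inverse (z $ j) -
       (\<Sum>i\<in>UNIV. (if i = j then - (inverse (y $ j) * inverse (y $ j)) else 0) * (x $ i - z $ i))) \<le> \<epsilon> * r"
  proof (intro exI[of _ N1] allI impI ballI)
    fix N x z r assume N: "N \<ge> N1" and x: "x \<in> pball y N" and z: "z \<in> pball y N"
      and d: "\<forall>i. vabs (x $ i - z $ i) \<le> r"
    have "vabs (x $ j - y $ j) \<le> rad N" "vabs (z $ j - y $ j) \<le> rad N" using x z by (simp_all add: pdisc_def)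
    moreover have R: "rad N < ?a" "rad N \<le> \<epsilon> * ?a ^ 3" using N1[OF N] by auto
    ultimately have v: "vabs (x $ j) = ?a" "vabs (z $ j) = ?a" by (auto intro!: vabs_dominant)
    then have nz: "x $ j \<noteq> 0" "z $ j \<noteq> 0" using a by auto
    let ?u = "x $ j * (z $ j - y $ j) + y $ j * (x $ j - y $ j)"
    have "vabs ?u \<le> ?a * rad N"
      using x z v by (intro vabs_add_le) (auto simp: vabs_mult pdisc_def intro!: mult_left_mono)
    have s: "(\<Sum>i\<in>UNIV. (if i = j then - (inverse (y $ j) * inverse (y $ j)) else 0) * (x $ i - z $ i)) =
      - (inverse (y $ j) * inverse (y $ j)) * (x $ j - z $ j)"
      by (simp add: if_distrib[of "\<lambda>a. a * _"] sum.delta cong: if_cong)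
    have "inverse (x $ j) - inverse (z $ j) + (inverse (y $ j) * inverse (y $ j)) * (x $ j - z $ j) =
      (x $ j - z $ j) * ?u / (x $ j * z $ j * (y $ j * y $ j))"
      using nz y by (simp add: field_simps)
    then have "vabs (inverse (x $ j) - inverse (z $ j) - - (inverse (y $ j) * inverse (y $ j)) * (x $ j - z $ j)) =
      vabs (x $ j - z $ j) * (vabs ?u / ?a ^ 4)"
      using v by (simp add: vabs_mult vabs_divide power4_eq_xxxx mult.assoc)
    also have "\<dots> \<le> r * \<epsilon>"
    proof (rule mult_mono)
      have "vabs ?u \<le> \<epsilon> * ?a ^ 4"
        using order_trans[OF \<open>vabs ?u \<le> ?a * rad N\<close> mult_left_mono[OF R(2)]] a
        by (simp add: power4_eq_xxxx power3_eq_cube mult_ac)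
      then show "vabs ?u / ?a ^ 4 \<le> \<epsilon>" using a by (simp add: divide_le_eq)
      show "0 \<le> r" using d order_trans[OF vabs_nonneg] by blast
    qed (use d a in auto)
    finally show "vabs (inverse (x $ j) - inverse (z $ j) -
       (\<Sum>i\<in>UNIV. (if i = j then - (inverse (y $ j) * inverse (y $ j)) else 0) * (x $ i - z $ i))) \<le> \<epsilon> * r"
      unfolding s by (simp add: mult.commute)
  qed
qed

lemma strict_deriv_cong: "strict_deriv F y G \<Longrightarrow> (\<And>x. F x = F' x) \<Longrightarrow> (\<And>i. G i = G' i) \<Longrightarrow> strict_deriv F' y G'"
  by (simp add: strict_deriv_def)

lemma strict_deriv_power:
  assumes "strict_deriv F y G"
  shows "strict_deriv (\<lambda>x. F x ^ n) y (\<lambda>i. of_nat n * F y ^ (n - 1) * G i)"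
proof (induction n)
  case 0 then show ?case using strict_deriv_const[of 1 y] by (rule strict_deriv_cong) auto
next
  case (Suc n)
  show ?case
    by (rule strict_deriv_cong[OF strict_deriv_mult[OF assms Suc.IH]])
      (cases n; simp add: algebra_simps)+
qed

lemma strict_deriv_power_int_component:
  assumes y: "(y :: 'k ^ 'n::finite) $ j \<noteq> 0"
  shows "strict_deriv (\<lambda>x. x $ j powi m) y (\<lambda>i. if i = j then of_int m * y $ j powi (m - 1) else 0)"
proof (cases "m \<ge> 0")
  case True
  then obtain n where n: "m = int n" using nonneg_int_cases by blast
  show ?thesis
  proof (rule strict_deriv_cong[OF strict_deriv_power[OF strict_deriv_component[of j], where n = n]])
    show "of_nat n * y $ j ^ (n - 1) * (if i = j then 1 else 0) = (if i = j then of_int m * y $ j powi (m - 1) else 0)" for i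
      using y by (cases n) (auto simp: n power_int_diff)
  qed (simp add: n)
next
  case False
  then obtain n where n: "m = - int n" "n > 0" by (metis neg_int_cases not_le of_nat_0_less_iff)
  show ?thesis
  proof (rule strict_deriv_cong[OF strict_deriv_power[OF strict_deriv_inverse_component[OF y], where n = n]])
    show "inverse (x $ j) ^ n = x $ j powi m" for x :: "'k ^ 'n" by (simp add: n power_int_minus power_inverse)
    have "inverse (y $ j) ^ (n - 1) * (inverse (y $ j) * inverse (y $ j)) = y $ j powi (m - 1)"
    proof -
      have "m - 1 = - int (Suc n)" using n by simp
      then have "y $ j powi (m - 1) = inverse (y $ j) ^ Suc n" by (simp only: power_int_minus power_int_of_nat power_inverse)
      then show ?thesis using n(2) by (cases n) (simp_all add: mult_ac)
    qed
    then show "of_nat n * inverse (y $ j) ^ (n - 1) * (if i = j then - (inverse (y $ j) * inverse (y $ j)) else 0) =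
      (if i = j then of_int m * y $ j powi (m - 1) else 0)" for i
      using n by (auto simp: mult.assoc)
  qed
qed

definition monomial :: "int ^ 'n::finite \<Rightarrow> 'k ^ 'n \<Rightarrow> 'k" where
  "monomial m x = (\<Prod>i\<in>UNIV. x $ i powi (m $ i))"

text \<open>The product rule along the coordinates. On the torus it covers negative exponents, and
  lowering by \<open>axis i 1\<close> matches the form of \<open>laurent_partial\<close>.\<close>

lemma strict_deriv_monomial:
  assumes y: "y \<in> torus"
  shows "strict_deriv (monomial m) y (\<lambda>i. of_int (m $ i) * monomial (m - axis i 1) y)"
proof -
  have yi: "y $ i \<noteq> 0" for i using y by (simp add: torus_def)
  have "strict_deriv (\<lambda>x. \<Prod>i\<in>A. x $ i powi (m $ i)) y
    (\<lambda>j. if j \<in> A then of_int (m $ j) * (\<Prod>i\<in>A. y $ i powi ((m - axis j 1) $ i)) else 0)" if "finite A" for A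
    using that
  proof induction
    case empty then show ?case using strict_deriv_const[of 1 y] by simp
  next
    case (insert a A)
    show ?case
    proof (rule strict_deriv_cong[OF strict_deriv_mult[OF strict_deriv_power_int_component[OF yi, of a "m $ a"] insert.IH]])
      show "x $ a powi (m $ a) * (\<Prod>i\<in>A. x $ i powi (m $ i)) = (\<Prod>i\<in>insert a A. x $ i powi (m $ i))" for x
        using insert by simp
      have Aa: "(\<Prod>i\<in>A. y $ i powi ((m - axis a 1) $ i)) = (\<Prod>i\<in>A. y $ i powi (m $ i))"
        using insert by (intro prod.cong) (auto simp: axis_def)
      show "y $ a powi (m $ a) *
        (if i \<in> A then of_int (m $ i) * (\<Prod>k\<in>A. y $ k powi ((m - axis i 1) $ k)) else 0) +
        (\<Prod>i\<in>A. y $ i powi (m $ i)) * (if i = a then of_int (m $ a) * y $ a powi (m $ a - 1) else 0) =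
        (if i \<in> insert a A then of_int (m $ i) * (\<Prod>k\<in>insert a A. y $ k powi ((m - axis i 1) $ k)) else 0)" for i
      proof (cases "i = a")
        case True
        then show ?thesis using insert Aa by (simp add: axis_def mult_ac)
      next
        case False
        then have "(m - axis i 1) $ a = m $ a" by (simp add: axis_def)
        then show ?thesis using insert False by (simp add: mult_ac)
      qed
    qed
  qed
  from this[of UNIV] show ?thesis unfolding monomial_def by simp
qed

lemma strict_deriv_sum:
  assumes "\<And>m. m \<in> A \<Longrightarrow> strict_deriv (F m) y (G m)"
  shows "strict_deriv (\<lambda>x. \<Sum>m\<in>A. F m x) y (\<lambda>i. \<Sum>m\<in>A. G m i)"
  using assms
proof (induction A rule: infinite_finite_induct)
  case (insert m A)
  then have "strict_deriv (\<lambda>x. F m x + (\<Sum>m\<in>A. F m x)) y (\<lambda>i. G m i + (\<Sum>m\<in>A. G m i))"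
    by (intro strict_deriv_add) auto
  then show ?case by (rule strict_deriv_cong) (use insert in auto)
qed (simp_all add: strict_deriv_const)

lemma strict_deriv_cmult: "strict_deriv F y G \<Longrightarrow> strict_deriv (\<lambda>x. c * F x) y (\<lambda>i. c * G i)"
  by (rule strict_deriv_cong[OF strict_deriv_mult[OF strict_deriv_const[of c]]]) auto

section \<open>Linearity of evaluation and the gradient of a Laurent polynomial\<close>

lemma laurent_eval_superset:
  assumes "finite A" "Poly_Mapping.keys f \<subseteq> A"
  shows "laurent_eval f x = (\<Sum>m\<in>A. Poly_Mapping.lookup f m * monomial m x)"
  unfolding laurent_eval_def monomial_def using assms
  by (intro sum.mono_neutral_left) (auto simp: in_keys_iff)

lemma laurent_eval_eq: "laurent_eval f x = (\<Sum>m\<in>Poly_Mapping.keys f. Poly_Mapping.lookup f m * monomial m x)"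
  by (simp add: laurent_eval_def monomial_def)

lemma laurent_eval_add: "laurent_eval (f + g) x = laurent_eval f x + laurent_eval g (x :: 'k ^ 'n::finite)"
proof -
  let ?A = "Poly_Mapping.keys f \<union> Poly_Mapping.keys g"
  have "Poly_Mapping.keys (f + g) \<subseteq> ?A" by (rule Poly_Mapping.keys_add)
  then show ?thesis
    by (simp add: laurent_eval_superset[of ?A] lookup_add distrib_right sum.distrib)
qed

lemma laurent_eval_0: "laurent_eval 0 (x :: 'k ^ 'n::finite) = 0"
  by (simp add: laurent_eval_def)

lemma laurent_eval_sum: "laurent_eval (sum g A) (x :: 'k ^ 'n::finite) = (\<Sum>a\<in>A. laurent_eval (g a) x)"
  by (induction A rule: infinite_finite_induct) (auto simp: laurent_eval_0 laurent_eval_add)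

lemma laurent_eval_single: "laurent_eval (Poly_Mapping.single m c) x = c * monomial m x"
  by (subst laurent_eval_superset[of "{m}"]) auto

lemma strict_deriv_laurent:
  assumes "y \<in> torus"
  shows "strict_deriv (laurent_eval f) y (\<lambda>i. laurent_eval (laurent_partial i f) y)"
proof -
  have "strict_deriv (\<lambda>x. \<Sum>m\<in>Poly_Mapping.keys f. Poly_Mapping.lookup f m * monomial m x) y
    (\<lambda>i. \<Sum>m\<in>Poly_Mapping.keys f. Poly_Mapping.lookup f m * (of_int (m $ i) * monomial (m - axis i 1) y))"
    by (intro strict_deriv_sum strict_deriv_cmult strict_deriv_monomial assms)
  then show ?thesis
  proof (rule strict_deriv_cong)
    show "(\<Sum>m\<in>Poly_Mapping.keys f. Poly_Mapping.lookup f m * (of_int (m $ i) * monomial (m - axis i 1) y)) =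
      laurent_eval (laurent_partial i f) y" for i
      unfolding laurent_partial_def laurent_eval_sum laurent_eval_single by (simp add: mult_ac)
  qed (simp add: laurent_eval_eq)
qed

end

section \<open>Simple cones\<close>

text \<open>
  The generators of a simple cone are recorded together with the coordinate functionals of an
  ambient lattice basis, extended linearly to real vectors.
\<close>

definition dual_family :: "(int ^ 'n::finite) set \<Rightarrow> (int ^ 'n \<Rightarrow> real ^ 'n \<Rightarrow> real) \<Rightarrow> bool" where
  "dual_family S \<phi> \<longleftrightarrow> finite S \<and> (\<forall>a\<in>S. linear (\<phi> a)) \<and>
     (\<forall>a\<in>S. \<forall>b\<in>S. \<phi> a (real_vec b) = (if a = b then 1 else 0)) \<and>
     (\<forall>a\<in>S. \<forall>v. \<phi> a (real_vec v) \<in> \<int>)"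

definition combination :: "(int ^ 'n::finite) set \<Rightarrow> (int ^ 'n \<Rightarrow> real) \<Rightarrow> real ^ 'n" where
  "combination S \<kappa> = (\<Sum>a\<in>S. \<kappa> a *\<^sub>R real_vec a)"

lemma real_vec_add: "real_vec (a + b) = real_vec a + real_vec b"
  by (simp add: real_vec_def vec_eq_iff)

lemma real_vec_scale: "real_vec (c *s a) = real_of_int c *\<^sub>R real_vec a"
  by (simp add: real_vec_def vec_eq_iff)

lemma real_vec_0 [simp]: "real_vec 0 = 0"
  by (simp add: real_vec_def vec_eq_iff)

lemma real_vec_sum: "real_vec (sum g A) = (\<Sum>i\<in>A. real_vec (g i))"
  by (induction A rule: infinite_finite_induct) (auto simp: real_vec_add)

lemma real_vec_inject [simp]: "real_vec a = real_vec b \<longleftrightarrow> a = b"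
  by (simp add: real_vec_def vec_eq_iff)

definition pairing :: "int ^ 'n::finite \<Rightarrow> int ^ 'n \<Rightarrow> int" where
  "pairing a m = (\<Sum>i\<in>UNIV. a $ i * m $ i)"

lemma inner_real_vec: "real_vec a \<bullet> real_vec m = real_of_int (pairing a m)"
  by (simp add: inner_vec_def real_vec_def pairing_def)

lemma convex_cone_hull_eq:
  assumes S: "finite S"
  shows "convex_cone hull (real_vec ` S) = {combination S \<kappa> |\<kappa>. \<forall>a\<in>S. 0 \<le> \<kappa> a}" (is "_ = ?C")
proof
  show "convex_cone hull (real_vec ` S) \<subseteq> ?C"
  proof (rule hull_minimal)
    show "real_vec ` S \<subseteq> ?C"
    proof clarify
      fix a assume "a \<in> S"
      then have "real_vec a = combination S (\<lambda>b. if b = a then 1 else 0)"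
        using S by (simp add: combination_def if_distrib[of "\<lambda>c. c *\<^sub>R _"] sum.delta cong: if_cong)
      then show "\<exists>\<kappa>. real_vec a = combination S \<kappa> \<and> (\<forall>a\<in>S. 0 \<le> \<kappa> a)"
        by (intro exI[of _ "\<lambda>b. if b = a then 1 else 0"]) simp
    qed
    show "convex_cone ?C"
      unfolding convex_cone_iff
    proof (intro conjI ballI allI impI)
      show "0 \<in> ?C" by (auto simp: combination_def intro!: exI[of _ "\<lambda>_. 0"])
    next
      fix x y assume "x \<in> ?C" "y \<in> ?C"
      then obtain k l where "x = combination S k" "\<forall>a\<in>S. 0 \<le> k a" "y = combination S l" "\<forall>a\<in>S. 0 \<le> l a" by blast
      then have "x + y = combination S (\<lambda>a. k a + l a)" "\<forall>a\<in>S. 0 \<le> k a + l a"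
        by (simp_all add: combination_def scaleR_left_distrib sum.distrib)
      then show "x + y \<in> ?C" by blast
    next
      fix x and c :: real assume "x \<in> ?C" "c \<ge> 0"
      then obtain k where "x = combination S k" "\<forall>a\<in>S. 0 \<le> k a" by blast
      then have "c *\<^sub>R x = combination S (\<lambda>a. c * k a)" "\<forall>a\<in>S. 0 \<le> c * k a"
        using \<open>c \<ge> 0\<close> by (simp_all add: combination_def scaleR_sum_right)
      then show "c *\<^sub>R x \<in> ?C" by blast
    qed
  qed
next
  have "combination T k \<in> convex_cone hull (real_vec ` S)" if "finite T" "T \<subseteq> S" "\<forall>a\<in>S. 0 \<le> k a" for T k
    using that
  proof (induction T)
    case empty then show ?case by (simp add: combination_def convex_cone_hull_contains_0)
  next
    case (insert a T)
    then have "combination (insert a T) k = k a *\<^sub>R real_vec a + combination T k" by (simp add: combination_def)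
    moreover have "k a *\<^sub>R real_vec a \<in> convex_cone hull (real_vec ` S)"
      using insert by (intro convex_cone_hull_mul hull_inc) auto
    ultimately show ?case using insert by (simp add: convex_cone_hull_add)
  qed
  then show "?C \<subseteq> convex_cone hull (real_vec ` S)" using S by blast
qed

lemma dual_family_combination:
  assumes "dual_family S \<phi>" "T \<subseteq> S" "a \<in> S"
  shows "\<phi> a (combination T \<kappa>) = (if a \<in> T then \<kappa> a else 0)"
proof -
  have T: "finite T" using assms finite_subset unfolding dual_family_def by blast
  have "\<phi> a (combination T \<kappa>) = (\<Sum>b\<in>T. \<kappa> b * \<phi> a (real_vec b))"
    using assms unfolding dual_family_def combination_def by (simp add: linear_sum linear_cmul)
  also have "\<dots> = (\<Sum>b\<in>T. if b = a then \<kappa> a else 0)"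
    using assms by (intro sum.cong) (auto simp: dual_family_def)
  finally show ?thesis using T by simp
qed

lemma dual_family_subset: "dual_family S \<phi> \<Longrightarrow> T \<subseteq> S \<Longrightarrow> dual_family T \<phi>"
  unfolding dual_family_def by (blast intro: finite_subset)

lemma mem_simple_cone:
  assumes "dual_family S \<phi>"
  shows "x \<in> convex_cone hull (real_vec ` S) \<longleftrightarrow> x = combination S (\<lambda>a. \<phi> a x) \<and> (\<forall>a\<in>S. 0 \<le> \<phi> a x)"
proof -
  have fin: "finite S" using assms by (simp add: dual_family_def)
  show ?thesis
  proof
    assume "x \<in> convex_cone hull (real_vec ` S)"
    then obtain \<kappa> where k: "x = combination S \<kappa>" "\<forall>a\<in>S. 0 \<le> \<kappa> a"
      unfolding convex_cone_hull_eq[OF fin] by blast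
    have "\<phi> a x = \<kappa> a" if "a \<in> S" for a
      unfolding k(1) using dual_family_combination[OF assms subset_refl that] that by simp
    then show "x = combination S (\<lambda>a. \<phi> a x) \<and> (\<forall>a\<in>S. 0 \<le> \<phi> a x)"
      using k by (simp add: combination_def)
  next
    assume "x = combination S (\<lambda>a. \<phi> a x) \<and> (\<forall>a\<in>S. 0 \<le> \<phi> a x)"
    then show "x \<in> convex_cone hull (real_vec ` S)" unfolding convex_cone_hull_eq[OF fin] by blast
  qed
qed

text \<open>The functionals \<open>\<phi> a\<close> with \<open>a\<close> outside \<open>T\<close>
  are nonnegative on the large cone and vanish on the small one. At an inner point of a segment they
  are a positive combination of the two end values, so both end values vanish too.\<close>

lemma simple_cone_face:
  assumes d: "dual_family S \<phi>" and T: "T \<subseteq> S"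
  shows "(convex_cone hull (real_vec ` T)) face_of (convex_cone hull (real_vec ` S))"
  unfolding face_of_def
proof (intro conjI ballI impI)
  have dT: "dual_family T \<phi>" using dual_family_subset[OF d T] .
  show "convex_cone hull (real_vec ` T) \<subseteq> convex_cone hull (real_vec ` S)"
    using T by (intro hull_mono) auto
  show "convex (convex_cone hull (real_vec ` T))" by (rule convex_convex_cone_hull)
  fix x y z
  assume x: "x \<in> convex_cone hull (real_vec ` S)" and y: "y \<in> convex_cone hull (real_vec ` S)"
    and z: "z \<in> convex_cone hull (real_vec ` T)" and seg: "z \<in> open_segment x y"
  obtain u where u: "0 < u" "u < 1" "z = (1 - u) *\<^sub>R x + u *\<^sub>R y"
    using seg by (auto simp: in_segment)
  have zero: "\<phi> a x = 0 \<and> \<phi> a y = 0" if "a \<in> S" "a \<notin> T" for a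
  proof -
    have "\<phi> a z = 0"
    proof -
      have "z = combination T (\<lambda>a. \<phi> a z)" using mem_simple_cone[OF dT, of z] z by blast
      then have "\<phi> a z = \<phi> a (combination T (\<lambda>a. \<phi> a z))" by simp
      then show ?thesis using dual_family_combination[OF d T that(1)] that(2) by simp
    qed
    moreover have "\<phi> a z = (1 - u) * \<phi> a x + u * \<phi> a y"
      using d that(1) unfolding u(3) dual_family_def by (simp add: linear_add linear_cmul)
    moreover have "0 \<le> \<phi> a x" "0 \<le> \<phi> a y" using mem_simple_cone[OF d] x y that by blast+
    ultimately show ?thesis using u by (simp add: add_nonneg_eq_0_iff)
  qed
  have "w \<in> convex_cone hull (real_vec ` T)"
    if w: "w \<in> convex_cone hull (real_vec ` S)" and w0: "\<And>a. a \<in> S \<Longrightarrow> a \<notin> T \<Longrightarrow> \<phi> a w = 0" for w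
  proof -
    have "w = combination S (\<lambda>a. \<phi> a w)" "\<forall>a\<in>S. 0 \<le> \<phi> a w" using mem_simple_cone[OF d] w by blast+
    moreover have "combination S (\<lambda>a. \<phi> a w) = combination T (\<lambda>a. \<phi> a w)"
      unfolding combination_def using d T w0
      by (intro sum.mono_neutral_right) (auto simp: dual_family_def)
    ultimately show ?thesis unfolding mem_simple_cone[OF dT] using T by auto
  qed
  then show "x \<in> convex_cone hull (real_vec ` T)" "y \<in> convex_cone hull (real_vec ` T)"
    using x y zero by blast+
qed

text \<open>The criterion is that the segment from any point of the cone to \<open>x\<close> can be
  prolonged beyond \<open>x\<close>. Starting at the generator \<open>a\<close>, this forces the
  coordinate \<open>\<phi> a x\<close> to be positive.\<close>

lemma rel_interior_simple_cone:
  assumes d: "dual_family S \<phi>"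
  shows "x \<in> rel_interior (convex_cone hull (real_vec ` S)) \<longleftrightarrow>
    x = combination S (\<lambda>a. \<phi> a x) \<and> (\<forall>a\<in>S. 0 < \<phi> a x)" (is "x \<in> rel_interior ?C \<longleftrightarrow> ?R")
proof
  have lin: "\<phi> a ((1 - e) *\<^sub>R u + e *\<^sub>R v) = (1 - e) * \<phi> a u + e * \<phi> a v" if "a \<in> S" for a e u v
    using d that unfolding dual_family_def by (simp add: linear_add linear_cmul)
  have fin: "finite S" using d by (simp add: dual_family_def)
  note iff = convex_rel_interior_iff[OF convex_convex_cone_hull convex_cone_hull_nonempty, of x "real_vec ` S"]
  {
    assume x: "x \<in> rel_interior ?C"
    then have xC: "x \<in> ?C" using rel_interior_subset by blast
    have "0 < \<phi> a x" if a: "a \<in> S" for a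
    proof -
      have "real_vec a \<in> ?C" using a by (intro hull_inc) auto
      then obtain e where e: "e > 1" "(1 - e) *\<^sub>R real_vec a + e *\<^sub>R x \<in> ?C" using x iff by blast
      then have "0 \<le> \<phi> a ((1 - e) *\<^sub>R real_vec a + e *\<^sub>R x)" using mem_simple_cone[OF d] a by blast
      also have "\<dots> = 1 - e + e * \<phi> a x" using lin[OF a] d a by (simp add: dual_family_def)
      finally have "0 < e * \<phi> a x" using e by linarith
      then show ?thesis using e by (simp add: zero_less_mult_iff)
    qed
    then show ?R using xC mem_simple_cone[OF d] by blast
  }
  {
    assume R: ?R
    have "\<exists>e>1. (1 - e) *\<^sub>R y + e *\<^sub>R x \<in> ?C" if y: "y \<in> ?C" for y
    proof -
      \<comment> \<open>One length of prolongation for all coordinates, built up over the finite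
        set; the denominator \<open>1 + \<bar>\<phi> b y\<bar>\<close> is positive whatever
        \<open>y\<close> is.\<close>
      have "\<exists>\<delta>>0. \<forall>a\<in>S. \<delta> * \<phi> a y \<le> \<phi> a x"
        using fin conjunct2[OF R]
      proof (induction S)
        case empty then show ?case by (intro exI[of _ 1]) simp
      next
        case (insert b S)
        from insert.prems have "\<forall>a\<in>S. 0 < \<phi> a x" by simp
        from insert.IH[OF this] obtain \<delta> where \<delta>: "\<delta> > 0" "\<forall>a\<in>S. \<delta> * \<phi> a y \<le> \<phi> a x" by blast
        define \<delta>' where "\<delta>' = min \<delta> (\<phi> b x / (1 + \<bar>\<phi> b y\<bar>))"
        have bx: "\<phi> b x > 0" using insert.prems by simp
        have "\<delta>' > 0" using \<delta> bx by (simp add: \<delta>'_def divide_pos_pos add_pos_nonneg)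
        moreover have "\<delta>' * \<phi> a y \<le> \<phi> a x" if "a \<in> insert b S" for a
        proof (cases "a = b")
          case True
          have "\<delta>' * \<phi> b y \<le> \<delta>' * (1 + \<bar>\<phi> b y\<bar>)" using \<open>\<delta>' > 0\<close> by (intro mult_left_mono) auto
          also have "\<dots> \<le> \<phi> b x / (1 + \<bar>\<phi> b y\<bar>) * (1 + \<bar>\<phi> b y\<bar>)"
            by (intro mult_right_mono) (auto simp: \<delta>'_def)
          also have "\<dots> = \<phi> b x" by (simp add: add_pos_nonneg pos_add_strict)
          finally show ?thesis using True by simp
        next
          case False
          then have a: "a \<in> S" using that by simp
          have ax: "\<phi> a x > 0" using insert.prems a by simp
          show ?thesis
          proof (cases "\<phi> a y \<ge> 0")
            case True
            have "\<delta>' * \<phi> a y \<le> \<delta> * \<phi> a y" using True by (intro mult_right_mono) (auto simp: \<delta>'_def)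
            then show ?thesis using \<delta>(2) a by fastforce
          next
            case False
            then have "\<delta>' * \<phi> a y \<le> 0" using \<open>\<delta>' > 0\<close> by (simp add: mult_nonneg_nonpos)
            then show ?thesis using ax by linarith
          qed
        qed
        ultimately show ?case by blast
      qed
      then obtain \<delta> where \<delta>: "\<delta> > 0" "\<forall>a\<in>S. \<delta> * \<phi> a y \<le> \<phi> a x" by blast
      define e where "e = 1 + \<delta>"
      let ?w = "(1 - e) *\<^sub>R y + e *\<^sub>R x"
      have "0 \<le> \<phi> a ?w" if "a \<in> S" for a
      proof -
        have "0 \<le> \<delta> * \<phi> a x" using \<delta> R that by (simp add: less_imp_le)
        then show ?thesis using \<delta>(2) that unfolding lin[OF that] e_def by (auto simp: algebra_simps)
      qed
      moreover have "?w = combination S (\<lambda>a. \<phi> a ?w)"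
      proof -
        have "combination S (\<lambda>a. \<phi> a ?w) = (\<Sum>a\<in>S. ((1 - e) * \<phi> a y + e * \<phi> a x) *\<^sub>R real_vec a)"
          unfolding combination_def using lin by (intro sum.cong) auto
        also have "\<dots> = (1 - e) *\<^sub>R combination S (\<lambda>a. \<phi> a y) + e *\<^sub>R combination S (\<lambda>a. \<phi> a x)"
          unfolding combination_def scaleR_sum_right by (simp add: scaleR_left_distrib sum.distrib)
        also have "\<dots> = ?w" using R mem_simple_cone[OF d] y by metis
        finally show ?thesis by simp
      qed
      ultimately have "?w \<in> ?C" using mem_simple_cone[OF d] by blast
      then show ?thesis using \<delta>(1) e_def by (intro exI[of _ e]) simp
    qed
    then show "x \<in> rel_interior ?C" using iff by blast
  }
qed

text \<open>Coordinates in a lattice basis are integral on lattice vectors and extend linearly to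
  real vectors. They give independence over the reals, hence the bound on the number of generators,
  and primitivity: a common divisor of the entries of a basis vector divides its coordinate
  1.\<close>

lemma lattice_basis_dual:
  fixes B :: "(int ^ 'n::finite) set"
  assumes B: "lattice_basis B" and S: "S \<subseteq> B"
  obtains \<phi> where "dual_family S \<phi>" "\<forall>a\<in>S. primitive_vec a" "card S \<le> CARD('n)"
proof -
  interpret zmod: module "(*s) :: int \<Rightarrow> int ^ 'n \<Rightarrow> int ^ 'n"
    by unfold_locales (auto simp: vec_eq_iff algebra_simps)
  have ind: "zmod.independent B" and sp: "\<And>v. v \<in> zmod.span B" using B by (auto simp: lattice_basis_def)
  define \<rho> where "\<rho> a v = zmod.representation B v a" for a v
  have \<rho>_sum: "\<rho> a (sum g I) = (\<Sum>i\<in>I. \<rho> a (g i))" for a g and I :: "'n set"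
    unfolding \<rho>_def using zmod.representation_sum[OF ind, of I g] sp by simp
  have \<rho>_scale: "\<rho> a (c *s v) = c * \<rho> a v" for a c v
    unfolding \<rho>_def using zmod.representation_scale[OF ind sp] by simp
  have \<rho>_basis: "\<rho> a b = (if a = b then 1 else 0)" if "b \<in> B" for a b
    unfolding \<rho>_def using zmod.representation_basis[OF ind that] by simp
  define \<phi> where "\<phi> a x = (\<Sum>i\<in>UNIV. x $ i * real_of_int (\<rho> a (axis i 1)))" for a and x :: "real ^ 'n"
  have lin: "linear (\<phi> a)" for a
    unfolding \<phi>_def by (rule linearI) (simp_all add: distrib_right sum.distrib sum_distrib_left mult.assoc)
  have \<phi>_\<rho>: "\<phi> a (real_vec v) = real_of_int (\<rho> a v)" for a v
  proof -
    have "v = (\<Sum>i\<in>UNIV. v $ i *s axis i 1)"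
      by (simp add: vec_eq_iff axis_def if_distrib[of "\<lambda>c. _ * c"] cong: if_cong)
    then have "\<rho> a v = (\<Sum>i\<in>UNIV. v $ i * \<rho> a (axis i 1))" by (metis (no_types, lifting) \<rho>_sum \<rho>_scale sum.cong)
    then show ?thesis by (simp add: \<phi>_def real_vec_def)
  qed
  have dual: "\<phi> a (real_vec b) = (if a = b then 1 else 0)" if "b \<in> S" for a b
    using \<rho>_basis[of b a] that S by (auto simp: \<phi>_\<rho>)
  have "independent (real_vec ` S)"
    unfolding independent_explicit_module
  proof (intro allI impI)
    fix t u v assume t: "finite t" "t \<subseteq> real_vec ` S" "(\<Sum>w\<in>t. u w *\<^sub>R w) = 0" "v \<in> t"
    then obtain a where a: "a \<in> S" "v = real_vec a" by blast
    have "0 = \<phi> a (\<Sum>w\<in>t. u w *\<^sub>R w)" using t(3) linear_0[OF lin] by simp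
    also have "\<dots> = (\<Sum>w\<in>t. u w * \<phi> a w)" using lin by (simp add: linear_sum linear_cmul)
    also have "\<dots> = (\<Sum>w\<in>t. if w = v then u v else 0)"
      using t(2) a dual by (intro sum.cong) (auto simp: dual)
    finally show "u v = 0" using t by simp
  qed
  then have "finite (real_vec ` S) \<and> card (real_vec ` S) \<le> DIM(real ^ 'n)" by (rule independent_bound)
  moreover have "inj_on real_vec S" by (rule inj_onI) simp
  ultimately have fin: "finite S" "card S \<le> CARD('n)" by (simp_all add: finite_image_iff card_image)
  have "primitive_vec a" if a: "a \<in> S" for a
  proof -
    define g where "g = Gcd (range (($) a))"
    have "g dvd a $ i" for i unfolding g_def by (rule Gcd_dvd) simp
    then have "\<forall>i. \<exists>c. a $ i = g * c" by (auto simp: dvd_def)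
    from choice[OF this] obtain c where c: "\<And>i. a $ i = g * c i" by blast
    then have "a = g *s (\<chi> i. c i)" by (simp add: vec_eq_iff)
    then have "1 = g * \<rho> a (\<chi> i. c i)" using \<rho>_basis[of a a] \<rho>_scale a S by (metis subsetD)
    then have "g dvd 1" by (rule dvdI)
    moreover have "g \<ge> 0" unfolding g_def by simp
    ultimately have "g = 1" by simp
    then show ?thesis by (simp add: primitive_vec_def g_def)
  qed
  moreover have "dual_family S \<phi>" unfolding dual_family_def using fin lin dual by (auto simp: \<phi>_\<rho>)
  ultimately show ?thesis using that fin by blast
qed

section \<open>Newton polytopes\<close>

text \<open>The half-space on which the linear form is at least its minimum over the support is
  convex, so it contains the whole hull.\<close>

lemma newton_d_eq:
  assumes "m0 \<in> Poly_Mapping.keys f" "\<And>m. m \<in> Poly_Mapping.keys f \<Longrightarrow> a \<bullet> real_vec m0 \<le> a \<bullet> real_vec m"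
  shows "newton_d f a = a \<bullet> real_vec m0"
proof -
  have "newton_polytope f \<subseteq> {x. a \<bullet> x \<ge> a \<bullet> real_vec m0}"
    unfolding newton_polytope_def using assms(2) by (intro hull_minimal convex_halfspace_ge) auto
  moreover have "real_vec m0 \<in> newton_polytope f"
    unfolding newton_polytope_def using assms(1) by (intro hull_inc) auto
  ultimately show ?thesis
    unfolding newton_d_def by (intro cInf_eq_minimum) auto
qed

lemma newton_d_attained:
  assumes "Poly_Mapping.keys f \<noteq> {}"
  obtains m0 where "m0 \<in> Poly_Mapping.keys f" "newton_d f a = a \<bullet> real_vec m0"
    "\<And>m. m \<in> Poly_Mapping.keys f \<Longrightarrow> a \<bullet> real_vec m0 \<le> a \<bullet> real_vec m"
proof -
  have "\<exists>m0\<in>Poly_Mapping.keys f. \<forall>m\<in>Poly_Mapping.keys f. a \<bullet> real_vec m0 \<le> a \<bullet> real_vec m"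
    using assms ex_is_arg_min_if_finite[OF finite_keys, of f "\<lambda>m. a \<bullet> real_vec m"]
    by (auto simp: is_arg_min_linorder)
  then show ?thesis using that newton_d_eq by blast
qed

lemma mem_newton_face:
  "m \<in> Poly_Mapping.keys f \<Longrightarrow> real_vec m \<in> newton_face f a \<longleftrightarrow> a \<bullet> real_vec m = newton_d f a"
  unfolding newton_face_def newton_polytope_def by (auto intro: hull_inc)

section \<open>The cones of the fan\<close>

text \<open>
  The linear form given by any generator is minimal on the support at one common monomial: the
  face is constant on the relative interior, so a vertex of it stays optimal for
  \<open>b + N a\<close> with \<open>N\<close> arbitrarily large.
\<close>

lemma common_minimum:
  assumes keys: "Poly_Mapping.keys f \<noteq> {}" and d: "dual_family S \<phi>"
    and sub: "\<forall>a\<in>rel_interior (convex_cone hull (real_vec ` S)). \<forall>a'\<in>rel_interior (convex_cone hull (real_vec ` S)).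
       newton_face f a = newton_face f a'"
  obtains m0 where "m0 \<in> Poly_Mapping.keys f"
    "\<And>a m. a \<in> S \<Longrightarrow> m \<in> Poly_Mapping.keys f \<Longrightarrow> pairing a m0 \<le> pairing a m"
proof -
  define b where "b = combination S (\<lambda>_. 1)"
  obtain m0 where m0: "m0 \<in> Poly_Mapping.keys f" "newton_d f b = b \<bullet> real_vec m0"
    using newton_d_attained[OF keys] by metis
  have fin: "finite S" using d by (simp add: dual_family_def)
  have int: "combination S \<kappa> \<in> rel_interior (convex_cone hull (real_vec ` S))" if "\<forall>a\<in>S. 0 < \<kappa> a" for \<kappa>
    unfolding rel_interior_simple_cone[OF d]
    using dual_family_combination[OF d subset_refl] that by (auto simp: combination_def)
  have "pairing a m0 \<le> pairing a m" if a: "a \<in> S" and m: "m \<in> Poly_Mapping.keys f" for a m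
  proof (rule ccontr)
    assume "\<not> pairing a m0 \<le> pairing a m"
    then have gap: "0 < real_of_int (pairing a m0) - real_of_int (pairing a m)" by linarith
    \<comment> \<open>If \<open>m\<close> were strictly better than \<open>m0\<close> for
      \<open>a\<close>, then \<open>N\<close> copies of \<open>a\<close> would outweigh the
      advantage of \<open>m0\<close> for \<open>b\<close>.\<close>
    obtain N :: nat where N: "real N * (real_of_int (pairing a m0) - real_of_int (pairing a m)) >
        b \<bullet> real_vec m - b \<bullet> real_vec m0"
      using reals_Archimedean3[OF gap] by blast
    define b' where "b' = combination S (\<lambda>c. if c = a then 1 + real N else 1)"
    have b': "b' = b + real N *\<^sub>R real_vec a"
    proof -
      have "b' = (\<Sum>c\<in>S. real_vec c + (if c = a then real N *\<^sub>R real_vec a else 0))"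
        unfolding b'_def combination_def by (intro sum.cong) (auto simp: scaleR_left_distrib)
      then show ?thesis using fin a by (simp add: sum.distrib b_def combination_def)
    qed
    have "newton_face f b = newton_face f b'"
    proof -
      have "b \<in> rel_interior (convex_cone hull (real_vec ` S))" unfolding b_def by (rule int) simp
      moreover have "b' \<in> rel_interior (convex_cone hull (real_vec ` S))" unfolding b'_def by (rule int) simp
      ultimately show ?thesis using sub by blast
    qed
    then have "b' \<bullet> real_vec m0 = newton_d f b'"
      using m0(2) mem_newton_face[OF m0(1), of b] mem_newton_face[OF m0(1), of b'] by simp
    moreover have "newton_d f b' \<le> b' \<bullet> real_vec m"
      by (rule newton_d_attained[OF keys, of b']) (use m in simp)
    ultimately have "b \<bullet> real_vec m0 + real N * real_of_int (pairing a m0) \<le> b \<bullet> real_vec m + real N * real_of_int (pairing a m)"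
      unfolding b' by (simp add: inner_add_left inner_real_vec)
    then show False using N by (simp add: algebra_simps)
  qed
  then show ?thesis using that m0(1) by blast
qed

text \<open>As many independent generators as dimensions span the real space, and a difference of
  exponents orthogonal to all of it is 0. Thus the face of a full-dimensional cone is a single
  exponent.\<close>

lemma pairing_separates:
  assumes d: "dual_family I \<phi>" and card: "card I = CARD('n)"
    and eq: "\<And>a. a \<in> I \<Longrightarrow> pairing a m = pairing a (m' :: int ^ 'n::finite)"
  shows "m = m'"
proof -
  have fin: "finite I" using d by (simp add: dual_family_def)
  have ind: "independent (real_vec ` I)"
    unfolding independent_explicit_module
  proof (intro allI impI)
    fix t u v assume t: "finite t" "t \<subseteq> real_vec ` I" "(\<Sum>w\<in>t. u w *\<^sub>R w) = 0" "v \<in> t"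
    then obtain a where a: "a \<in> I" "v = real_vec a" by blast
    have lin: "linear (\<phi> a)" using d a by (simp add: dual_family_def)
    have "0 = \<phi> a (\<Sum>w\<in>t. u w *\<^sub>R w)" using t(3) linear_0[OF lin] by simp
    also have "\<dots> = (\<Sum>w\<in>t. u w * \<phi> a w)" using lin by (simp add: linear_sum linear_cmul)
    also have "\<dots> = (\<Sum>w\<in>t. if w = v then u v else 0)"
      using t(2) a d by (intro sum.cong) (auto simp: dual_family_def)
    finally show "u v = 0" using t by simp
  qed
  have "card (real_vec ` I) = DIM(real ^ 'n)" using card by (subst card_image) (auto intro: inj_onI)
  then have span: "span (real_vec ` I) = UNIV"
    using ind dim_eq_card_independent[OF ind] dim_eq_full by metis
  have "orthogonal (real_vec (m - m')) x" if "x \<in> real_vec ` I" for x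
    using that eq by (auto simp: orthogonal_def inner_real_vec pairing_def inner_commute algebra_simps sum_subtractf)
  then have "orthogonal (real_vec (m - m')) (real_vec (m - m'))"
    using orthogonal_to_span[of "real_vec (m - m')" "real_vec ` I"] span by auto
  then have "real_vec (m - m') = real_vec 0" by (simp add: orthogonal_self)
  then have "m - m' = 0" by (simp only: real_vec_inject)
  then show ?thesis by simp
qed

definition cone_points :: "(int ^ 'n::finite) set \<Rightarrow> (int ^ 'n \<Rightarrow> nat) \<Rightarrow> int ^ 'n" where
  "cone_points S \<kappa> = (\<Sum>a\<in>S. int (\<kappa> a) *s a)"

lemma real_vec_cone_points: "real_vec (cone_points S \<kappa>) = combination S (\<lambda>a. real (\<kappa> a))"
  by (simp add: cone_points_def combination_def real_vec_sum real_vec_scale)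

lemma fan_face: "fan \<F> \<Longrightarrow> \<sigma> \<in> \<F> \<Longrightarrow> \<tau> face_of \<sigma> \<Longrightarrow> \<tau> \<noteq> {} \<Longrightarrow> \<tau> \<in> \<F>"
  unfolding fan_def by simp

text \<open>All that the summation over orders uses of the fan, in terms of integers. Coefficients
  start at 1 because a coefficient 0 would move the point to a smaller face, which is itself a cone
  of the fan.\<close>

lemma fan_generators:
  fixes f :: "('k::field, 'n::finite) laurent_poly"
  assumes keys: "Poly_Mapping.keys f \<noteq> {}" and fan: "fan \<F>" and simple: "simple_fan \<F>"
    and sub: "subordinated f \<F>" and supp: "fan_support \<F> = nonneg_orthant"
  obtains S \<phi> where
    "\<And>\<sigma>. \<sigma> \<in> \<F> \<Longrightarrow> dual_family (S \<sigma>) (\<phi> \<sigma>)"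
    "\<And>\<sigma>. \<sigma> \<in> \<F> \<Longrightarrow> card (S \<sigma>) \<le> CARD('n)"
    "\<And>\<sigma> a. \<sigma> \<in> \<F> \<Longrightarrow> a \<in> S \<sigma> \<Longrightarrow> a \<in> fan_edges \<F>"
    "\<And>\<sigma>. \<sigma> \<in> \<F> \<Longrightarrow> \<exists>m0\<in>Poly_Mapping.keys f. \<forall>a\<in>S \<sigma>. \<forall>m\<in>Poly_Mapping.keys f. pairing a m0 \<le> pairing a m"
    "\<And>v. (\<And>i. 0 \<le> v $ i) \<Longrightarrow> \<exists>\<sigma>\<in>\<F>. \<exists>\<kappa>. (\<forall>a\<in>S \<sigma>. \<kappa> a \<ge> 1) \<and> v = cone_points (S \<sigma>) \<kappa>"
    "\<And>\<sigma> \<sigma>' \<kappa> \<kappa>'. \<sigma> \<in> \<F> \<Longrightarrow> \<sigma>' \<in> \<F> \<Longrightarrow> \<forall>a\<in>S \<sigma>. \<kappa> a \<ge> 1 \<Longrightarrow> \<forall>a\<in>S \<sigma>'. \<kappa>' a \<ge> 1 \<Longrightarrow>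
       cone_points (S \<sigma>) \<kappa> = cone_points (S \<sigma>') \<kappa>' \<Longrightarrow> \<sigma> = \<sigma>' \<and> (\<forall>a\<in>S \<sigma>. \<kappa> a = \<kappa>' a)"
proof -
  have "\<forall>\<sigma>. \<exists>S \<phi>. \<sigma> \<in> \<F> \<longrightarrow> \<sigma> = convex_cone hull (real_vec ` S) \<and> dual_family S \<phi> \<and>
      (\<forall>a\<in>S. primitive_vec a) \<and> card S \<le> CARD('n)"
  proof (intro allI)
    fix \<sigma>
    show "\<exists>S \<phi>. \<sigma> \<in> \<F> \<longrightarrow> \<sigma> = convex_cone hull (real_vec ` S) \<and> dual_family S \<phi> \<and>
      (\<forall>a\<in>S. primitive_vec a) \<and> card S \<le> CARD('n)"
    proof (cases "\<sigma> \<in> \<F>")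
      case True
      then obtain B S where "lattice_basis B" "S \<subseteq> B" "\<sigma> = convex_cone hull (real_vec ` S)"
        using simple unfolding simple_fan_def by blast
      then show ?thesis by - (rule lattice_basis_dual[of B S], blast+)
    qed blast
  qed
  then obtain S \<phi> where S: "\<And>\<sigma>. \<sigma> \<in> \<F> \<Longrightarrow> \<sigma> = convex_cone hull (real_vec ` S \<sigma>) \<and> dual_family (S \<sigma>) (\<phi> \<sigma>) \<and>
      (\<forall>a\<in>S \<sigma>. primitive_vec a) \<and> card (S \<sigma>) \<le> CARD('n)"
    unfolding choice_iff by blast
  have dual: "dual_family (S \<sigma>) (\<phi> \<sigma>)" and hull: "\<sigma> = convex_cone hull (real_vec ` S \<sigma>)" if "\<sigma> \<in> \<F>" for \<sigma>
    using S[OF that] by blast+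
  have edges: "a \<in> fan_edges \<F>" if \<sigma>: "\<sigma> \<in> \<F>" and a: "a \<in> S \<sigma>" for \<sigma> a
  proof -
    have "(convex_cone hull (real_vec ` {a})) face_of \<sigma>"
      by (subst hull[OF \<sigma>], rule simple_cone_face[OF dual[OF \<sigma>]]) (use a in simp)
    then show ?thesis using S[OF \<sigma>] a \<sigma> by (auto simp: fan_edges_def)
  qed
  have min: "\<exists>m0\<in>Poly_Mapping.keys f. \<forall>a\<in>S \<sigma>. \<forall>m\<in>Poly_Mapping.keys f. pairing a m0 \<le> pairing a m"
    if \<sigma>: "\<sigma> \<in> \<F>" for \<sigma>
  proof -
    have "\<forall>a\<in>rel_interior (convex_cone hull (real_vec ` S \<sigma>)). \<forall>a'\<in>rel_interior (convex_cone hull (real_vec ` S \<sigma>)).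
       newton_face f a = newton_face f a'"
      using sub \<sigma> unfolding subordinated_def hull[OF \<sigma>, symmetric] by blast
    then show ?thesis by (rule common_minimum[OF keys dual[OF \<sigma>]]) blast
  qed
  have cover: "\<exists>\<sigma>\<in>\<F>. \<exists>\<kappa>. (\<forall>a\<in>S \<sigma>. \<kappa> a \<ge> 1) \<and> v = cone_points (S \<sigma>) \<kappa>" if v: "\<And>i. 0 \<le> v $ i" for v
  proof -
    have "real_vec v \<in> nonneg_orthant" using v by (simp add: nonneg_orthant_def real_vec_def)
    then obtain \<sigma> where \<sigma>: "\<sigma> \<in> \<F>" "real_vec v \<in> \<sigma>" using supp by (auto simp: fan_support_def)
    \<comment> \<open>The generators with positive coordinate span the face that contains
      \<open>v\<close> in its relative interior.\<close>
    define T where "T = {a \<in> S \<sigma>. \<phi> \<sigma> a (real_vec v) > 0}"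
    have T: "T \<subseteq> S \<sigma>" by (auto simp: T_def)
    let ?\<tau> = "convex_cone hull (real_vec ` T)"
    have "?\<tau> face_of \<sigma>" by (subst hull[OF \<sigma>(1)], rule simple_cone_face[OF dual[OF \<sigma>(1)] T])
    then have \<tau>: "?\<tau> \<in> \<F>" by (rule fan_face[OF fan \<sigma>(1)]) (rule convex_cone_hull_nonempty)
    have dT: "dual_family T (\<phi> \<sigma>)" using dual_family_subset[OF dual[OF \<sigma>(1)] T] .
    have v\<sigma>: "real_vec v = combination (S \<sigma>) (\<lambda>a. \<phi> \<sigma> a (real_vec v))" "\<forall>a\<in>S \<sigma>. 0 \<le> \<phi> \<sigma> a (real_vec v)"
      using \<sigma>(2) mem_simple_cone[OF dual[OF \<sigma>(1)], of "real_vec v", unfolded hull[OF \<sigma>(1), symmetric]] by blast+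
    have "combination (S \<sigma>) (\<lambda>a. \<phi> \<sigma> a (real_vec v)) = combination T (\<lambda>a. \<phi> \<sigma> a (real_vec v))"
      unfolding combination_def using dual[OF \<sigma>(1)] T v\<sigma>(2)
      by (intro sum.mono_neutral_right) (auto simp: dual_family_def T_def)
    then have "real_vec v \<in> rel_interior ?\<tau>"
      unfolding rel_interior_simple_cone[OF dT] using v\<sigma>(1) by (auto simp: T_def)
    \<comment> \<open>The generators chosen for this face come from a separate choice and are not
      compared with \<open>T\<close>. The relative interior depends on the cone only, so membership
      passes from one description to the other.\<close>
    then have "real_vec v \<in> rel_interior (convex_cone hull (real_vec ` S ?\<tau>))" unfolding hull[OF \<tau>, symmetric] .
    then have r: "real_vec v = combination (S ?\<tau>) (\<lambda>a. \<phi> ?\<tau> a (real_vec v))" "\<forall>a\<in>S ?\<tau>. 0 < \<phi> ?\<tau> a (real_vec v)"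
      unfolding rel_interior_simple_cone[OF dual[OF \<tau>]] by blast+
    define \<kappa> where "\<kappa> a = nat \<lfloor>\<phi> ?\<tau> a (real_vec v)\<rfloor>" for a
    have \<kappa>: "real (\<kappa> a) = \<phi> ?\<tau> a (real_vec v)" if "a \<in> S ?\<tau>" for a
    proof -
      have "\<phi> ?\<tau> a (real_vec v) \<in> \<int>" using dual[OF \<tau>] that by (simp add: dual_family_def)
      then show ?thesis using r(2) that by (auto simp: \<kappa>_def Ints_def intro!: of_nat_nat)
    qed
    have "real_vec v = real_vec (cone_points (S ?\<tau>) \<kappa>)"
      unfolding real_vec_cone_points using r(1) \<kappa> by (simp add: combination_def)
    moreover have "\<kappa> a \<ge> 1" if "a \<in> S ?\<tau>" for a
    proof -
      have "0 < real (\<kappa> a)" using \<kappa>[OF that] r(2) that by simp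
      then show ?thesis by simp
    qed
    ultimately show ?thesis using \<tau> by auto
  qed
  have uniq: "\<sigma> = \<sigma>' \<and> (\<forall>a\<in>S \<sigma>. \<kappa> a = \<kappa>' a)"
    if \<sigma>: "\<sigma> \<in> \<F>" "\<sigma>' \<in> \<F>" and k: "\<forall>a\<in>S \<sigma>. \<kappa> a \<ge> 1" "\<forall>a\<in>S \<sigma>'. \<kappa>' a \<ge> 1"
      and eq: "cone_points (S \<sigma>) \<kappa> = cone_points (S \<sigma>') \<kappa>'" for \<sigma> \<sigma>' \<kappa> \<kappa>'
  proof -
    have int: "real_vec (cone_points (S \<rho>) l) \<in> rel_interior \<rho>" if \<rho>: "\<rho> \<in> \<F>" and l: "\<forall>a\<in>S \<rho>. l a \<ge> 1" for \<rho> l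
    proof -
      have "\<phi> \<rho> a (real_vec (cone_points (S \<rho>) l)) = real (l a)" if "a \<in> S \<rho>" for a
        unfolding real_vec_cone_points using dual_family_combination[OF dual[OF \<rho>] subset_refl that] that by simp
      then have "real_vec (cone_points (S \<rho>) l) \<in> rel_interior (convex_cone hull (real_vec ` S \<rho>))"
        unfolding rel_interior_simple_cone[OF dual[OF \<rho>]] using l
        by (auto simp: real_vec_cone_points combination_def Suc_le_eq)
      then show ?thesis unfolding hull[OF \<rho>, symmetric] .
    qed
    let ?x = "real_vec (cone_points (S \<sigma>) \<kappa>)"
    have x: "?x \<in> rel_interior \<sigma>" "?x \<in> rel_interior \<sigma>'"
      using int[OF \<sigma>(1) k(1)] int[OF \<sigma>(2) k(2)] unfolding eq by blast+
    then have x': "?x \<in> \<sigma> \<inter> \<sigma>'" using rel_interior_subset by blast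
    have face: "(\<sigma> \<inter> \<sigma>') face_of \<sigma>" "(\<sigma> \<inter> \<sigma>') face_of \<sigma>'" using fan \<sigma> unfolding fan_def by blast+
    \<comment> \<open>A face that meets the relative interior of a cone is the whole cone; applied
      to both cones, this identifies them.\<close>
    have "\<sigma> \<subseteq> \<sigma> \<inter> \<sigma>'" by (rule subset_of_face_of[OF face(1)]) (use x x' in blast)+
    moreover have "\<sigma>' \<subseteq> \<sigma> \<inter> \<sigma>'" by (rule subset_of_face_of[OF face(2)]) (use x x' in blast)+
    ultimately
    have \<sigma>\<sigma>': "\<sigma> = \<sigma>'" by blast
    have "\<kappa> a = \<kappa>' a" if "a \<in> S \<sigma>" for a
    proof -
      have "real (\<kappa> a) = \<phi> \<sigma> a (real_vec (cone_points (S \<sigma>) \<kappa>))" "real (\<kappa>' a) = \<phi> \<sigma> a (real_vec (cone_points (S \<sigma>) \<kappa>'))"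
        unfolding real_vec_cone_points using dual_family_combination[OF dual[OF \<sigma>(1)] subset_refl that] that by simp_all
      then show ?thesis using eq \<sigma>\<sigma>' by simp
    qed
    then show ?thesis using \<sigma>\<sigma>' by blast
  qed
  show ?thesis
  proof (rule that[of S \<phi>])
    show "card (S \<sigma>) \<le> CARD('n)" if "\<sigma> \<in> \<F>" for \<sigma> using S[OF that] by blast
  qed (fact dual edges min cover uniq)+
qed

text \<open>Positivity of the weight keeps the factor of an edge with \<open>d(a) = 0\<close> inside
  the unit disc, so that such an edge yields no pole.\<close>

lemma fan_edges_nonneg:
  assumes supp: "fan_support \<F> = nonneg_orthant" and a: "a \<in> fan_edges \<F>"
  shows "0 \<le> a $ i" "0 < vec_weight a"
proof -
  obtain \<sigma> where \<sigma>: "\<sigma> \<in> \<F>" "(convex_cone hull {real_vec a}) face_of \<sigma>" and prim: "primitive_vec a"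
    using a by (auto simp: fan_edges_def)
  have "real_vec a \<in> convex_cone hull {real_vec a}" by (rule hull_inc) simp
  then have "real_vec a \<in> \<sigma>" using face_of_imp_subset[OF \<sigma>(2)] by blast
  then have "real_vec a \<in> nonneg_orthant" using \<sigma>(1) supp unfolding fan_support_def by blast
  then have nn: "0 \<le> a $ i" for i by (simp add: nonneg_orthant_def real_vec_def)
  then show "0 \<le> a $ i" .
  have "a \<noteq> 0" using prim by (auto simp: primitive_vec_def)
  then obtain i where "a $ i \<noteq> 0" by (auto simp: vec_eq_iff)
  then show "0 < vec_weight a" unfolding vec_weight_def
    using nn by (intro sum_pos2[of _ i]) (auto simp: less_le)
qed

text \<open>The ray of an edge is one of the finitely many cones of the fan. Two primitive vectors
  on one ray differ by a factor \<open>r \<ge> 0\<close>, and comparing greatest common divisors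
  gives \<open>r = 1\<close>.\<close>

lemma finite_fan_edges:
  assumes fan: "fan \<F>" shows "finite (fan_edges \<F>)"
proof (rule finite_imageD)
  let ?h = "\<lambda>a. convex_cone hull {real_vec a}"
  have "?h a \<in> \<F>" if a: "a \<in> fan_edges \<F>" for a
  proof -
    obtain \<sigma> where "\<sigma> \<in> \<F>" "?h a face_of \<sigma>" using a unfolding fan_edges_def by blast
    then show ?thesis by (rule fan_face[OF fan]) (rule convex_cone_hull_nonempty)
  qed
  then have "?h ` fan_edges \<F> \<subseteq> \<F>" by blast
  moreover have "finite \<F>" using fan by (simp add: fan_def)
  ultimately show "finite (?h ` fan_edges \<F>)" by (rule finite_subset)
  show "inj_on ?h (fan_edges \<F>)"
  proof (rule inj_onI)
    fix a b assume ab: "a \<in> fan_edges \<F>" "b \<in> fan_edges \<F>" "?h a = ?h b"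
    have single: "?h c = {combination {c} \<kappa> |\<kappa>. \<forall>a\<in>{c}. 0 \<le> \<kappa> a}" for c
      using convex_cone_hull_eq[of "{c}"] by simp
    have mult: "\<exists>r\<ge>0. real_vec c = r *\<^sub>R real_vec e" if "?h c = ?h e" for c e
    proof -
      have "real_vec c \<in> ?h c" by (rule hull_inc) simp
      then have "real_vec c \<in> ?h e" unfolding that .
      then show ?thesis unfolding single by (auto simp: combination_def)
    qed
    have prim: "primitive_vec a" "primitive_vec b" using ab by (auto simp: fan_edges_def)
    obtain r where r: "r \<ge> 0" "real_vec a = r *\<^sub>R real_vec b" using mult[OF ab(3)] by blast
    have "a \<noteq> 0" using prim by (auto simp: primitive_vec_def)
    then obtain i where i: "a $ i \<noteq> 0" by (auto simp: vec_eq_iff)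
    have comp: "real_of_int (a $ j) = r * real_of_int (b $ j)" for j
      using arg_cong[OF r(2), of "\<lambda>x. x $ j"] by (simp add: real_vec_def)
    \<comment> \<open>Proportionality freed of the real factor \<open>r\<close>, so that it can
      enter a gcd of integers.\<close>
    have cross: "a $ j * b $ i = b $ j * a $ i" for j
    proof -
      have "real_of_int (a $ j * b $ i) = real_of_int (b $ j * a $ i)" by (simp add: comp)
      then show ?thesis by (simp only: of_int_eq_iff)
    qed
    have "Gcd (range (\<lambda>j. b $ i * a $ j)) = Gcd (range (\<lambda>j. a $ i * b $ j))"
      using cross by (simp add: mult.commute)
    moreover have "Gcd (range (\<lambda>j. c * d $ j)) = \<bar>c\<bar> * Gcd (range (\<lambda>j. d $ j))" for c and d :: "int ^ 'a"
      using Gcd_mult[of c "range (\<lambda>j. d $ j)"] by (simp add: image_image abs_mult)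
    ultimately have "\<bar>b $ i\<bar> = \<bar>a $ i\<bar>" using prim by (simp add: primitive_vec_def)
    then have "\<bar>real_of_int (b $ i)\<bar> = \<bar>real_of_int (a $ i)\<bar>" by (simp only: of_int_abs[symmetric])
    moreover have "\<bar>real_of_int (a $ i)\<bar> = r * \<bar>real_of_int (b $ i)\<bar>"
      using arg_cong[OF comp[of i], of abs] r(1) by (simp add: abs_mult)
    ultimately have "\<bar>real_of_int (a $ i)\<bar> = r * \<bar>real_of_int (a $ i)\<bar>" by simp
    then have "r = 1" using i by simp
    then show "a = b" using r(2) by simp
  qed
qed

section \<open>Multiplicative translation and level sets\<close>

context padic
begin

definition twist :: "int ^ 'n::finite \<Rightarrow> 'k ^ 'n \<Rightarrow> 'k ^ 'n" where
  "twist w y = (\<chi> i. \<pi> powi (w $ i) * y $ i)"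

definition level :: "int ^ 'n::finite \<Rightarrow> ('k ^ 'n) set" where
  "level k = {x \<in> torus. \<forall>i. kord (x $ i) = k $ i}"

lemma pi_powi_mult: "\<pi> powi a * \<pi> powi b = \<pi> powi (a + b)"
  by (simp add: power_int_add)

lemma twist_twist: "twist v (twist w y) = twist (v + w) y"
  by (simp add: twist_def vec_eq_iff power_int_add mult.assoc)

lemma twist_0 [simp]: "twist 0 y = y"
  by (simp add: twist_def vec_eq_iff)

lemma twist_cancel [simp]: "twist w (twist (- w) x) = x" "twist (- w) (twist w x) = x"
  by (simp_all add: twist_twist)

lemma twist_preimage_pball: "{x. twist (- w) x \<in> pball y N} = pdisc (twist w y) (vec N + w)"
proof -
  have "vabs (\<pi> powi (- k) * a - b) \<le> rad N \<longleftrightarrow> vabs (a - \<pi> powi k * b) \<le> rad (N + k)" for k a b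
  proof -
    have "\<pi> powi (- k) * a - b = \<pi> powi (- k) * (a - \<pi> powi k * b)"
      by (simp add: power_int_minus right_diff_distrib flip: mult.assoc)
    then have "vabs (\<pi> powi (- k) * a - b) = vabs (a - \<pi> powi k * b) / rad k"
      by (simp only: vabs_mult vabs_pi_powi rad_minus) simp
    then show ?thesis by (simp add: rad_add divide_le_eq)
  qed
  then show ?thesis by (simp add: pdisc_def twist_def)
qed

lemma twist_torus [simp]: "twist w x \<in> torus \<longleftrightarrow> x \<in> torus"
  by (simp add: twist_def torus_def)

lemma twist_level: "twist (- w) x \<in> level k \<longleftrightarrow> x \<in> level (k + w)"
proof -
  have "kord (\<pi> powi (- (w $ i)) * x $ i) = kord (x $ i) - w $ i" if "x \<in> torus" for i
    using that by (subst kord_mult) (auto simp: torus_def)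
  then show ?thesis by (auto simp: level_def twist_torus) (auto simp: twist_def algebra_simps)
qed

lemma level_disjoint: "x \<in> level k \<Longrightarrow> x \<in> level k' \<Longrightarrow> k = k'"
  by (auto simp: level_def vec_eq_iff)

lemma open_if_pball: "(\<And>x. x \<in> U \<Longrightarrow> \<exists>N. pball x N \<subseteq> U) \<Longrightarrow> open (U :: ('k ^ 'n::finite) set)"
proof -
  assume U: "\<And>x. x \<in> U \<Longrightarrow> \<exists>N. pball x N \<subseteq> U"
  show ?thesis
    unfolding open_subopen[of U]
  proof
    fix x assume "x \<in> U"
    from U[OF this] obtain N where "pball x N \<subseteq> U" by blast
    then have "open (pball x N) \<and> x \<in> pball x N \<and> pball x N \<subseteq> U" by (simp add: open_pdisc)
    then show "\<exists>T. open T \<and> x \<in> T \<and> T \<subseteq> U" by (rule exI)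
  qed
qed

lemma int_upper_bound: "\<exists>N. \<forall>i. (k :: 'n::finite \<Rightarrow> int) i < N"
  by (intro exI[of _ "Max (range k) + 1"] allI) (simp add: zle_add1_eq_le)

text \<open>A ball whose radius is below every coordinate of its centre cannot change any
  order.\<close>

lemma pball_level:
  assumes "y \<in> torus" "\<And>i. kord (y $ i) < N"
  shows "pball y N \<subseteq> level (\<chi> i. kord (y $ i))"
proof
  fix x assume x: "x \<in> pball y N"
  have "vabs (x $ i) = vabs (y $ i)" for i
  proof (rule vabs_dominant)
    have "rad N < vabs (y $ i)" using assms vabs_kord[of "y $ i"] by (simp add: torus_def)
    then show "vabs (x $ i - y $ i) < vabs (y $ i)" using x by (auto simp: pdisc_def intro: le_less_trans)
  qed
  then have v: "vabs (x $ i) = rad (kord (y $ i))" for i using assms vabs_kord[of "y $ i"] by (simp add: torus_def)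
  then have "kord (x $ i) = kord (y $ i)" for i by (rule kord_eqI)
  moreover have "x $ i \<noteq> 0" for i
  proof
    assume "x $ i = 0"
    then show False using v[of i] by simp
  qed
  ultimately show "x \<in> level (\<chi> i. kord (y $ i))" by (simp add: level_def torus_def)
qed

lemma torus_pball: assumes "y \<in> torus" shows "\<exists>N0. \<forall>N\<ge>N0. pball y N \<subseteq> level (\<chi> i. kord (y $ i))"
proof -
  obtain N0 where N0: "\<And>i. kord (y $ i) < N0" using int_upper_bound[of "\<lambda>i. kord (y $ i)"] by blast
  have "pball y N \<subseteq> level (\<chi> i. kord (y $ i))" if N: "N \<ge> N0" for N
  proof (rule pball_level[OF assms])
    show "kord (y $ i) < N" for i using N0[of i] N by simp
  qed
  then show ?thesis by blast
qed

lemma level_sub_torus: "level k \<subseteq> torus" by (auto simp: level_def)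

lemma open_level: "open (level k :: ('k ^ 'n::finite) set)"
proof (rule open_if_pball)
  fix x assume x: "x \<in> level k"
  then have "k = (\<chi> i. kord (x $ i))" "x \<in> torus" by (auto simp: level_def vec_eq_iff)
  then show "\<exists>N. pball x N \<subseteq> level k" using torus_pball[of x] by auto
qed

lemma continuous_on_laurent: "continuous_on torus (laurent_eval f :: 'k ^ 'n::finite \<Rightarrow> 'k)"
proof (rule continuous_at_imp_continuous_on, rule ballI)
  fix y :: "'k ^ 'n" assume y: "y \<in> torus"
  show "isCont (laurent_eval f) y"
    unfolding continuous_at_eps_delta
  proof (intro allI impI)
    fix e :: real assume "e > 0"
    then have e2: "e / 2 > 0" by simp
    obtain N0 where N0: "\<And>N x. N \<ge> N0 \<Longrightarrow> x \<in> pball y N \<Longrightarrow> vabs (laurent_eval f x - laurent_eval f y) \<le> e / 2"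
      using strict_deriv_near[OF strict_deriv_laurent[OF y, of f] e2] by blast
    have "dist (laurent_eval f x) (laurent_eval f y) < e" if d: "dist x y < rad N0" for x
    proof -
      have "dist (x $ i) (y $ i) \<le> rad N0" for i using dist_vec_nth_le[of x i y] d by linarith
      then have "x \<in> pball y N0" unfolding pdisc_def dist_vabs by simp
      from N0[OF order_refl this] show ?thesis using \<open>e > 0\<close> unfolding dist_vabs by linarith
    qed
    then show "\<exists>d>0. \<forall>x. dist x y < d \<longrightarrow> dist (laurent_eval f x) (laurent_eval f y) < e"
      using rad_pos by blast
  qed
qed

lemma fibre_open:
  assumes "pdisc y e \<subseteq> torus"
  shows "open {x \<in> pdisc y e. vabs (laurent_eval f x - v) \<le> rad k}"
proof -
  have "continuous_on (pdisc y e) (laurent_eval f)" using continuous_on_laurent assms continuous_on_subset by blast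
  then have "open (pdisc y e \<inter> laurent_eval f -` {t. vabs (t - v) \<le> rad k})"
    by (rule continuous_open_preimage[OF _ open_pdisc]) (simp add: le_rad_eq_ball)
  moreover have "pdisc y e \<inter> laurent_eval f -` {t. vabs (t - v) \<le> rad k} = {x \<in> pdisc y e. vabs (laurent_eval f x - v) \<le> rad k}"
    by auto
  ultimately show ?thesis by simp
qed

text \<open>The refinement step for \<open>pball_induct\<close>: the new centres are
  \<open>y\<close> plus one digit at place \<open>N\<close> in every coordinate.\<close>

lemma pball_partition:
  fixes y :: "'k ^ 'n::finite"
  obtains P where "finite P" "\<Union>P = pball y N" "disjoint P" "\<And>B. B \<in> P \<Longrightarrow> \<exists>z\<in>pball y N. B = pball z (N + 1)"
proof -
  obtain T where T: "reps 1 T" using reps_exist by blast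
  define h where "h t = (\<chi> i. y $ i + \<pi> powi N * t i)" for t :: "'n \<Rightarrow> 'k"
  define Z where "Z = h ` (UNIV \<rightarrow>\<^sub>E T)"
  have "finite Z" unfolding Z_def using reps_finite[OF T] by (intro finite_imageI finite_PiE) auto
  have Z_sub: "Z \<subseteq> pball y N"
    using reps_le_1[OF T] by (auto simp: Z_def h_def pdisc_def PiE_iff vabs_mult mult_left_le)
  have cover: "\<exists>z\<in>Z. x \<in> pball z (N + 1)" if x: "x \<in> pball y N" for x
  proof -
    have "\<exists>t\<in>T. vabs (x $ i - (y $ i + \<pi> powi N * t)) \<le> rad (N + 1)" for i
    proof -
      have "vabs ((x $ i - y $ i) * \<pi> powi (- N)) \<le> 1"
        using x by (simp add: pdisc_def vabs_mult rad_minus divide_le_eq)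
      then obtain t where t: "t \<in> T" "vabs ((x $ i - y $ i) * \<pi> powi (- N) - t) \<le> rad 1"
        using reps_obtain[OF T] by force
      have "x $ i - (y $ i + \<pi> powi N * t) = \<pi> powi N * ((x $ i - y $ i) * \<pi> powi (- N) - t)"
        by (simp add: power_int_minus algebra_simps)
      then have "vabs (x $ i - (y $ i + \<pi> powi N * t)) \<le> rad (N + 1)"
        using t(2) by (simp add: vabs_mult rad_add)
      then show ?thesis using t(1) by blast
    qed
    then have "\<forall>i. \<exists>t. t \<in> T \<and> vabs (x $ i - (y $ i + \<pi> powi N * t)) \<le> rad (N + 1)" by blast
    from choice[OF this] obtain t where t: "\<And>i. t i \<in> T" "\<And>i. vabs (x $ i - (y $ i + \<pi> powi N * t i)) \<le> rad (N + 1)" by blast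
    then have "h t \<in> Z" "x \<in> pball (h t) (N + 1)" by (auto simp: Z_def h_def pdisc_def)
    then show ?thesis by blast
  qed
  show ?thesis
  proof (rule that[of "(\<lambda>z. pball z (N + 1)) ` Z"])
    show "finite ((\<lambda>z. pball z (N + 1)) ` Z)" using \<open>finite Z\<close> by simp
    have "pball z (N + 1) \<subseteq> pball y N" if "z \<in> Z" for z
    proof -
      have "pball z N = pball y N" by (rule pdisc_eq) (use that Z_sub in blast)
      moreover have "pball z (N + 1) \<subseteq> pball z N" by (rule pball_mono) simp
      ultimately show ?thesis by blast
    qed
    then show "\<Union>((\<lambda>z. pball z (N + 1)) ` Z) = pball y N" using cover by blast
    show "disjoint ((\<lambda>z. pball z (N + 1)) ` Z)"
    proof (rule disjointI)
      fix A B assume AB: "A \<in> (\<lambda>z. pball z (N + 1)) ` Z" "B \<in> (\<lambda>z. pball z (N + 1)) ` Z" "A \<noteq> B"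
      then obtain z z' where z: "A = pball z (N + 1)" "B = pball z' (N + 1)" by blast
      have False if "x \<in> A" "x \<in> B" for x
        using pdisc_eq[OF that(1)[unfolded z]] pdisc_eq[OF that(2)[unfolded z]] AB(3) z by simp
      then show "A \<inter> B = {}" by blast
    qed
    show "\<exists>z\<in>pball y N. B = pball z (N + 1)" if "B \<in> (\<lambda>z. pball z (N + 1)) ` Z" for B
      using that Z_sub by blast
  qed
qed

lemma pi_powi_sum: "\<pi> powi (\<Sum>i\<in>A. g i) = (\<Prod>i\<in>A. \<pi> powi (g i))"
  by (induction A rule: infinite_finite_induct) (auto simp: power_int_add)

lemma monomial_twist: "monomial m (twist w y) = \<pi> powi (pairing w m) * monomial m y"
proof -
  have "monomial m (twist w y) = (\<Prod>i\<in>UNIV. \<pi> powi (w $ i * m $ i) * y $ i powi (m $ i))"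
    by (simp add: monomial_def twist_def power_int_mult_distrib power_int_mult)
  then show ?thesis by (simp add: prod.distrib pairing_def pi_powi_sum monomial_def)
qed

lemma monomial_nonzero: "y \<in> torus \<Longrightarrow> monomial m y \<noteq> 0"
  by (auto simp: monomial_def torus_def)

end

lemma pairing_cone_points: "pairing (cone_points I \<kappa>) m = (\<Sum>a\<in>I. int (\<kappa> a) * pairing a m)"
  unfolding pairing_def cone_points_def
  by (simp add: sum_distrib_left sum_distrib_right mult.assoc sum.swap[of _ I])

lemma sum_cone_points: "(\<Sum>i\<in>UNIV. cone_points I \<kappa> $ i) = (\<Sum>a\<in>I. int (\<kappa> a) * vec_weight a)"
  unfolding vec_weight_def cone_points_def
  by (simp add: sum_distrib_left sum.swap[of _ I])

text \<open>Both constants may be enlarged freely, so finitely many individual choices are merged by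
  maxima.\<close>

lemma finite_uniform_bound:
  assumes "finite A" "\<And>m. m \<in> A \<Longrightarrow> \<exists>L>0. \<exists>N0. Q m L N0"
    and mono: "\<And>m L L' N0 N0'. Q m L N0 \<Longrightarrow> L \<le> L' \<Longrightarrow> N0 \<le> N0' \<Longrightarrow> Q m (L' :: real) (N0' :: int)"
  shows "\<exists>L>0. \<exists>N0. \<forall>m\<in>A. Q m L N0"
  using assms(1,2)
proof induction
  case empty then show ?case by (intro exI[of _ 1]) simp
next
  case (insert a A)
  then obtain L N0 where 1: "L > 0" "\<And>m. m \<in> A \<Longrightarrow> Q m L N0" by auto
  obtain L' N0' where 2: "L' > 0" "Q a L' N0'" using insert.prems by blast
  have "Q m (max L L') (max N0 N0')" if "m \<in> insert a A" for m
  proof (cases "m = a")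
    case True
    then show ?thesis using mono[OF 2(2)] by simp
  next
    case False
    then show ?thesis using that mono[OF 1(2)[of m]] by simp
  qed
  then show ?case using 1(1) by (intro exI[of _ "max L L'"] conjI exI[of _ "max N0 N0'"]) auto
qed

section \<open>The contribution of one cone\<close>

text \<open>The face polynomial expressed by pairings with generators; unlike
  \<open>face_function\<close> it does not refer to a point of the cone.\<close>

definition face_part :: "('k::field, 'n::finite) laurent_poly \<Rightarrow> int ^ 'n \<Rightarrow> (int ^ 'n) set \<Rightarrow> ('k, 'n) laurent_poly" where
  "face_part f m0 I = (\<Sum>m\<in>{m \<in> Poly_Mapping.keys f. \<forall>a\<in>I. pairing a m = pairing a m0}.
     Poly_Mapping.single m (Poly_Mapping.lookup f m))"

text \<open>Separates the analysis from fans and polytopes. As \<open>m0\<close> is minimal for all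
  generators at once, \<open>pairing a m0\<close> plays the role of \<open>d(a)\<close>.
  Non-degeneracy is assumed for every \<open>I\<close>, because freezing some coefficients leaves
  the face of the others. The set \<open>E\<close> avoids 0 and the zeros of all
  denominators.\<close>

locale zeta_cone = haar \<pi> \<mu> for \<pi> :: "'k::valued_field" and \<mu> :: "('k ^ 'n::finite) measure" +
  fixes f :: "('k, 'n) laurent_poly" and \<Phi> :: "'k ^ 'n \<Rightarrow> complex"
    and \<eta> :: "'k \<Rightarrow> complex" and c :: nat
    and S :: "(int ^ 'n) set" and m0 :: "int ^ 'n" and E :: "complex set"
  assumes \<Phi>_locally_constant: "\<exists>U. open U \<and> x \<in> U \<and> \<Phi> constant_on U"
    and finite_S: "finite S" and card_S: "card S \<le> CARD('n)"
    and S_nonneg: "a \<in> S \<Longrightarrow> 0 \<le> a $ i"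
    and S_weight: "a \<in> S \<Longrightarrow> 0 < vec_weight a"
    and m0: "m0 \<in> Poly_Mapping.keys f"
    and m0_min: "a \<in> S \<Longrightarrow> m \<in> Poly_Mapping.keys f \<Longrightarrow> pairing a m0 \<le> pairing a m"
    and nondeg: "I \<subseteq> S \<Longrightarrow> y \<in> torus \<Longrightarrow> laurent_eval (face_part f m0 I) y = 0 \<Longrightarrow>
        \<exists>i. laurent_eval (laurent_partial i (face_part f m0 I)) y \<noteq> 0"
    and separating: "I \<subseteq> S \<Longrightarrow> card I = CARD('n) \<Longrightarrow> (\<And>a. a \<in> I \<Longrightarrow> pairing a m = pairing a m') \<Longrightarrow> m = m'"
    and injective: "cone_points S \<kappa> = cone_points S \<kappa>' \<Longrightarrow> a \<in> S \<Longrightarrow> \<kappa> a = \<kappa>' a"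
    and E_0: "0 \<notin> E" and E_q: "of_nat q \<notin> E"
    and E_S: "t \<in> E \<Longrightarrow> a \<in> S \<Longrightarrow> complex_of_real (rad (vec_weight a)) * t powi (pairing a m0) \<noteq> 1"
begin

definition ratio :: "int ^ 'n \<Rightarrow> complex \<Rightarrow> complex" where
  "ratio a \<tau> = complex_of_real (rad (vec_weight a)) * \<tau> powi (pairing a m0)"

definition convergent_char :: "('k \<Rightarrow> complex) \<Rightarrow> complex \<Rightarrow> bool" where
  "convergent_char \<omega> \<tau> \<longleftrightarrow> quasichar_data \<omega> \<tau> \<eta> c \<and> norm \<tau> < real q \<and> (\<forall>a\<in>S. norm (ratio a \<tau>) < 1)"

text \<open>Extended by 0 off the torus. Zeros of \<open>f\<close> need no case of their own, since
  the characters considered vanish at 0.\<close>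

definition integrand :: "('k \<Rightarrow> complex) \<Rightarrow> 'k ^ 'n \<Rightarrow> complex" where
  "integrand \<omega> x = (if x \<in> torus then \<Phi> x * \<omega> (laurent_eval f x) else 0)"

text \<open>The allowance for the factor with pole at -1: it is granted only if fewer than
  \<open>CARD('n)\<close> geometric series are to follow.\<close>

definition pole_bound :: "(int ^ 'n) set \<Rightarrow> nat" where
  "pole_bound I = (if card I < CARD('n) then 1 else 0)"

definition translate :: "int ^ 'n \<Rightarrow> ('k ^ 'n) set \<Rightarrow> ('k ^ 'n) set" where
  "translate w B = {x. twist (- w) x \<in> B}"

text \<open>\<open>R\<close> does not depend on the character, since it provides the continuation.
  The constant \<open>C\<close> may depend on it, since it only serves convergence.\<close>

definition scaled_by :: "(int ^ 'n) set \<Rightarrow> ('k ^ 'n) set \<Rightarrow> (complex \<Rightarrow> complex) \<Rightarrow> nat \<Rightarrow> bool" where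
  "scaled_by I B R M \<longleftrightarrow> (\<forall>\<omega> \<tau>. convergent_char \<omega> \<tau> \<longrightarrow> (\<exists>C. \<forall>\<kappa>. (\<forall>a\<in>I. M \<le> \<kappa> a) \<longrightarrow>
     set_integrable \<mu> (translate (cone_points I \<kappa>) B) (integrand \<omega>) \<and>
     (LINT x:translate (cone_points I \<kappa>) B|\<mu>. integrand \<omega> x) = (\<Prod>a\<in>I. ratio a \<tau> ^ \<kappa> a) * R \<tau> \<and>
     (LINT x:translate (cone_points I \<kappa>) B|\<mu>. norm (integrand \<omega> x)) \<le> C * (\<Prod>a\<in>I. norm (ratio a \<tau>) ^ \<kappa> a)))"

text \<open>
  For large \<open>\<kappa>\<close> the integral over the translate of \<open>B\<close> by \<open>\<Sum> \<kappa>\<^sub>a a\<close> scales exactly geometrically.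
\<close>

definition scaled :: "(int ^ 'n) set \<Rightarrow> ('k ^ 'n) set \<Rightarrow> bool" where
  "scaled I B \<longleftrightarrow> (\<forall>w. translate w B \<in> sets borel) \<and>
     (\<exists>R M. admissible E (pole_bound I) R \<and> scaled_by I B R M)"

lemma scaled_byD:
  assumes "scaled_by I B R M" "convergent_char \<omega> \<tau>"
  obtains C where "\<And>\<kappa>. \<forall>a\<in>I. M \<le> \<kappa> a \<Longrightarrow> set_integrable \<mu> (translate (cone_points I \<kappa>) B) (integrand \<omega>)"
    "\<And>\<kappa>. \<forall>a\<in>I. M \<le> \<kappa> a \<Longrightarrow>
       (LINT x:translate (cone_points I \<kappa>) B|\<mu>. integrand \<omega> x) = (\<Prod>a\<in>I. ratio a \<tau> ^ \<kappa> a) * R \<tau>"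
    "\<And>\<kappa>. \<forall>a\<in>I. M \<le> \<kappa> a \<Longrightarrow>
       (LINT x:translate (cone_points I \<kappa>) B|\<mu>. norm (integrand \<omega> x)) \<le> C * (\<Prod>a\<in>I. norm (ratio a \<tau>) ^ \<kappa> a)"
  using assms unfolding scaled_by_def by blast

lemma scaled_empty: "scaled I {}"
proof -
  have "scaled_by I {} (\<lambda>_. 0) 0"
    unfolding scaled_by_def translate_def
    by (auto simp: set_integrable_def set_lebesgue_integral_def intro!: exI[of _ 0])
  then show ?thesis unfolding scaled_def translate_def by (auto intro: admissible_const)
qed

lemma translate_Un: "translate w (B \<union> B') = translate w B \<union> translate w B'"
  by (auto simp: translate_def)

lemma scaled_Un:
  assumes B: "scaled I B" and B': "scaled I B'" and disj: "B \<inter> B' = {}"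
  shows "scaled I (B \<union> B')"
proof -
  obtain R M where R: "admissible E (pole_bound I) R" "scaled_by I B R M" using B unfolding scaled_def by blast
  obtain R' M' where R': "admissible E (pole_bound I) R'" "scaled_by I B' R' M'" using B' unfolding scaled_def by blast
  have meas: "translate w B \<in> sets \<mu>" "translate w B' \<in> sets \<mu>" for w
    using B B' unfolding scaled_def by simp_all
  have dj: "translate w B \<inter> translate w B' = {}" for w using disj by (auto simp: translate_def)
  have "scaled_by I (B \<union> B') (\<lambda>t. R t + R' t) (max M M')"
    unfolding scaled_by_def
  proof (intro allI impI)
    fix \<omega> \<tau> assume ch: "convergent_char \<omega> \<tau>"
    obtain C where C: "\<And>\<kappa>. \<forall>a\<in>I. M \<le> \<kappa> a \<Longrightarrow> set_integrable \<mu> (translate (cone_points I \<kappa>) B) (integrand \<omega>)"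
      "\<And>\<kappa>. \<forall>a\<in>I. M \<le> \<kappa> a \<Longrightarrow>
       (LINT x:translate (cone_points I \<kappa>) B|\<mu>. integrand \<omega> x) = (\<Prod>a\<in>I. ratio a \<tau> ^ \<kappa> a) * R \<tau>"
      "\<And>\<kappa>. \<forall>a\<in>I. M \<le> \<kappa> a \<Longrightarrow>
       (LINT x:translate (cone_points I \<kappa>) B|\<mu>. norm (integrand \<omega> x)) \<le> C * (\<Prod>a\<in>I. norm (ratio a \<tau>) ^ \<kappa> a)"
      by (rule scaled_byD[OF R(2) ch]) (rule that; assumption)
    obtain C' where C': "\<And>\<kappa>. \<forall>a\<in>I. M' \<le> \<kappa> a \<Longrightarrow> set_integrable \<mu> (translate (cone_points I \<kappa>) B') (integrand \<omega>)"
      "\<And>\<kappa>. \<forall>a\<in>I. M' \<le> \<kappa> a \<Longrightarrow>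
       (LINT x:translate (cone_points I \<kappa>) B'|\<mu>. integrand \<omega> x) = (\<Prod>a\<in>I. ratio a \<tau> ^ \<kappa> a) * R' \<tau>"
      "\<And>\<kappa>. \<forall>a\<in>I. M' \<le> \<kappa> a \<Longrightarrow>
       (LINT x:translate (cone_points I \<kappa>) B'|\<mu>. norm (integrand \<omega> x)) \<le> C' * (\<Prod>a\<in>I. norm (ratio a \<tau>) ^ \<kappa> a)"
      by (rule scaled_byD[OF R'(2) ch]) (rule that; assumption)
    show "\<exists>C. \<forall>\<kappa>. (\<forall>a\<in>I. max M M' \<le> \<kappa> a) \<longrightarrow>
       set_integrable \<mu> (translate (cone_points I \<kappa>) (B \<union> B')) (integrand \<omega>) \<and>
       (LINT x:translate (cone_points I \<kappa>) (B \<union> B')|\<mu>. integrand \<omega> x) = (\<Prod>a\<in>I. ratio a \<tau> ^ \<kappa> a) * (R \<tau> + R' \<tau>) \<and>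
       (LINT x:translate (cone_points I \<kappa>) (B \<union> B')|\<mu>. norm (integrand \<omega> x)) \<le> C * (\<Prod>a\<in>I. norm (ratio a \<tau>) ^ \<kappa> a)"
    proof (intro exI[of _ "C + C'"] allI impI)
      fix \<kappa> assume k: "\<forall>a\<in>I. max M M' \<le> \<kappa> a"
      have k1: "\<forall>a\<in>I. M \<le> \<kappa> a" and k2: "\<forall>a\<in>I. M' \<le> \<kappa> a" using k by simp_all
      let ?w = "cone_points I \<kappa>"
      note int = C(1)[of \<kappa>, OF k1] C'(1)[of \<kappa>, OF k2]
      have i: "set_integrable \<mu> (translate ?w B \<union> translate ?w B') (integrand \<omega>)"
        by (rule set_integrable_Un[OF int meas])
      have v: "(LINT x:translate ?w B \<union> translate ?w B'|\<mu>. integrand \<omega> x) =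
          (\<Prod>a\<in>I. ratio a \<tau> ^ \<kappa> a) * (R \<tau> + R' \<tau>)"
        unfolding set_integral_Un[OF dj int] C(2)[of \<kappa>, OF k1] C'(2)[of \<kappa>, OF k2] by (simp add: distrib_left)
      have n: "(LINT x:translate ?w B \<union> translate ?w B'|\<mu>. norm (integrand \<omega> x)) \<le>
          (C + C') * (\<Prod>a\<in>I. norm (ratio a \<tau>) ^ \<kappa> a)"
        unfolding set_integral_Un[OF dj set_integrable_norm[OF int(1)] set_integrable_norm[OF int(2)]]
        using C(3)[of \<kappa>, OF k1] C'(3)[of \<kappa>, OF k2] by (simp add: distrib_right)
      show "set_integrable \<mu> (translate ?w (B \<union> B')) (integrand \<omega>) \<and>
       (LINT x:translate ?w (B \<union> B')|\<mu>. integrand \<omega> x) = (\<Prod>a\<in>I. ratio a \<tau> ^ \<kappa> a) * (R \<tau> + R' \<tau>) \<and>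
       (LINT x:translate ?w (B \<union> B')|\<mu>. norm (integrand \<omega> x)) \<le> (C + C') * (\<Prod>a\<in>I. norm (ratio a \<tau>) ^ \<kappa> a)"
        unfolding translate_Un using i v n by blast
    qed
  qed
  moreover have "translate w (B \<union> B') \<in> sets borel" for w unfolding translate_Un using meas[of w] by simp
  ultimately show ?thesis unfolding scaled_def using admissible_add[OF R(1) R'(1)] by blast
qed

lemma scaled_Union:
  assumes "finite P" "disjoint P" "\<And>B. B \<in> P \<Longrightarrow> scaled I (B \<inter> U)"
  shows "scaled I (\<Union>P \<inter> U)"
  using assms
proof (induction P)
  case empty then show ?case by (simp add: scaled_empty)
next
  case (insert B P)
  have "scaled I (\<Union>P \<inter> U)"
  proof (rule insert.IH)
    show "disjoint P" using insert.prems(1) by (simp add: pairwise_insert)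
    show "scaled I (B \<inter> U)" if "B \<in> P" for B using insert.prems(2) that by simp
  qed
  moreover have "scaled I (B \<inter> U)" using insert.prems(2) by simp
  moreover have "(B \<inter> U) \<inter> (\<Union>P \<inter> U) = {}"
  proof -
    have "B \<inter> B' = {}" if "B' \<in> P" for B'
    proof -
      have "B \<noteq> B'" using that insert.hyps(2) by blast
      then show ?thesis using insert.prems(1) that by (simp add: pairwise_insert disjnt_def)
    qed
    then show ?thesis by blast
  qed
  ultimately have "scaled I ((B \<inter> U) \<union> (\<Union>P \<inter> U))" by (intro scaled_Un)
  then show ?case by (simp add: Int_Un_distrib2)
qed

text \<open>The volume factor of the substitution times the power of \<open>\<tau>\<close>
  contributed by the power of \<open>\<pi>\<close> extracted from \<open>f\<close>.\<close>

lemma ratio_prod: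
  assumes "\<tau> \<noteq> 0"
  shows "(\<Prod>a\<in>I. ratio a \<tau> ^ \<kappa> a) =
    complex_of_real (rad (\<Sum>i\<in>UNIV. cone_points I \<kappa> $ i)) * \<tau> powi (pairing (cone_points I \<kappa>) m0)"
proof -
  have one: "ratio a \<tau> ^ n = complex_of_real (rad (int n * vec_weight a)) * \<tau> powi (int n * pairing a m0)" for a n
  proof -
    have "(\<tau> powi pairing a m0) ^ n = \<tau> powi (int n * pairing a m0)"
      by (simp add: mult.commute[of "int n"] power_int_mult)
    moreover have "rad (vec_weight a) ^ n = rad (int n * vec_weight a)" by (simp add: rad_power mult.commute)
    ultimately show ?thesis by (simp add: ratio_def power_mult_distrib flip: of_real_power)
  qed
  have "(\<Prod>a\<in>I. ratio a \<tau> ^ \<kappa> a) = complex_of_real (rad (\<Sum>a\<in>I. int (\<kappa> a) * vec_weight a)) *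
      \<tau> powi (\<Sum>a\<in>I. int (\<kappa> a) * pairing a m0)"
    unfolding one by (induction I rule: infinite_finite_induct) (auto simp: rad_add power_int_add assms)
  then show ?thesis by (simp add: sum_cone_points pairing_cone_points)
qed

lemma norm_ratio_prod:
  assumes "\<tau> \<noteq> 0"
  shows "(\<Prod>a\<in>I. norm (ratio a \<tau>) ^ \<kappa> a) =
    rad (\<Sum>i\<in>UNIV. cone_points I \<kappa> $ i) * norm \<tau> powi (pairing (cone_points I \<kappa>) m0)"
proof -
  have "(\<Prod>a\<in>I. norm (ratio a \<tau>) ^ \<kappa> a) = norm (\<Prod>a\<in>I. ratio a \<tau> ^ \<kappa> a)"
    by (simp add: prod_norm[symmetric] norm_power)
  then show ?thesis unfolding ratio_prod[OF assms] by (simp add: norm_mult norm_power_int)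
qed

subsection \<open>Expansion at a face\<close>

definition remainder :: "(int ^ 'n) set \<Rightarrow> (int ^ 'n \<Rightarrow> nat) \<Rightarrow> 'k ^ 'n \<Rightarrow> 'k" where
  "remainder I \<kappa> x = (\<Sum>m\<in>{m \<in> Poly_Mapping.keys f. \<not> (\<forall>a\<in>I. pairing a m = pairing a m0)}.
     \<pi> powi (pairing (cone_points I \<kappa>) m - pairing (cone_points I \<kappa>) m0) * (Poly_Mapping.lookup f m * monomial m x))"

lemma laurent_eval_twist:
  "laurent_eval f (twist (cone_points I \<kappa>) x) =
     \<pi> powi (pairing (cone_points I \<kappa>) m0) * (laurent_eval (face_part f m0 I) x + remainder I \<kappa> x)"
proof -
  let ?w = "cone_points I \<kappa>"
  let ?K = "{m \<in> Poly_Mapping.keys f. \<forall>a\<in>I. pairing a m = pairing a m0}"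
  let ?K' = "{m \<in> Poly_Mapping.keys f. \<not> (\<forall>a\<in>I. pairing a m = pairing a m0)}"
  let ?t = "\<lambda>m. Poly_Mapping.lookup f m * (\<pi> powi (pairing ?w m) * monomial m x)"
  have "laurent_eval f (twist ?w x) = (\<Sum>m\<in>Poly_Mapping.keys f. ?t m)"
    by (simp add: laurent_eval_eq monomial_twist)
  also have "\<dots> = (\<Sum>m\<in>?K \<union> ?K'. ?t m)" by (rule sum.cong) auto
  also have "\<dots> = (\<Sum>m\<in>?K. ?t m) + (\<Sum>m\<in>?K'. ?t m)" by (rule sum.union_disjoint) auto
  also have "(\<Sum>m\<in>?K. ?t m) = \<pi> powi (pairing ?w m0) * laurent_eval (face_part f m0 I) x"
    unfolding face_part_def laurent_eval_sum laurent_eval_single sum_distrib_left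
    by (intro sum.cong) (auto simp: pairing_cone_points mult_ac)
  also have "(\<Sum>m\<in>?K'. ?t m) = \<pi> powi (pairing ?w m0) * remainder I \<kappa> x"
    unfolding remainder_def sum_distrib_left
  proof (rule sum.cong[OF refl])
    fix m
    have "\<pi> powi (pairing ?w m) = \<pi> powi (pairing ?w m0) * \<pi> powi (pairing ?w m - pairing ?w m0)"
      unfolding pi_powi_mult by simp
    then show "?t m = \<pi> powi (pairing ?w m0) *
        (\<pi> powi (pairing ?w m - pairing ?w m0) * (Poly_Mapping.lookup f m * monomial m x))"
      by (simp only: mult_ac)
  qed
  finally show ?thesis by (simp only: distrib_left)
qed

text \<open>Off the face some pairing exceeds its minimum, and by at least 1 because pairings are
  integers. This gap is multiplied by a coefficient of size at least \<open>M\<close>, and the other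
  generators contribute nonnegative terms.\<close>

lemma remainder_exponent:
  assumes I: "I \<subseteq> S" and k: "\<And>a. a \<in> I \<Longrightarrow> M \<le> \<kappa> a" and m: "m \<in> Poly_Mapping.keys f"
    and a0: "a0 \<in> I" "pairing a0 m \<noteq> pairing a0 m0"
  shows "int M \<le> pairing (cone_points I \<kappa>) m - pairing (cone_points I \<kappa>) m0"
proof -
  have fin: "finite I" using I finite_S finite_subset by blast
  have nn: "0 \<le> pairing a m - pairing a m0" if "a \<in> I" for a using m0_min[of a m] that I m by auto
  have "1 \<le> pairing a0 m - pairing a0 m0" using nn[OF a0(1)] a0(2) by linarith
  then have "int M * 1 \<le> int (\<kappa> a0) * (pairing a0 m - pairing a0 m0)"
    using k[OF a0(1)] by (intro mult_mono) auto
  also have "\<dots> \<le> (\<Sum>a\<in>I. int (\<kappa> a) * (pairing a m - pairing a m0))"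
    using a0 fin nn by (intro member_le_sum) auto
  also have "\<dots> = pairing (cone_points I \<kappa>) m - pairing (cone_points I \<kappa>) m0"
    by (simp add: pairing_cone_points right_diff_distrib sum_subtractf)
  finally show ?thesis by simp
qed

text \<open>Not only the size but also the Lipschitz constant decays, uniformly in
  \<open>\<kappa>\<close>; near a zero of the face polynomial the remainder could otherwise destroy
  the isometry along lines.\<close>

lemma remainder_bounds:
  assumes I: "I \<subseteq> S" and y: "y \<in> torus"
  obtains L N0 where "L > 0"
    "\<And>N \<kappa> M x. N \<ge> N0 \<Longrightarrow> \<forall>a\<in>I. M \<le> \<kappa> a \<Longrightarrow> x \<in> pball y N \<Longrightarrow> vabs (remainder I \<kappa> x) \<le> L * rad (int M)"
    "\<And>N \<kappa> M x z r. N \<ge> N0 \<Longrightarrow> \<forall>a\<in>I. M \<le> \<kappa> a \<Longrightarrow> x \<in> pball y N \<Longrightarrow> z \<in> pball y N \<Longrightarrow>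
       \<forall>i. vabs (x $ i - z $ i) \<le> r \<Longrightarrow> vabs (remainder I \<kappa> x - remainder I \<kappa> z) \<le> L * rad (int M) * r"
proof -
  define T where "T m x = Poly_Mapping.lookup f m * monomial m x" for m and x :: "'k ^ 'n"
  define Q where "Q m L N0 \<longleftrightarrow> (\<forall>N\<ge>N0. \<forall>x\<in>pball y N. vabs (T m x) \<le> L \<and>
      (\<forall>z\<in>pball y N. \<forall>r. (\<forall>i. vabs (x $ i - z $ i) \<le> r) \<longrightarrow> vabs (T m x - T m z) \<le> L * r))" for m and L :: real and N0
  have Q_ex: "\<exists>L>0. \<exists>N0. Q m L N0" for m
  proof -
    have sd: "strict_deriv (T m) y (\<lambda>i. Poly_Mapping.lookup f m * (of_int (m $ i) * monomial (m - axis i 1) y))"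
      unfolding T_def by (intro strict_deriv_cmult strict_deriv_monomial y)
    obtain L N0 where L: "L > 0" "\<And>N x z r. N \<ge> N0 \<Longrightarrow> x \<in> pball y N \<Longrightarrow> z \<in> pball y N \<Longrightarrow>
        (\<And>i. vabs (x $ i - z $ i) \<le> r) \<Longrightarrow> vabs (T m x - T m z) \<le> L * r"
      using strict_deriv_Lipschitz[OF sd] by blast
    obtain N1 where N1: "\<And>N x. N \<ge> N1 \<Longrightarrow> x \<in> pball y N \<Longrightarrow> vabs (T m x - T m y) \<le> 1"
      using strict_deriv_near[OF sd, of 1] by auto
    define L' where "L' = L + 1 + vabs (T m y)"
    have L': "L \<le> L'" "1 \<le> L'" "vabs (T m y) \<le> L'" using L(1) vabs_nonneg[of "T m y"] by (simp_all add: L'_def)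
    have "Q m L' (max N0 N1)"
      unfolding Q_def
    proof (intro allI impI ballI conjI)
      fix N x assume N: "max N0 N1 \<le> N" and x: "x \<in> pball y N"
      have "vabs (T m x - T m y) \<le> L'" using N1[of N x] N x L' by simp
      from vabs_add_le[OF this L'(3)] show "vabs (T m x) \<le> L'" by simp
      fix z r assume z: "z \<in> pball y N" and d: "\<forall>i. vabs (x $ i - z $ i) \<le> r"
      have r: "0 \<le> r" using d order_trans[OF vabs_nonneg] by blast
      have "vabs (T m x - T m z) \<le> L * r" using L(2)[of N x z r] N x z d by simp
      also have "\<dots> \<le> L' * r" using L'(1) r by (rule mult_right_mono)
      finally show "vabs (T m x - T m z) \<le> L' * r" .
    qed
    moreover have "L' > 0" using L' by linarith
    ultimately show ?thesis by blast
  qed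
  have Q_mono: "Q m L' N0'" if Q: "Q m L N0" and le: "L \<le> L'" "N0 \<le> N0'" for m L L' N0 N0'
    unfolding Q_def
  proof (intro allI impI ballI conjI)
    fix N x assume N: "N0' \<le> N" and x: "x \<in> pball y N"
    have N': "N0 \<le> N" using N le by simp
    show "vabs (T m x) \<le> L'" using Q[unfolded Q_def, rule_format, OF N' x] le(1) by linarith
    fix z r assume z: "z \<in> pball y N" and d: "\<forall>i. vabs (x $ i - z $ i) \<le> r"
    have r: "0 \<le> r" using d order_trans[OF vabs_nonneg] by blast
    have "vabs (T m x - T m z) \<le> L * r" using Q[unfolded Q_def] N' x z d by blast
    also have "\<dots> \<le> L' * r" using le(1) r by (rule mult_right_mono)
    finally show "vabs (T m x - T m z) \<le> L' * r" .
  qed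
  have "\<exists>L>0. \<exists>N0. \<forall>m\<in>Poly_Mapping.keys f. Q m L N0"
    by (rule finite_uniform_bound, rule finite_keys, rule Q_ex, rule Q_mono)
  then obtain L N0 where L: "L > 0" "\<And>m. m \<in> Poly_Mapping.keys f \<Longrightarrow> Q m L N0" by blast
  let ?K' = "{m \<in> Poly_Mapping.keys f. \<not> (\<forall>a\<in>I. pairing a m = pairing a m0)}"
  have e: "rad (pairing (cone_points I \<kappa>) m - pairing (cone_points I \<kappa>) m0) \<le> rad (int M)"
    if k: "\<And>a. a \<in> I \<Longrightarrow> M \<le> \<kappa> a" and m: "m \<in> ?K'" for m M \<kappa>
  proof -
    obtain a0 where "a0 \<in> I" "pairing a0 m \<noteq> pairing a0 m0" using m by blast
    from remainder_exponent[OF I k _ this] m show ?thesis by simp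
  qed
  show ?thesis
  proof (rule that[OF L(1)])
    fix N and \<kappa> :: "int ^ 'n \<Rightarrow> nat" and M x assume N: "N \<ge> N0" and k': "\<forall>a\<in>I. M \<le> \<kappa> a" and x: "x \<in> pball y N"
    have k: "M \<le> \<kappa> a" if "a \<in> I" for a using k' that by blast
    show "vabs (remainder I \<kappa> x) \<le> L * rad (int M)"
      unfolding remainder_def
    proof (rule vabs_sum_le)
      fix m assume m: "m \<in> ?K'"
      have "vabs (T m x) \<le> L" using L(2)[of m, unfolded Q_def] m N x by blast
      then have "rad (pairing (cone_points I \<kappa>) m - pairing (cone_points I \<kappa>) m0) * vabs (T m x) \<le> rad (int M) * L"
        using e[OF k m] by (intro mult_mono) auto
      then show "vabs (\<pi> powi (pairing (cone_points I \<kappa>) m - pairing (cone_points I \<kappa>) m0) *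
          (Poly_Mapping.lookup f m * monomial m x)) \<le> L * rad (int M)"
        unfolding T_def by (subst vabs_mult) (simp add: mult.commute)
    qed (use L(1) in simp)
  next
    fix N and \<kappa> :: "int ^ 'n \<Rightarrow> nat" and M x z r assume N: "N \<ge> N0" and k': "\<forall>a\<in>I. M \<le> \<kappa> a" and x: "x \<in> pball y N" and z: "z \<in> pball y N"
      and d: "\<forall>i. vabs (x $ i - z $ i) \<le> r"
    have k: "M \<le> \<kappa> a" if "a \<in> I" for a using k' that by blast
    have r: "0 \<le> r" using d order_trans[OF vabs_nonneg] by blast
    have "remainder I \<kappa> x - remainder I \<kappa> z = (\<Sum>m\<in>?K'.
        \<pi> powi (pairing (cone_points I \<kappa>) m - pairing (cone_points I \<kappa>) m0) * (T m x - T m z))"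
      unfolding remainder_def T_def by (simp add: sum_subtractf right_diff_distrib)
    also have "vabs \<dots> \<le> L * rad (int M) * r"
    proof (rule vabs_sum_le)
      fix m assume m: "m \<in> ?K'"
      have "vabs (T m x - T m z) \<le> L * r" using L(2)[of m, unfolded Q_def] m N x z d by blast
      then have "rad (pairing (cone_points I \<kappa>) m - pairing (cone_points I \<kappa>) m0) * vabs (T m x - T m z) \<le> rad (int M) * (L * r)"
        using e[OF k m] by (intro mult_mono) auto
      then show "vabs (\<pi> powi (pairing (cone_points I \<kappa>) m - pairing (cone_points I \<kappa>) m0) *
          (T m x - T m z)) \<le> L * rad (int M) * r"
        by (subst vabs_mult) (simp add: mult_ac)
    qed (use L(1) r in simp)
    finally show "vabs (remainder I \<kappa> x - remainder I \<kappa> z) \<le> L * rad (int M) * r" .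
  qed
qed

text \<open>As the coefficients grow, the coordinates in which some generator of \<open>I\<close> is
  nonzero tend to 0, while the others keep their value. The limit point \<open>y0\<close> may lie
  outside the torus; local constancy of \<open>\<Phi>\<close> on all of the space is used
  there.\<close>

lemma \<Phi>_eventually_constant:
  assumes I: "I \<subseteq> S"
  obtains \<phi>0 N1 M1 where "\<And>N \<kappa> x. N \<ge> N1 \<Longrightarrow> \<forall>a\<in>I. M1 \<le> \<kappa> a \<Longrightarrow>
    x \<in> translate (cone_points I \<kappa>) (pball y N) \<Longrightarrow> \<Phi> x = \<phi>0"
proof -
  define y0 where "y0 = (\<chi> i. if \<exists>a\<in>I. a $ i \<noteq> 0 then 0 else y $ i)"
  obtain U where U: "open U" "y0 \<in> U" "\<Phi> constant_on U" using \<Phi>_locally_constant by blast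
  obtain \<phi>0 where \<phi>0: "\<And>x. x \<in> U \<Longrightarrow> \<Phi> x = \<phi>0" using U(3) unfolding constant_on_def by blast
  obtain N1 where N1: "pball y0 N1 \<subseteq> U" using open_contains_pball[OF U(1,2)] by blast
  obtain L where L: "L > 0" "\<And>i. vabs (y $ i) \<le> L" using finite_vabs_bound by blast
  \<comment> \<open>\<open>L + 1\<close> bounds the coordinates of all points of a ball of radius at
    most 1 around \<open>y\<close>; the lower bound \<open>max N1 0\<close> on \<open>N\<close>
    ensures that radius.\<close>
  obtain M1' where M1': "\<And>M. M \<ge> M1' \<Longrightarrow> rad M < rad N1 / (L + 1)"
    using rad_arbitrarily_small[of "rad N1 / (L + 1)"] L(1) by auto
  define M1 where "M1 = nat M1'"
  have fin: "finite I" using I finite_S finite_subset by blast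
  show ?thesis
  proof (rule that[of "max N1 0" M1 \<phi>0])
    fix N \<kappa> x assume N: "N \<ge> max N1 0" and k': "\<forall>a\<in>I. M1 \<le> \<kappa> a"
      and x: "x \<in> translate (cone_points I \<kappa>) (pball y N)"
    have k: "M1 \<le> \<kappa> a" if "a \<in> I" for a using k' that by blast
    let ?w = "cone_points I \<kappa>"
    define x' where "x' = twist (- ?w) x"
    have x': "x' \<in> pball y N" "x = twist ?w x'" using x by (simp_all add: translate_def x'_def)
    have nn: "0 \<le> a $ i" if "a \<in> I" for a i using S_nonneg I that by blast
    have "vabs (x $ i - y0 $ i) \<le> rad N1" for i
    proof (cases "\<exists>a\<in>I. a $ i \<noteq> 0")
      case True
      then obtain a where a: "a \<in> I" "a $ i \<noteq> 0" by blast
      have "1 \<le> a $ i" using nn[OF a(1), of i] a(2) by linarith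
      then have "int M1 * 1 \<le> int (\<kappa> a) * a $ i" using k[OF a(1)] by (intro mult_mono) auto
      also have "\<dots> \<le> (\<Sum>a\<in>I. int (\<kappa> a) * a $ i)" using a fin nn by (intro member_le_sum) auto
      also have "\<dots> = ?w $ i" by (simp add: cone_points_def)
      finally have "int M1 \<le> ?w $ i" by simp
      moreover have "M1' \<le> int M1" by (simp add: M1_def)
      ultimately have "M1' \<le> ?w $ i" by linarith
      then have small: "rad (?w $ i) < rad N1 / (L + 1)" by (rule M1')
      have "vabs (x' $ i - y $ i) \<le> 1"
        using x'(1) N rad_le_1_iff[of N] by (auto simp: pdisc_def intro: order_trans)
      then have "vabs (x' $ i - y $ i + y $ i) \<le> L + 1"
        using L by (intro vabs_add_le) (auto intro: order_trans[of _ 1] order_trans[of _ L])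
      then have "vabs (x' $ i) \<le> L + 1" by simp
      then have "rad (?w $ i) * vabs (x' $ i) \<le> rad N1 / (L + 1) * (L + 1)"
        using small L(1) by (intro mult_mono) auto
      then have "vabs (x $ i) \<le> rad N1" unfolding x'(2) using L(1) by (simp add: twist_def vabs_mult)
      then show ?thesis using True by (simp add: y0_def)
    next
      case False
      then have "?w $ i = 0" by (simp add: cone_points_def)
      then have "x $ i = x' $ i" unfolding x'(2) by (simp add: twist_def)
      moreover have "rad N \<le> rad N1" using N by simp
      ultimately show ?thesis using x'(1) False by (auto simp: pdisc_def y0_def intro: order_trans)
    qed
    then have "x \<in> pball y0 N1" by (simp add: pdisc_def)
    then show "\<Phi> x = \<phi>0" using N1 \<phi>0 by blast
  qed
qed

subsection \<open>Geometric scaling near a point of the torus\<close>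

lemma translate_pball: "translate w (pball y N) = pdisc (twist w y) (vec N + w)"
  unfolding translate_def by (rule twist_preimage_pball)

lemma measure_translate:
  "measure \<mu> (translate w (pball y N)) = rad (int CARD('n) * N) * rad (\<Sum>i\<in>UNIV. w $ i)"
  unfolding translate_pball measure_pdisc by (simp add: sum.distrib rad_add)

lemma scale_ratio:
  assumes "\<tau> \<noteq> 0"
  shows "measure \<mu> (translate (cone_points I \<kappa>) (pball y N)) *\<^sub>R (\<tau> powi (pairing (cone_points I \<kappa>) m0 + k) * b) =
    (\<Prod>a\<in>I. ratio a \<tau> ^ \<kappa> a) * (complex_of_real (rad (int CARD('n) * N)) * (\<tau> powi k * b))"
  unfolding measure_translate ratio_prod[OF assms] using assms
  by (simp add: power_int_add scaleR_conv_of_real mult_ac)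

lemma scale_norm_ratio:
  assumes "\<tau> \<noteq> 0"
  shows "measure \<mu> (translate (cone_points I \<kappa>) (pball y N)) * (norm \<tau> powi (pairing (cone_points I \<kappa>) m0 + k) * b) =
    (\<Prod>a\<in>I. norm (ratio a \<tau>) ^ \<kappa> a) * (rad (int CARD('n) * N) * (norm \<tau> powi k * b))"
  unfolding measure_translate norm_ratio_prod[OF assms] using assms
  by (simp add: power_int_add mult_ac)

text \<open>The property \<open>scaled_by\<close> before the locally constant factor
  \<open>\<Phi>\<close> is multiplied in.\<close>

definition geometric_at :: "(int ^ 'n) set \<Rightarrow> ('k ^ 'n) set \<Rightarrow> (complex \<Rightarrow> complex) \<Rightarrow> nat \<Rightarrow> bool" where
  "geometric_at I B R M \<longleftrightarrow> (\<forall>\<omega> \<tau>. convergent_char \<omega> \<tau> \<longrightarrow> (\<exists>C. \<forall>\<kappa>. (\<forall>a\<in>I. M \<le> \<kappa> a) \<longrightarrow>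
     set_integrable \<mu> (translate (cone_points I \<kappa>) B) (\<lambda>x. \<omega> (laurent_eval f x)) \<and>
     (LINT x:translate (cone_points I \<kappa>) B|\<mu>. \<omega> (laurent_eval f x)) = (\<Prod>a\<in>I. ratio a \<tau> ^ \<kappa> a) * R \<tau> \<and>
     (LINT x:translate (cone_points I \<kappa>) B|\<mu>. norm (\<omega> (laurent_eval f x))) \<le> C * (\<Prod>a\<in>I. norm (ratio a \<tau>) ^ \<kappa> a)))"

lemma scaled_pballI:
  assumes sub: "pball y N \<subseteq> torus"
    and phi: "\<And>\<kappa> x. \<forall>a\<in>I. M1 \<le> \<kappa> a \<Longrightarrow> x \<in> translate (cone_points I \<kappa>) (pball y N) \<Longrightarrow> \<Phi> x = \<phi>0"
    and geo: "geometric_at I (pball y N) R M2" and adm: "admissible E (pole_bound I) R"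
  shows "scaled I (pball y N)"
proof -
  have "scaled_by I (pball y N) (\<lambda>t. \<phi>0 * R t) (max M1 M2)"
    unfolding scaled_by_def
  proof (intro allI impI)
    fix \<omega> \<tau> assume "convergent_char \<omega> \<tau>"
    then obtain C where C: "\<forall>\<kappa>. (\<forall>a\<in>I. M2 \<le> \<kappa> a) \<longrightarrow>
     set_integrable \<mu> (translate (cone_points I \<kappa>) (pball y N)) (\<lambda>x. \<omega> (laurent_eval f x)) \<and>
     (LINT x:translate (cone_points I \<kappa>) (pball y N)|\<mu>. \<omega> (laurent_eval f x)) = (\<Prod>a\<in>I. ratio a \<tau> ^ \<kappa> a) * R \<tau> \<and>
     (LINT x:translate (cone_points I \<kappa>) (pball y N)|\<mu>. norm (\<omega> (laurent_eval f x))) \<le> C * (\<Prod>a\<in>I. norm (ratio a \<tau>) ^ \<kappa> a)"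
      using geo unfolding geometric_at_def by blast
    show "\<exists>C. \<forall>\<kappa>. (\<forall>a\<in>I. max M1 M2 \<le> \<kappa> a) \<longrightarrow>
       set_integrable \<mu> (translate (cone_points I \<kappa>) (pball y N)) (integrand \<omega>) \<and>
       (LINT x:translate (cone_points I \<kappa>) (pball y N)|\<mu>. integrand \<omega> x) = (\<Prod>a\<in>I. ratio a \<tau> ^ \<kappa> a) * (\<phi>0 * R \<tau>) \<and>
       (LINT x:translate (cone_points I \<kappa>) (pball y N)|\<mu>. norm (integrand \<omega> x)) \<le> C * (\<Prod>a\<in>I. norm (ratio a \<tau>) ^ \<kappa> a)"
    proof (intro exI[of _ "norm \<phi>0 * C"] allI impI)
      fix \<kappa> assume k: "\<forall>a\<in>I. max M1 M2 \<le> \<kappa> a"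
      let ?A = "translate (cone_points I \<kappa>) (pball y N)"
      have k1: "\<forall>a\<in>I. M1 \<le> \<kappa> a" and k2: "\<forall>a\<in>I. M2 \<le> \<kappa> a" using k by simp_all
      have c1: "set_integrable \<mu> ?A (\<lambda>x. \<omega> (laurent_eval f x))"
        and c2: "(LINT x:?A|\<mu>. \<omega> (laurent_eval f x)) = (\<Prod>a\<in>I. ratio a \<tau> ^ \<kappa> a) * R \<tau>"
        and c3: "(LINT x:?A|\<mu>. norm (\<omega> (laurent_eval f x))) \<le> C * (\<Prod>a\<in>I. norm (ratio a \<tau>) ^ \<kappa> a)"
        using C k2 by blast+
      have eq: "integrand \<omega> x = \<phi>0 * \<omega> (laurent_eval f x)" if x: "x \<in> ?A" for x
      proof -
        have "twist (- cone_points I \<kappa>) x \<in> torus" using x sub unfolding translate_def by blast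
        then have "x \<in> torus" by simp
        then show ?thesis using phi[OF k1 x] by (simp add: integrand_def)
      qed
      have A: "?A \<in> sets \<mu>" by (simp add: translate_pball)
      have "set_integrable \<mu> ?A (\<lambda>x. \<phi>0 * \<omega> (laurent_eval f x))" using c1 by (rule set_integrable_mult_right)
      moreover have "set_integrable \<mu> ?A (integrand \<omega>) \<longleftrightarrow> set_integrable \<mu> ?A (\<lambda>x. \<phi>0 * \<omega> (laurent_eval f x))"
        by (rule set_integrable_cong[OF refl refl]) (rule eq)
      ultimately have 1: "set_integrable \<mu> ?A (integrand \<omega>)" by blast
      have "(LINT x:?A|\<mu>. integrand \<omega> x) = (LINT x:?A|\<mu>. \<phi>0 * \<omega> (laurent_eval f x))"
        using eq by (intro set_lebesgue_integral_cong[OF A]) blast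
      then have 2: "(LINT x:?A|\<mu>. integrand \<omega> x) = (\<Prod>a\<in>I. ratio a \<tau> ^ \<kappa> a) * (\<phi>0 * R \<tau>)"
        by (simp add: c2 mult_ac)
      have "(LINT x:?A|\<mu>. norm (integrand \<omega> x)) = (LINT x:?A|\<mu>. norm \<phi>0 * norm (\<omega> (laurent_eval f x)))"
        using eq by (intro set_lebesgue_integral_cong[OF A]) (auto simp: norm_mult)
      also have "\<dots> \<le> norm \<phi>0 * C * (\<Prod>a\<in>I. norm (ratio a \<tau>) ^ \<kappa> a)"
        using mult_left_mono[OF c3, of "norm \<phi>0"] by (simp add: mult.assoc)
      finally show "set_integrable \<mu> ?A (integrand \<omega>) \<and>
          (LINT x:?A|\<mu>. integrand \<omega> x) = (\<Prod>a\<in>I. ratio a \<tau> ^ \<kappa> a) * (\<phi>0 * R \<tau>) \<and>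
          (LINT x:?A|\<mu>. norm (integrand \<omega> x)) \<le> norm \<phi>0 * C * (\<Prod>a\<in>I. norm (ratio a \<tau>) ^ \<kappa> a)"
        using 1 2 by blast
    qed
  qed
  moreover have "translate w (pball y N) \<in> sets borel" for w by (simp add: translate_pball)
  ultimately show ?thesis unfolding scaled_def using admissible_cmult[OF adm] by blast
qed

text \<open>With \<open>v\<close> the nonzero value of the face polynomial at \<open>y\<close>, the
  values of \<open>f\<close> on the translate stay within relative accuracy \<open>rad c\<close> of
  \<open>\<pi> powi D * v\<close>. The character is then constant there, and the integral is a
  volume times one value.\<close>

lemma geometric_nonzero:
  assumes I: "I \<subseteq> S" and y: "y \<in> torus" and v: "laurent_eval (face_part f m0 I) y \<noteq> 0"
  shows "\<exists>N0. \<forall>N\<ge>N0. \<exists>R M. admissible E (pole_bound I) R \<and> geometric_at I (pball y N) R M"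
proof -
  define v where "v = laurent_eval (face_part f m0 I) y"
  have v0: "v \<noteq> 0" using assms by (simp add: v_def)
  have eps: "rad (int c) * vabs v > 0" using v0 by simp
  obtain N1 where N1: "\<And>N x. N \<ge> N1 \<Longrightarrow> x \<in> pball y N \<Longrightarrow>
      vabs (laurent_eval (face_part f m0 I) x - v) \<le> rad (int c) * vabs v"
    using strict_deriv_near[OF strict_deriv_laurent[OF y, of "face_part f m0 I"] eps] unfolding v_def by blast
  obtain L N2 where L: "L > 0"
    "\<And>N \<kappa> M x. N \<ge> N2 \<Longrightarrow> \<forall>a\<in>I. M \<le> \<kappa> a \<Longrightarrow> x \<in> pball y N \<Longrightarrow> vabs (remainder I \<kappa> x) \<le> L * rad (int M)"
    by (rule remainder_bounds[OF I y]) (rule that; assumption)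
  obtain M0 where M0: "\<And>M. M \<ge> M0 \<Longrightarrow> rad M < rad (int c) * vabs v / L"
    using rad_arbitrarily_small[of "rad (int c) * vabs v / L"] eps L(1) by auto
  define M where "M = nat M0"
  have M: "L * rad (int M) \<le> rad (int c) * vabs v"
    using M0[of "int M"] L(1) by (simp add: M_def less_divide_eq mult.commute less_imp_le)
  have "\<exists>R M. admissible E (pole_bound I) R \<and> geometric_at I (pball y N) R M" if N: "N \<ge> max N1 N2" for N
  proof -
    define R where "R t = complex_of_real (rad (int CARD('n) * N)) * (t powi (kord v) * \<eta> (ac \<pi> v))" for t
    have "admissible E (pole_bound I) (\<lambda>t. (complex_of_real (rad (int CARD('n) * N)) * \<eta> (ac \<pi> v)) * t powi (kord v))"
      by (intro admissible_cmult admissible_power_int E_0)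
    then have adm: "admissible E (pole_bound I) R" by (simp add: R_def[abs_def] mult_ac)
    have "geometric_at I (pball y N) R M"
      unfolding geometric_at_def
    proof (intro allI impI)
      fix \<omega> \<tau> assume ch: "convergent_char \<omega> \<tau>"
      then have \<omega>: "quasichar_data \<omega> \<tau> \<eta> c" by (simp add: convergent_char_def)
      then have \<tau>0: "\<tau> \<noteq> 0" by (simp add: quasichar_data_def)
      show "\<exists>C. \<forall>\<kappa>. (\<forall>a\<in>I. M \<le> \<kappa> a) \<longrightarrow>
         set_integrable \<mu> (translate (cone_points I \<kappa>) (pball y N)) (\<lambda>x. \<omega> (laurent_eval f x)) \<and>
         (LINT x:translate (cone_points I \<kappa>) (pball y N)|\<mu>. \<omega> (laurent_eval f x)) = (\<Prod>a\<in>I. ratio a \<tau> ^ \<kappa> a) * R \<tau> \<and>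
         (LINT x:translate (cone_points I \<kappa>) (pball y N)|\<mu>. norm (\<omega> (laurent_eval f x))) \<le> C * (\<Prod>a\<in>I. norm (ratio a \<tau>) ^ \<kappa> a)"
      proof (intro exI[of _ "rad (int CARD('n) * N) * (norm \<tau> powi (kord v) * norm (\<eta> (ac \<pi> v)))"] allI impI)
        fix \<kappa> assume k: "\<forall>a\<in>I. M \<le> \<kappa> a"
        let ?w = "cone_points I \<kappa>"
        let ?A = "translate ?w (pball y N)"
        define D where "D = pairing ?w m0"
        define v' where "v' = \<pi> powi D * v"
        have v'0: "v' \<noteq> 0" using v0 by (simp add: v'_def)
        have kv': "kord v' = D + kord v" unfolding v'_def using v0 by (subst kord_mult) simp_all
        have "ac \<pi> v' = v' * \<pi> powi (- (D + kord v))" by (simp only: ac_def kv')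
        also have "\<dots> = (\<pi> powi D * \<pi> powi (- (D + kord v))) * v" by (simp only: v'_def mult_ac)
        also have "\<dots> = ac \<pi> v" unfolding pi_powi_mult ac_def by (simp add: mult.commute)
        finally have acv': "ac \<pi> v' = ac \<pi> v" .
        have F: "vabs (laurent_eval f x - v') \<le> rad (int c) * vabs v'" if x: "x \<in> pdisc (twist ?w y) (vec N + ?w)" for x
        proof -
          define x' where "x' = twist (- ?w) x"
          have x': "x' \<in> pball y N" "x = twist ?w x'"
            using x unfolding translate_pball[symmetric] translate_def x'_def by simp_all
          have 1: "vabs (laurent_eval (face_part f m0 I) x' - v) \<le> rad (int c) * vabs v" using N1[of N x'] N x' by simp
          have "vabs (remainder I \<kappa> x') \<le> L * rad (int M)"
            by (rule L(2)[of N, OF _ k x'(1)]) (use N in simp)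
          then have 2: "vabs (remainder I \<kappa> x') \<le> rad (int c) * vabs v" using M by linarith
          have "laurent_eval f x - v' = \<pi> powi D * ((laurent_eval (face_part f m0 I) x' - v) + remainder I \<kappa> x')"
            unfolding x'(2) laurent_eval_twist D_def[symmetric] v'_def by (simp add: algebra_simps)
          then have "vabs (laurent_eval f x - v') = rad D * vabs ((laurent_eval (face_part f m0 I) x' - v) + remainder I \<kappa> x')"
            by (simp only: vabs_mult vabs_pi_powi)
          also have "\<dots> \<le> rad D * (rad (int c) * vabs v)"
            using vabs_add_le[OF 1 2] by (intro mult_left_mono) auto
          finally show ?thesis by (simp add: v'_def vabs_mult mult_ac)
        qed
        note near = integral_near[where F = "laurent_eval f" and y = "twist ?w y" and e = "vec N + ?w", OF \<omega> v'0 F, unfolded translate_pball[symmetric]]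
        have b: "measure \<mu> ?A * norm (\<tau> powi (D + kord v) * \<eta> (ac \<pi> v)) =
            measure \<mu> ?A * (norm \<tau> powi (D + kord v) * norm (\<eta> (ac \<pi> v)))"
          by (simp add: norm_mult norm_power_int)
        show "set_integrable \<mu> ?A (\<lambda>x. \<omega> (laurent_eval f x)) \<and>
         (LINT x:?A|\<mu>. \<omega> (laurent_eval f x)) = (\<Prod>a\<in>I. ratio a \<tau> ^ \<kappa> a) * R \<tau> \<and>
         (LINT x:?A|\<mu>. norm (\<omega> (laurent_eval f x))) \<le>
           rad (int CARD('n) * N) * (norm \<tau> powi (kord v) * norm (\<eta> (ac \<pi> v))) * (\<Prod>a\<in>I. norm (ratio a \<tau>) ^ \<kappa> a)"
        proof (intro conjI)
          show "set_integrable \<mu> ?A (\<lambda>x. \<omega> (laurent_eval f x))" by (rule near(1))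
          show "(LINT x:?A|\<mu>. \<omega> (laurent_eval f x)) = (\<Prod>a\<in>I. ratio a \<tau> ^ \<kappa> a) * R \<tau>"
          proof -
            have "(LINT x:?A|\<mu>. \<omega> (laurent_eval f x)) = measure \<mu> ?A *\<^sub>R (\<tau> powi (D + kord v) * \<eta> (ac \<pi> v))"
              using near(2) unfolding kv' acv' .
            then show ?thesis unfolding D_def scale_ratio[OF \<tau>0] R_def .
          qed
          show "(LINT x:?A|\<mu>. norm (\<omega> (laurent_eval f x))) \<le>
           rad (int CARD('n) * N) * (norm \<tau> powi (kord v) * norm (\<eta> (ac \<pi> v))) * (\<Prod>a\<in>I. norm (ratio a \<tau>) ^ \<kappa> a)"
          proof -
            have "(LINT x:?A|\<mu>. norm (\<omega> (laurent_eval f x))) =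
                measure \<mu> ?A * (norm \<tau> powi (D + kord v) * norm (\<eta> (ac \<pi> v)))"
              using near(3) unfolding kv' acv' b .
            then show ?thesis unfolding D_def scale_norm_ratio[OF \<tau>0] by (simp add: mult.commute)
          qed
        qed
      qed
    qed
    then show ?thesis using adm by blast
  qed
  then show ?thesis by blast
qed

text \<open>
  At a zero of the face polynomial the gradient is nonzero there, and its largest entry provides
  the direction in which \<open>f\<close> is a scaled isometry.
\<close>

lemma geometric_zero:
  assumes I: "I \<subseteq> S" and y: "y \<in> torus" and v: "laurent_eval (face_part f m0 I) y = 0" and card: "card I < CARD('n)"
  shows "\<exists>N0. \<forall>N\<ge>N0. \<exists>R M. admissible E (pole_bound I) R \<and> geometric_at I (pball y N) R M"
proof -
  define G where "G i = laurent_eval (laurent_partial i (face_part f m0 I)) y" for i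
  define g where "g = laurent_eval (face_part f m0 I)"
  have sd: "strict_deriv g y G" unfolding g_def G_def by (rule strict_deriv_laurent[OF y])
  obtain i0 where i0: "G i0 \<noteq> 0" using nondeg[OF I y v] by (auto simp: G_def)
  have "Max (range (\<lambda>i. vabs (G i))) \<in> range (\<lambda>i. vabs (G i))" by (rule Max_in) auto
  then obtain j where "Max (range (\<lambda>i. vabs (G i))) = vabs (G j)" by (rule rangeE)
  then have j: "vabs (G i) \<le> vabs (G j)" for i using Max_ge[of "range (\<lambda>i. vabs (G i))" "vabs (G i)"] by simp
  have "0 < vabs (G j)" using j[of i0] i0 vabs_pos_iff[of "G i0"] by linarith
  then have Gj: "G j \<noteq> 0" by simp
  define \<delta> where "\<delta> = kord (G j)"
  have G\<delta>: "vabs (G j) = rad \<delta>" "\<And>i. vabs (G i) \<le> rad \<delta>" using j vabs_kord[OF Gj] by (simp_all add: \<delta>_def)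
  \<comment> \<open>The accuracy is one power of \<open>q\<close> better than the largest entry of
    the gradient, so that in direction \<open>j\<close> the linear term strictly dominates the
    error.\<close>
  obtain N1 where N1: "\<And>N x z r. N \<ge> N1 \<Longrightarrow> x \<in> pball y N \<Longrightarrow> z \<in> pball y N \<Longrightarrow> (\<And>i. vabs (x $ i - z $ i) \<le> r) \<Longrightarrow>
    vabs (g x - g z - (\<Sum>i\<in>UNIV. G i * (x $ i - z $ i))) \<le> rad (\<delta> + 1) * r"
    using strict_derivE[OF sd, of "rad (\<delta> + 1)"] by auto
  obtain L N2 where L: "L > 0"
    "\<And>N \<kappa> M x. N \<ge> N2 \<Longrightarrow> \<forall>a\<in>I. M \<le> \<kappa> a \<Longrightarrow> x \<in> pball y N \<Longrightarrow> vabs (remainder I \<kappa> x) \<le> L * rad (int M)"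
    "\<And>N \<kappa> M x z r. N \<ge> N2 \<Longrightarrow> \<forall>a\<in>I. M \<le> \<kappa> a \<Longrightarrow> x \<in> pball y N \<Longrightarrow> z \<in> pball y N \<Longrightarrow>
       \<forall>i. vabs (x $ i - z $ i) \<le> r \<Longrightarrow> vabs (remainder I \<kappa> x - remainder I \<kappa> z) \<le> L * rad (int M) * r"
    by (rule remainder_bounds[OF I y]) (rule that; assumption)
  obtain N3 where N3: "\<And>N. N \<ge> N3 \<Longrightarrow> pball y N \<subseteq> torus"
  proof -
    obtain N3 where "\<And>N. N \<ge> N3 \<Longrightarrow> pball y N \<subseteq> level (\<chi> i. kord (y $ i))" using torus_pball[OF y] by blast
    then have "\<And>N. N \<ge> N3 \<Longrightarrow> pball y N \<subseteq> torus" using level_sub_torus by (rule order_trans)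
    then show ?thesis using that by blast
  qed
  have "\<exists>R M. admissible E (pole_bound I) R \<and> geometric_at I (pball y N) R M" if N: "N \<ge> max N1 (max N2 N3)" for N
  proof -
    have N': "N \<ge> N1" "N \<ge> N2" "N \<ge> N3" using N by simp_all
    \<comment> \<open>Two demands on the remainder: its Lipschitz constant must stay below the
      gradient, and its size must not exceed the radius \<open>rad (N + \<delta>)\<close> of the
      image.\<close>
    obtain M0 where M0: "\<And>M. M \<ge> M0 \<Longrightarrow> rad M < min (rad (\<delta> + 1)) (rad (N + \<delta>)) / L"
      using rad_arbitrarily_small[of "min (rad (\<delta> + 1)) (rad (N + \<delta>)) / L"] L(1) by auto
    define M where "M = nat M0"
    have "rad (int M) * L < min (rad (\<delta> + 1)) (rad (N + \<delta>))"
      using M0[of "int M"] L(1) by (simp add: M_def less_divide_eq)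
    then have M: "L * rad (int M) \<le> rad (\<delta> + 1)" "L * rad (int M) \<le> rad (N + \<delta>)" by (simp_all add: mult.commute)
    define R where "R t = complex_of_real (rad (int CARD('n) * N)) * (t powi (N + \<delta>) * (unit_mean \<eta> c / (1 - t / of_nat q)))" for t
    have "admissible E 1 (\<lambda>t. 1 / (1 - (1 / of_nat q) * t powi 1))"
    proof (rule admissible_geometric[OF E_0])
      show "(1 / of_nat q) * t powi 1 \<noteq> 1" if "t \<in> E" for t using that E_q q_ge_2 by auto
    qed (use q_ge_2 in auto)
    then have "admissible E (0 + 1) (\<lambda>t. (complex_of_real (rad (int CARD('n) * N)) * unit_mean \<eta> c * t powi (N + \<delta>)) *
        (1 / (1 - (1 / of_nat q) * t powi 1)))"
      by (intro admissible_mult admissible_cmult admissible_power_int E_0)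
    then have adm: "admissible E (pole_bound I) R" using card by (simp add: R_def[abs_def] pole_bound_def mult_ac)
    have "geometric_at I (pball y N) R M"
      unfolding geometric_at_def
    proof (intro allI impI)
      fix \<omega> \<tau> assume ch: "convergent_char \<omega> \<tau>"
      then have \<omega>: "quasichar_data \<omega> \<tau> \<eta> c" and \<tau>q: "norm \<tau> < real q" by (simp_all add: convergent_char_def)
      then have \<tau>0: "\<tau> \<noteq> 0" by (simp add: quasichar_data_def)
      define C where "C = rad (int CARD('n) * N) * (norm \<tau> powi (N + \<delta>) * (unit_norm_mean \<eta> c / (1 - norm \<tau> / q)))"
      show "\<exists>C. \<forall>\<kappa>. (\<forall>a\<in>I. M \<le> \<kappa> a) \<longrightarrow>
         set_integrable \<mu> (translate (cone_points I \<kappa>) (pball y N)) (\<lambda>x. \<omega> (laurent_eval f x)) \<and>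
         (LINT x:translate (cone_points I \<kappa>) (pball y N)|\<mu>. \<omega> (laurent_eval f x)) = (\<Prod>a\<in>I. ratio a \<tau> ^ \<kappa> a) * R \<tau> \<and>
         (LINT x:translate (cone_points I \<kappa>) (pball y N)|\<mu>. norm (\<omega> (laurent_eval f x))) \<le> C * (\<Prod>a\<in>I. norm (ratio a \<tau>) ^ \<kappa> a)"
      proof (intro exI[of _ C] allI impI)
        fix \<kappa> assume k: "\<forall>a\<in>I. M \<le> \<kappa> a"
        let ?w = "cone_points I \<kappa>"
        let ?A = "translate ?w (pball y N)"
        let ?P = "pdisc (twist ?w y) (vec N + ?w)"
        define D where "D = pairing ?w m0"
        \<comment> \<open>The scaling exponent in the original variables: \<open>D\<close> from the
          extracted power of \<open>\<pi>\<close>, \<open>\<delta>\<close> from the gradient, and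
          \<open>- ?w $ j\<close> because a step \<open>h\<close> in coordinate \<open>j\<close> is
          \<open>\<pi> powi (- ?w $ j) * h\<close> after the substitution.\<close>
        define \<rho> where "\<rho> = D + \<delta> - ?w $ j"
        have s: "\<rho> + (vec N + ?w) $ j = D + (N + \<delta>)" by (simp add: \<rho>_def)
        have P: "x \<in> ?P \<longleftrightarrow> twist (- ?w) x \<in> pball y N" for x
          unfolding translate_pball[symmetric] translate_def by simp
        have P_torus: "?P \<subseteq> torus"
        proof
          fix x assume "x \<in> ?P"
          then have "twist (- ?w) x \<in> torus" using P N3[OF N'(3)] by blast
          then show "x \<in> torus" by simp
        qed
        have meas: "{x \<in> ?P. vabs (laurent_eval f x - b) \<le> rad k} \<in> sets borel" for b k
          by (rule borel_open[OF fibre_open[OF P_torus]])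
        have expand: "laurent_eval f x = \<pi> powi D * (g (twist (- ?w) x) + remainder I \<kappa> (twist (- ?w) x))" for x
          using laurent_eval_twist[of I \<kappa> "twist (- ?w) x"] by (simp add: D_def g_def)
        have line: "vabs (laurent_eval f (x + axis j h) - laurent_eval f x) = rad \<rho> * vabs h"
          if x: "x \<in> ?P" and h: "vabs h \<le> rad ((vec N + ?w) $ j)" for x h
        proof (cases "h = 0")
          case True
          have e: "x + axis j h = x" using True by (simp add: axis_def vec_eq_iff)
          show ?thesis unfolding e using True by simp
        next
          case False
          define x' where "x' = twist (- ?w) x"
          define h' where "h' = \<pi> powi (- (?w $ j)) * h"
          define z where "z = twist (- ?w) (x + axis j h)"
          have z_eq: "z = x' + axis j h'"
            unfolding z_def x'_def h'_def by (simp add: twist_def vec_eq_iff axis_def algebra_simps)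
          have vh': "vabs h' = rad (- (?w $ j)) * vabs h" by (simp only: h'_def vabs_mult vabs_pi_powi)
          have "vabs h' \<le> rad (- (?w $ j)) * rad ((vec N + ?w) $ j)" unfolding vh' using h by (intro mult_left_mono) auto
          also have "\<dots> = rad N" by (simp flip: rad_add)
          finally have h'N: "vabs h' \<le> rad N" .
          have h'0: "vabs h' > 0" using False by (simp add: h'_def)
          have x': "x' \<in> pball y N" using x P by (simp add: x'_def)
          have z: "z \<in> pball y N"
            unfolding pdisc_def
          proof (intro CollectI allI)
            fix i
            have "vabs (x' $ i - y $ i) \<le> rad N" using x' by (simp add: pdisc_def)
            moreover have "vabs (axis j h' $ i) \<le> rad N" using h'N by (simp add: axis_def)
            ultimately have "vabs ((x' $ i - y $ i) + axis j h' $ i) \<le> rad N" by (rule vabs_add_le)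
            then show "vabs (z $ i - y $ i) \<le> rad (vec N $ i)" by (simp add: z_eq algebra_simps)
          qed
          have d: "vabs (z $ i - x' $ i) \<le> vabs h'" for i by (simp add: z_eq axis_def)
          have sum: "(\<Sum>i\<in>UNIV. G i * (z $ i - x' $ i)) = G j * h'"
            by (simp add: z_eq axis_def if_distrib[of "\<lambda>a. _ * a"] cong: if_cong)
          have e1: "vabs (g z - g x' - G j * h') \<le> rad (\<delta> + 1) * vabs h'"
            using N1[OF N'(1) z x' d] unfolding sum .
          have "vabs (remainder I \<kappa> z - remainder I \<kappa> x') \<le> L * rad (int M) * vabs h'"
            by (rule L(3)[OF N'(2) k z x']) (use d in blast)
          also have "\<dots> \<le> rad (\<delta> + 1) * vabs h'" using M(1) by (rule mult_right_mono) simp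
          finally have e2: "vabs (remainder I \<kappa> z - remainder I \<kappa> x') \<le> rad (\<delta> + 1) * vabs h'" .
          let ?T = "(g z + remainder I \<kappa> z) - (g x' + remainder I \<kappa> x')"
          have "?T - G j * h' = (g z - g x' - G j * h') + (remainder I \<kappa> z - remainder I \<kappa> x')" by simp
          then have "vabs (?T - G j * h') \<le> rad (\<delta> + 1) * vabs h'" using vabs_add_le[OF e1 e2] by (simp only:)
          also have "\<dots> < rad \<delta> * vabs h'" using h'0 by (intro mult_strict_right_mono) auto
          also have "\<dots> = vabs (G j * h')" by (simp add: vabs_mult G\<delta>)
          finally have "vabs ?T = vabs (G j * h')" by (rule vabs_dominant)
          moreover have "laurent_eval f (x + axis j h) - laurent_eval f x = \<pi> powi D * ?T"
            unfolding expand z_def[symmetric] x'_def[symmetric] by (simp only: right_diff_distrib)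
          ultimately have "vabs (laurent_eval f (x + axis j h) - laurent_eval f x) = rad D * (rad \<delta> * vabs h')"
            by (simp only: vabs_mult vabs_pi_powi G\<delta>(1))
          also have "\<dots> = rad \<rho> * vabs h"
            unfolding vh' \<rho>_def by (simp add: rad_diff rad_add rad_minus)
          finally show ?thesis .
        qed
        \<comment> \<open>The linear estimate is taken from the centre \<open>y\<close>, where the
          face polynomial vanishes; hence the image lies in a ball around 0.\<close>
        have bound: "vabs (laurent_eval f x) \<le> rad (\<rho> + (vec N + ?w) $ j)" if x: "x \<in> ?P" for x
        proof -
          define x' where "x' = twist (- ?w) x"
          have x': "x' \<in> pball y N" using x P by (simp add: x'_def)
          have d: "vabs (x' $ i - y $ i) \<le> rad N" for i using x' by (simp add: pdisc_def)
          have "vabs (g x' - g y - (\<Sum>i\<in>UNIV. G i * (x' $ i - y $ i))) \<le> rad (\<delta> + 1) * rad N"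
            by (rule N1[OF N'(1) x' pdisc_self d])
          also have "\<dots> \<le> rad \<delta> * rad N" by (intro mult_right_mono) auto
          finally have 1: "vabs (g x' - g y - (\<Sum>i\<in>UNIV. G i * (x' $ i - y $ i))) \<le> rad \<delta> * rad N" .
          have 2: "vabs (\<Sum>i\<in>UNIV. G i * (x' $ i - y $ i)) \<le> rad \<delta> * rad N"
            by (rule vabs_linear_le) (use G\<delta> d in auto)
          have "g y = 0" using v by (simp add: g_def)
          then have "vabs (g x') \<le> rad (N + \<delta>)" using vabs_add_le[OF 1 2] by (simp add: rad_add mult.commute)
          moreover have "vabs (remainder I \<kappa> x') \<le> rad (N + \<delta>)"
            using L(2)[OF N'(2) k x'] M(2) by linarith
          ultimately have "vabs (g x' + remainder I \<kappa> x') \<le> rad (N + \<delta>)" by (rule vabs_add_le)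
          then have "rad D * vabs (g x' + remainder I \<kappa> x') \<le> rad D * rad (N + \<delta>)" by (rule mult_left_mono) simp
          then show ?thesis unfolding s expand x'_def[symmetric] by (simp add: vabs_mult rad_add)
        qed
        note fib = integral_fibred[where F = "laurent_eval f" and y = "twist ?w y" and e = "vec N + ?w" and j = j, OF \<omega> \<tau>q meas line bound, unfolded s translate_pball[symmetric]]
        show "set_integrable \<mu> ?A (\<lambda>x. \<omega> (laurent_eval f x)) \<and>
         (LINT x:?A|\<mu>. \<omega> (laurent_eval f x)) = (\<Prod>a\<in>I. ratio a \<tau> ^ \<kappa> a) * R \<tau> \<and>
         (LINT x:?A|\<mu>. norm (\<omega> (laurent_eval f x))) \<le> C * (\<Prod>a\<in>I. norm (ratio a \<tau>) ^ \<kappa> a)"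
        proof (intro conjI)
          show "set_integrable \<mu> ?A (\<lambda>x. \<omega> (laurent_eval f x))" by (rule fib(1))
          have "(LINT x:?A|\<mu>. \<omega> (laurent_eval f x)) =
              measure \<mu> ?A *\<^sub>R (\<tau> powi (D + (N + \<delta>)) * (unit_mean \<eta> c / (1 - \<tau> / of_nat q)))"
            using fib(2) by (simp add: scaleR_conv_of_real)
          then show "(LINT x:?A|\<mu>. \<omega> (laurent_eval f x)) = (\<Prod>a\<in>I. ratio a \<tau> ^ \<kappa> a) * R \<tau>"
            unfolding D_def scale_ratio[OF \<tau>0] R_def .
          have "(LINT x:?A|\<mu>. norm (\<omega> (laurent_eval f x))) \<le>
              measure \<mu> ?A * (norm \<tau> powi (D + (N + \<delta>)) * (unit_norm_mean \<eta> c / (1 - norm \<tau> / q)))"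
            using fib(3) by simp
          then show "(LINT x:?A|\<mu>. norm (\<omega> (laurent_eval f x))) \<le> C * (\<Prod>a\<in>I. norm (ratio a \<tau>) ^ \<kappa> a)"
            unfolding D_def scale_norm_ratio[OF \<tau>0] C_def by (simp add: mult.commute)
        qed
      qed
    qed
    then show ?thesis using adm by blast
  qed
  then show ?thesis by blast
qed

lemma face_monomial_nonzero:
  assumes I: "I \<subseteq> S" and card: "card I = CARD('n)" and y: "y \<in> torus"
  shows "laurent_eval (face_part f m0 I) y \<noteq> 0"
proof -
  have "m = m0" if "\<forall>a\<in>I. pairing a m = pairing a m0" for m
    by (rule separating[OF I card]) (use that in blast)
  then have "{m \<in> Poly_Mapping.keys f. \<forall>a\<in>I. pairing a m = pairing a m0} = {m0}" using m0 by auto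
  then have "face_part f m0 I = Poly_Mapping.single m0 (Poly_Mapping.lookup f m0)" by (simp add: face_part_def)
  then show ?thesis using m0 monomial_nonzero[OF y, of m0] by (simp add: laurent_eval_single in_keys_iff)
qed

lemma scaled_local:
  assumes I: "I \<subseteq> S" and y: "y \<in> torus"
  shows "\<exists>N0. \<forall>N\<ge>N0. scaled I (pball y N)"
proof -
  have "card I \<le> CARD('n)" using card_mono[OF finite_S I] card_S by simp
  then have "\<exists>N0. \<forall>N\<ge>N0. \<exists>R M. admissible E (pole_bound I) R \<and> geometric_at I (pball y N) R M"
    using geometric_nonzero[OF I y] geometric_zero[OF I y] face_monomial_nonzero[OF I _ y] le_neq_implies_less by blast
  then obtain N0 where N0: "\<And>N. N \<ge> N0 \<Longrightarrow> \<exists>R M. admissible E (pole_bound I) R \<and> geometric_at I (pball y N) R M" by blast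
  obtain \<phi>0 N1 M1 where phi: "\<And>N \<kappa> x. N \<ge> N1 \<Longrightarrow> \<forall>a\<in>I. M1 \<le> \<kappa> a \<Longrightarrow>
    x \<in> translate (cone_points I \<kappa>) (pball y N) \<Longrightarrow> \<Phi> x = \<phi>0"
    by (rule \<Phi>_eventually_constant[OF I, of y]) (rule that; assumption)
  obtain N2 where N2: "\<And>N. N \<ge> N2 \<Longrightarrow> pball y N \<subseteq> level (\<chi> i. kord (y $ i))" using torus_pball[OF y] by blast
  have "scaled I (pball y N)" if N: "N \<ge> max N0 (max N1 N2)" for N
  proof -
    obtain R M where RM: "admissible E (pole_bound I) R" "geometric_at I (pball y N) R M" using N0[of N] N by auto
    have N': "N \<ge> N1" "N \<ge> N2" using N by simp_all
    have "pball y N \<subseteq> torus" using N2[OF N'(2)] level_sub_torus by (rule order_trans)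
    then show ?thesis
      by (rule scaled_pballI[OF _ phi[OF N'(1)] RM(2,1)])
  qed
  then show ?thesis by blast
qed

text \<open>Near a point of the torus small balls lie in a single level; near a point with a zero
  coordinate they miss the given level. The thresholds differ from ball to ball, and the descent
  merges them through finite unions.\<close>

lemma scaled_level:
  assumes I: "I \<subseteq> S" shows "scaled I (level k)"
proof -
  \<comment> \<open>Makes the ball of exponent \<open>- N'\<close> around 0, where the descent
    starts, contain the whole level.\<close>
  obtain N' where N': "\<And>i. - (k $ i) < N'" using int_upper_bound[of "\<lambda>i. - (k $ i)"] by blast
  have "scaled I (pball 0 (- N') \<inter> level k)"
  proof (rule pball_induct[where R = "\<lambda>B. scaled I (B \<inter> level k)"])
    fix y :: "'k ^ 'n" and N
    assume IH: "\<And>z. z \<in> pball y N \<Longrightarrow> scaled I (pball z (N + 1) \<inter> level k)"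
    obtain P where P: "finite P" "\<Union>P = pball y N" "disjoint P"
      "\<And>B. B \<in> P \<Longrightarrow> \<exists>z\<in>pball y N. B = pball z (N + 1)" by (rule pball_partition[of y N]) blast
    have "scaled I (\<Union>P \<inter> level k)"
    proof (rule scaled_Union[OF P(1,3)])
      fix B assume "B \<in> P"
      then obtain z where "z \<in> pball y N" "B = pball z (N + 1)" using P(4) by blast
      then show "scaled I (B \<inter> level k)" using IH by simp
    qed
    then show "scaled I (pball y N \<inter> level k)" unfolding P(2) .
  next
    fix y :: "'k ^ 'n"
    show "\<exists>M. \<forall>N\<ge>M. scaled I (pball y N \<inter> level k)"
    proof (cases "y \<in> torus")
      case True
      obtain N2 where N2: "\<And>N. N \<ge> N2 \<Longrightarrow> pball y N \<subseteq> level (\<chi> i. kord (y $ i))" using torus_pball[OF True] by blast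
      obtain N0 where N0: "\<And>N. N \<ge> N0 \<Longrightarrow> scaled I (pball y N)" using scaled_local[OF I True] by blast
      have "scaled I (pball y N \<inter> level k)" if N: "N \<ge> max N0 N2" for N
      proof (cases "k = (\<chi> i. kord (y $ i))")
        case True
        then have "pball y N \<inter> level k = pball y N" using N2[of N] N by auto
        then show ?thesis using N0[of N] N by simp
      next
        case False
        have N': "N \<ge> N2" using N by simp
        have "k = (\<chi> i. kord (y $ i))" if "x \<in> pball y N" "x \<in> level k" for x
          using level_disjoint[OF that(2)] N2[OF N'] that(1) by blast
        then have "pball y N \<inter> level k = {}" using False by blast
        then show ?thesis by (simp add: scaled_empty)
      qed
      then show ?thesis by blast
    next
      case False
      then obtain i where i: "y $ i = 0" by (auto simp: torus_def)
      have "scaled I (pball y N \<inter> level k)" if N: "N \<ge> k $ i + 1" for N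
      proof -
        have False if x: "x \<in> pball y N" "x \<in> level k" for x
        proof -
          have "vabs (x $ i) \<le> rad N" using x(1) i by (auto simp: pdisc_def dest: spec[of _ i])
          moreover have "vabs (x $ i) = rad (k $ i)" using x(2) vabs_kord[of "x $ i"] by (simp add: level_def torus_def)
          ultimately show False using N by simp
        qed
        then have "pball y N \<inter> level k = {}" by blast
        then show ?thesis by (simp add: scaled_empty)
      qed
      then show ?thesis by blast
    qed
  qed
  moreover have "level k \<subseteq> pball 0 (- N')"
  proof
    fix x assume x: "x \<in> level k"
    have "vabs (x $ i) \<le> rad (- N')" for i
    proof -
      have "vabs (x $ i) = rad (k $ i)" using x vabs_kord[of "x $ i"] by (simp add: level_def torus_def)
      then show ?thesis using N'[of i] by simp
    qed
    then show "x \<in> pball 0 (- N')" by (simp add: pdisc_def)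
  qed
  ultimately show ?thesis by (simp add: Int_absorb1)
qed

subsection \<open>Summation over boxes of the cone\<close>

text \<open>The intermediate stages of an iterated summation: coefficients in \<open>I\<close> run
  upwards from \<open>m\<close>, the others are frozen.\<close>

definition box :: "int ^ 'n \<Rightarrow> (int ^ 'n) set \<Rightarrow> (int ^ 'n \<Rightarrow> nat) \<Rightarrow> (int ^ 'n \<Rightarrow> nat) \<Rightarrow> ('k ^ 'n) set" where
  "box k0 I \<kappa> m = (\<Union>\<kappa>'\<in>{\<kappa>'. (\<forall>a. a \<notin> I \<longrightarrow> \<kappa>' a = \<kappa> a) \<and> (\<forall>a\<in>I. m a \<le> \<kappa>' a)}. level (k0 + cone_points S \<kappa>'))"

lemma open_box: "open (box k0 I \<kappa> m)"
  unfolding box_def by (intro open_UN ballI open_level)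

lemma box_empty: "box k0 {} \<kappa> m = level (k0 + cone_points S \<kappa>)"
proof -
  have "{\<kappa>'. (\<forall>a. a \<notin> {} \<longrightarrow> \<kappa>' a = \<kappa> a) \<and> (\<forall>a\<in>{}. m a \<le> \<kappa>' a)} = {\<kappa>}" by auto
  then show ?thesis unfolding box_def by (simp only: UN_insert UN_empty Un_empty_right)
qed

lemma level_inj:
  assumes "x \<in> level (k0 + cone_points S \<kappa>)" "x \<in> level (k0 + cone_points S \<kappa>')" "a \<in> S"
  shows "\<kappa> a = \<kappa>' a"
proof -
  have "k0 + cone_points S \<kappa> = k0 + cone_points S \<kappa>'" by (rule level_disjoint[OF assms(1,2)])
  then have "cone_points S \<kappa> = cone_points S \<kappa>'" by simp
  then show ?thesis by (rule injective) (rule assms(3))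
qed

lemma box_insert:
  assumes b: "b \<notin> J"
  shows "box k0 (insert b J) \<kappa> m = (\<Union>l. box k0 J (\<kappa>(b := m b + l)) m)"
proof
  show "box k0 (insert b J) \<kappa> m \<subseteq> (\<Union>l. box k0 J (\<kappa>(b := m b + l)) m)"
  proof
    fix x assume "x \<in> box k0 (insert b J) \<kappa> m"
    then obtain \<kappa>' where k: "\<forall>a. a \<notin> insert b J \<longrightarrow> \<kappa>' a = \<kappa> a" "\<forall>a\<in>insert b J. m a \<le> \<kappa>' a"
      "x \<in> level (k0 + cone_points S \<kappa>')" unfolding box_def by blast
    have "\<kappa>' b = m b + (\<kappa>' b - m b)" using k(2) by simp
    then have "\<forall>a. a \<notin> J \<longrightarrow> \<kappa>' a = (\<kappa>(b := m b + (\<kappa>' b - m b))) a" using k(1) by auto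
    then have "x \<in> box k0 J (\<kappa>(b := m b + (\<kappa>' b - m b))) m" unfolding box_def using k(2,3) by blast
    then show "x \<in> (\<Union>l. box k0 J (\<kappa>(b := m b + l)) m)" by blast
  qed
  show "(\<Union>l. box k0 J (\<kappa>(b := m b + l)) m) \<subseteq> box k0 (insert b J) \<kappa> m"
  proof
    fix x assume "x \<in> (\<Union>l. box k0 J (\<kappa>(b := m b + l)) m)"
    then obtain l where "x \<in> box k0 J (\<kappa>(b := m b + l)) m" by blast
    then obtain \<kappa>' where k: "\<forall>a. a \<notin> J \<longrightarrow> \<kappa>' a = (\<kappa>(b := m b + l)) a" "\<forall>a\<in>J. m a \<le> \<kappa>' a"
      "x \<in> level (k0 + cone_points S \<kappa>')" unfolding box_def by blast
    have "\<kappa>' b = m b + l" using k(1) b by simp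
    then have "\<forall>a\<in>insert b J. m a \<le> \<kappa>' a" using k(2) by simp
    moreover have "\<forall>a. a \<notin> insert b J \<longrightarrow> \<kappa>' a = \<kappa> a" using k(1) by simp
    ultimately show "x \<in> box k0 (insert b J) \<kappa> m" unfolding box_def using k(3) by blast
  qed
qed

lemma box_disjoint:
  assumes b: "b \<in> S" "b \<notin> J" and x: "x \<in> box k0 J \<kappa> m" "x \<in> box k0 J \<kappa>' m"
  shows "\<kappa> b = \<kappa>' b"
proof -
  obtain l where l: "\<forall>a. a \<notin> J \<longrightarrow> l a = \<kappa> a" "x \<in> level (k0 + cone_points S l)" using x(1) unfolding box_def by blast
  obtain l' where l': "\<forall>a. a \<notin> J \<longrightarrow> l' a = \<kappa>' a" "x \<in> level (k0 + cone_points S l')" using x(2) unfolding box_def by blast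
  have "l b = l' b" by (rule level_inj[OF l(2) l'(2) b(1)])
  then show ?thesis using l(1) l'(1) b(2) by simp
qed

text \<open>The coordinates in \<open>J\<close> are summed one at a time, each replacing a power of
  its ratio \<open>z\<close> by \<open>z ^ m b / (1 - z)\<close>. The bound on norms is carried
  along because the next summation requires it.\<close>

lemma geometric_box:
  assumes ch: "convergent_char \<omega> \<tau>" and I: "I \<subseteq> S" and J: "J \<subseteq> I"
    and base: "\<And>\<kappa>'. \<forall>a. a \<notin> I \<longrightarrow> \<kappa>' a = u a \<Longrightarrow> \<forall>a\<in>I. m a \<le> \<kappa>' a \<Longrightarrow>
      set_integrable \<mu> (level (k0 + cone_points S \<kappa>')) (integrand \<omega>) \<and>
      (LINT x:level (k0 + cone_points S \<kappa>')|\<mu>. integrand \<omega> x) = c0 * (\<Prod>a\<in>I. ratio a \<tau> ^ \<kappa>' a) \<and>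
      (LINT x:level (k0 + cone_points S \<kappa>')|\<mu>. norm (integrand \<omega> x)) \<le> C * (\<Prod>a\<in>I. norm (ratio a \<tau>) ^ \<kappa>' a)"
    and \<kappa>: "\<forall>a. a \<notin> I \<longrightarrow> \<kappa> a = u a" "\<forall>a\<in>I. m a \<le> \<kappa> a"
  shows "set_integrable \<mu> (box k0 J \<kappa> m) (integrand \<omega>) \<and>
      (LINT x:box k0 J \<kappa> m|\<mu>. integrand \<omega> x) =
         c0 * (\<Prod>a\<in>I - J. ratio a \<tau> ^ \<kappa> a) * (\<Prod>a\<in>J. ratio a \<tau> ^ m a / (1 - ratio a \<tau>)) \<and>
      (LINT x:box k0 J \<kappa> m|\<mu>. norm (integrand \<omega> x)) \<le>
         C * (\<Prod>a\<in>I - J. norm (ratio a \<tau>) ^ \<kappa> a) * (\<Prod>a\<in>J. norm (ratio a \<tau>) ^ m a / (1 - norm (ratio a \<tau>)))"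
proof -
  have finI: "finite I" using I finite_S finite_subset by blast
  have "finite J" using J finI finite_subset by blast
  then show ?thesis using J \<kappa>
  proof (induction J arbitrary: \<kappa>)
    case empty
    then show ?case unfolding box_empty using base[of \<kappa>] by simp
  next
    case (insert b J)
    define B where "B l = box k0 J (\<kappa>(b := m b + l)) m" for l
    have bI: "b \<in> I" and bS: "b \<in> S" and bJ: "b \<notin> J" and JI: "J \<subseteq> I" using insert.prems insert.hyps I by blast+
    define z where "z = ratio b \<tau>"
    have z: "norm z < 1" using ch bS by (simp add: convergent_char_def z_def)
    have IH: "set_integrable \<mu> (B l) (integrand \<omega>) \<and>
      (LINT x:B l|\<mu>. integrand \<omega> x) =
         c0 * (\<Prod>a\<in>I - J. ratio a \<tau> ^ (\<kappa>(b := m b + l)) a) * (\<Prod>a\<in>J. ratio a \<tau> ^ m a / (1 - ratio a \<tau>)) \<and>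
      (LINT x:B l|\<mu>. norm (integrand \<omega> x)) \<le>
         C * (\<Prod>a\<in>I - J. norm (ratio a \<tau>) ^ (\<kappa>(b := m b + l)) a) * (\<Prod>a\<in>J. norm (ratio a \<tau>) ^ m a / (1 - norm (ratio a \<tau>)))"
      for l
      unfolding B_def
    proof (rule insert.IH[OF JI])
      show "\<forall>a. a \<notin> I \<longrightarrow> (\<kappa>(b := m b + l)) a = u a" using insert.prems(2) bI by auto
      show "\<forall>a\<in>I. m a \<le> (\<kappa>(b := m b + l)) a" using insert.prems(3) by simp
    qed
    have split: "(\<Prod>a\<in>I - J. h a ^ (\<kappa>(b := m b + l)) a) = h b ^ (m b + l) * (\<Prod>a\<in>I - insert b J. h a ^ \<kappa> a)"
      for h :: "int ^ 'n \<Rightarrow> 'b::comm_semiring_1" and l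
    proof -
      have "(\<Prod>a\<in>I - J. h a ^ (\<kappa>(b := m b + l)) a) =
          h b ^ (\<kappa>(b := m b + l)) b * (\<Prod>a\<in>I - J - {b}. h a ^ (\<kappa>(b := m b + l)) a)"
        by (rule prod.remove) (use finI bI bJ in auto)
      also have "\<dots> = h b ^ (m b + l) * (\<Prod>a\<in>I - insert b J. h a ^ (\<kappa>(b := m b + l)) a)"
        by (simp add: Diff_insert[symmetric])
      also have "(\<Prod>a\<in>I - insert b J. h a ^ (\<kappa>(b := m b + l)) a) = (\<Prod>a\<in>I - insert b J. h a ^ \<kappa> a)"
        by (intro prod.cong) auto
      finally show ?thesis .
    qed
    define p where "p = (\<Prod>a\<in>I - insert b J. ratio a \<tau> ^ \<kappa> a)"
    define p' where "p' = (\<Prod>a\<in>I - insert b J. norm (ratio a \<tau>) ^ \<kappa> a)"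
    define s where "s = (\<Prod>a\<in>J. ratio a \<tau> ^ m a / (1 - ratio a \<tau>))"
    define s' where "s' = (\<Prod>a\<in>J. norm (ratio a \<tau>) ^ m a / (1 - norm (ratio a \<tau>)))"
    have int: "set_integrable \<mu> (B l) (integrand \<omega>)" for l using IH by blast
    have val: "(LINT x:B l|\<mu>. integrand \<omega> x) = (c0 * p * s * z ^ m b) * z ^ l" for l
    proof -
      have "(LINT x:B l|\<mu>. integrand \<omega> x) = c0 * (z ^ (m b + l) * p) * s"
        using IH[of l] unfolding split p_def s_def z_def by blast
      then show ?thesis by (simp add: power_add mult_ac)
    qed
    have bnd: "(LINT x:B l|\<mu>. norm (integrand \<omega> x)) \<le> (C * p' * s' * norm z ^ m b) * norm z ^ l" for l
    proof -
      have "(LINT x:B l|\<mu>. norm (integrand \<omega> x)) \<le> C * (norm z ^ (m b + l) * p') * s'"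
        using IH[of l] unfolding split p'_def s'_def z_def by blast
      then show ?thesis by (simp add: power_add mult_ac)
    qed
    have disj: "disjoint_family B"
      unfolding disjoint_family_on_def
    proof (intro ballI impI)
      fix l l' :: nat assume "l \<noteq> l'"
      have "l = l'" if "x \<in> B l" "x \<in> B l'" for x
        using box_disjoint[OF bS bJ that[unfolded B_def]] by simp
      then show "B l \<inter> B l' = {}" using \<open>l \<noteq> l'\<close> by blast
    qed
    have sets: "B l \<in> sets \<mu>" for l unfolding B_def using borel_open[OF open_box] by simp
    have U: "box k0 (insert b J) \<kappa> m = (\<Union>l. B l)" unfolding B_def by (rule box_insert[OF bJ])
    note geo = set_integral_geometric_union[OF disj sets int val bnd norm_ge_zero z z, folded U]
    have pr: "(\<Prod>a\<in>insert b J. ratio a \<tau> ^ m a / (1 - ratio a \<tau>)) = z ^ m b / (1 - z) * s"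
      "(\<Prod>a\<in>insert b J. norm (ratio a \<tau>) ^ m a / (1 - norm (ratio a \<tau>))) = norm z ^ m b / (1 - norm z) * s'"
      using insert.hyps by (simp_all add: z_def s_def s'_def)
    have "(LINT x:box k0 (insert b J) \<kappa> m|\<mu>. integrand \<omega> x) = c0 * p * (z ^ m b / (1 - z) * s)"
      using geo(2) by (simp add: mult_ac)
    moreover have "(LINT x:box k0 (insert b J) \<kappa> m|\<mu>. norm (integrand \<omega> x)) \<le> C * p' * (norm z ^ m b / (1 - norm z) * s')"
      using geo(3) by (simp add: mult_ac)
    ultimately show ?case unfolding pr p_def[symmetric] p'_def[symmetric] using geo(1) by blast
  qed
qed

definition computed :: "('k ^ 'n) set \<Rightarrow> bool" where
  "computed A \<longleftrightarrow> (\<exists>R. admissible E CARD('n) R \<and> (\<forall>\<omega> \<tau>. convergent_char \<omega> \<tau> \<longrightarrow>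
     set_integrable \<mu> A (integrand \<omega>) \<and> (LINT x:A|\<mu>. integrand \<omega> x) = R \<tau>))"

lemma computed_Un:
  assumes "computed A" "computed B" "A \<inter> B = {}" "A \<in> sets \<mu>" "B \<in> sets \<mu>"
  shows "computed (A \<union> B)"
proof -
  obtain R where R: "admissible E CARD('n) R" "\<And>\<omega> \<tau>. convergent_char \<omega> \<tau> \<Longrightarrow>
     set_integrable \<mu> A (integrand \<omega>) \<and> (LINT x:A|\<mu>. integrand \<omega> x) = R \<tau>"
    using assms(1) unfolding computed_def by blast
  obtain R' where R': "admissible E CARD('n) R'" "\<And>\<omega> \<tau>. convergent_char \<omega> \<tau> \<Longrightarrow>
     set_integrable \<mu> B (integrand \<omega>) \<and> (LINT x:B|\<mu>. integrand \<omega> x) = R' \<tau>"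
    using assms(2) unfolding computed_def by blast
  have "set_integrable \<mu> (A \<union> B) (integrand \<omega>) \<and> (LINT x:A \<union> B|\<mu>. integrand \<omega> x) = R \<tau> + R' \<tau>"
    if ch: "convergent_char \<omega> \<tau>" for \<omega> \<tau>
  proof -
    have i: "set_integrable \<mu> A (integrand \<omega>)" "set_integrable \<mu> B (integrand \<omega>)" using R(2)[OF ch] R'(2)[OF ch] by blast+
    show ?thesis
      using set_integrable_Un[OF i assms(4,5)] set_integral_Un[OF assms(3) i] R(2)[OF ch] R'(2)[OF ch] by simp
  qed
  then show ?thesis unfolding computed_def using admissible_add[OF R(1) R'(1)] by blast
qed

lemma admissible_ratio:
  assumes a: "a \<in> S"
  shows "admissible E 1 (\<lambda>t. ratio a t ^ k / (1 - ratio a t))"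
proof -
  have w: "0 < rad (vec_weight a)" "rad (vec_weight a) < 1" using S_weight[OF a] by simp_all
  have "admissible E 1 (\<lambda>t. 1 / (1 - complex_of_real (rad (vec_weight a)) * t powi (pairing a m0)))"
  proof (rule admissible_geometric[OF E_0])
    show "complex_of_real (rad (vec_weight a)) \<noteq> 0" using w(1) by simp
    show "complex_of_real (rad (vec_weight a)) \<noteq> 1" using w(2) by (metis less_irrefl of_real_eq_1_iff)
    show "complex_of_real (rad (vec_weight a)) * t powi (pairing a m0) \<noteq> 1" if "t \<in> E" for t
      by (rule E_S[OF that a])
  qed
  then have 1: "admissible E 1 (\<lambda>t. 1 / (1 - ratio a t))" by (simp add: ratio_def)
  have "admissible E 0 (\<lambda>t. ratio a t ^ k)"
    unfolding ratio_def by (intro admissible_power admissible_cmult admissible_power_int E_0)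
  from admissible_mult[OF this 1] show ?thesis by simp
qed

lemma cone_points_split: "I \<subseteq> S \<Longrightarrow> cone_points S \<kappa> = cone_points (S - I) \<kappa> + cone_points I \<kappa>"
  unfolding cone_points_def using finite_S by (simp add: sum.subset_diff)

text \<open>
  Boxes far out on \<open>I\<close> are geometric series; the others are reached by lowering one bound at a
  time, which splits off a box with fewer free coordinates.
\<close>

lemma computed_box:
  assumes I: "I \<subseteq> S" shows "computed (box k0 I \<kappa> m)"
  using I
proof (induction "card I" arbitrary: I \<kappa> m rule: less_induct)
  case less
  note I = less.prems
  have finI: "finite I" using I finite_S finite_subset by blast
  define k where "k = k0 + cone_points (S - I) \<kappa>"
  obtain R0 M where R0: "admissible E (pole_bound I) R0" "scaled_by I (level k) R0 M"
    using scaled_level[OF I, of k] unfolding scaled_def by blast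
  have far: "computed (box k0 I \<kappa> m)" if m: "\<forall>a\<in>I. M \<le> m a" for m
  proof -
    \<comment> \<open>The \<open>card I\<close> geometric series and the \<open>pole_bound\<close>
      of the level together give a pole order of at most \<open>CARD('n)\<close>.\<close>
    define R where "R t = R0 t * (\<Prod>a\<in>I. ratio a t ^ m a / (1 - ratio a t))" for t
    have "admissible E (card I) (\<lambda>t. \<Prod>a\<in>I. ratio a t ^ m a / (1 - ratio a t))"
      by (rule admissible_prod[OF finI]) (rule admissible_ratio, use I in blast)
    then have "admissible E (pole_bound I + card I) R" unfolding R_def by (rule admissible_mult[OF R0(1)])
    moreover have "pole_bound I + card I \<le> CARD('n)"
      using card_mono[OF finite_S I] card_S by (simp add: pole_bound_def)
    ultimately have adm: "admissible E CARD('n) R" by (rule admissible_mono)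
    have "set_integrable \<mu> (box k0 I \<kappa> m) (integrand \<omega>) \<and> (LINT x:box k0 I \<kappa> m|\<mu>. integrand \<omega> x) = R \<tau>"
      if ch: "convergent_char \<omega> \<tau>" for \<omega> \<tau>
    proof -
      obtain C where C: "\<forall>\<kappa>. (\<forall>a\<in>I. M \<le> \<kappa> a) \<longrightarrow>
         set_integrable \<mu> (translate (cone_points I \<kappa>) (level k)) (integrand \<omega>) \<and>
         (LINT x:translate (cone_points I \<kappa>) (level k)|\<mu>. integrand \<omega> x) = (\<Prod>a\<in>I. ratio a \<tau> ^ \<kappa> a) * R0 \<tau> \<and>
         (LINT x:translate (cone_points I \<kappa>) (level k)|\<mu>. norm (integrand \<omega> x)) \<le> C * (\<Prod>a\<in>I. norm (ratio a \<tau>) ^ \<kappa> a)"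
        using R0(2) ch unfolding scaled_by_def by blast
      \<comment> \<open>Adjusts the values on \<open>I\<close>, which the box does not see, to meet
        the condition \<open>m a \<le> \<kappa> a\<close> of the iterated summation.\<close>
      define \<kappa>1 where "\<kappa>1 a = (if a \<in> I then m a else \<kappa> a)" for a
      have box1: "box k0 I \<kappa> m = box k0 I \<kappa>1 m"
      proof -
        have "{\<kappa>'. (\<forall>a. a \<notin> I \<longrightarrow> \<kappa>' a = \<kappa> a) \<and> (\<forall>a\<in>I. m a \<le> \<kappa>' a)} =
            {\<kappa>'. (\<forall>a. a \<notin> I \<longrightarrow> \<kappa>' a = \<kappa>1 a) \<and> (\<forall>a\<in>I. m a \<le> \<kappa>' a)}" by (auto simp: \<kappa>1_def)
        then show ?thesis unfolding box_def by (simp only:)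
      qed
      have "set_integrable \<mu> (box k0 I \<kappa>1 m) (integrand \<omega>) \<and>
        (LINT x:box k0 I \<kappa>1 m|\<mu>. integrand \<omega> x) =
         R0 \<tau> * (\<Prod>a\<in>I - I. ratio a \<tau> ^ \<kappa>1 a) * (\<Prod>a\<in>I. ratio a \<tau> ^ m a / (1 - ratio a \<tau>)) \<and>
        (LINT x:box k0 I \<kappa>1 m|\<mu>. norm (integrand \<omega> x)) \<le>
         C * (\<Prod>a\<in>I - I. norm (ratio a \<tau>) ^ \<kappa>1 a) * (\<Prod>a\<in>I. norm (ratio a \<tau>) ^ m a / (1 - norm (ratio a \<tau>)))"
      proof (rule geometric_box[OF ch I subset_refl, where u = \<kappa>])
        fix \<kappa>' assume off: "\<forall>a. a \<notin> I \<longrightarrow> \<kappa>' a = \<kappa> a" and on: "\<forall>a\<in>I. m a \<le> \<kappa>' a"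
        have "cone_points (S - I) \<kappa>' = cone_points (S - I) \<kappa>"
          unfolding cone_points_def using off by (intro sum.cong) auto
        then have "level (k0 + cone_points S \<kappa>') = translate (cone_points I \<kappa>') (level k)"
          unfolding translate_def twist_level k_def using cone_points_split[OF I, of \<kappa>'] by (simp add: add.assoc)
        moreover have "\<forall>a\<in>I. M \<le> \<kappa>' a" using on m order_trans by blast
        ultimately show "set_integrable \<mu> (level (k0 + cone_points S \<kappa>')) (integrand \<omega>) \<and>
          (LINT x:level (k0 + cone_points S \<kappa>')|\<mu>. integrand \<omega> x) = R0 \<tau> * (\<Prod>a\<in>I. ratio a \<tau> ^ \<kappa>' a) \<and>
          (LINT x:level (k0 + cone_points S \<kappa>')|\<mu>. norm (integrand \<omega> x)) \<le> C * (\<Prod>a\<in>I. norm (ratio a \<tau>) ^ \<kappa>' a)"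
          using C[rule_format, of \<kappa>'] by (simp add: mult.commute)
      qed (auto simp: \<kappa>1_def)
      then show ?thesis unfolding box1 R_def by simp
    qed
    then show ?thesis unfolding computed_def using adm by blast
  qed
  \<comment> \<open>The truncated differences measure how far \<open>m\<close> is from the region
    covered by \<open>far\<close>; raising one \<open>m b\<close> below \<open>M\<close> lowers
    their sum.\<close>
  have "computed (box k0 I \<kappa> m)" if "(\<Sum>a\<in>I. M - m a) = j" for j m
    using that
  proof (induction j arbitrary: m rule: less_induct)
    case (less j)
    show ?case
    proof (cases "\<forall>a\<in>I. M \<le> m a")
      case True
      then show ?thesis by (rule far)
    next
      case False
      then obtain b where b: "b \<in> I" "m b < M" by auto
      define m' where "m' = m(b := Suc (m b))"
      have "(\<Sum>a\<in>I. M - m' a) < (\<Sum>a\<in>I. M - m a)"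
        using b finI by (intro sum_strict_mono_ex1) (auto simp: m'_def)
      then have 1: "computed (box k0 I \<kappa> m')" using less.IH less.prems by blast
      have "card (I - {b}) < card I" using b finI by (intro psubset_card_mono) auto
      then have 2: "computed (box k0 (I - {b}) (\<kappa>(b := m b)) m)"
        using \<open>\<And>I' \<kappa> m. card I' < card I \<Longrightarrow> I' \<subseteq> S \<Longrightarrow> computed (box k0 I' \<kappa> m)\<close> I by blast
      \<comment> \<open>The slice in which the coefficient of \<open>b\<close> equals
        \<open>m b\<close> becomes a box over \<open>I - {b}\<close>; in the rest the lower bound
        rises to \<open>Suc (m b)\<close>.\<close>
      have split: "{\<kappa>'. (\<forall>a. a \<notin> I \<longrightarrow> \<kappa>' a = \<kappa> a) \<and> (\<forall>a\<in>I. m a \<le> \<kappa>' a)} =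
         {\<kappa>'. (\<forall>a. a \<notin> I \<longrightarrow> \<kappa>' a = \<kappa> a) \<and> (\<forall>a\<in>I. m' a \<le> \<kappa>' a)} \<union>
         {\<kappa>'. (\<forall>a. a \<notin> I - {b} \<longrightarrow> \<kappa>' a = (\<kappa>(b := m b)) a) \<and> (\<forall>a\<in>I - {b}. m a \<le> \<kappa>' a)}" (is "?U = ?V \<union> ?W")
      proof
        show "?U \<subseteq> ?V \<union> ?W"
        proof
          fix l assume l: "l \<in> ?U"
          show "l \<in> ?V \<union> ?W"
          proof (cases "l b = m b")
            case True
            then have "l \<in> ?W" using l b by auto
            then show ?thesis by blast
          next
            case False
            moreover have "m b \<le> l b" using l b by blast
            ultimately have "Suc (m b) \<le> l b" by simp
            then have "l \<in> ?V" using l by (auto simp: m'_def)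
            then show ?thesis by blast
          qed
        qed
        have "?V \<subseteq> ?U"
        proof
          fix l assume l: "l \<in> ?V"
          have "m a \<le> m' a" for a by (simp add: m'_def)
          then show "l \<in> ?U" using l order_trans by blast
        qed
        moreover have "?W \<subseteq> ?U"
        proof
          fix l assume l: "l \<in> ?W"
          have "l a = \<kappa> a" if "a \<notin> I" for a
          proof -
            have "a \<noteq> b" using that b by blast
            then show ?thesis using l that by simp
          qed
          moreover have "m a \<le> l a" if "a \<in> I" for a
            using l that by (cases "a = b") auto
          ultimately show "l \<in> ?U" by blast
        qed
        ultimately show "?V \<union> ?W \<subseteq> ?U" by blast
      qed
      have un: "box k0 I \<kappa> m = box k0 I \<kappa> m' \<union> box k0 (I - {b}) (\<kappa>(b := m b)) m"
        unfolding box_def split by (rule UN_Un)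
      have disj: "box k0 I \<kappa> m' \<inter> box k0 (I - {b}) (\<kappa>(b := m b)) m = {}"
      proof -
        have False if x: "x \<in> box k0 I \<kappa> m'" "x \<in> box k0 (I - {b}) (\<kappa>(b := m b)) m" for x
        proof -
          obtain l where l: "\<forall>a\<in>I. m' a \<le> l a" "x \<in> level (k0 + cone_points S l)" using x(1) unfolding box_def by blast
          obtain l' where l': "\<forall>a. a \<notin> I - {b} \<longrightarrow> l' a = (\<kappa>(b := m b)) a" "x \<in> level (k0 + cone_points S l')"
            using x(2) unfolding box_def by blast
          have "b \<in> S" using b I by blast
          then have "l b = l' b" by (rule level_inj[OF l(2) l'(2)])
          moreover have "l' b = m b" using l'(1) by simp
          moreover have "Suc (m b) \<le> l b" using l(1) b by (auto simp: m'_def)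
          ultimately show False by simp
        qed
        then show ?thesis by blast
      qed
      show ?thesis unfolding un
        by (rule computed_Un[OF 1 2 disj]) (simp_all add: borel_open[OF open_box])
    qed
  qed
  then show ?case by blast
qed

end

section \<open>Quasicharacters\<close>

text \<open>The multiplicative group has no small subgroups: in
  \<open>z^2 - 1 = (z - 1) (z + 1)\<close> the second factor is close to 2, so each squaring moves a
  point other than 1 away from 1 by a factor of at least 3/2.\<close>

lemma complex_no_small_powers:
  fixes z :: complex
  assumes "\<And>k. norm (z ^ (2 ^ k) - 1) < 1 / 2" shows "z = 1"
proof (rule ccontr)
  assume "z \<noteq> 1"
  then have pos: "norm (z - 1) > 0" by simp
  have grow: "(3 / 2) ^ k * norm (z - 1) \<le> norm (z ^ (2 ^ k) - 1)" for k
  proof (induction k)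
    case (Suc k)
    let ?w = "z ^ (2 ^ k)"
    have "z ^ (2 ^ Suc k) = ?w * ?w" by (simp add: power_add[symmetric] mult_2)
    then have "z ^ (2 ^ Suc k) - 1 = (?w - 1) * (?w + 1)" by (simp add: algebra_simps)
    then have eq: "norm (z ^ (2 ^ Suc k) - 1) = norm (?w - 1) * norm (?w + 1)" by (simp only: norm_mult)
    have "norm (2 :: complex) \<le> norm (?w + 1) + norm (1 - ?w)" using norm_triangle_ineq[of "?w + 1" "1 - ?w"] by simp
    then have "3 / 2 \<le> norm (?w + 1)" using assms[of k] by (simp add: norm_minus_commute)
    then have "norm (?w - 1) * (3 / 2) \<le> norm (?w - 1) * norm (?w + 1)" by (rule mult_left_mono) simp
    then have "(3 / 2) * norm (?w - 1) \<le> norm (z ^ (2 ^ Suc k) - 1)" unfolding eq by (simp add: mult.commute)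
    moreover have "(3 / 2) * ((3 / 2) ^ k * norm (z - 1)) \<le> (3 / 2) * norm (?w - 1)"
      using Suc.IH by (rule mult_left_mono) simp
    moreover have "(3 / 2 :: real) ^ Suc k * norm (z - 1) = (3 / 2) * ((3 / 2) ^ k * norm (z - 1))" by simp
    ultimately show ?case by linarith
  qed simp
  obtain k where "1 / norm (z - 1) < (3 / 2 :: real) ^ k" using real_arch_pow[of "3 / 2" "1 / norm (z - 1)"] by auto
  then have "1 < (3 / 2) ^ k * norm (z - 1)" using pos by (simp add: divide_less_eq)
  then show False using grow[of k] assms[of k] by linarith
qed

context padic
begin

text \<open>A small ball around 1 is stable under squaring and, by continuity, mapped close to 1;
  the powers with exponents \<open>2 ^ k\<close> then force the value 1. Multiplicativity carries
  this from 1 to all units.\<close>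

lemma unit_char_conductor:
  assumes \<eta>: "\<eta> \<in> unit_chars"
  shows "\<exists>c::nat. c \<ge> 1 \<and> (\<forall>u u'. vabs u = 1 \<longrightarrow> vabs (u - u') \<le> rad (int c) \<longrightarrow> \<eta> u' = \<eta> (u :: 'k))"
proof -
  have mult: "\<eta> (x * y) = \<eta> x * \<eta> y" if "vabs x = 1" "vabs y = 1" for x y
    using \<eta> that by (simp add: unit_chars_def unit_group_def)
  have nz: "\<eta> x \<noteq> 0" if "vabs x = 1" for x using \<eta> that by (simp add: unit_chars_def unit_group_def)
  have \<eta>1: "\<eta> 1 = 1" using mult[of 1 1] nz[of 1] by simp
  have cont: "continuous_on unit_group \<eta>" using \<eta> by (simp add: unit_chars_def)
  have "(1 :: 'k) \<in> unit_group" by (simp add: unit_group_def)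
  then obtain d where d: "d > 0" "\<And>x. x \<in> unit_group \<Longrightarrow> dist x 1 < d \<Longrightarrow> dist (\<eta> x) (\<eta> 1) < 1 / 2"
    using cont[unfolded continuous_on_iff, rule_format, of 1 "1 / 2"] by auto
  obtain N where N: "\<And>M. M \<ge> N \<Longrightarrow> rad M < d" using rad_arbitrarily_small[OF d(1)] by blast
  \<comment> \<open>At least 1, so that the ball of radius \<open>rad c\<close> around 1 consists of
    units.\<close>
  define c where "c = nat (max 1 N)"
  have "int c = max 1 N" by (simp add: c_def)
  then have c: "c \<ge> 1" "rad (int c) < d" using N[of "int c"] by linarith+
  have c1: "rad (int c) < 1" using c(1) by simp
  have one: "\<eta> v = 1" if v: "vabs (v - 1) \<le> rad (int c)" for v
  proof (rule complex_no_small_powers)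
    have unit: "vabs w = 1" if "vabs (w - 1) \<le> rad (int c)" for w
      using vabs_dominant[of w 1] that c1 by simp
    have pow: "vabs (v ^ (2 ^ k) - 1) \<le> rad (int c)" for k
    proof (induction k)
      case (Suc k)
      let ?w = "v ^ (2 ^ k)"
      have "v ^ (2 ^ Suc k) = ?w * ?w" by (simp add: power_add[symmetric] mult_2)
      then have "v ^ (2 ^ Suc k) - 1 = (?w - 1) * (?w + 1)" by (simp add: algebra_simps)
      then have "vabs (v ^ (2 ^ Suc k) - 1) = vabs (?w - 1) * vabs (?w + 1)" by (simp only: vabs_mult)
      also have "\<dots> \<le> rad (int c) * 1"
        using Suc.IH vabs_add_le[of ?w 1 1] unit[OF Suc.IH] by (intro mult_mono) auto
      finally show ?case by simp
    qed (use v in simp)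
    have \<eta>pow: "\<eta> (v ^ n) = \<eta> v ^ n" for n
    proof (induction n)
      case (Suc n)
      have "vabs (v ^ n) = 1" using unit[OF v] by (simp add: vabs_power)
      then show ?case using mult[OF unit[OF v]] Suc.IH by simp
    qed (simp add: \<eta>1)
    fix k
    have "v ^ (2 ^ k) \<in> unit_group" using unit[OF pow[of k]] by (simp add: unit_group_def)
    moreover have "dist (v ^ (2 ^ k)) 1 < d" using pow[of k] c(2) by (simp add: dist_vabs)
    ultimately have "dist (\<eta> (v ^ (2 ^ k))) (\<eta> 1) < 1 / 2" by (rule d(2))
    then show "norm (\<eta> v ^ (2 ^ k) - 1) < 1 / 2" by (simp add: \<eta>pow \<eta>1 dist_norm)
  qed
  have "\<eta> u' = \<eta> u" if u: "vabs u = 1" and uu: "vabs (u - u') \<le> rad (int c)" for u u'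
  proof -
    have u0: "u \<noteq> 0" using u by auto
    have "u' / u - 1 = (u' - u) / u" using u0 by (simp add: diff_divide_distrib)
    then have near: "vabs (u' / u - 1) \<le> rad (int c)" using uu u by (simp add: vabs_divide vabs_diff_commute[of u'])
    have "vabs (u' / u) = 1" using vabs_dominant[of "u' / u" 1] near c1 by simp
    then have "\<eta> (u * (u' / u)) = \<eta> u * \<eta> (u' / u)" using mult[OF u] by blast
    then show ?thesis using one[OF near] u0 by simp
  qed
  then show ?thesis using c(1) by blast
qed

definition restrict_units :: "('k \<Rightarrow> complex) \<Rightarrow> 'k \<Rightarrow> complex" where
  "restrict_units \<omega> x = (if vabs x = 1 then \<omega> x else 0)"

lemma restrict_units_char: "\<omega> \<in> quasichars \<Longrightarrow> restrict_units \<omega> \<in> unit_chars"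
proof -
  assume \<omega>: "\<omega> \<in> quasichars"
  have cont: "continuous_on (UNIV - {0}) \<omega>" and zero: "\<And>x. \<omega> x = 0 \<longleftrightarrow> x = 0"
    and mult: "\<And>x y. x \<noteq> 0 \<Longrightarrow> y \<noteq> 0 \<Longrightarrow> \<omega> (x * y) = \<omega> x * \<omega> y"
    using \<omega> unfolding quasichars_def by blast+
  have "continuous_on unit_group \<omega>" by (rule continuous_on_subset[OF cont]) (auto simp: unit_group_def)
  then have "continuous_on unit_group (restrict_units \<omega>)"
    by (rule continuous_on_eq) (simp add: restrict_units_def unit_group_def)
  moreover have "restrict_units \<omega> x = 0 \<longleftrightarrow> x \<notin> unit_group" for x
    using zero[of x] by (auto simp: restrict_units_def unit_group_def)
  moreover have "restrict_units \<omega> (x * y) = restrict_units \<omega> x * restrict_units \<omega> y"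
    if "x \<in> unit_group" "y \<in> unit_group" for x y
  proof -
    have "vabs x = 1" "vabs y = 1" using that by (simp_all add: unit_group_def)
    moreover have "x \<noteq> 0" "y \<noteq> 0" using calculation by auto
    ultimately show ?thesis using mult by (simp add: restrict_units_def vabs_mult)
  qed
  ultimately show ?thesis unfolding unit_chars_def by blast
qed

lemma quasichar_data_restrict:
  assumes \<omega>: "\<omega> \<in> quasichars" and c: "c \<ge> 1"
    and cond: "\<forall>u u'. vabs u = 1 \<longrightarrow> vabs (u - u') \<le> rad (int c) \<longrightarrow> restrict_units \<omega> u' = restrict_units \<omega> u"
  shows "quasichar_data \<omega> (\<omega> \<pi>) (restrict_units \<omega>) c"
proof -
  have zero: "\<And>x. \<omega> x = 0 \<longleftrightarrow> x = 0"
    and mult: "\<And>x y. x \<noteq> 0 \<Longrightarrow> y \<noteq> 0 \<Longrightarrow> \<omega> (x * y) = \<omega> x * \<omega> y"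
    using \<omega> unfolding quasichars_def by blast+
  have one: "\<omega> 1 = 1" using mult[of 1 1] zero[of 1] by simp
  have pow: "\<omega> (x ^ n) = \<omega> x ^ n" if "x \<noteq> 0" for x n
    by (induction n) (use that one mult in simp_all)
  have inv: "\<omega> (inverse x) = inverse (\<omega> x)" if "x \<noteq> 0" for x
  proof -
    have "\<omega> x * \<omega> (inverse x) = 1" using mult[of x "inverse x"] that one by simp
    then show ?thesis using inverse_unique by metis
  qed
  have powi: "\<omega> (\<pi> powi k) = \<omega> \<pi> powi k" for k
    unfolding power_int_def using pow[of \<pi>] pow[of "inverse \<pi>"] inv[of \<pi>] by simp
  have "\<forall>k u. vabs u = 1 \<longrightarrow> \<omega> (\<pi> powi k * u) = \<omega> \<pi> powi k * restrict_units \<omega> u"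
  proof (intro allI impI)
    fix k and u :: 'k assume u: "vabs u = 1"
    have "u \<noteq> 0" using u by auto
    then have "\<omega> (\<pi> powi k * u) = \<omega> (\<pi> powi k) * \<omega> u" by (intro mult) simp_all
    then show "\<omega> (\<pi> powi k * u) = \<omega> \<pi> powi k * restrict_units \<omega> u"
      using u by (simp add: powi restrict_units_def)
  qed
  moreover have "\<omega> \<pi> \<noteq> 0" "\<omega> 0 = 0" using zero by simp_all
  ultimately show ?thesis unfolding quasichar_data_def using c cond by blast
qed

section \<open>The quasicharacter with parameters \<open>s\<close> and \<open>\<eta>\<close>\<close>

lemma q_powr_neg_eq: "q_powr_neg TYPE('k) s = exp (- (s * complex_of_real (ln (real q))))"
  using q_ge_2 by (simp add: q_powr_neg_def residue_card_eq powr_def Ln_of_nat)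

lemma norm_q_powr_neg: "norm (q_powr_neg TYPE('k) s) = real q powr (- Re s)"
  using q_ge_2 by (simp add: q_powr_neg_eq powr_def)

lemma quasichar_uniformizer:
  assumes "\<eta> \<in> unit_chars" shows "quasichar \<pi> s \<eta> \<pi> = q_powr_neg TYPE('k) s"
proof -
  have "kord \<pi> = 1" using kord_pi_powi[of 1] by simp
  then have "ac \<pi> \<pi> = 1" by (simp add: ac_def power_int_minus)
  moreover have "\<eta> 1 = 1"
  proof -
    have "\<eta> (1 * 1) = \<eta> 1 * \<eta> 1" "\<eta> 1 \<noteq> 0"
      using assms vabs_1[where 'k = 'k] unfolding unit_chars_def unit_group_def by blast+
    then show ?thesis by simp
  qed
  moreover have "vabs \<pi> = rad 1" using vabs_pi_powi[of 1] by simp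
  moreover have "complex_of_real (rad 1) powr s = exp (- (s * complex_of_real (ln (real q))))"
  proof -
    have "Ln (complex_of_real (rad 1)) = complex_of_real (ln (rad 1))" by (rule Ln_of_real) simp
    moreover have "ln (rad 1) = - ln (real q)" using q_ge_2 by (simp add: rad_1 ln_div)
    ultimately show ?thesis by (simp add: powr_def)
  qed
  ultimately show ?thesis by (simp add: quasichar_def q_powr_neg_eq)
qed

lemma restrict_units_quasichar:
  assumes "\<eta> \<in> unit_chars" shows "restrict_units (quasichar \<pi> s \<eta>) = \<eta>"
proof
  fix x :: 'k
  show "restrict_units (quasichar \<pi> s \<eta>) x = \<eta> x"
  proof (cases "vabs x = 1")
    case True
    then have "kord x = 0" by (intro kord_eqI) simp
    then show ?thesis using True by (simp add: restrict_units_def quasichar_def ac_def)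
  next
    case False
    then show ?thesis using assms by (simp add: restrict_units_def unit_chars_def unit_group_def)
  qed
qed

end

section \<open>Poles in the variable s\<close>

lemma finite_power_int_roots:
  assumes "c \<noteq> 0" "d = 0 \<Longrightarrow> c \<noteq> 1"
  shows "finite {t::complex. t \<noteq> 0 \<and> c * t powi d = 1}"
proof (cases "d \<ge> 0")
  case True
  define k where "k = nat d"
  have k: "d = int k" using True by (simp add: k_def)
  define p where "p = monom c k - 1"
  have "p \<noteq> 0"
  proof
    assume "p = 0"
    then have "monom c k = monom 1 0" by (simp add: p_def)
    then have "coeff (monom c k) 0 = coeff (monom 1 0) 0" "coeff (monom c k) k = coeff (monom 1 0) k" by simp_all
    then show False using assms k by (cases "k = 0") auto
  qed
  moreover have "{t. t \<noteq> 0 \<and> c * t powi d = 1} \<subseteq> {t. poly p t = 0}" by (auto simp: p_def poly_monom k)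
  ultimately show ?thesis using poly_roots_finite finite_subset by blast
next
  case False
  define k where "k = nat (- d)"
  have k: "d = - int k" "k > 0" using False by (auto simp: k_def)
  define p where "p = monom 1 k - [:c:]"
  have "coeff p k = 1" using k by (simp add: p_def coeff_pCons split: nat.split)
  then have "p \<noteq> 0" by auto
  moreover have "{t. t \<noteq> 0 \<and> c * t powi d = 1} \<subseteq> {t. poly p t = 0}"
    by (auto simp: p_def poly_monom k power_int_minus field_simps)
  ultimately show ?thesis using poly_roots_finite finite_subset by blast
qed

text \<open>With \<open>L = ln q\<close> the hypothesis is \<open>q^(-s) = q\<close>; periodicity of
  the exponential yields the progression through -1.\<close>

lemma exp_eq_of_real_exp:
  assumes "exp (- (s * complex_of_real L)) = exp (complex_of_real L)" and L: "L \<noteq> 0"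
  shows "\<exists>k::int. s = -1 + 2 * complex_of_real pi * \<i> * of_int k / complex_of_real L"
proof -
  obtain n :: int where n: "- (s * complex_of_real L) = complex_of_real L + (of_int (2 * n) * pi) * \<i>"
    using assms(1) exp_eq by blast
  then have "s * complex_of_real L = - complex_of_real L - (of_int (2 * n) * pi) * \<i>"
    by (metis add.commute diff_conv_add_uminus minus_add_distrib minus_minus)
  then have "s = (- complex_of_real L - (of_int (2 * n) * pi) * \<i>) / complex_of_real L"
    using L by (simp add: eq_divide_eq)
  also have "\<dots> = -1 + 2 * complex_of_real pi * \<i> * of_int (- n) / complex_of_real L"
    using L by (simp add: field_simps)
  finally show ?thesis by blast
qed

text \<open>With \<open>L = ln q\<close> the hypothesis is \<open>q^(-w - s d) = 1\<close>, the
  vanishing of the denominator that belongs to an edge of weight \<open>w\<close>.\<close>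

lemma exp_eq_1_ratio:
  assumes eq: "complex_of_real (exp (- (real_of_int w * L))) * exp (- (s * complex_of_real L)) powi d = 1"
    and L: "L \<noteq> 0" and d: "d \<noteq> 0"
  shows "\<exists>k::int. s = complex_of_real (- of_int w / of_int d) + 2 * complex_of_real pi * \<i> * of_int k / complex_of_real (of_int d * L)"
proof -
  have "exp (- (s * complex_of_real L)) powi d = exp (of_int d * (- (s * complex_of_real L)))"
    by (simp add: exp_power_int)
  then have "exp (- (complex_of_real (real_of_int w * L)) + of_int d * (- (s * complex_of_real L))) = 1"
    using eq by (simp only: exp_add exp_of_real[symmetric] of_real_minus)
  then have "exp (- (complex_of_real (real_of_int w * L)) + of_int d * (- (s * complex_of_real L))) = exp 0" by simp
  then obtain n :: int where n: "- (complex_of_real (real_of_int w * L)) + of_int d * (- (s * complex_of_real L)) = 0 + of_int (2 * n) * pi * \<i>"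
    using exp_eq by blast
  have "s * (of_int d * complex_of_real L) = - (complex_of_real (real_of_int w * L)) - of_int (2 * n) * pi * \<i>"
    using n by (simp add: algebra_simps)
  then have "s = (- (complex_of_real (real_of_int w * L)) - of_int (2 * n) * pi * \<i>) / (of_int d * complex_of_real L)"
    using L d by (simp add: eq_divide_eq)
  also have "\<dots> = complex_of_real (- of_int w / of_int d) + 2 * complex_of_real pi * \<i> * of_int (- n) / complex_of_real (of_int d * L)"
    using L d by (simp add: field_simps)
  finally show ?thesis by blast
qed

section \<open>The whole zeta function\<close>

context haar
begin

lemma bruhat_schwartz_support:
  assumes "bruhat_schwartz (\<Phi> :: 'k ^ 'n \<Rightarrow> complex)"
  shows "\<exists>N. \<forall>x i. \<Phi> x \<noteq> 0 \<longrightarrow> vabs (x $ i) \<le> rad (- N)"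
proof -
  have "bounded (closure {x. \<Phi> x \<noteq> 0})" using assms by (simp add: bruhat_schwartz_def compact_imp_bounded)
  then obtain e where e: "\<And>x. x \<in> closure {x. \<Phi> x \<noteq> 0} \<Longrightarrow> dist 0 x \<le> e" using bounded_any_center[of _ 0] by blast
  obtain N where N: "rad N < 1 / (1 + \<bar>e\<bar>)" using rad_arbitrarily_small[of "1 / (1 + \<bar>e\<bar>)"] by (auto simp: add_pos_nonneg)
  have big: "e \<le> rad (- N)"
  proof -
    have "rad N * (1 + \<bar>e\<bar>) < 1" using N by (simp add: less_divide_eq add_pos_nonneg)
    then have "1 + \<bar>e\<bar> < rad (- N)" by (simp add: rad_minus less_divide_eq mult.commute)
    then show ?thesis by linarith
  qed
  have "vabs (x $ i) \<le> rad (- N)" if x: "\<Phi> x \<noteq> 0" for x i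
  proof -
    have "x \<in> closure {x. \<Phi> x \<noteq> 0}" by (rule subsetD[OF closure_subset]) (simp add: x)
    then have "dist 0 x \<le> e" by (rule e)
    then have "dist (0 $ i) (x $ i) \<le> e" using dist_vec_nth_le[of 0 i x] by linarith
    then have "vabs (x $ i) \<le> e" by (simp add: dist_vabs)
    then show ?thesis using big by (rule order_trans)
  qed
  then show ?thesis by blast
qed

text \<open>The sum of the generators lies in the relative interior of their cone, and an exponent
  is minimal for the sum only if it is minimal for every summand, all differences to
  \<open>m0\<close> being nonnegative. In this way weak non-degeneracy reaches every set of
  generators.\<close>

lemma face_function_eq_face_part:
  assumes I: "finite I" and m0: "m0 \<in> Poly_Mapping.keys f"
    and min: "\<And>a m. a \<in> I \<Longrightarrow> m \<in> Poly_Mapping.keys f \<Longrightarrow> pairing a m0 \<le> pairing a m"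
  shows "face_function f (real_vec (cone_points I (\<lambda>_. 1))) = face_part f m0 I"
proof -
  let ?b = "cone_points I (\<lambda>_. 1)"
  have pair: "pairing ?b m = (\<Sum>a\<in>I. pairing a m)" for m by (simp add: pairing_cone_points)
  have nd: "newton_d f (real_vec ?b) = real_vec ?b \<bullet> real_vec m0"
  proof (rule newton_d_eq[OF m0])
    fix m assume m: "m \<in> Poly_Mapping.keys f"
    have "pairing ?b m0 \<le> pairing ?b m" unfolding pair by (rule sum_mono) (rule min[OF _ m])
    then show "real_vec ?b \<bullet> real_vec m0 \<le> real_vec ?b \<bullet> real_vec m" by (simp only: inner_real_vec of_int_le_iff)
  qed
  have "real_vec m \<in> newton_face f (real_vec ?b) \<longleftrightarrow> (\<forall>a\<in>I. pairing a m = pairing a m0)"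
    if m: "m \<in> Poly_Mapping.keys f" for m
  proof -

    have "real_vec m \<in> newton_face f (real_vec ?b) \<longleftrightarrow> (\<Sum>a\<in>I. pairing a m - pairing a m0) = 0"
      unfolding mem_newton_face[OF m] nd inner_real_vec of_int_eq_iff pair sum_subtractf by simp
    also have "\<dots> \<longleftrightarrow> (\<forall>a\<in>I. pairing a m - pairing a m0 = 0)"
      using I min m by (intro sum_nonneg_eq_0_iff) auto
    finally show ?thesis by simp
  qed
  then have "{m \<in> Poly_Mapping.keys f. real_vec m \<in> newton_face f (real_vec ?b)} =
      {m \<in> Poly_Mapping.keys f. \<forall>a\<in>I. pairing a m = pairing a m0}" by blast
  then show ?thesis unfolding face_function_def face_part_def by (rule sum.cong) simp
qed

text \<open>\<open>newton_d\<close> is real-valued; the integer witness makes \<open>powi\<close>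
  available.\<close>

definition pole_factor :: "('k, 'n) laurent_poly \<Rightarrow> int ^ 'n \<Rightarrow> complex \<Rightarrow> bool" where
  "pole_factor f a t \<longleftrightarrow> (\<exists>d. newton_d f (real_vec a) = real_of_int d \<and> complex_of_real (rad (vec_weight a)) * t powi d = 1)"

definition regular_points :: "('k, 'n) laurent_poly \<Rightarrow> (real ^ 'n) set set \<Rightarrow> complex set" where
  "regular_points f \<F> = {t. t \<noteq> 0 \<and> t \<noteq> of_nat q \<and> (\<forall>a\<in>fan_edges \<F>. \<not> pole_factor f a t)}"

text \<open>For \<open>t = q^(-s)\<close> these are the conditions \<open>Re s > -1\<close> and
  \<open>vec_weight a + d * Re s > 0\<close>.\<close>

definition convergence_range :: "('k, 'n) laurent_poly \<Rightarrow> (real ^ 'n) set set \<Rightarrow> complex set" where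
  "convergence_range f \<F> = {t. norm t < real q \<and> (\<forall>a\<in>fan_edges \<F>. \<forall>d. newton_d f (real_vec a) = real_of_int d \<longrightarrow>
     norm (complex_of_real (rad (vec_weight a)) * t powi d) < 1)}"

lemma finite_singular_points:
  assumes fan: "fan \<F>" and supp: "fan_support \<F> = nonneg_orthant"
  shows "finite (- regular_points f \<F>)"
proof -
  have "finite {t. t \<noteq> 0 \<and> pole_factor f a t}" if a: "a \<in> fan_edges \<F>" for a
  proof (cases "\<exists>d. newton_d f (real_vec a) = real_of_int d")
    case True
    then obtain d where d: "newton_d f (real_vec a) = real_of_int d" by blast
    have w: "0 < rad (vec_weight a)" "rad (vec_weight a) < 1" using fan_edges_nonneg(2)[OF supp a] by simp_all
    have "finite {t. t \<noteq> 0 \<and> complex_of_real (rad (vec_weight a)) * t powi d = 1}"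
    proof (rule finite_power_int_roots)
      show "complex_of_real (rad (vec_weight a)) \<noteq> 0" using w(1) by simp
      show "complex_of_real (rad (vec_weight a)) \<noteq> 1" using w(2) by (metis less_irrefl of_real_eq_1_iff)
    qed
    then show ?thesis using d by (simp add: pole_factor_def)
  qed (simp add: pole_factor_def)
  then have "finite (\<Union>a\<in>fan_edges \<F>. {t. t \<noteq> 0 \<and> pole_factor f a t})"
    using finite_fan_edges[OF fan] by blast
  moreover have "- regular_points f \<F> \<subseteq> {0, of_nat q} \<union> (\<Union>a\<in>fan_edges \<F>. {t. t \<noteq> 0 \<and> pole_factor f a t})"
    by (auto simp: regular_points_def)
  ultimately show ?thesis by (auto elim: finite_subset)
qed

text \<open>
  The translate by \<open>N\<close> in each coordinate makes the orders of all points of the support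
  nonnegative, so that they lie in the cones of the fan.
\<close>

theorem zeta_rational:
  fixes f :: "('k, 'n) laurent_poly" and \<Phi> :: "'k ^ 'n \<Rightarrow> complex"
  assumes keys: "Poly_Mapping.keys f \<noteq> {}" and nondeg: "weakly_nondegenerate f"
    and fan: "fan \<F>" and simple: "simple_fan \<F>" and sub: "subordinated f \<F>"
    and supp: "fan_support \<F> = nonneg_orthant" and bs: "bruhat_schwartz \<Phi>"
  shows "\<exists>R. admissible (regular_points f \<F>) CARD('n) R \<and>
     (\<forall>\<omega> \<tau>. quasichar_data \<omega> \<tau> \<eta> c \<longrightarrow> \<tau> \<in> convergence_range f \<F> \<longrightarrow>
        zeta_converges \<mu> \<Phi> \<omega> f \<and> local_zeta \<mu> \<Phi> \<omega> f = R \<tau>)"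
proof -
  let ?E = "regular_points f \<F>"
  obtain S \<phi> where S: "\<And>\<sigma>. \<sigma> \<in> \<F> \<Longrightarrow> dual_family (S \<sigma>) (\<phi> \<sigma>)"
    "\<And>\<sigma>. \<sigma> \<in> \<F> \<Longrightarrow> card (S \<sigma>) \<le> CARD('n)"
    "\<And>\<sigma> a. \<sigma> \<in> \<F> \<Longrightarrow> a \<in> S \<sigma> \<Longrightarrow> a \<in> fan_edges \<F>"
    "\<And>\<sigma>. \<sigma> \<in> \<F> \<Longrightarrow> \<exists>m0\<in>Poly_Mapping.keys f. \<forall>a\<in>S \<sigma>. \<forall>m\<in>Poly_Mapping.keys f. pairing a m0 \<le> pairing a m"
    "\<And>v. \<forall>i. 0 \<le> v $ i \<Longrightarrow> \<exists>\<sigma>\<in>\<F>. \<exists>\<kappa>. (\<forall>a\<in>S \<sigma>. \<kappa> a \<ge> 1) \<and> v = cone_points (S \<sigma>) \<kappa>"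
    "\<And>\<sigma> \<sigma>' \<kappa> \<kappa>'. \<sigma> \<in> \<F> \<Longrightarrow> \<sigma>' \<in> \<F> \<Longrightarrow> \<forall>a\<in>S \<sigma>. \<kappa> a \<ge> 1 \<Longrightarrow> \<forall>a\<in>S \<sigma>'. \<kappa>' a \<ge> 1 \<Longrightarrow>
       cone_points (S \<sigma>) \<kappa> = cone_points (S \<sigma>') \<kappa>' \<Longrightarrow> \<sigma> = \<sigma>' \<and> (\<forall>a\<in>S \<sigma>. \<kappa> a = \<kappa>' a)"
  proof (rule fan_generators[OF keys fan simple sub supp], goal_cases)
    case (1 S \<phi>)
    show ?case by (rule 1(1), erule 1(2), erule 1(3), erule (1) 1(4), erule 1(5), rule 1(6), erule spec, rule 1(7))
  qed
  have "\<forall>\<sigma>. \<exists>m0. \<sigma> \<in> \<F> \<longrightarrow> m0 \<in> Poly_Mapping.keys f \<and> (\<forall>a\<in>S \<sigma>. \<forall>m\<in>Poly_Mapping.keys f. pairing a m0 \<le> pairing a m)"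
    using S(4) by blast
  from choice[OF this] obtain m0 where m0: "\<And>\<sigma>. \<sigma> \<in> \<F> \<Longrightarrow> m0 \<sigma> \<in> Poly_Mapping.keys f"
    "\<And>\<sigma> a m. \<sigma> \<in> \<F> \<Longrightarrow> a \<in> S \<sigma> \<Longrightarrow> m \<in> Poly_Mapping.keys f \<Longrightarrow> pairing a (m0 \<sigma>) \<le> pairing a m" by blast
  have nd: "newton_d f (real_vec a) = real_of_int (pairing a (m0 \<sigma>))" if \<sigma>: "\<sigma> \<in> \<F>" and a: "a \<in> S \<sigma>" for \<sigma> a
    using newton_d_eq[OF m0(1)[OF \<sigma>], of "real_vec a"] m0(2)[OF \<sigma> a] by (simp add: inner_real_vec)
  have cone: "zeta_cone \<pi> \<mu> f \<Phi> (S \<sigma>) (m0 \<sigma>) ?E" if \<sigma>: "\<sigma> \<in> \<F>" for \<sigma>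
  proof unfold_locales
    show "\<exists>U. open U \<and> x \<in> U \<and> \<Phi> constant_on U" for x using bs unfolding bruhat_schwartz_def by blast
    show fin: "finite (S \<sigma>)" using S(1)[OF \<sigma>] by (simp add: dual_family_def)
    show "card (S \<sigma>) \<le> CARD('n)" by (rule S(2)[OF \<sigma>])
    show nonneg: "0 \<le> a $ i" if "a \<in> S \<sigma>" for a i by (rule fan_edges_nonneg(1)[OF supp S(3)[OF \<sigma> that]])
    show "0 < vec_weight a" if "a \<in> S \<sigma>" for a by (rule fan_edges_nonneg(2)[OF supp S(3)[OF \<sigma> that]])
    show "m0 \<sigma> \<in> Poly_Mapping.keys f" by (rule m0(1)[OF \<sigma>])
    show "pairing a (m0 \<sigma>) \<le> pairing a m" if "a \<in> S \<sigma>" "m \<in> Poly_Mapping.keys f" for a m by (rule m0(2)[OF \<sigma> that])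
    \<comment> \<open>Non-degeneracy is applied at the sum of the generators in \<open>I\<close>.
      For empty \<open>I\<close> this point is 0 and the face polynomial is \<open>f\<close>
      itself.\<close>
    show "\<exists>i. laurent_eval (laurent_partial i (face_part f (m0 \<sigma>) I)) y \<noteq> 0"
      if I: "I \<subseteq> S \<sigma>" and y: "y \<in> torus" and z: "laurent_eval (face_part f (m0 \<sigma>) I) y = 0" for I y
    proof -
      have finI: "finite I" using I fin finite_subset by blast
      let ?b = "real_vec (cone_points I (\<lambda>_. 1))"
      have "cone_points I (\<lambda>_. 1) $ i \<ge> 0" for i
        using nonneg I by (auto simp: cone_points_def intro!: sum_nonneg)
      then have "?b \<in> nonneg_orthant" by (simp add: nonneg_orthant_def real_vec_def)
      moreover have "face_function f ?b = face_part f (m0 \<sigma>) I"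
        by (rule face_function_eq_face_part[OF finI m0(1)[OF \<sigma>]]) (use m0(2)[OF \<sigma>] I in blast)
      ultimately show ?thesis using nondeg[unfolded weakly_nondegenerate_def, rule_format, of ?b] y z by auto
    qed
    show "m = m'" if I: "I \<subseteq> S \<sigma>" and "card I = CARD('n)" and "\<And>a. a \<in> I \<Longrightarrow> pairing a m = pairing a m'" for I m m'
      by (rule pairing_separates[OF dual_family_subset[OF S(1)[OF \<sigma>] I] that(2,3)])
    show "\<kappa> a = \<kappa>' a" if eq: "cone_points (S \<sigma>) \<kappa> = cone_points (S \<sigma>) \<kappa>'" and a: "a \<in> S \<sigma>" for \<kappa> \<kappa>' a
    proof -
      have "\<phi> \<sigma> a (real_vec (cone_points (S \<sigma>) l)) = real (l a)" for l
        unfolding real_vec_cone_points using dual_family_combination[OF S(1)[OF \<sigma>] subset_refl a] a by simp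
      then have "real (\<kappa> a) = real (\<kappa>' a)" using eq by metis
      then show ?thesis by simp
    qed
    show "0 \<notin> ?E" "of_nat q \<notin> ?E" by (simp_all add: regular_points_def)
    show "complex_of_real (rad (vec_weight a)) * t powi (pairing a (m0 \<sigma>)) \<noteq> 1" if "t \<in> ?E" "a \<in> S \<sigma>" for t a
      using that S(3)[OF \<sigma>] nd[OF \<sigma>] unfolding regular_points_def pole_factor_def by blast
  qed
  obtain N where N: "\<And>x i. \<Phi> x \<noteq> 0 \<Longrightarrow> vabs (x $ i) \<le> rad (- N)" using bruhat_schwartz_support[OF bs] by blast
  define k0 where "k0 = (vec (- N) :: int ^ 'n)"
  \<comment> \<open>The lower bound 1 on all coefficients selects the lattice points in the relative
    interior, so that different cones give disjoint sets.\<close>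
  define A :: "(real ^ 'n) set \<Rightarrow> ('k ^ 'n) set" where "A \<sigma> = zeta_cone.box (S \<sigma>) k0 (S \<sigma>) (\<lambda>_. 1) (\<lambda>_. 1)" for \<sigma>
  define g where "g \<omega> x = (if x \<in> torus then \<Phi> x * \<omega> (laurent_eval f x) else 0)" for \<omega> :: "'k \<Rightarrow> complex" and x
  have "\<forall>\<sigma>. \<exists>R. \<sigma> \<in> \<F> \<longrightarrow> admissible ?E CARD('n) R \<and> (\<forall>\<omega> \<tau>. zeta_cone.convergent_char \<pi> \<eta> c (S \<sigma>) (m0 \<sigma>) \<omega> \<tau> \<longrightarrow>
     set_integrable \<mu> (A \<sigma>) (g \<omega>) \<and> (LINT x:A \<sigma>|\<mu>. g \<omega> x) = R \<tau>)"
  proof (intro allI)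
    fix \<sigma>
    show "\<exists>R. \<sigma> \<in> \<F> \<longrightarrow> admissible ?E CARD('n) R \<and> (\<forall>\<omega> \<tau>. zeta_cone.convergent_char \<pi> \<eta> c (S \<sigma>) (m0 \<sigma>) \<omega> \<tau> \<longrightarrow>
       set_integrable \<mu> (A \<sigma>) (g \<omega>) \<and> (LINT x:A \<sigma>|\<mu>. g \<omega> x) = R \<tau>)"
    proof (cases "\<sigma> \<in> \<F>")
      case True
      interpret z: zeta_cone \<pi> \<mu> f \<Phi> \<eta> c "S \<sigma>" "m0 \<sigma>" ?E by (rule cone[OF True])
      have "z.integrand \<omega> = g \<omega>" for \<omega> by (simp add: z.integrand_def g_def fun_eq_iff)
      then show ?thesis using z.computed_box[OF subset_refl, of k0 "\<lambda>_. 1" "\<lambda>_. 1"]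
        unfolding z.computed_def A_def by auto
    qed blast
  qed
  from choice[OF this] obtain R where R: "\<And>\<sigma>. \<sigma> \<in> \<F> \<Longrightarrow> admissible ?E CARD('n) (R \<sigma>)"
    "\<And>\<sigma> \<omega> \<tau>. \<sigma> \<in> \<F> \<Longrightarrow> zeta_cone.convergent_char \<pi> \<eta> c (S \<sigma>) (m0 \<sigma>) \<omega> \<tau> \<Longrightarrow>
       set_integrable \<mu> (A \<sigma>) (g \<omega>) \<and> (LINT x:A \<sigma>|\<mu>. g \<omega> x) = R \<sigma> \<tau>" by blast
  have A_mem: "x \<in> A \<sigma> \<longleftrightarrow> (\<exists>\<kappa>. (\<forall>a\<in>S \<sigma>. \<kappa> a \<ge> 1) \<and> x \<in> level (k0 + cone_points (S \<sigma>) \<kappa>))" if \<sigma>: "\<sigma> \<in> \<F>" for x \<sigma>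
  proof
    interpret z: zeta_cone \<pi> \<mu> f \<Phi> \<eta> c "S \<sigma>" "m0 \<sigma>" ?E by (rule cone[OF \<sigma>])
    show "x \<in> A \<sigma> \<Longrightarrow> \<exists>\<kappa>. (\<forall>a\<in>S \<sigma>. \<kappa> a \<ge> 1) \<and> x \<in> level (k0 + cone_points (S \<sigma>) \<kappa>)"
      unfolding A_def z.box_def by blast
    assume "\<exists>\<kappa>. (\<forall>a\<in>S \<sigma>. \<kappa> a \<ge> 1) \<and> x \<in> level (k0 + cone_points (S \<sigma>) \<kappa>)"
    then obtain \<kappa> where k: "\<forall>a\<in>S \<sigma>. \<kappa> a \<ge> 1" "x \<in> level (k0 + cone_points (S \<sigma>) \<kappa>)" by blast
    define \<kappa>' where "\<kappa>' a = (if a \<in> S \<sigma> then \<kappa> a else 1)" for a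
    have "cone_points (S \<sigma>) \<kappa>' = cone_points (S \<sigma>) \<kappa>" unfolding cone_points_def by (rule sum.cong) (auto simp: \<kappa>'_def)
    then have "x \<in> level (k0 + cone_points (S \<sigma>) \<kappa>')" using k(2) by simp
    moreover have "\<forall>a. a \<notin> S \<sigma> \<longrightarrow> \<kappa>' a = 1" "\<forall>a\<in>S \<sigma>. 1 \<le> \<kappa>' a" using k(1) by (simp_all add: \<kappa>'_def)
    ultimately show "x \<in> A \<sigma>" unfolding A_def z.box_def by blast
  qed
  have A_disj: "\<sigma> = \<sigma>'" if \<sigma>: "\<sigma> \<in> \<F>" "\<sigma>' \<in> \<F>" and x: "x \<in> A \<sigma>" "x \<in> A \<sigma>'" for x \<sigma> \<sigma>'
  proof -
    obtain \<kappa> where k: "\<forall>a\<in>S \<sigma>. \<kappa> a \<ge> 1" "x \<in> level (k0 + cone_points (S \<sigma>) \<kappa>)" using A_mem[OF \<sigma>(1)] x(1) by blast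
    obtain \<kappa>' where k': "\<forall>a\<in>S \<sigma>'. \<kappa>' a \<ge> 1" "x \<in> level (k0 + cone_points (S \<sigma>') \<kappa>')" using A_mem[OF \<sigma>(2)] x(2) by blast
    have "k0 + cone_points (S \<sigma>) \<kappa> = k0 + cone_points (S \<sigma>') \<kappa>'" by (rule level_disjoint[OF k(2) k'(2)])
    then have "cone_points (S \<sigma>) \<kappa> = cone_points (S \<sigma>') \<kappa>'" by simp
    from S(6)[OF \<sigma> k(1) k'(1) this] show ?thesis by blast
  qed
  have A_cover: "\<exists>\<sigma>\<in>\<F>. x \<in> A \<sigma>" if x: "x \<in> torus" "\<Phi> x \<noteq> 0" for x
  proof -
    define v where "v = (\<chi> i. kord (x $ i) + N)"
    have "0 \<le> v $ i" for i
    proof -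
      have "rad (kord (x $ i)) \<le> rad (- N)" using N[OF x(2), of i] x(1) vabs_kord[of "x $ i"] by (simp add: torus_def)
      then show ?thesis by (simp add: v_def)
    qed
    then have "\<exists>\<sigma>\<in>\<F>. \<exists>\<kappa>. (\<forall>a\<in>S \<sigma>. \<kappa> a \<ge> 1) \<and> v = cone_points (S \<sigma>) \<kappa>" by (intro S(5)) blast
    then obtain \<sigma> \<kappa> where \<sigma>: "\<sigma> \<in> \<F>" "\<forall>a\<in>S \<sigma>. \<kappa> a \<ge> 1" "v = cone_points (S \<sigma>) \<kappa>" by blast
    have "x \<in> level (k0 + v)" using x(1) by (simp add: level_def k0_def v_def)
    then show ?thesis using \<sigma> A_mem[OF \<sigma>(1)] by blast
  qed
  have finF: "finite \<F>" using fan by (simp add: fan_def)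
  define Rs where "Rs t = (\<Sum>\<sigma>\<in>\<F>. R \<sigma> t)" for t
  have adm: "admissible ?E CARD('n) Rs" unfolding Rs_def by (rule admissible_sum) (rule R(1))
  have "zeta_converges \<mu> \<Phi> \<omega> f \<and> local_zeta \<mu> \<Phi> \<omega> f = Rs \<tau>"
    if \<omega>: "quasichar_data \<omega> \<tau> \<eta> c" and \<tau>: "\<tau> \<in> convergence_range f \<F>" for \<omega> \<tau>
  proof -
    have ch: "zeta_cone.convergent_char \<pi> \<eta> c (S \<sigma>) (m0 \<sigma>) \<omega> \<tau>" if \<sigma>: "\<sigma> \<in> \<F>" for \<sigma>
    proof -
      interpret z: zeta_cone \<pi> \<mu> f \<Phi> \<eta> c "S \<sigma>" "m0 \<sigma>" ?E by (rule cone[OF \<sigma>])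
      have "norm (z.ratio a \<tau>) < 1" if "a \<in> S \<sigma>" for a
        using \<tau> S(3)[OF \<sigma> that] nd[OF \<sigma> that] unfolding convergence_range_def z.ratio_def by blast
      then show ?thesis unfolding z.convergent_char_def using \<omega> \<tau> by (simp add: convergence_range_def)
    qed
    have int: "integrable \<mu> (\<lambda>x. indicator (A \<sigma>) x *\<^sub>R g \<omega> x)" if "\<sigma> \<in> \<F>" for \<sigma>
      using R(2)[OF that ch[OF that]] by (simp add: set_integrable_def)
    have val: "(\<integral>x. indicator (A \<sigma>) x *\<^sub>R g \<omega> x \<partial>\<mu>) = R \<sigma> \<tau>" if "\<sigma> \<in> \<F>" for \<sigma>
      using R(2)[OF that ch[OF that]] by (simp add: set_lebesgue_integral_def)
    \<comment> \<open>Where the integrand is nonzero, the point lies in the torus and in the support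
      of \<open>\<Phi>\<close>, hence in exactly one of the sets \<open>A \<sigma>\<close>.\<close>
    have split: "g \<omega> x = (\<Sum>\<sigma>\<in>\<F>. indicator (A \<sigma>) x *\<^sub>R g \<omega> x)" for x
    proof (cases "g \<omega> x = 0")
      case False
      then have "x \<in> torus" "\<Phi> x \<noteq> 0" by (auto simp: g_def split: if_splits)
      then obtain \<sigma> where \<sigma>: "\<sigma> \<in> \<F>" "x \<in> A \<sigma>" using A_cover by blast
      have "(\<Sum>\<sigma>'\<in>\<F>. indicator (A \<sigma>') x *\<^sub>R g \<omega> x) = (\<Sum>\<sigma>'\<in>\<F>. if \<sigma>' = \<sigma> then g \<omega> x else 0)"
      proof (rule sum.cong[OF refl])
        fix \<sigma>' assume \<sigma>': "\<sigma>' \<in> \<F>"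
        show "indicator (A \<sigma>') x *\<^sub>R g \<omega> x = (if \<sigma>' = \<sigma> then g \<omega> x else 0)"
        proof (cases "\<sigma>' = \<sigma>")
          case True then show ?thesis using \<sigma>(2) by simp
        next
          case False
          then have "x \<notin> A \<sigma>'" using A_disj[OF \<sigma>' \<sigma>(1) _ \<sigma>(2)] by blast
          then show ?thesis using False by simp
        qed
      qed
      then show ?thesis using \<sigma>(1) finF by simp
    qed simp
    \<comment> \<open>The zeros of \<open>f\<close> on the torus, which \<open>zeta_domain\<close>
      removes, contribute 0 because \<open>\<omega> 0 = 0\<close>.\<close>
    have zd: "indicator (zeta_domain f) x *\<^sub>R (\<Phi> x * \<omega> (laurent_eval f x)) = g \<omega> x" for x
      using \<omega> by (auto simp: zeta_domain_def g_def indicator_def quasichar_data_def)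
    have "integrable \<mu> (\<lambda>x. \<Sum>\<sigma>\<in>\<F>. indicator (A \<sigma>) x *\<^sub>R g \<omega> x)"
      by (rule Bochner_Integration.integrable_sum) (rule int)
    then have "integrable \<mu> (g \<omega>)" by (simp only: split[symmetric])
    moreover have "(\<integral>x. g \<omega> x \<partial>\<mu>) = Rs \<tau>"
    proof -
      have "(\<integral>x. g \<omega> x \<partial>\<mu>) = (\<integral>x. (\<Sum>\<sigma>\<in>\<F>. indicator (A \<sigma>) x *\<^sub>R g \<omega> x) \<partial>\<mu>)" by (rule Bochner_Integration.integral_cong[OF refl split])
      also have "\<dots> = (\<Sum>\<sigma>\<in>\<F>. \<integral>x. indicator (A \<sigma>) x *\<^sub>R g \<omega> x \<partial>\<mu>)" by (rule Bochner_Integration.integral_sum) (rule int)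
      also have "\<dots> = Rs \<tau>" unfolding Rs_def by (rule sum.cong[OF refl val])
      finally show ?thesis .
    qed
    ultimately show ?thesis
      unfolding zeta_converges_def local_zeta_def set_integrable_def set_lebesgue_integral_def zd by blast
  qed
  then show ?thesis using adm by blast
qed

text \<open>The factor of an edge has norm \<open>q^(-(vec_weight a + d * Re s))\<close>. For
  \<open>d < 0\<close> it is below 1 when \<open>Re s\<close> is below the ratio entering
  \<open>fan_alpha\<close>, for \<open>d > 0\<close> when it is above the one entering
  \<open>fan_beta\<close>, and for \<open>d = 0\<close> always. The element -1 in
  \<open>fan_beta\<close> accounts for \<open>norm (\<omega> \<pi>) < q\<close>.\<close>

lemma strip_convergence_range:
  fixes f :: "('k, 'n) laurent_poly"
  assumes fan: "fan \<F>" and supp: "fan_support \<F> = nonneg_orthant"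
    and \<omega>: "\<omega> \<in> quasichars_strip \<pi> (fan_beta f \<F>) (fan_alpha f \<F>)"
  shows "\<omega> \<in> quasichars" "\<omega> \<pi> \<in> convergence_range f \<F>"
proof -
  show "\<omega> \<in> quasichars" using \<omega> by (simp add: quasichars_strip_def)
  obtain s where s: "\<omega> \<pi> = q_powr_neg TYPE('k) s" "ereal (fan_beta f \<F>) < ereal (Re s)" "ereal (Re s) < fan_alpha f \<F>"
    using \<omega> unfolding quasichars_strip_def by blast
  have fe: "finite (fan_edges \<F>)" by (rule finite_fan_edges[OF fan])
  have "pos_ratios f \<F> \<subseteq> (\<lambda>a. of_int (vec_weight a) / (- newton_d f (real_vec a))) ` fan_edges \<F>"
    unfolding pos_ratios_def by blast
  then have fp: "finite (pos_ratios f \<F> \<union> {-1})" using fe by (auto intro: finite_subset)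
  have "neg_ratios f \<F> \<subseteq> (\<lambda>a. of_int (vec_weight a) / (- newton_d f (real_vec a))) ` fan_edges \<F>"
    unfolding neg_ratios_def by blast
  then have fn: "finite (neg_ratios f \<F>)" using fe by (auto intro: finite_subset)
  have lower: "r < Re s" if "r \<in> pos_ratios f \<F> \<union> {-1}" for r
  proof -
    have "r \<le> fan_beta f \<F>" unfolding fan_beta_def by (rule Max_ge[OF fp that])
    then show ?thesis using s(2) by simp
  qed
  have upper: "Re s < r" if r: "r \<in> neg_ratios f \<F>" for r
  proof -
    have "fan_alpha f \<F> = ereal (Min (neg_ratios f \<F>))" using r by (auto simp: fan_alpha_def)
    moreover have "Min (neg_ratios f \<F>) \<le> r" by (rule Min_le[OF fn r])
    ultimately show ?thesis using s(3) by simp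
  qed
  have q1: "real q > 1" using q_ge_2 by simp
  have "norm (\<omega> \<pi>) < real q powr 1" unfolding s(1) norm_q_powr_neg using lower[of "-1"] q1 by (intro powr_less_mono) simp_all
  then have "norm (\<omega> \<pi>) < real q" using q1 by simp
  moreover have "norm (complex_of_real (rad (vec_weight a)) * \<omega> \<pi> powi d) < 1"
    if a: "a \<in> fan_edges \<F>" and d: "newton_d f (real_vec a) = real_of_int d" for a d
  proof -
    have w: "0 < vec_weight a" by (rule fan_edges_nonneg(2)[OF supp a])
    have "0 < real_of_int (vec_weight a) + Re s * real_of_int d"
    proof (cases d "0::int" rule: linorder_cases)
      case less
      then have "real_of_int (vec_weight a) / (- real_of_int d) \<in> neg_ratios f \<F>"
        unfolding neg_ratios_def using a d by (intro CollectI exI[of _ a]) simp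
      then have "Re s < real_of_int (vec_weight a) / (- real_of_int d)" by (rule upper)
      then have "Re s * (- real_of_int d) < real_of_int (vec_weight a)" using less by (subst (asm) pos_less_divide_eq) simp_all
      then show ?thesis by simp
    next
      case greater
      then have "real_of_int (vec_weight a) / (- real_of_int d) \<in> pos_ratios f \<F>"
        unfolding pos_ratios_def using a d by (intro CollectI exI[of _ a]) simp
      then have "real_of_int (vec_weight a) / (- real_of_int d) < Re s" by (intro lower) blast
      then have "- (Re s * real_of_int d) < real_of_int (vec_weight a)"
        using greater by (subst (asm) neg_divide_less_eq) simp_all
      then show ?thesis by simp
    qed (use w in simp)
    moreover have "norm (complex_of_real (rad (vec_weight a)) * \<omega> \<pi> powi d) =
        real q powr (- (real_of_int (vec_weight a) + Re s * real_of_int d))"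
    proof -
      have "rad (vec_weight a) = real q powr (- real_of_int (vec_weight a))"
        using q1 powr_real_of_int'[of "real q" "- vec_weight a"] by (simp add: rad_eq)
      moreover have "norm (\<omega> \<pi> powi d) = (real q powr (- Re s)) powr real_of_int d"
        unfolding s(1) norm_power_int norm_q_powr_neg using q1 by (subst powr_real_of_int') simp_all
      ultimately show ?thesis by (simp add: norm_mult powr_powr powr_add[symmetric])
    qed
    ultimately show ?thesis using q1 powr_less_mono[of "- (real_of_int (vec_weight a) + Re s * real_of_int d)" 0 "real q"] by simp
  qed
  ultimately show "\<omega> \<pi> \<in> convergence_range f \<F>" unfolding convergence_range_def by blast
qed

lemma convergence_range_regular: "t \<in> convergence_range f \<F> \<Longrightarrow> t \<noteq> 0 \<Longrightarrow> t \<in> regular_points f \<F>"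
  by (force simp: convergence_range_def regular_points_def pole_factor_def)

text \<open>Since \<open>q^(-s)\<close> is nonzero, a singular value is either \<open>q\<close> or a
  zero of the denominator of an edge. In the second case \<open>d(a)\<close> is not 0, because
  otherwise the factor would be \<open>q^(- vec_weight a) < 1\<close>.\<close>

lemma singular_candidate_poles:
  fixes f :: "('k, 'n) laurent_poly"
  assumes supp: "fan_support \<F> = nonneg_orthant" and sing: "q_powr_neg TYPE('k) s \<notin> regular_points f \<F>"
  shows "s \<in> (\<Union>a\<in>fan_edges \<F>. candidate_poles f a) \<union>
     {-1 + 2 * complex_of_real pi * \<i> * of_int k / complex_of_real (ln (real (residue_card TYPE('k)))) |k. True}"
proof -
  let ?L = "ln (real q)"
  have L: "?L \<noteq> 0" using q_ge_2 by simp
  have t: "q_powr_neg TYPE('k) s = exp (- (s * complex_of_real ?L))" by (rule q_powr_neg_eq)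
  consider "exp (- (s * complex_of_real ?L)) = of_nat q"
    | a where "a \<in> fan_edges \<F>" "pole_factor f a (exp (- (s * complex_of_real ?L)))"
    using sing unfolding regular_points_def t by auto
  then show ?thesis
  proof cases
    case 1
    have "complex_of_nat q = exp (complex_of_real ?L)" using q_ge_2 by (simp add: exp_of_real)
    then have "\<exists>k::int. s = -1 + 2 * complex_of_real pi * \<i> * of_int k / complex_of_real ?L"
      using 1 by (intro exp_eq_of_real_exp[OF _ L]) simp
    then show ?thesis unfolding residue_card_eq by blast
  next
    case 2
    then obtain d where d: "newton_d f (real_vec a) = real_of_int d"
      "complex_of_real (rad (vec_weight a)) * exp (- (s * complex_of_real ?L)) powi d = 1" unfolding pole_factor_def by blast
    have "rad (vec_weight a) < 1" using fan_edges_nonneg(2)[OF supp 2(1)] by simp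
    then have d0: "d \<noteq> 0" using d(2) by (metis less_irrefl mult.right_neutral of_real_eq_1_iff power_int_0_right)
    have "rad (vec_weight a) = exp (- (real_of_int (vec_weight a) * ?L))"
      using q_ge_2 powr_real_of_int'[of "real q" "- vec_weight a"] by (simp add: rad_eq powr_def)
    then have "\<exists>k::int. s = complex_of_real (- of_int (vec_weight a) / of_int d) +
        2 * complex_of_real pi * \<i> * of_int k / complex_of_real (of_int d * ?L)"
      using d(2) by (intro exp_eq_1_ratio[OF _ L d0]) simp
    then have "s \<in> candidate_poles f a"
      unfolding candidate_poles_def Let_def d(1) residue_card_eq using d0 by simp
    then show ?thesis using 2(1) by blast
  qed
qed

end

section \<open>One function on all quasicharacters, assembled from the rational functions of the
  unit characters\<close>

theorem theorem3p3:
  fixes f :: "('k::valued_field, 'n::finite) laurent_poly"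
    and \<pi> :: 'k
    and \<F> :: "(real ^ 'n) set set"
    and \<Phi> :: "'k ^ 'n \<Rightarrow> complex"
    and \<mu> :: "('k ^ 'n) measure"
  assumes "padic_field TYPE('k)"
    and "uniformizer \<pi>"
    and "normalised_haar \<mu>"
    and "\<exists>m\<in>Poly_Mapping.keys f. m \<noteq> 0"
    and "aff_dim (newton_polytope f) = int CARD('n)"
    and "weakly_nondegenerate f"
    and "fan \<F>"
    and "simple_fan \<F>"
    and "\<F> \<noteq> trivial_fan"
    and "subordinated f \<F>"
    and "fan_support \<F> = nonneg_orthant"
    and "bruhat_schwartz \<Phi>"
  shows "(\<forall>\<omega>\<in>quasichars_strip \<pi> (fan_beta f \<F>) (fan_alpha f \<F>). zeta_converges \<mu> \<Phi> \<omega> f) \<and>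
    (\<exists>Z :: ('k \<Rightarrow> complex) \<Rightarrow> complex.
       (\<forall>\<omega>\<in>quasichars_strip \<pi> (fan_beta f \<F>) (fan_alpha f \<F>). Z \<omega> = local_zeta \<mu> \<Phi> \<omega> f) \<and>
       (\<forall>\<eta>\<in>unit_chars.
          (\<lambda>s. Z (quasichar \<pi> s \<eta>)) nicely_meromorphic_on UNIV \<and>
          (\<exists>P Q :: complex poly. Q \<noteq> 0 \<and>
             (\<forall>s. poly Q (q_powr_neg TYPE('k) s) \<noteq> 0 \<longrightarrow>
                Z (quasichar \<pi> s \<eta>) =
                  poly P (q_powr_neg TYPE('k) s) / poly Q (q_powr_neg TYPE('k) s))) \<and>
          (\<forall>s. is_pole (\<lambda>s. Z (quasichar \<pi> s \<eta>)) s \<longrightarrow>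
             s \<in> (\<Union>a\<in>fan_edges \<F>. candidate_poles f a) \<union>
                 {-1 + 2 * complex_of_real pi * \<i> * of_int k /
                    complex_of_real (ln (real (residue_card TYPE('k)))) |k. True} \<and>
             - zorder (\<lambda>s. Z (quasichar \<pi> s \<eta>)) s \<le> int CARD('n))))"
proof -
  interpret padic \<pi> by (rule padic_locale[OF assms(1,2)])
  interpret haar \<pi> \<mu> by unfold_locales (rule assms(3))
  note keys = assms(4) and nondeg = assms(6) and fan = assms(7) and simple = assms(8)
    and sub = assms(10) and supp = assms(11) and bs = assms(12)
  let ?E = "regular_points f \<F>"
  let ?strip = "quasichars_strip \<pi> (fan_beta f \<F>) (fan_alpha f \<F>)"
  let ?t = "q_powr_neg TYPE('k)"
  have keys0: "Poly_Mapping.keys f \<noteq> {}" using keys by blast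
  \<comment> \<open>One coprime pair for each unit character rather than for each quasicharacter;
    this makes the continuation rational in \<open>q^(-s)\<close> on the component of
    \<open>\<eta>\<close>.\<close>
  have ex: "\<forall>\<eta>. \<exists>P Q. \<eta> \<in> unit_chars \<longrightarrow> Q \<noteq> 0 \<and> coprime P Q \<and> (\<forall>t\<in>?E. poly Q t \<noteq> 0) \<and> (\<forall>t. t \<noteq> 0 \<longrightarrow> order t Q \<le> CARD('n)) \<and>
     (\<forall>\<omega>\<in>?strip. restrict_units \<omega> = \<eta> \<longrightarrow> zeta_converges \<mu> \<Phi> \<omega> f \<and> local_zeta \<mu> \<Phi> \<omega> f = poly P (\<omega> \<pi>) / poly Q (\<omega> \<pi>))"
    (is "\<forall>\<eta>. \<exists>P Q. ?G \<eta> P Q")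
  proof (intro allI)
    fix \<eta> :: "'k \<Rightarrow> complex"
    show "\<exists>P Q. ?G \<eta> P Q"
    proof (cases "\<eta> \<in> unit_chars")
      case True
      from unit_char_conductor[OF True] obtain c :: nat where c: "c \<ge> 1"
        "\<forall>u u'. vabs u = 1 \<longrightarrow> vabs (u - u') \<le> rad (int c) \<longrightarrow> \<eta> u' = \<eta> u" by blast
      obtain R where R: "admissible ?E CARD('n) R"
        "\<And>\<omega> \<tau>. quasichar_data \<omega> \<tau> \<eta> c \<Longrightarrow> \<tau> \<in> convergence_range f \<F> \<Longrightarrow>
          zeta_converges \<mu> \<Phi> \<omega> f \<and> local_zeta \<mu> \<Phi> \<omega> f = R \<tau>"
        using zeta_rational[OF keys0 nondeg fan simple sub supp bs, of \<eta> c] by blast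
      obtain P Q where PQ: "Q \<noteq> 0" "coprime P Q" "\<And>t. t \<in> ?E \<Longrightarrow> poly Q t \<noteq> 0"
        "\<And>t. t \<in> ?E \<Longrightarrow> R t = poly P t / poly Q t" "\<And>t. t \<noteq> 0 \<Longrightarrow> order t Q \<le> CARD('n)"
        by (rule admissible_imp_coprime[OF R(1) finite_singular_points[OF fan supp]]) (rule that; assumption)
      have "zeta_converges \<mu> \<Phi> \<omega> f \<and> local_zeta \<mu> \<Phi> \<omega> f = poly P (\<omega> \<pi>) / poly Q (\<omega> \<pi>)"
        if \<omega>: "\<omega> \<in> ?strip" and \<eta>: "restrict_units \<omega> = \<eta>" for \<omega>
      proof -
        note range = strip_convergence_range[OF fan supp \<omega>]
        have "quasichar_data \<omega> (\<omega> \<pi>) (restrict_units \<omega>) c"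
          by (rule quasichar_data_restrict[OF range(1) c(1)]) (use c(2) \<eta> in blast)
        then have data: "quasichar_data \<omega> (\<omega> \<pi>) \<eta> c" by (simp only: \<eta>)
        have "\<omega> \<pi> \<noteq> 0" using data by (simp add: quasichar_data_def)
        then have "\<omega> \<pi> \<in> ?E" by (rule convergence_range_regular[OF range(2)])
        then show ?thesis using R(2)[OF data range(2)] PQ(4) by simp
      qed
      then show ?thesis using PQ(1-3,5) by blast
    qed blast
  qed
  from choice[OF ex] obtain P where "\<forall>\<eta>. \<exists>Q. ?G \<eta> (P \<eta>) Q" by blast
  from choice[OF this] obtain Q where G: "\<forall>\<eta>. ?G \<eta> (P \<eta>) (Q \<eta>)" by blast
  have PQ: "\<And>\<eta>. \<eta> \<in> unit_chars \<Longrightarrow> Q \<eta> \<noteq> 0" "\<And>\<eta>. \<eta> \<in> unit_chars \<Longrightarrow> coprime (P \<eta>) (Q \<eta>)"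
    "\<And>\<eta> t. \<eta> \<in> unit_chars \<Longrightarrow> t \<in> ?E \<Longrightarrow> poly (Q \<eta>) t \<noteq> 0"
    "\<And>\<eta> t. \<eta> \<in> unit_chars \<Longrightarrow> t \<noteq> 0 \<Longrightarrow> order t (Q \<eta>) \<le> CARD('n)"
    "\<And>\<eta> \<omega>. \<eta> \<in> unit_chars \<Longrightarrow> \<omega> \<in> ?strip \<Longrightarrow> restrict_units \<omega> = \<eta> \<Longrightarrow>
       zeta_converges \<mu> \<Phi> \<omega> f \<and> local_zeta \<mu> \<Phi> \<omega> f = poly (P \<eta>) (\<omega> \<pi>) / poly (Q \<eta>) (\<omega> \<pi>)"
    using G by blast+
  \<comment> \<open>A quasicharacter is sorted by its restriction to the units and evaluated at its
    value on \<open>\<pi>\<close>; for \<open>quasichar \<pi> s \<eta>\<close> these are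
    \<open>\<eta>\<close> and \<open>q^(-s)\<close>.\<close>
  define Z where "Z \<omega> = poly (P (restrict_units \<omega>)) (\<omega> \<pi>) / poly (Q (restrict_units \<omega>)) (\<omega> \<pi>)" for \<omega>
  have strip: "zeta_converges \<mu> \<Phi> \<omega> f \<and> local_zeta \<mu> \<Phi> \<omega> f = Z \<omega>" if "\<omega> \<in> ?strip" for \<omega>
    unfolding Z_def by (rule PQ(5)[OF restrict_units_char[OF strip_convergence_range(1)[OF fan supp that]] that refl])
  have L: "ln (real q) \<noteq> 0" using q_ge_2 by simp
  show ?thesis
  proof (intro conjI ballI exI[of _ Z])
    show "zeta_converges \<mu> \<Phi> \<omega> f" "Z \<omega> = local_zeta \<mu> \<Phi> \<omega> f" if "\<omega> \<in> ?strip" for \<omega> using strip[OF that] by simp_all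
    fix \<eta> :: "'k \<Rightarrow> complex" assume \<eta>: "\<eta> \<in> unit_chars"
    have Z: "Z (quasichar \<pi> s \<eta>) = poly (P \<eta>) (?t s) / poly (Q \<eta>) (?t s)" for s
      by (simp add: Z_def restrict_units_quasichar[OF \<eta>] quasichar_uniformizer[OF \<eta>])
    have Z_eq: "(\<lambda>s. Z (quasichar \<pi> s \<eta>)) = (\<lambda>s. poly (P \<eta>) (exp (- (s * complex_of_real (ln (real q))))) /
        poly (Q \<eta>) (exp (- (s * complex_of_real (ln (real q))))))"
      unfolding Z q_powr_neg_eq ..
    show "(\<lambda>s. Z (quasichar \<pi> s \<eta>)) nicely_meromorphic_on UNIV" unfolding Z_eq
      by (rule rational_exp_meromorphic(1)[OF L PQ(1)[OF \<eta>] PQ(2)[OF \<eta>]]) (erule PQ(4)[OF \<eta>])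
    show "\<exists>P Q. Q \<noteq> 0 \<and> (\<forall>s. poly Q (?t s) \<noteq> 0 \<longrightarrow> Z (quasichar \<pi> s \<eta>) = poly P (?t s) / poly Q (?t s))"
      using PQ(1)[OF \<eta>] Z by blast
    show "\<forall>s. is_pole (\<lambda>s. Z (quasichar \<pi> s \<eta>)) s \<longrightarrow>
        s \<in> (\<Union>a\<in>fan_edges \<F>. candidate_poles f a) \<union>
           {-1 + 2 * complex_of_real pi * \<i> * of_int k / complex_of_real (ln (real (residue_card TYPE('k)))) |k. True} \<and>
        - zorder (\<lambda>s. Z (quasichar \<pi> s \<eta>)) s \<le> int CARD('n)"
    proof (intro allI impI conjI)
      fix s assume pole: "is_pole (\<lambda>s. Z (quasichar \<pi> s \<eta>)) s"
      have mero: "poly (Q \<eta>) (?t s) = 0 \<and> - zorder (\<lambda>s. Z (quasichar \<pi> s \<eta>)) s \<le> int CARD('n)"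
        using pole unfolding Z_eq q_powr_neg_eq
        by (rule rational_exp_meromorphic(2)[OF L PQ(1)[OF \<eta>] PQ(2)[OF \<eta>], rotated]) (erule PQ(4)[OF \<eta>])
      then show "- zorder (\<lambda>s. Z (quasichar \<pi> s \<eta>)) s \<le> int CARD('n)" by blast
      have "poly (Q \<eta>) (?t s) = 0" using mero by blast
      then have "?t s \<notin> ?E" using PQ(3)[OF \<eta>] by blast
      then show "s \<in> (\<Union>a\<in>fan_edges \<F>. candidate_poles f a) \<union>
          {-1 + 2 * complex_of_real pi * \<i> * of_int k / complex_of_real (ln (real (residue_card TYPE('k)))) |k. True}"
        by (rule singular_candidate_poles[OF supp])
    qed
  qed
qed

end
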